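(* Let $N\in\mathbb{N}^*$, let $A=\{a_j\}_{j\le N}\subset(0,1)$, and let $\mu\in H^1(A)$. **1.** Let $T>0$, $\psi_0\in H^1_0$ and $u\in L^2((0,T),\mathbb{R})$. Then there exists a unique mild solution $\psi\in C([0,T],H^1_0)$ of the problem $$i\partial_t\psi=-\Delta\psi+u(t)\mu(x)\psi\ \ (x\in(0,1)),\qquad \psi(t,0)=\psi(t,1)=0,\qquad \psi(0,\cdot)=\psi_0, \qquad (D)$$ that is, a unique $\psi\in C([0,T],H^1_0)$ satisfying $$\psi(t)=e^{i\Delta t}\psi_0-i\int_0^t e^{i\Delta(t-s)}u(s)\mu\psi(s)\,ds,\qquad t\in[0,T].$$ **2.** Let $l\in\mathbb{N}^*$ be such that $$j^2-l^2\neq l^2-k^2\qquad\forall j,k\in\mathbb{N}^*\setminus\{l\}.$$ Assume there exists a constant $C>0$ such that $|\langle\mu\phi_l,\phi_k\rangle_{L^2}|\ge \frac{C}{k}$ for all $k\in\mathbb{N}^*$. Then for any $T>0$ there exists $\delta>0$ such that, for any $\psi_0,\psi_1\in H^1_0$ with $\|\psi_0\|_{L^2}=\|\psi_1\|_{L^2}=1$ and $$\|\psi_0-\phi_l\|_{H^1_0}<\delta,\qquad \|\psi_1-\phi_l(T)\|_{H^1_0}<\delta,$$ there exists a control $u\in L^2((0,T),\mathbb{R})$ such that the corresponding mild solution $\psi$ of (D) with $\psi(0)=\psi_0$ satisfies $\psi(T)=\psi_1$.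
   Context: $\mathbb{N}^*=\{1,2,\dots\}$. $L^2=L^2((0,1),\mathbb{C})$ with $\langle f,g\rangle_{L^2}=\int_0^1 f\overline{g}\,dx$. $\Delta$ is the Dirichlet Laplacian on $(0,1)$; $-\Delta$ has eigenvalues $\lambda_k=k^2\pi^2$ and Hilbert basis of eigenfunctions $\phi_k(x)=\sqrt2\sin(k\pi x)$, $k\in\mathbb{N}^*$. The unitary group $e^{i\Delta t}$ on $L^2$ is given by $e^{i\Delta t}\phi_k=e^{-i\lambda_k t}\phi_k$. Eigensolutions: $\phi_l(t)=e^{-i\lambda_l t}\phi_l$. $H^1_0=H^1_0((0,1),\mathbb{C})$ is endowed with the norm $\|\psi\|_{H^1_0}=\big(\sum_{k\ge1}|k\langle\phi_k,\psi\rangle_{L^2}|^2\big)^{1/2}$. For $A=\{a_1<\dots<a_N\}\subset(0,1)$, $H^1(A)$ is the space of real-valued $L^2$ functions on $(0,1)$ that are $H^1$ up to the discontinuities $a_j$, i.e. $H^1(A)=H^1((0,a_1),\mathbb{R})\times\prod_{j=1}^{N-1}H^1((a_j,a_{j+1}),\mathbb{R})\times H^1((a_N,1),\mathbb{R})$. *)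

theory Defs
  imports "HOL-Analysis.Analysis"
begin

section \<open>The Hilbert space of complex square integrable functions on (0,1)\<close>

definition sq_integrable_on :: "(real \<Rightarrow> 'b::real_normed_vector) \<Rightarrow> real set \<Rightarrow> bool"
    (infixr "sq'_integrable'_on" 46) where
  "f sq_integrable_on S \<longleftrightarrow>
     f \<in> borel_measurable (lebesgue_on S) \<and> integrable (lebesgue_on S) (\<lambda>x. (norm (f x))\<^sup>2)"

abbreviation leb01 :: "real measure" where
  "leb01 \<equiv> lebesgue_on {0<..<1}"

lemma finite_measure_leb01: "finite_measure leb01"
  by (rule finite_measureI) (simp add: emeasure_restrict_space)

lemma sq_integrable_on_measurable [measurable_dest]:
  "f sq_integrable_on S \<Longrightarrow> f \<in> borel_measurable (lebesgue_on S)"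
  by (simp add: sq_integrable_on_def)

lemma sq_integrable_on_zero: "(\<lambda>x. 0) sq_integrable_on S"
  by (simp add: sq_integrable_on_def)

lemma sq_integrable_on_add:
  fixes f g :: "real \<Rightarrow> complex"
  assumes "f sq_integrable_on S" "g sq_integrable_on S"
  shows "(\<lambda>x. f x + g x) sq_integrable_on S"
  unfolding sq_integrable_on_def
proof
  have [measurable]: "f \<in> borel_measurable (lebesgue_on S)" "g \<in> borel_measurable (lebesgue_on S)"
    using assms by (auto simp: sq_integrable_on_def)
  show "(\<lambda>x. f x + g x) \<in> borel_measurable (lebesgue_on S)" by measurable
  have bd: "(norm (f x + g x))\<^sup>2 \<le> 2 * (norm (f x))\<^sup>2 + 2 * (norm (g x))\<^sup>2" for x
  proof -
    have "(norm (f x + g x))\<^sup>2 \<le> (norm (f x) + norm (g x))\<^sup>2"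
      by (intro power_mono norm_triangle_ineq) auto
    also have "\<dots> \<le> 2 * (norm (f x))\<^sup>2 + 2 * (norm (g x))\<^sup>2"
      using sum_squares_bound[of "norm (f x)" "norm (g x)"] by (simp add: power2_sum)
    finally show ?thesis .
  qed
  show "integrable (lebesgue_on S) (\<lambda>x. (norm (f x + g x))\<^sup>2)"
    by (rule Bochner_Integration.integrable_bound
        [where f = "\<lambda>x. 2 * (norm (f x))\<^sup>2 + 2 * (norm (g x))\<^sup>2"])
      (use assms bd in \<open>auto simp: sq_integrable_on_def intro!: AE_I2\<close>)
qed

lemma sq_integrable_on_cmult:
  fixes f :: "real \<Rightarrow> complex"
  assumes "f sq_integrable_on S"
  shows "(\<lambda>x. c * f x) sq_integrable_on S"
  using assms by (auto simp: sq_integrable_on_def norm_mult power_mult_distrib)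

lemma sq_integrable_on_uminus:
  fixes f :: "real \<Rightarrow> complex"
  assumes "f sq_integrable_on S"
  shows "(\<lambda>x. - f x) sq_integrable_on S"
  using sq_integrable_on_cmult[OF assms, of "-1"] by simp

lemma sq_integrable_on_diff:
  fixes f g :: "real \<Rightarrow> complex"
  assumes "f sq_integrable_on S" "g sq_integrable_on S"
  shows "(\<lambda>x. f x - g x) sq_integrable_on S"
  using sq_integrable_on_add[OF assms(1) sq_integrable_on_uminus[OF assms(2)]] by simp

lemma sq_integrable_on_mult_cnj:
  fixes f g :: "real \<Rightarrow> complex"
  assumes "f sq_integrable_on S" "g sq_integrable_on S"
  shows "integrable (lebesgue_on S) (\<lambda>x. f x * cnj (g x))"
proof -
  have [measurable]: "f \<in> borel_measurable (lebesgue_on S)" "g \<in> borel_measurable (lebesgue_on S)"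
    using assms by (auto simp: sq_integrable_on_def)
  have bd: "norm (f x * cnj (g x)) \<le> (norm (f x))\<^sup>2 + (norm (g x))\<^sup>2" for x
  proof -
    have "2 * norm (f x) * norm (g x) \<le> (norm (f x))\<^sup>2 + (norm (g x))\<^sup>2"
      by (rule sum_squares_bound)
    moreover have "0 \<le> norm (f x) * norm (g x)" by simp
    ultimately show ?thesis unfolding norm_mult complex_mod_cnj by linarith
  qed
  have cnj: "(\<lambda>x. cnj (g x)) \<in> borel_measurable (lebesgue_on S)"
    by (rule measurable_compose[OF _ borel_measurable_continuous_onI[of cnj]])
      (auto intro: continuous_intros)
  have m: "(\<lambda>x. f x * cnj (g x)) \<in> borel_measurable (lebesgue_on S)"
    by (intro borel_measurable_times cnj) measurable
  show ?thesis
    by (rule Bochner_Integration.integrable_bound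
        [where f = "\<lambda>x. (norm (f x))\<^sup>2 + (norm (g x))\<^sup>2"])
      (use assms bd m in \<open>auto simp: sq_integrable_on_def intro!: AE_I2\<close>)
qed

definition L2_rel :: "(real \<Rightarrow> complex) \<Rightarrow> (real \<Rightarrow> complex) \<Rightarrow> bool" where
  "L2_rel f g \<longleftrightarrow> f sq_integrable_on {0<..<1} \<and> g sq_integrable_on {0<..<1} \<and>
     (AE x in leb01. f x = g x)"

text \<open>Classes of square integrable functions modulo equality almost everywhere.\<close>

quotient_type L2 = "real \<Rightarrow> complex" / partial: L2_rel
proof (rule part_equivpI)
  show "\<exists>f. L2_rel f f"
    by (rule exI[of _ "\<lambda>x. 0"]) (auto simp: L2_rel_def sq_integrable_on_zero)
  show "symp L2_rel"
    by (auto simp: symp_def L2_rel_def elim: AE_mp)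
  show "transp L2_rel"
  proof (rule transpI)
    fix f g h assume a: "L2_rel f g" "L2_rel g h"
    then have "AE x in leb01. f x = g x" "AE x in leb01. g x = h x" by (auto simp: L2_rel_def)
    then have "AE x in leb01. f x = h x" by eventually_elim simp
    with a show "L2_rel f h" by (auto simp: L2_rel_def)
  qed
qed

instantiation L2 :: real_vector
begin

lift_definition zero_L2 :: L2 is "\<lambda>x. 0"
  by (auto simp: L2_rel_def sq_integrable_on_zero)

lift_definition plus_L2 :: "L2 \<Rightarrow> L2 \<Rightarrow> L2" is "\<lambda>f g x. f x + g x"
  by (auto simp: L2_rel_def intro!: sq_integrable_on_add)

lift_definition uminus_L2 :: "L2 \<Rightarrow> L2" is "\<lambda>f x. - f x"
  by (auto simp: L2_rel_def intro!: sq_integrable_on_uminus)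

lift_definition minus_L2 :: "L2 \<Rightarrow> L2 \<Rightarrow> L2" is "\<lambda>f g x. f x - g x"
  by (auto simp: L2_rel_def intro!: sq_integrable_on_diff)

lift_definition scaleR_L2 :: "real \<Rightarrow> L2 \<Rightarrow> L2" is "\<lambda>r f x. of_real r * f x"
  by (auto simp: L2_rel_def intro!: sq_integrable_on_cmult)

instance
proof
  fix a b :: real and x y z :: L2
  show "x + y + z = x + (y + z)"
    by transfer (auto simp: L2_rel_def add.assoc intro!: sq_integrable_on_add)
  show "x + y = y + x"
    by transfer (auto simp: L2_rel_def add.commute intro!: sq_integrable_on_add)
  show "0 + x = x"
    by transfer (auto simp: L2_rel_def)
  show "- x + x = 0"
    by transfer (auto simp: L2_rel_def sq_integrable_on_zero)
  show "x - y = x + - y"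
    by transfer (auto simp: L2_rel_def intro!: sq_integrable_on_diff)
  show "a *\<^sub>R (x + y) = a *\<^sub>R x + a *\<^sub>R y"
    by transfer (auto simp: L2_rel_def distrib_left intro!: sq_integrable_on_add sq_integrable_on_cmult)
  show "(a + b) *\<^sub>R x = a *\<^sub>R x + b *\<^sub>R x"
    by transfer (auto simp: L2_rel_def distrib_right intro!: sq_integrable_on_add sq_integrable_on_cmult)
  show "a *\<^sub>R b *\<^sub>R x = (a * b) *\<^sub>R x"
    by transfer (auto simp: L2_rel_def mult.assoc intro!: sq_integrable_on_cmult)
  show "1 *\<^sub>R x = x"
    by transfer (auto simp: L2_rel_def)
qed

end

lift_definition scaleC_L2 :: "complex \<Rightarrow> L2 \<Rightarrow> L2" (infixr "*\<^sub>C" 75) is "\<lambda>c f x. c * f x"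
  by (auto simp: L2_rel_def intro!: sq_integrable_on_cmult)

lift_definition cinner_L2 :: "L2 \<Rightarrow> L2 \<Rightarrow> complex" is
  "\<lambda>f g. integral\<^sup>L leb01 (\<lambda>x. f x * cnj (g x))"
proof -
  fix f f' g g' assume a: "L2_rel f f'" "L2_rel g g'"
  then have i: "integrable leb01 (\<lambda>x. f x * cnj (g x))" "integrable leb01 (\<lambda>x. f' x * cnj (g' x))"
    by (auto simp: L2_rel_def intro: sq_integrable_on_mult_cnj)
  have "AE x in leb01. f x = f' x" "AE x in leb01. g x = g' x"
    using a by (auto simp: L2_rel_def)
  then have "AE x in leb01. f x * cnj (g x) = f' x * cnj (g' x)"
    by eventually_elim simp
  then show "integral\<^sup>L leb01 (\<lambda>x. f x * cnj (g x)) = integral\<^sup>L leb01 (\<lambda>x. f' x * cnj (g' x))"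
    using i by (intro integral_cong_AE) (auto dest: borel_measurable_integrable)
qed

lemma cinner_L2_commute: "cinner_L2 g f = cnj (cinner_L2 f g)"
proof transfer
  fix f g :: "real \<Rightarrow> complex"
  have "cnj (integral\<^sup>L leb01 (\<lambda>x. f x * cnj (g x))) = integral\<^sup>L leb01 (\<lambda>x. cnj (f x * cnj (g x)))"
    by (rule Bochner_Integration.integral_cnj[symmetric])
  then show "integral\<^sup>L leb01 (\<lambda>x. g x * cnj (f x)) = cnj (integral\<^sup>L leb01 (\<lambda>x. f x * cnj (g x)))"
    by (simp add: mult.commute)
qed

lemma cinner_L2_add_left: "cinner_L2 (f + g) h = cinner_L2 f h + cinner_L2 g h"
  by transfer (simp add: L2_rel_def distrib_right sq_integrable_on_mult_cnj)

lemma cinner_L2_scaleC_left: "cinner_L2 (c *\<^sub>C f) g = c * cinner_L2 f g"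
  by transfer (simp add: mult.assoc)

lemma scaleR_L2_scaleC: "r *\<^sub>R f = complex_of_real r *\<^sub>C f"
  by transfer (auto simp: L2_rel_def intro!: sq_integrable_on_cmult)

lemma cinner_L2_same:
  "cinner_L2 f f = complex_of_real (Re (cinner_L2 f f))" "Re (cinner_L2 f f) \<ge> 0"
proof -
  have *: "cinner_L2 f f = of_real (integral\<^sup>L leb01 (\<lambda>x. (cmod (rep_L2 f x))\<^sup>2))"
    by (simp add: cinner_L2.rep_eq flip: complex_norm_square integral_complex_of_real)
  show "cinner_L2 f f = complex_of_real (Re (cinner_L2 f f))" "Re (cinner_L2 f f) \<ge> 0"
    by (auto simp: *)
qed

instantiation L2 :: real_inner
begin

definition inner_L2 :: "L2 \<Rightarrow> L2 \<Rightarrow> real" where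
  "inner_L2 f g = Re (cinner_L2 f g)"
definition norm_L2 :: "L2 \<Rightarrow> real" where
  "norm_L2 f = sqrt (inner f f)"
definition dist_L2 :: "L2 \<Rightarrow> L2 \<Rightarrow> real" where
  "dist_L2 f g = norm (f - g)"
definition sgn_L2 :: "L2 \<Rightarrow> L2" where
  "sgn_L2 f = inverse (norm f) *\<^sub>R f"
definition uniformity_L2 :: "(L2 \<times> L2) filter" where
  "uniformity_L2 = (INF e\<in>{0<..}. principal {(x, y). dist x y < e})"
definition open_L2 :: "L2 set \<Rightarrow> bool" where
  "open_L2 U = (\<forall>x\<in>U. \<forall>\<^sub>F (x', y) in uniformity. x' = x \<longrightarrow> y \<in> U)"

instance
proof
  fix r :: real and f g h :: L2 and U :: "L2 set"
  show "dist f g = norm (f - g)" by (rule dist_L2_def)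
  show "sgn f = f /\<^sub>R norm f" by (rule sgn_L2_def)
  show "uniformity = (INF e\<in>{0<..}. principal {(x, y :: L2). dist x y < e})"
    by (rule uniformity_L2_def)
  show "open U \<longleftrightarrow> (\<forall>x\<in>U. \<forall>\<^sub>F (x', y) in uniformity. x' = x \<longrightarrow> y \<in> U)"
    by (rule open_L2_def)
  show "inner f g = inner g f"
    using cinner_L2_commute[of f g] by (simp add: inner_L2_def)
  show "inner (f + g) h = inner f h + inner g h"
    by (simp add: inner_L2_def cinner_L2_add_left)
  show "inner (r *\<^sub>R f) g = r * inner f g"
    by (simp add: inner_L2_def scaleR_L2_scaleC cinner_L2_scaleC_left)
  show "0 \<le> inner f f"
    by (simp add: inner_L2_def cinner_L2_same(2))
  show "inner f f = 0 \<longleftrightarrow> f = 0"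
  proof
    assume "inner f f = 0"
    then have "cinner_L2 f f = 0"
      using cinner_L2_same(1)[of f] by (metis inner_L2_def of_real_0)
    then show "f = 0"
    proof transfer
      fix f assume f: "L2_rel f f" and 0: "integral\<^sup>L leb01 (\<lambda>x. f x * cnj (f x)) = 0"
      have "complex_of_real (integral\<^sup>L leb01 (\<lambda>x. (cmod (f x))\<^sup>2)) = 0"
        using 0 by (simp flip: complex_norm_square integral_complex_of_real)
      then have "integral\<^sup>L leb01 (\<lambda>x. (cmod (f x))\<^sup>2) = 0" by simp
      moreover have "integrable leb01 (\<lambda>x. (cmod (f x))\<^sup>2)"
        using f by (simp add: L2_rel_def sq_integrable_on_def)
      ultimately have "AE x in leb01. (cmod (f x))\<^sup>2 = 0"
        by (subst (asm) integral_nonneg_eq_0_iff_AE) auto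
      then show "L2_rel f (\<lambda>x. 0)"
        using f by (auto simp: L2_rel_def sq_integrable_on_zero)
    qed
  next
    assume "f = 0"
    moreover have "cinner_L2 0 0 = 0" by transfer simp
    ultimately show "inner f f = 0" by (simp add: inner_L2_def)
  qed
  show "norm f = sqrt (inner f f)" by (rule norm_L2_def)
qed

end

text \<open>The class of a square integrable function (and 0 if the function is not square
  integrable).\<close>

definition to_L2 :: "(real \<Rightarrow> complex) \<Rightarrow> L2" where
  "to_L2 f = (if f sq_integrable_on {0<..<1} then abs_L2 f else 0)"

lemma L2_rel_rep: "L2_rel (rep_L2 f) (rep_L2 f)"
  by (metis Quotient3_L2 Quotient3_rep_reflp)

lemma sq_integrable_rep_L2: "rep_L2 f sq_integrable_on {0<..<1}"
  using L2_rel_rep by (auto simp: L2_rel_def)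

lemma to_L2_rep_L2 [simp]: "to_L2 (rep_L2 f) = f"
  by (simp add: to_L2_def sq_integrable_rep_L2 Quotient3_abs_rep[OF Quotient3_L2])

lemma rep_L2_to_L2:
  assumes "f sq_integrable_on {0<..<1}"
  shows "AE x in leb01. rep_L2 (to_L2 f) x = f x"
proof -
  have "L2_rel f f" using assms by (auto simp: L2_rel_def)
  then have "L2_rel (rep_L2 (abs_L2 f)) f" by (rule rep_abs_rsp_left[OF Quotient3_L2])
  then show ?thesis using assms by (auto simp: to_L2_def L2_rel_def)
qed

lemma to_L2_eq_iff:
  assumes "f sq_integrable_on {0<..<1}" "g sq_integrable_on {0<..<1}"
  shows "to_L2 f = to_L2 g \<longleftrightarrow> (AE x in leb01. f x = g x)"
  using assms Quotient3_rel[OF Quotient3_L2, of f g] by (auto simp: to_L2_def L2_rel_def)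

lemma norm_to_L2:
  assumes "f sq_integrable_on {0<..<1}"
  shows "norm (to_L2 f) = sqrt (integral\<^sup>L leb01 (\<lambda>x. (cmod (f x))\<^sup>2))"
proof -
  have "cinner_L2 (abs_L2 f) (abs_L2 f) = integral\<^sup>L leb01 (\<lambda>x. f x * cnj (f x))"
    using assms by (intro cinner_L2.abs_eq) (auto simp: L2_rel_def)
  then have "cinner_L2 (abs_L2 f) (abs_L2 f) = of_real (integral\<^sup>L leb01 (\<lambda>x. (cmod (f x))\<^sup>2))"
    by (simp flip: complex_norm_square integral_complex_of_real)
  then show ?thesis
    using assms by (simp add: to_L2_def norm_L2_def inner_L2_def)
qed

lemma to_L2_diff:
  assumes "f sq_integrable_on {0<..<1}" "g sq_integrable_on {0<..<1}"
  shows "to_L2 f - to_L2 g = to_L2 (\<lambda>x. f x - g x)"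
    and "(\<lambda>x. f x - g x) sq_integrable_on {0<..<1}"
proof -
  show *: "(\<lambda>x. f x - g x) sq_integrable_on {0<..<1}"
    using sq_integrable_on_add[OF assms(1) sq_integrable_on_uminus[OF assms(2)]] by simp
  show "to_L2 f - to_L2 g = to_L2 (\<lambda>x. f x - g x)"
    using assms * by (simp add: to_L2_def) (intro minus_L2.abs_eq, auto simp: L2_rel_def)
qed

subsection \<open>Completeness\<close>

lemma integrable_norm_leb01:
  fixes f :: "real \<Rightarrow> complex"
  assumes "f sq_integrable_on {0<..<1}"
  shows "integrable leb01 f"
    and "e > 0 \<Longrightarrow> norm (to_L2 f) < e \<Longrightarrow> integral\<^sup>L leb01 (\<lambda>x. norm (f x)) < e"
proof -
  interpret finite_measure leb01 by (rule finite_measure_leb01)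
  have [measurable]: "f \<in> borel_measurable leb01"
    using assms by (auto simp: sq_integrable_on_def)
  have i: "integrable leb01 (\<lambda>x. (norm (f x))\<^sup>2)"
    using assms by (auto simp: sq_integrable_on_def)
  have bd: "norm (f x) \<le> ((norm (f x))\<^sup>2 / e + e) / 2" if "e > 0" for e x
    using that sum_squares_bound[of "norm (f x)" e] by (simp add: field_simps power2_eq_square)
  show j: "integrable leb01 f"
    by (rule Bochner_Integration.integrable_bound[where f = "\<lambda>x. ((norm (f x))\<^sup>2 / 1 + 1) / 2"])
      (use i bd[of 1] in \<open>auto intro!: AE_I2 order_trans[OF bd[of 1]]\<close>)
  assume e: "e > 0" "norm (to_L2 f) < e"
  have "integral\<^sup>L leb01 (\<lambda>x. norm (f x)) \<le> integral\<^sup>L leb01 (\<lambda>x. ((norm (f x))\<^sup>2 / e + e) / 2)"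
    using j i bd[OF e(1)] by (intro integral_mono) auto
  also have "\<dots> = (integral\<^sup>L leb01 (\<lambda>x. (norm (f x))\<^sup>2) / e + e) / 2"
    using i by (simp add: measure_restrict_space)
  also have "\<dots> < (e\<^sup>2 / e + e) / 2"
  proof -
    have "integral\<^sup>L leb01 (\<lambda>x. (norm (f x))\<^sup>2) = (norm (to_L2 f))\<^sup>2"
      by (simp add: norm_to_L2[OF assms] integral_nonneg_AE)
    also have "\<dots> < e\<^sup>2" using e by (intro power_strict_mono) auto
    finally show ?thesis using e by (simp add: divide_strict_right_mono)
  qed
  also have "\<dots> = e" using e by (simp add: power2_eq_square)
  finally show "integral\<^sup>L leb01 (\<lambda>x. norm (f x)) < e" .
qed

instance L2 :: banach
proof
  fix X :: "nat \<Rightarrow> L2" assume X: "Cauchy X"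
  let ?s = "\<lambda>n. rep_L2 (X n)"
  have sq: "?s n sq_integrable_on {0<..<1}" for n by (rule sq_integrable_rep_L2)
  have [measurable]: "?s n \<in> borel_measurable leb01" for n
    using sq[of n] by (auto simp: sq_integrable_on_def)
  have diff: "(\<lambda>x. ?s n x - ?s m x) sq_integrable_on {0<..<1}"
    "to_L2 (\<lambda>x. ?s n x - ?s m x) = X n - X m" for n m
    using to_L2_diff[OF sq sq, of n m] by auto
  have L1: "\<exists>N. \<forall>i\<ge>N. \<forall>j\<ge>N. integral\<^sup>L leb01 (\<lambda>x. norm (?s i x - ?s j x)) < e" if "e > 0" for e
  proof -
    obtain N where "\<forall>i\<ge>N. \<forall>j\<ge>N. norm (X i - X j) < e"
      using CauchyD[OF X \<open>e > 0\<close>] by auto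
    then show ?thesis
      using integrable_norm_leb01(2)[OF diff(1) \<open>e > 0\<close>, unfolded diff(2)] by metis
  qed
  obtain r where r: "strict_mono r" and "AE x in leb01. Cauchy (\<lambda>i. ?s (r i) x)"
    by (rule cauchy_L1_AE_cauchy_subseq[of leb01 ?s, OF integrable_norm_leb01(1)[OF sq] L1])
  then have ae: "AE x in leb01. (\<lambda>i. ?s (r i) x) \<longlonglongrightarrow> lim (\<lambda>i. ?s (r i) x)"
    by (auto simp: Cauchy_convergent_iff convergent_LIMSEQ_iff)
  define g where "g x = lim (\<lambda>i. ?s (r i) x)" for x
  have [measurable]: "g \<in> borel_measurable leb01" unfolding g_def by measurable
  have fatou: "(\<lambda>x. g x - ?s n x) sq_integrable_on {0<..<1}"
      "norm (to_L2 (\<lambda>x. g x - ?s n x)) \<le> e"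
    if e: "e > 0" and N: "\<And>i. i \<ge> N \<Longrightarrow> norm (X i - X n) \<le> e" for e N n
  proof -
    have le: "(\<integral>\<^sup>+x. ennreal ((norm (?s (r i) x - ?s n x))\<^sup>2) \<partial>leb01) \<le> ennreal (e\<^sup>2)" if "i \<ge> N" for i
    proof -
      have "(\<integral>\<^sup>+x. ennreal ((norm (?s (r i) x - ?s n x))\<^sup>2) \<partial>leb01)
          = ennreal (integral\<^sup>L leb01 (\<lambda>x. (norm (?s (r i) x - ?s n x))\<^sup>2))"
        using diff(1)[of "r i" n] by (intro nn_integral_eq_integral) (auto simp: sq_integrable_on_def)
      also have "integral\<^sup>L leb01 (\<lambda>x. (norm (?s (r i) x - ?s n x))\<^sup>2) = (norm (X (r i) - X n))\<^sup>2"
        unfolding diff(2)[symmetric] by (simp add: norm_to_L2[OF diff(1)] integral_nonneg_AE)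
      also have "\<dots> \<le> e\<^sup>2"
        using N[of "r i"] that seq_suble[OF r, of i] by (intro power_mono) auto
      finally show ?thesis using e by (simp add: ennreal_leI)
    qed
    have "(\<integral>\<^sup>+x. ennreal ((norm (g x - ?s n x))\<^sup>2) \<partial>leb01)
        = (\<integral>\<^sup>+x. liminf (\<lambda>i. ennreal ((norm (?s (r i) x - ?s n x))\<^sup>2)) \<partial>leb01)"
    proof (rule nn_integral_cong_AE)
      show "AE x in leb01. ennreal ((norm (g x - ?s n x))\<^sup>2) =
          liminf (\<lambda>i. ennreal ((norm (?s (r i) x - ?s n x))\<^sup>2))"
        using ae
      proof eventually_elim
        case (elim x)
        then have "(\<lambda>i. ennreal ((norm (?s (r i) x - ?s n x))\<^sup>2)) \<longlonglongrightarrow> ennreal ((norm (g x - ?s n x))\<^sup>2)"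
          unfolding g_def by (intro tendsto_ennrealI tendsto_intros)
        from lim_imp_Liminf[OF _ this] show ?case by simp
      qed
    qed
    also have "\<dots> \<le> liminf (\<lambda>i. \<integral>\<^sup>+x. ennreal ((norm (?s (r i) x - ?s n x))\<^sup>2) \<partial>leb01)"
      by (intro nn_integral_liminf) measurable
    also have "\<dots> \<le> ennreal (e\<^sup>2)"
      by (rule Liminf_le) (use le in \<open>auto simp: eventually_sequentially\<close>)
    finally have *: "(\<integral>\<^sup>+x. ennreal ((norm (g x - ?s n x))\<^sup>2) \<partial>leb01) \<le> ennreal (e\<^sup>2)" .
    then have i: "integrable leb01 (\<lambda>x. (norm (g x - ?s n x))\<^sup>2)"
      by (intro integrableI_bounded) (auto simp: top_unique less_top intro: le_less_trans)
    then show sqi: "(\<lambda>x. g x - ?s n x) sq_integrable_on {0<..<1}"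
      by (simp add: sq_integrable_on_def)
    have "ennreal (integral\<^sup>L leb01 (\<lambda>x. (norm (g x - ?s n x))\<^sup>2)) \<le> ennreal (e\<^sup>2)"
      using * i by (subst nn_integral_eq_integral[symmetric]) auto
    then have "integral\<^sup>L leb01 (\<lambda>x. (norm (g x - ?s n x))\<^sup>2) \<le> e\<^sup>2"
      by (subst (asm) ennreal_le_iff) auto
    then show "norm (to_L2 (\<lambda>x. g x - ?s n x)) \<le> e"
      using e by (simp add: norm_to_L2[OF sqi] real_le_lsqrt integral_nonneg_AE)
  qed
  obtain N where N: "\<forall>i\<ge>N. \<forall>j\<ge>N. norm (X i - X j) < 1"
    using CauchyD[OF X, of 1] by auto
  have "(\<lambda>x. g x - ?s N x) sq_integrable_on {0<..<1}"
    by (rule fatou(1)[of 1 N]) (use N in \<open>auto intro: less_imp_le\<close>)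
  from sq_integrable_on_add[OF this sq[of N]] have g: "g sq_integrable_on {0<..<1}" by simp
  have "X \<longlonglongrightarrow> to_L2 g"
  proof (rule LIMSEQ_I)
    fix e :: real assume "e > 0"
    then obtain M where M: "\<forall>i\<ge>M. \<forall>j\<ge>M. norm (X i - X j) < e / 2"
      using CauchyD[OF X, of "e / 2"] by auto
    have "norm (X n - to_L2 g) < e" if "n \<ge> M" for n
    proof -
      have "norm (to_L2 (\<lambda>x. g x - ?s n x)) \<le> e / 2"
        by (rule fatou(2)[of _ M]) (use \<open>e > 0\<close> M that in \<open>auto intro: less_imp_le\<close>)
      then have "norm (to_L2 g - X n) \<le> e / 2"
        using to_L2_diff(1)[OF g sq[of n]] by simp
      then show ?thesis using \<open>e > 0\<close> by (simp add: norm_minus_commute)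
    qed
    then show "\<exists>M. \<forall>n\<ge>M. norm (X n - to_L2 g) < e" by blast
  qed
  then show "convergent X" by (auto simp: convergent_def)
qed

subsection \<open>Separability, needed for Bochner integrals with values in L2\<close>

definition rat_step :: "nat \<Rightarrow> (rat \<times> rat) list \<Rightarrow> real \<Rightarrow> complex" where
  "rat_step n cs x = (let i = nat \<lfloor>real n * x\<rfloor> in
     if i < length cs then Complex (of_rat (fst (cs ! i))) (of_rat (snd (cs ! i))) else 0)"

lemma bounded_sq_integrable_leb01:
  fixes f :: "real \<Rightarrow> complex"
  assumes [measurable]: "f \<in> borel_measurable leb01" and bd: "\<And>x. 0 < x \<Longrightarrow> x < 1 \<Longrightarrow> norm (f x) \<le> B"
  shows "f sq_integrable_on {0<..<1}" and "norm (to_L2 f) \<le> B"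
proof -
  interpret finite_measure leb01 by (rule finite_measure_leb01)
  have bd2: "AE x in leb01. (norm (f x))\<^sup>2 \<le> B\<^sup>2"
    by (intro AE_I2 power_mono) (auto simp: bd)
  have i: "integrable leb01 (\<lambda>x. (norm (f x))\<^sup>2)"
    by (rule integrable_const_bound[where B = "B\<^sup>2"]) (use bd2 in auto)
  then show *: "f sq_integrable_on {0<..<1}"
    by (simp add: sq_integrable_on_def)
  have "integral\<^sup>L leb01 (\<lambda>x. (norm (f x))\<^sup>2) \<le> integral\<^sup>L leb01 (\<lambda>x. B\<^sup>2)"
    by (intro integral_mono_AE i bd2) auto
  moreover have "0 \<le> B" using bd[of "1/2"] by (auto intro: order_trans[OF norm_ge_zero])
  ultimately show "norm (to_L2 f) \<le> B"
    by (auto simp: norm_to_L2[OF *] measure_restrict_space intro!: real_le_lsqrt integral_nonneg_AE)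
qed

lemma L2_dense_bounded:
  assumes "e > 0"
  obtains f B where "f \<in> borel_measurable leb01" "\<And>x. norm (f x) \<le> B" "norm (F - to_L2 f) < e"
proof -
  let ?F = "rep_L2 F"
  have F: "?F sq_integrable_on {0<..<1}" by (rule sq_integrable_rep_L2)
  then have [measurable]: "?F \<in> borel_measurable leb01" by (auto simp: sq_integrable_on_def)
  define t where "t k x = (if norm (?F x) \<le> real k then ?F x else 0)" for k x
  have [measurable]: "t k \<in> borel_measurable leb01" for k unfolding t_def by measurable
  have t: "t k sq_integrable_on {0<..<1}" for k
    by (rule bounded_sq_integrable_leb01[where B = "real k"]) (auto simp: t_def)
  have "(\<lambda>k. integral\<^sup>L leb01 (\<lambda>x. (norm (?F x - t k x))\<^sup>2)) \<longlonglongrightarrow> integral\<^sup>L leb01 (\<lambda>x. 0::real)"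
  proof (rule integral_dominated_convergence[where w = "\<lambda>x. (norm (?F x))\<^sup>2"])
    show "AE x in leb01. (\<lambda>k. (norm (?F x - t k x))\<^sup>2) \<longlonglongrightarrow> 0"
    proof (rule AE_I2)
      fix x
      obtain K where K: "norm (?F x) \<le> real K" using real_arch_simple by blast
      have "eventually (\<lambda>k. (norm (?F x - t k x))\<^sup>2 = 0) sequentially"
        using eventually_ge_at_top[of K] by eventually_elim (use K in \<open>auto simp: t_def\<close>)
      then show "(\<lambda>k. (norm (?F x - t k x))\<^sup>2) \<longlonglongrightarrow> 0" by (rule tendsto_eventually)
    qed
  qed (use F in \<open>auto simp: sq_integrable_on_def t_def\<close>)
  then have "(\<lambda>k. sqrt (integral\<^sup>L leb01 (\<lambda>x. (norm (?F x - t k x))\<^sup>2))) \<longlonglongrightarrow> sqrt 0"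
    by (intro tendsto_real_sqrt) simp
  then have "(\<lambda>k. norm (F - to_L2 (t k))) \<longlonglongrightarrow> 0"
    using to_L2_diff[OF F t] by (simp add: norm_to_L2)
  from order_tendstoD(2)[OF this assms] obtain k where "norm (F - to_L2 (t k)) < e"
    by (auto simp: eventually_sequentially)
  then show thesis by (intro that[of "t k" "real k"]) (auto simp: t_def)
qed

lemma L2_dense_continuous:
  assumes "e > 0"
  obtains g :: "real \<Rightarrow> complex" where "continuous_on UNIV g" "norm (F - to_L2 g) < e" "g sq_integrable_on {0<..<1}"
proof -
  obtain f B where f [measurable]: "f \<in> borel_measurable leb01" and B: "\<And>x. norm (f x) \<le> B"
    and fF: "norm (F - to_L2 f) < e / 2"
    using L2_dense_bounded[of "e / 2" F] assms by auto
  have f2: "f sq_integrable_on {0<..<1}"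
    by (rule bounded_sq_integrable_leb01[where B = B]) (auto simp: B)
  have "f measurable_on {0<..<1}"
    by (simp add: measurable_on_iff_borel_measurable)
  then obtain N h where N: "negligible N" and h: "\<And>n. continuous_on UNIV (h n)"
    and lim: "\<And>x. x \<notin> N \<Longrightarrow> (\<lambda>n. h n x) \<longlonglongrightarrow> (if x \<in> {0<..<1} then f x else 0)"
    unfolding measurable_on_def by blast
  have B0: "0 \<le> B" using B[of 0] by (rule order_trans[OF norm_ge_zero])
  define c where "c = closest_point (cball (0::complex) B)"
  have cc: "continuous_on UNIV c" unfolding c_def
    by (intro continuous_on_closest_point) (use B0 in auto)
  have cB: "norm (c z) \<le> B" for z
    using closest_point_in_set[of "cball 0 B" z] B0 by (auto simp: c_def)
  have cf: "c (f x) = f x" for x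
    using closest_point_self[of "f x" "cball 0 B"] B[of x] by (simp add: c_def)
  define k where "k n x = c (h n x)" for n x
  have kc: "continuous_on UNIV (k n)" for n
    unfolding k_def by (rule continuous_on_compose2[OF cc h]) auto
  then have km [measurable]: "k n \<in> borel_measurable leb01" for n
    by (intro continuous_imp_measurable_on_sets_lebesgue continuous_on_subset[OF kc]) auto
  have k2: "k n sq_integrable_on {0<..<1}" for n
    by (rule bounded_sq_integrable_leb01[where B = B]) (auto simp: k_def cB)
  have "(\<lambda>n. integral\<^sup>L leb01 (\<lambda>x. (norm (f x - k n x))\<^sup>2)) \<longlonglongrightarrow> integral\<^sup>L leb01 (\<lambda>x. 0::real)"
  proof (rule integral_dominated_convergence[where w = "\<lambda>x. (2 * B)\<^sup>2"])
    have "AE x in lebesgue. x \<notin> N"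
      using N by (intro AE_not_in) (simp add: negligible_iff_null_sets)
    then have "AE x in leb01. x \<notin> N" by (subst AE_restrict_space_iff) (auto elim: AE_mp)
    then show "AE x in leb01. (\<lambda>n. (norm (f x - k n x))\<^sup>2) \<longlonglongrightarrow> 0"
      using AE_space
    proof eventually_elim
      case (elim x)
      have "(\<lambda>n. k n x) \<longlonglongrightarrow> c (f x)"
        unfolding k_def by (rule continuous_on_tendsto_compose[OF cc]) (use lim[of x] elim in auto)
      then have "(\<lambda>n. (norm (f x - k n x))\<^sup>2) \<longlonglongrightarrow> (norm (f x - c (f x)))\<^sup>2"
        by (intro tendsto_intros)
      then show ?case by (simp add: cf)
    qed
    show "AE x in leb01. norm ((norm (f x - k n x))\<^sup>2) \<le> (2 * B)\<^sup>2" for n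
    proof (rule AE_I2)
      fix x
      have "norm (f x - k n x) \<le> 2 * B"
        using norm_triangle_ineq4[of "f x" "k n x"] B[of x] cB[of "h n x"] by (simp add: k_def)
      then show "norm ((norm (f x - k n x))\<^sup>2) \<le> (2 * B)\<^sup>2"
        by (simp only: real_norm_def abs_power2) (intro power_mono, auto)
    qed
  qed (auto simp: finite_measure.integrable_const[OF finite_measure_leb01])
  then have "(\<lambda>n. sqrt (integral\<^sup>L leb01 (\<lambda>x. (norm (f x - k n x))\<^sup>2))) \<longlonglongrightarrow> sqrt 0"
    by (intro tendsto_real_sqrt) simp
  then have "(\<lambda>n. norm (to_L2 f - to_L2 (k n))) \<longlonglongrightarrow> 0"
    using to_L2_diff[OF f2 k2] by (simp add: norm_to_L2)
  from order_tendstoD(2)[OF this, of "e / 2"] assms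
  obtain n where "norm (to_L2 f - to_L2 (k n)) < e / 2"
    by (auto simp: eventually_sequentially)
  then have "norm (F - to_L2 (k n)) < e"
    using fF norm_triangle_ineq[of "F - to_L2 f" "to_L2 f - to_L2 (k n)"] by simp
  then show thesis by (intro that[of "k n"] kc k2)
qed

lemma rat_step_measurable: "rat_step n cs \<in> borel_measurable leb01"
proof -
  have "(\<lambda>x::real. nat \<lfloor>real n * x\<rfloor>) \<in> measurable borel (count_space UNIV)"
    by measurable
  moreover have "(\<lambda>i. if i < length cs then Complex (of_rat (fst (cs ! i))) (of_rat (snd (cs ! i))) else 0)
      \<in> borel_measurable (count_space UNIV)" by simp
  ultimately have "(\<lambda>x::real. (\<lambda>i. if i < length cs then Complex (of_rat (fst (cs ! i))) (of_rat (snd (cs ! i))) else 0)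
      (nat \<lfloor>real n * x\<rfloor>)) \<in> borel_measurable borel"
    by (rule measurable_compose)
  then have "rat_step n cs \<in> borel_measurable borel"
    by (simp add: rat_step_def[abs_def] Let_def)
  then show ?thesis
    by (intro measurable_restrict_space1) (simp add: measurable_completion)
qed

lemma complex_rat_dense:
  assumes "e > 0"
  shows "\<exists>q :: rat \<times> rat. norm (z - Complex (of_rat (fst q)) (of_rat (snd q))) < e"
proof -
  obtain p where p: "Re z < of_rat p" "of_rat p < Re z + e / 2"
    using of_rat_dense[of "Re z" "Re z + e / 2"] assms by auto
  obtain q where q: "Im z < of_rat q" "of_rat q < Im z + e / 2"
    using of_rat_dense[of "Im z" "Im z + e / 2"] assms by auto
  have "norm (z - Complex (of_rat p) (of_rat q)) \<le> \<bar>Re z - of_rat p\<bar> + \<bar>Im z - of_rat q\<bar>"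
    using cmod_le[of "z - Complex (of_rat p) (of_rat q)"] by simp
  also have "\<dots> < e" using p q by linarith
  finally show ?thesis by (intro exI[of _ "(p, q)"]) simp
qed

lemma L2_dense_rat_step:
  assumes "e > 0"
  shows "\<exists>n cs. norm (F - to_L2 (rat_step n cs)) < e"
proof -
  obtain g :: "real \<Rightarrow> complex" where g: "continuous_on UNIV g" and gF: "norm (F - to_L2 g) < e / 2"
    and g2: "g sq_integrable_on {0<..<1}"
    using L2_dense_continuous[of "e / 2" F] assms by auto
  have "uniformly_continuous_on {0..1} g"
    by (intro compact_uniformly_continuous continuous_on_subset[OF g]) auto
  then obtain d where d: "d > 0"
    and gd: "\<And>x y. x \<in> {0..1} \<Longrightarrow> y \<in> {0..1} \<Longrightarrow> dist x y < d \<Longrightarrow> dist (g x) (g y) < e / 8"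
    unfolding uniformly_continuous_on_def using assms by (metis zero_less_divide_iff zero_less_numeral)
  obtain n :: nat where n: "n > 0" "1 / real n < d"
    using d by (metis nat_approx_posE zero_less_Suc)
  have "\<forall>i. \<exists>q. norm (g (real i / real n) - Complex (of_rat (fst q)) (of_rat (snd q))) < e / 8"
    using complex_rat_dense[of "e / 8"] assms by simp
  then obtain q where q: "\<And>i. norm (g (real i / real n) - Complex (of_rat (fst (q i))) (of_rat (snd (q i)))) < e / 8"
    by metis
  define cs where "cs = map q [0..<n]"
  have bd: "norm (g x - rat_step n cs x) \<le> e / 4" if x: "0 < x" "x < 1" for x
  proof -
    define i where "i = nat \<lfloor>real n * x\<rfloor>"
    have i: "real i \<le> real n * x" "real n * x < real i + 1"
      using x by (simp_all add: i_def)
    have "real n * x < real n * 1" using x n by (intro mult_strict_left_mono) auto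
    then have i_n: "i < n" using i(1) by simp
    have "dist x (real i / real n) < d"
    proof -
      have "real i / real n \<le> x" "x < real i / real n + 1 / real n"
        using i n by (auto simp: field_simps)
      then show ?thesis using n by (simp add: dist_real_def)
    qed
    then have "norm (g x - g (real i / real n)) < e / 8"
      using gd[of x "real i / real n"] x i_n by (simp add: dist_norm)
    moreover have "rat_step n cs x = Complex (of_rat (fst (q i))) (of_rat (snd (q i)))"
      using i_n by (simp add: rat_step_def cs_def Let_def flip: i_def)
    ultimately show ?thesis
      using q[of i] norm_triangle_ineq[of "g x - g (real i / real n)" "g (real i / real n) - rat_step n cs x"]
      by simp
  qed
  have [measurable]: "rat_step n cs \<in> borel_measurable leb01" by (rule rat_step_measurable)
  have [measurable]: "g \<in> borel_measurable leb01" using g2 by (simp add: sq_integrable_on_def)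
  have d2: "(\<lambda>x. g x - rat_step n cs x) sq_integrable_on {0<..<1}"
    and dn: "norm (to_L2 (\<lambda>x. g x - rat_step n cs x)) \<le> e / 4"
    by (intro bounded_sq_integrable_leb01[where B = "e / 4"] bd; measurable)+
  have r2: "rat_step n cs sq_integrable_on {0<..<1}"
    using sq_integrable_on_diff[OF g2 d2] by simp
  have "norm (to_L2 g - to_L2 (rat_step n cs)) \<le> e / 4"
    using dn to_L2_diff(1)[OF g2 r2] by simp
  then have "norm (F - to_L2 (rat_step n cs)) < e"
    using gF norm_triangle_ineq[of "F - to_L2 g" "to_L2 g - to_L2 (rat_step n cs)"] assms by simp
  then show ?thesis by blast
qed

instance L2 :: second_countable_topology
proof
  define D where "D = range (\<lambda>(n, cs). to_L2 (rat_step n cs))"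
  define \<B> where "\<B> = (\<lambda>(f, n). ball f (1 / real (Suc n))) ` (D \<times> UNIV)"
  have "countable \<B>" by (simp add: \<B>_def D_def)
  moreover have "topological_basis \<B>"
  proof (rule topological_basisI)
    fix B assume "B \<in> \<B>" then show "open B" by (auto simp: \<B>_def)
  next
    fix U :: "L2 set" and F assume "open U" "F \<in> U"
    then obtain e where e: "e > 0" "ball F e \<subseteq> U" by (auto simp: open_contains_ball)
    obtain n where n: "1 / real (Suc n) < e / 2"
      using e nat_approx_posE[of "e / 2"] by auto
    obtain m cs where h: "norm (F - to_L2 (rat_step m cs)) < 1 / real (Suc n)"
      using L2_dense_rat_step[of "1 / real (Suc n)" F] by auto
    have "F \<in> ball (to_L2 (rat_step m cs)) (1 / real (Suc n))"
      using h by (simp add: dist_norm norm_minus_commute)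
    moreover have "ball (to_L2 (rat_step m cs)) (1 / real (Suc n)) \<subseteq> ball F e"
    proof
      fix G assume "G \<in> ball (to_L2 (rat_step m cs)) (1 / real (Suc n))"
      then have "dist F G < 1 / real (Suc n) + 1 / real (Suc n)"
        using h dist_triangle[of F G "to_L2 (rat_step m cs)"] by (simp add: dist_norm)
      then show "G \<in> ball F e" using n by simp
    qed
    moreover have "ball (to_L2 (rat_step m cs)) (1 / real (Suc n)) \<in> \<B>"
      by (force simp: \<B>_def D_def)
    ultimately show "\<exists>B\<in>\<B>. F \<in> B \<and> B \<subseteq> U" using e(2) by blast
  qed
  ultimately show "\<exists>\<B> :: L2 set set. countable \<B> \<and> open = generate_topology \<B>"
    by (blast intro: topological_basis_imp_subbasis)
qed


section \<open>Sobolev spaces\<close>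

text \<open>Weak derivatives on an interval are tested against continuously differentiable functions
  with compact support, and \<open>H10\<close> is the closure of these functions in the \<open>H1\<close> norm
  (as in Brezis, Functional Analysis, Sobolev Spaces and PDE, Chapter 8; smooth
  test functions yield the same spaces).\<close>

definition test_fun :: "real \<Rightarrow> real \<Rightarrow> (real \<Rightarrow> 'b::real_normed_vector) \<Rightarrow> bool" where
  "test_fun a b \<theta> \<longleftrightarrow> \<theta> C1_differentiable_on UNIV \<and> closure {x. \<theta> x \<noteq> 0} \<subseteq> {a<..<b}"

definition has_weak_deriv ::
    "real \<Rightarrow> real \<Rightarrow> (real \<Rightarrow> 'b::{banach, second_countable_topology}) \<Rightarrow> (real \<Rightarrow> 'b) \<Rightarrow> bool" where
  "has_weak_deriv a b f g \<longleftrightarrow>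
     (\<forall>\<theta> :: real \<Rightarrow> real. test_fun a b \<theta> \<longrightarrow>
        integral\<^sup>L (lebesgue_on {a<..<b}) (\<lambda>x. vector_derivative \<theta> (at x) *\<^sub>R f x) =
        - integral\<^sup>L (lebesgue_on {a<..<b}) (\<lambda>x. \<theta> x *\<^sub>R g x))"

definition H1 :: "real \<Rightarrow> real \<Rightarrow> (real \<Rightarrow> 'b::{banach, second_countable_topology}) set" where
  "H1 a b = {f. f sq_integrable_on {a<..<b} \<and>
     (\<exists>g. g sq_integrable_on {a<..<b} \<and> has_weak_deriv a b f g)}"

text \<open>The intervals below are those between consecutive points of \<open>A \<union> {0, 1}\<close>.\<close>

definition H1_piecewise :: "real set \<Rightarrow> (real \<Rightarrow> real) set" where
  "H1_piecewise A = {\<mu>. \<mu> sq_integrable_on {0<..<1} \<and>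
     (\<forall>a b. a \<in> A \<union> {0, 1} \<and> b \<in> A \<union> {0, 1} \<and> a < b \<and> {a<..<b} \<inter> A = {} \<longrightarrow> \<mu> \<in> H1 a b)}"

definition H10 :: "L2 set" where
  "H10 = {to_L2 f | f. f sq_integrable_on {0<..<1} \<and>
     (\<exists>g. g sq_integrable_on {0<..<1} \<and> has_weak_deriv 0 1 f g \<and>
       (\<forall>\<epsilon>>0. \<exists>\<theta> :: real \<Rightarrow> complex. test_fun 0 1 \<theta> \<and>
          norm (to_L2 f - to_L2 \<theta>) < \<epsilon> \<and>
          norm (to_L2 g - to_L2 (\<lambda>x. vector_derivative \<theta> (at x))) < \<epsilon>))}"


section \<open>The Dirichlet Laplacian, the Schroedinger group and mild solutions\<close>

definition phi :: "nat \<Rightarrow> L2" where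
  "phi k = to_L2 (\<lambda>x. complex_of_real (sqrt 2 * sin (real k * pi * x)))"

definition eigenval :: "nat \<Rightarrow> real" where
  "eigenval k = (real k)\<^sup>2 * pi\<^sup>2"

text \<open>The series converges on \<open>H10\<close>; elsewhere \<open>infsum\<close> takes the value 0, so this is only
  meaningful together with membership in \<open>H10\<close>.\<close>

definition H10_norm :: "L2 \<Rightarrow> real" where
  "H10_norm \<psi> = sqrt (\<Sum>\<^sub>\<infinity>k\<in>{1..}. (cmod (of_nat k * cinner_L2 (phi k) \<psi>))\<^sup>2)"

text \<open>The functions \<open>phi k\<close>, \<open>k \<ge> 1\<close>, form a Hilbert basis, and \<open>schroedinger t\<close> is the
  bounded operator with \<open>phi k \<mapsto> exp (- i (eigenval k) t) phi k\<close>.\<close>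

definition schroedinger :: "real \<Rightarrow> L2 \<Rightarrow> L2" where
  "schroedinger t f = (\<Sum>\<^sub>\<infinity>k\<in>{1..}.
     (exp (- \<i> * complex_of_real (eigenval k * t)) * cinner_L2 f (phi k)) *\<^sub>C phi k)"

definition eigensol :: "nat \<Rightarrow> real \<Rightarrow> L2" where
  "eigensol l t = exp (- \<i> * complex_of_real (eigenval l * t)) *\<^sub>C phi l"

definition mult_L2 :: "(real \<Rightarrow> real) \<Rightarrow> L2 \<Rightarrow> L2" where
  "mult_L2 \<mu> f = to_L2 (\<lambda>x. complex_of_real (\<mu> x) * rep_L2 f x)"

definition continuous_into_H10 :: "real \<Rightarrow> (real \<Rightarrow> L2) \<Rightarrow> bool" where
  "continuous_into_H10 T \<psi> \<longleftrightarrow> (\<forall>t\<in>{0..T}. \<psi> t \<in> H10 \<and>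
     ((\<lambda>s. H10_norm (\<psi> s - \<psi> t)) \<longlongrightarrow> 0) (at t within {0..T}))"

text \<open>The Duhamel integral is a Bochner integral in \<open>L2\<close>; only the values of \<open>\<psi>\<close> on
  \<open>{0..T}\<close> matter.\<close>

definition mild_solution ::
    "real \<Rightarrow> (real \<Rightarrow> real) \<Rightarrow> L2 \<Rightarrow> (real \<Rightarrow> real) \<Rightarrow> (real \<Rightarrow> L2) \<Rightarrow> bool" where
  "mild_solution T \<mu> \<psi>\<^sub>0 u \<psi> \<longleftrightarrow> continuous_into_H10 T \<psi> \<and>
     (\<forall>t\<in>{0..T}.
        integrable (lebesgue_on {0..t}) (\<lambda>s. schroedinger (t - s) (u s *\<^sub>R mult_L2 \<mu> (\<psi> s))) \<and>
        \<psi> t = schroedinger t \<psi>\<^sub>0 -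
          \<i> *\<^sub>C integral\<^sup>L (lebesgue_on {0..t}) (\<lambda>s. schroedinger (t - s) (u s *\<^sub>R mult_L2 \<mu> (\<psi> s))))"

end

theory Submission
  imports Defs
begin

text \<open>Part 1. In the interaction picture, \<open>\<psi> t = schroedinger t (Linv (x t))\<close>, where \<open>Linv\<close> is a
  multiple of the inverse square root of the Dirichlet Laplacian, so that \<open>H10\<close> becomes \<open>L2\<close> and
  \<open>x\<close> solves an integral equation. Multiplication by \<open>\<mu>\<close> leaves \<open>H10\<close>, but the coefficients of the
  product are a finite sum of jump terms of order \<open>1 / k\<close> plus a regular part; since the frequencies
  \<open>k\<^sup>2 pi\<^sup>2\<close> make the exponentials orthogonal on intervals of length \<open>2 / pi\<close>, Bessel's inequality in
  time regains the missing derivative, and a contraction argument in a weighted norm applies.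

  Part 2. The linearisation at the eigensolution is a trigonometric moment problem with frequencies
  \<open>(k\<^sup>2 - l\<^sup>2) pi\<^sup>2\<close>. Their gaps tend to infinity and, by the non-resonance assumption, they and their
  opposites are distinct, so Ingham's inequality with Haraux's removal of finitely many frequencies
  solves it in any positive time with real controls, Lipschitz in the target. A fixed point argument
  transfers this to the nonlinear problem up to the component of the end point in the direction of
  \<open>phi l\<close>, whose real part the linearisation does not reach; conservation of the \<open>L2\<close> norm determines it.\<close>

section \<open>Complex inner product structure of L2\<close>

text \<open>That controls are real shapes Part 2. The moment of a real \<open>u\<close> at one
  frequency is the conjugate of its moment at the opposite frequency, so both have to be prescribed
  together. Non-resonance makes this consistent except at frequency 0, the mode
  \<open>k = l\<close>, where only a real moment can be reached. Since the coefficient of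
  \<open>mult_L2 \<mu> (phi l)\<close> along \<open>phi l\<close> is real, the linear response along
  \<open>phi l\<close> is purely imaginary there. The lower bound \<open>C / k\<close> compensates
  the weight \<open>k\<close> of the \<open>H10\<close> norm: dividing by \<open>k\<close> times the
  coefficients of \<open>mult_L2 \<mu> (phi l)\<close> is bounded on \<open>L2\<close>, so the cost
  of the control is bounded by the \<open>H10\<close> size of the target. Only Lipschitz dependence
  of the control on the target enters, so Banach's theorem takes the place of the inverse function
  theorem and the end point map is never differentiated. The unreached component \<alpha> satisfies
  \<open>\<alpha> * (2 * c + \<alpha>) = 0\<close> by norm conservation, and closeness to the
  eigensolution excludes the nonzero root. As \<open>u\<close> is merely square integrable in time,
  norm conservation is proved by refining partitions of the time interval, not by
  differentiating.\<close>

lemma cinner_L2_add_right: "cinner_L2 f (g + h) = cinner_L2 f g + cinner_L2 f h"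
  by (metis cinner_L2_add_left cinner_L2_commute complex_cnj_add)

lemma cinner_L2_scaleC_right: "cinner_L2 f (c *\<^sub>C g) = cnj c * cinner_L2 f g"
  by (metis cinner_L2_commute cinner_L2_scaleC_left complex_cnj_mult)

lemma cinner_L2_scaleR_left: "cinner_L2 (r *\<^sub>R f) g = r *\<^sub>R cinner_L2 f g"
  by (simp add: scaleR_L2_scaleC cinner_L2_scaleC_left scaleR_conv_of_real)

lemma cinner_L2_scaleR_right: "cinner_L2 f (r *\<^sub>R g) = r *\<^sub>R cinner_L2 f g"
  by (simp add: scaleR_L2_scaleC cinner_L2_scaleC_right scaleR_conv_of_real)

lemma cinner_L2_zero_left [simp]: "cinner_L2 0 g = 0"
  using cinner_L2_scaleR_left[of 0 0 g] by simp

lemma cinner_L2_zero_right [simp]: "cinner_L2 g 0 = 0"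
  using cinner_L2_scaleR_right[of g 0 0] by simp

lemma cinner_L2_minus_left: "cinner_L2 (- f) g = - cinner_L2 f g"
  using cinner_L2_scaleR_left[of "-1" f g] by simp

lemma cinner_L2_minus_right: "cinner_L2 g (- f) = - cinner_L2 g f"
  using cinner_L2_scaleR_right[of g "-1" f] by simp

lemma cinner_L2_diff_left: "cinner_L2 (f - g) h = cinner_L2 f h - cinner_L2 g h"
  using cinner_L2_add_left[of f "- g" h] by (simp add: cinner_L2_minus_left)

lemma cinner_L2_diff_right: "cinner_L2 h (f - g) = cinner_L2 h f - cinner_L2 h g"
  using cinner_L2_add_right[of h f "- g"] by (simp add: cinner_L2_minus_right)

lemma cinner_L2_sum_left: "cinner_L2 (\<Sum>i\<in>F. f i) g = (\<Sum>i\<in>F. cinner_L2 (f i) g)"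
  by (induction F rule: infinite_finite_induct) (auto simp: cinner_L2_add_left)

lemma cinner_L2_sum_right: "cinner_L2 g (\<Sum>i\<in>F. f i) = (\<Sum>i\<in>F. cinner_L2 g (f i))"
  by (induction F rule: infinite_finite_induct) (auto simp: cinner_L2_add_right)

lemma cinner_L2_norm: "cinner_L2 f f = complex_of_real ((norm f)\<^sup>2)"
  by (metis cinner_L2_same(1) inner_L2_def power2_norm_eq_inner)

lemma norm_scaleC_L2: "norm (c *\<^sub>C f) = cmod c * norm f" for f :: L2
proof -
  have "complex_of_real ((norm (c *\<^sub>C f))\<^sup>2) = complex_of_real ((cmod c * norm f)\<^sup>2)"
    by (simp only: cinner_L2_norm[symmetric] cinner_L2_scaleC_left cinner_L2_scaleC_right)
      (simp add: cinner_L2_norm power_mult_distrib, metis complex_norm_square mult.commute of_real_power)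
  then have "(norm (c *\<^sub>C f))\<^sup>2 = (cmod c * norm f)\<^sup>2"
    by (simp only: of_real_eq_iff)
  then show ?thesis by (simp add: power2_eq_iff_nonneg)
qed

lemma scaleC_L2_add_right: "c *\<^sub>C (f + g) = c *\<^sub>C f + c *\<^sub>C g" for f g :: L2
  by transfer (auto simp: L2_rel_def distrib_left intro!: sq_integrable_on_add sq_integrable_on_cmult)

lemma scaleC_L2_add_left: "(c + d) *\<^sub>C f = c *\<^sub>C f + d *\<^sub>C f" for f :: L2
  by transfer (auto simp: L2_rel_def distrib_right intro!: sq_integrable_on_add sq_integrable_on_cmult)

lemma scaleC_L2_scaleC: "c *\<^sub>C d *\<^sub>C f = (c * d) *\<^sub>C f" for f :: L2
  by transfer (auto simp: L2_rel_def mult.assoc intro!: sq_integrable_on_cmult)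

lemma scaleC_L2_zero_left [simp]: "0 *\<^sub>C f = (0 :: L2)"
  using scaleR_L2_scaleC[of 0 f] by simp

lemma scaleC_L2_scaleR_left: "(r *\<^sub>R c) *\<^sub>C f = r *\<^sub>R (c *\<^sub>C f)" for f :: L2
  by (simp add: scaleR_L2_scaleC scaleC_L2_scaleC scaleR_conv_of_real)

lemma scaleC_L2_scaleR_right: "c *\<^sub>C (r *\<^sub>R f) = r *\<^sub>R (c *\<^sub>C f)" for f :: L2
  by (simp add: scaleR_L2_scaleC scaleC_L2_scaleC mult.commute)

lemma bounded_bilinear_scaleC_L2: "bounded_bilinear (\<lambda>c (f :: L2). c *\<^sub>C f)"
  by standard
    (auto simp: scaleC_L2_add_left scaleC_L2_add_right scaleC_L2_scaleR_left scaleC_L2_scaleR_right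
      norm_scaleC_L2 intro!: exI[of _ 1])

lemmas bounded_linear_scaleC_L2 = bounded_bilinear.bounded_linear_right[OF bounded_bilinear_scaleC_L2]

lemmas continuous_on_scaleC_L2 [continuous_intros] =
  bounded_bilinear.continuous_on[OF bounded_bilinear_scaleC_L2]

lemma cinner_L2_Cauchy_Schwarz: "cmod (cinner_L2 f g) \<le> norm f * norm g"
proof (cases "cinner_L2 f g = 0")
  case False
  \<comment> \<open>The phase that rotates the complex inner product onto the positive real axis,
    where it agrees with \<open>inner\<close> and the real Cauchy-Schwarz inequality
    applies.\<close>
  define c where "c = cnj (cinner_L2 f g) / cmod (cinner_L2 f g)"
  have "cmod c = 1" using False by (simp add: c_def norm_divide)
  have "cinner_L2 (c *\<^sub>C f) g = cmod (cinner_L2 f g)"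
    using False by (simp add: c_def cinner_L2_scaleC_left mult.commute flip: complex_norm_square)
      (simp add: power2_eq_square)
  then have "cmod (cinner_L2 f g) = inner (c *\<^sub>C f) g" by (simp add: inner_L2_def)
  also have "\<dots> \<le> norm (c *\<^sub>C f) * norm g" by (rule norm_cauchy_schwarz)
  finally show ?thesis using \<open>cmod c = 1\<close> by (simp add: norm_scaleC_L2)
qed auto

lemma bounded_bilinear_cinner_L2: "bounded_bilinear cinner_L2"
  by standard
    (auto simp: cinner_L2_add_left cinner_L2_add_right cinner_L2_scaleR_left cinner_L2_scaleR_right
      intro!: exI[of _ 1] cinner_L2_Cauchy_Schwarz)

lemmas bounded_linear_cinner_L2_left = bounded_bilinear.bounded_linear_left[OF bounded_bilinear_cinner_L2]
lemmas tendsto_cinner_L2 [tendsto_intros] = bounded_bilinear.tendsto[OF bounded_bilinear_cinner_L2]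
lemmas continuous_on_cinner_L2 [continuous_intros] =
  bounded_bilinear.continuous_on[OF bounded_bilinear_cinner_L2]

lemma cinner_to_L2:
  assumes "f sq_integrable_on {0<..<1}" "g sq_integrable_on {0<..<1}"
  shows "cinner_L2 (to_L2 f) (to_L2 g) = integral\<^sup>L leb01 (\<lambda>x. f x * cnj (g x))"
  using assms by (simp add: to_L2_def) (intro cinner_L2.abs_eq, auto simp: L2_rel_def)

lemma to_L2_add:
  assumes "f sq_integrable_on {0<..<1}" "g sq_integrable_on {0<..<1}"
  shows "to_L2 (\<lambda>x. f x + g x) = to_L2 f + to_L2 g"
  using assms sq_integrable_on_add[OF assms]
  by (simp add: to_L2_def) (intro plus_L2.abs_eq[symmetric], auto simp: L2_rel_def)

lemma to_L2_cmult:
  assumes "f sq_integrable_on {0<..<1}"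
  shows "to_L2 (\<lambda>x. c * f x) = c *\<^sub>C to_L2 f"
  using assms sq_integrable_on_cmult[OF assms]
  by (simp add: to_L2_def) (intro scaleC_L2.abs_eq[symmetric], auto simp: L2_rel_def)

lemma to_L2_zero: "to_L2 (\<lambda>x. 0) = 0"
  by (simp add: to_L2_def sq_integrable_on_zero zero_L2_def)

lemma sq_integrable_on_sum:
  fixes f :: "'i \<Rightarrow> real \<Rightarrow> complex"
  assumes "\<And>i. i \<in> I \<Longrightarrow> f i sq_integrable_on S"
  shows "(\<lambda>x. \<Sum>i\<in>I. f i x) sq_integrable_on S"
  using assms
  by (induction I rule: infinite_finite_induct)
    (auto simp: sq_integrable_on_zero intro!: sq_integrable_on_add)

lemma to_L2_sum:
  assumes "\<And>i. i \<in> I \<Longrightarrow> f i sq_integrable_on {0<..<1}"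
  shows "to_L2 (\<lambda>x. \<Sum>i\<in>I. f i x) = (\<Sum>i\<in>I. to_L2 (f i))"
  using assms
  by (induction I rule: infinite_finite_induct)
    (auto simp: to_L2_zero to_L2_add sq_integrable_on_sum)

lemma to_L2_cong_AE:
  assumes "f sq_integrable_on {0<..<1}" "g \<in> borel_measurable leb01" "AE x in leb01. f x = g x"
  shows "to_L2 f = to_L2 g" and "g sq_integrable_on {0<..<1}"
proof -
  have [measurable]: "f \<in> borel_measurable leb01" "g \<in> borel_measurable leb01"
    using assms by (auto simp: sq_integrable_on_def)
  have "integrable leb01 (\<lambda>x. (norm (f x))\<^sup>2) \<longleftrightarrow> integrable leb01 (\<lambda>x. (norm (g x))\<^sup>2)"
    by (rule integrable_cong_AE) (use assms(3) in auto)
  then show "g sq_integrable_on {0<..<1}" using assms by (auto simp: sq_integrable_on_def)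
  then show "to_L2 f = to_L2 g" using assms by (subst to_L2_eq_iff) auto
qed

subsection \<open>Multiplication by an essentially bounded function\<close>

text \<open>Without such a bound \<open>mult_L2\<close> need not even be additive, because
  \<open>to_L2\<close> sends a product that is not square integrable to 0.\<close>

definition ess_bounded :: "real \<Rightarrow> (real \<Rightarrow> real) \<Rightarrow> bool" where
  "ess_bounded B \<mu> \<longleftrightarrow> 0 \<le> B \<and> \<mu> \<in> borel_measurable leb01 \<and> (AE x in leb01. \<bar>\<mu> x\<bar> \<le> B)"

lemma ess_bounded_mult:
  fixes f :: "real \<Rightarrow> complex"
  assumes "ess_bounded B \<mu>" "f sq_integrable_on {0<..<1}"
  shows "(\<lambda>x. complex_of_real (\<mu> x) * f x) sq_integrable_on {0<..<1}"
    and "norm (to_L2 (\<lambda>x. complex_of_real (\<mu> x) * f x)) \<le> B * norm (to_L2 f)"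
proof -
  have [measurable]: "\<mu> \<in> borel_measurable leb01" "f \<in> borel_measurable leb01"
    and i: "integrable leb01 (\<lambda>x. (norm (f x))\<^sup>2)" and B: "0 \<le> B"
    using assms by (auto simp: sq_integrable_on_def ess_bounded_def)
  have "AE x in leb01. \<bar>\<mu> x\<bar> \<le> B" using assms by (simp add: ess_bounded_def)
  then have bd: "AE x in leb01. (norm (complex_of_real (\<mu> x) * f x))\<^sup>2 \<le> B\<^sup>2 * (norm (f x))\<^sup>2"
  proof eventually_elim
    case (elim x)
    then have "norm (complex_of_real (\<mu> x) * f x) \<le> B * norm (f x)"
      by (simp add: norm_mult mult_right_mono)
    then show ?case by (metis norm_ge_zero power_mono power_mult_distrib)
  qed
  have ib: "integrable leb01 (\<lambda>x. (norm (complex_of_real (\<mu> x) * f x))\<^sup>2)"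
    by (rule Bochner_Integration.integrable_bound[where f = "\<lambda>x. B\<^sup>2 * (norm (f x))\<^sup>2"])
      (use i bd in auto)
  then show s: "(\<lambda>x. complex_of_real (\<mu> x) * f x) sq_integrable_on {0<..<1}"
    by (simp add: sq_integrable_on_def)
  have "integral\<^sup>L leb01 (\<lambda>x. (norm (complex_of_real (\<mu> x) * f x))\<^sup>2)
      \<le> integral\<^sup>L leb01 (\<lambda>x. B\<^sup>2 * (norm (f x))\<^sup>2)"
    by (rule integral_mono_AE) (use ib i bd in auto)
  also have "\<dots> = B\<^sup>2 * integral\<^sup>L leb01 (\<lambda>x. (norm (f x))\<^sup>2)" by simp
  finally have "sqrt (integral\<^sup>L leb01 (\<lambda>x. (norm (complex_of_real (\<mu> x) * f x))\<^sup>2))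
      \<le> sqrt (B\<^sup>2 * integral\<^sup>L leb01 (\<lambda>x. (norm (f x))\<^sup>2))"
    by (rule real_sqrt_le_mono)
  then show "norm (to_L2 (\<lambda>x. complex_of_real (\<mu> x) * f x)) \<le> B * norm (to_L2 f)"
    using B by (simp add: norm_to_L2[OF s] norm_to_L2[OF assms(2)] real_sqrt_mult)
qed

lemma mult_L2_to_L2:
  assumes "ess_bounded B \<mu>" "f sq_integrable_on {0<..<1}"
  shows "mult_L2 \<mu> (to_L2 f) = to_L2 (\<lambda>x. complex_of_real (\<mu> x) * f x)"
  unfolding mult_L2_def
proof (rule to_L2_cong_AE(1))
  have [measurable]: "\<mu> \<in> borel_measurable leb01" "f \<in> borel_measurable leb01"
    using assms by (auto simp: sq_integrable_on_def ess_bounded_def)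
  show "(\<lambda>x. complex_of_real (\<mu> x) * rep_L2 (to_L2 f) x) sq_integrable_on {0<..<1}"
    by (rule ess_bounded_mult[OF assms(1) sq_integrable_rep_L2])
  show "(\<lambda>x. complex_of_real (\<mu> x) * f x) \<in> borel_measurable leb01" by measurable
  show "AE x in leb01. complex_of_real (\<mu> x) * rep_L2 (to_L2 f) x = complex_of_real (\<mu> x) * f x"
    using rep_L2_to_L2[OF assms(2)] by eventually_elim simp
qed

lemma norm_mult_L2:
  assumes "ess_bounded B \<mu>"
  shows "norm (mult_L2 \<mu> f) \<le> B * norm f"
  using ess_bounded_mult(2)[OF assms sq_integrable_rep_L2[of f]]
    mult_L2_to_L2[OF assms sq_integrable_rep_L2[of f]] by simp

lemma mult_L2_add:
  assumes "ess_bounded B \<mu>"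
  shows "mult_L2 \<mu> (f + g) = mult_L2 \<mu> f + mult_L2 \<mu> g"
proof -
  note s = sq_integrable_rep_L2 and m = ess_bounded_mult(1)[OF assms sq_integrable_rep_L2]
  have "f + g = to_L2 (\<lambda>x. rep_L2 f x + rep_L2 g x)"
    using to_L2_add[OF s s, of f g] by simp
  then have "mult_L2 \<mu> (f + g) = to_L2 (\<lambda>x. complex_of_real (\<mu> x) * (rep_L2 f x + rep_L2 g x))"
    using mult_L2_to_L2[OF assms sq_integrable_on_add[OF s s]] by simp
  also have "\<dots> = mult_L2 \<mu> f + mult_L2 \<mu> g"
    using to_L2_add[OF m m, of f g] by (simp add: mult_L2_def distrib_left)
  finally show ?thesis .
qed

lemma mult_L2_scaleC:
  assumes "ess_bounded B \<mu>"
  shows "mult_L2 \<mu> (c *\<^sub>C f) = c *\<^sub>C mult_L2 \<mu> f"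
proof -
  note s = sq_integrable_rep_L2 and m = ess_bounded_mult(1)[OF assms sq_integrable_rep_L2]
  have "c *\<^sub>C f = to_L2 (\<lambda>x. c * rep_L2 f x)"
    using to_L2_cmult[OF s, of c f] by simp
  then have "mult_L2 \<mu> (c *\<^sub>C f) = to_L2 (\<lambda>x. complex_of_real (\<mu> x) * (c * rep_L2 f x))"
    using mult_L2_to_L2[OF assms sq_integrable_on_cmult[OF s]] by simp
  also have "\<dots> = c *\<^sub>C mult_L2 \<mu> f"
    using to_L2_cmult[OF m, of c f] by (simp add: mult_L2_def mult.left_commute)
  finally show ?thesis .
qed

lemma bounded_linear_mult_L2:
  assumes "ess_bounded B \<mu>"
  shows "bounded_linear (mult_L2 \<mu>)"
  by (rule bounded_linear_intro[where K = B])
    (use norm_mult_L2[OF assms] in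
      \<open>auto simp: mult_L2_add[OF assms] scaleR_L2_scaleC mult_L2_scaleC[OF assms] mult.commute\<close>)

lemma cinner_mult_L2:
  assumes "ess_bounded B \<mu>"
  shows "cinner_L2 (mult_L2 \<mu> f) g = cinner_L2 f (mult_L2 \<mu> g)"
proof -
  note s = sq_integrable_rep_L2 and m = ess_bounded_mult(1)[OF assms sq_integrable_rep_L2]
  have "cinner_L2 (mult_L2 \<mu> f) g = cinner_L2 (mult_L2 \<mu> f) (to_L2 (rep_L2 g))" by simp
  also have "\<dots> = integral\<^sup>L leb01 (\<lambda>x. (complex_of_real (\<mu> x) * rep_L2 f x) * cnj (rep_L2 g x))"
    unfolding mult_L2_def by (intro cinner_to_L2 m s)
  also have "\<dots> = integral\<^sup>L leb01 (\<lambda>x. rep_L2 f x * cnj (complex_of_real (\<mu> x) * rep_L2 g x))"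
    by (simp add: mult_ac)
  also have "\<dots> = cinner_L2 (to_L2 (rep_L2 f)) (mult_L2 \<mu> g)"
    unfolding mult_L2_def by (intro cinner_to_L2[symmetric] m s)
  finally show ?thesis by simp
qed

section \<open>Orthonormal families\<close>

definition orthonormal :: "('i \<Rightarrow> L2) \<Rightarrow> 'i set \<Rightarrow> bool" where
  "orthonormal e I \<longleftrightarrow> (\<forall>i\<in>I. \<forall>j\<in>I. cinner_L2 (e i) (e j) = (if i = j then 1 else 0))"

lemma orthonormal_cinner_sum:
  assumes "orthonormal e I" "finite F" "F \<subseteq> I" "j \<in> I"
  shows "cinner_L2 (\<Sum>i\<in>F. c i *\<^sub>C e i) (e j) = (if j \<in> F then c j else 0)"
proof -
  have "cinner_L2 (\<Sum>i\<in>F. c i *\<^sub>C e i) (e j) = (\<Sum>i\<in>F. if i = j then c i else 0)"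
    unfolding cinner_L2_sum_left cinner_L2_scaleC_left
    by (rule sum.cong) (use assms in \<open>auto simp: orthonormal_def\<close>)
  then show ?thesis using assms(2) by simp
qed

lemma orthonormal_norm_sum:
  assumes "orthonormal e I" "finite F" "F \<subseteq> I"
  shows "(norm (\<Sum>i\<in>F. c i *\<^sub>C e i))\<^sup>2 = (\<Sum>i\<in>F. (cmod (c i))\<^sup>2)"
proof -
  have "complex_of_real ((norm (\<Sum>i\<in>F. c i *\<^sub>C e i))\<^sup>2) = (\<Sum>j\<in>F. cnj (c j) * c j)"
    unfolding cinner_L2_norm[symmetric] cinner_L2_sum_right[of _ "\<lambda>i. c i *\<^sub>C e i"] cinner_L2_scaleC_right
    by (rule sum.cong) (use assms in \<open>auto simp: orthonormal_cinner_sum subsetD\<close>)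
  also have "\<dots> = complex_of_real (\<Sum>j\<in>F. (cmod (c j))\<^sup>2)"
    by (simp add: complex_norm_square mult.commute del: of_real_power)
  finally show ?thesis by (simp only: of_real_eq_iff)
qed

text \<open>The sum is the squared norm of the partial expansion \<open>p\<close>, and it also
  equals \<open>inner f p\<close>; Cauchy-Schwarz then gives
  \<open>norm p \<le> norm f\<close>.\<close>

lemma orthonormal_Bessel_finite:
  assumes "orthonormal e I" "finite F" "F \<subseteq> I"
  shows "(\<Sum>i\<in>F. (cmod (cinner_L2 f (e i)))\<^sup>2) \<le> (norm f)\<^sup>2"
proof -
  define p where "p = (\<Sum>i\<in>F. cinner_L2 f (e i) *\<^sub>C e i)"
  have p2: "(norm p)\<^sup>2 = (\<Sum>i\<in>F. (cmod (cinner_L2 f (e i)))\<^sup>2)"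
    unfolding p_def by (rule orthonormal_norm_sum[OF assms])
  have "cinner_L2 f p = (\<Sum>i\<in>F. cnj (cinner_L2 f (e i)) * cinner_L2 f (e i))"
    by (simp add: p_def cinner_L2_sum_right cinner_L2_scaleC_right)
  also have "\<dots> = complex_of_real ((norm p)\<^sup>2)"
    unfolding p2 by (simp add: complex_norm_square mult.commute del: of_real_power)
  finally have "inner f p = (norm p)\<^sup>2" by (simp add: inner_L2_def del: of_real_power)
  then have "(norm p)\<^sup>2 \<le> norm f * norm p" by (metis norm_cauchy_schwarz)
  then have "norm p \<le> norm f"
    by (cases "norm p = 0") (auto simp: power2_eq_square)
  then show ?thesis using p2 by (metis norm_ge_zero power_mono)
qed

lemma nonneg_summable_on_bounded:
  fixes g :: "'i \<Rightarrow> real"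
  assumes "\<And>i. i \<in> I \<Longrightarrow> 0 \<le> g i" "\<And>F. finite F \<Longrightarrow> F \<subseteq> I \<Longrightarrow> sum g F \<le> B"
  shows "g summable_on I" and "infsum g I \<le> B"
proof -
  show s: "g summable_on I"
    by (rule nonneg_bdd_above_summable_on) (use assms in \<open>auto intro!: bdd_aboveI[of _ B]\<close>)
  show "infsum g I \<le> B"
    by (rule infsum_le_finite_sums[OF s]) (use assms in auto)
qed

lemma orthonormal_Bessel:
  assumes "orthonormal e I"
  shows "(\<lambda>i. (cmod (cinner_L2 f (e i)))\<^sup>2) summable_on I"
    and "(\<Sum>\<^sub>\<infinity>i\<in>I. (cmod (cinner_L2 f (e i)))\<^sup>2) \<le> (norm f)\<^sup>2"
  using nonneg_summable_on_bounded[of I "\<lambda>i. (cmod (cinner_L2 f (e i)))\<^sup>2" "(norm f)\<^sup>2"]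
    orthonormal_Bessel_finite[OF assms] by auto

text \<open>Cauchy criterion for unconditional sums: two finite index sets containing
  \<open>F0\<close> have partial sums that differ only by sums over sets disjoint from
  \<open>F0\<close>, so the net of partial sums is Cauchy.\<close>

lemma summable_on_banach_Cauchy:
  fixes f :: "'i \<Rightarrow> 'b :: banach"
  assumes "\<And>\<epsilon>. \<epsilon> > 0 \<Longrightarrow> \<exists>F0. finite F0 \<and> F0 \<subseteq> I \<and>
    (\<forall>F. finite F \<longrightarrow> F \<subseteq> I \<longrightarrow> F \<inter> F0 = {} \<longrightarrow> norm (sum f F) < \<epsilon>)"
  shows "f summable_on I"
proof -
  have "\<exists>P. eventually P (finite_subsets_at_top I) \<and>
              (\<forall>F F'. P F \<and> P F' \<longrightarrow> dist (sum f F) (sum f F') < \<epsilon>)" if e: "\<epsilon> > 0" for \<epsilon>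
  proof -
    obtain F0 where F0: "finite F0" "F0 \<subseteq> I"
      "\<And>F. finite F \<Longrightarrow> F \<subseteq> I \<Longrightarrow> F \<inter> F0 = {} \<Longrightarrow> norm (sum f F) < \<epsilon> / 2"
      using assms[of "\<epsilon> / 2"] half_gt_zero[OF e] by meson
    define P where "P F \<longleftrightarrow> finite F \<and> F0 \<subseteq> F \<and> F \<subseteq> I" for F
    have "eventually P (finite_subsets_at_top I)"
      unfolding eventually_finite_subsets_at_top P_def using F0 by blast
    moreover have "dist (sum f F) (sum f F') < \<epsilon>" if "P F" "P F'" for F F'
    proof -
      have a: "sum f G = sum f F0 + sum f (G - F0)" if "P G" for G
        using that F0 by (metis P_def sum.subset_diff add.commute)
      have b: "norm (sum f (G - F0)) < \<epsilon> / 2" if "P G" for G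
        using that by (intro F0(3)) (auto simp: P_def)
      have "dist (sum f F) (sum f F') = norm (sum f (F - F0) - sum f (F' - F0))"
        using a[OF that(1)] a[OF that(2)] by (simp add: dist_norm)
      also have "\<dots> < \<epsilon>"
        using b[OF that(1)] b[OF that(2)] norm_triangle_ineq4[of "sum f (F - F0)" "sum f (F' - F0)"]
        by linarith
      finally show ?thesis .
    qed
    ultimately show ?thesis by blast
  qed
  then have "cauchy_filter (filtermap (sum f) (finite_subsets_at_top I))"
    by (simp add: cauchy_filter_metric_filtermap)
  moreover have "complete (UNIV::'b set)"
    by (meson Cauchy_convergent UNIV_I complete_def convergent_def)
  ultimately obtain L where "(sum f \<longlongrightarrow> L) (finite_subsets_at_top I)"
    using complete_uniform[where S = UNIV] by (force simp add: filterlim_def)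
  then show ?thesis using summable_on_def has_sum_def by blast
qed

lemma summable_on_tail_small:
  fixes g :: "'i \<Rightarrow> real"
  assumes "g summable_on I" "\<And>i. i \<in> I \<Longrightarrow> 0 \<le> g i" "\<epsilon> > 0"
  shows "\<exists>F0. finite F0 \<and> F0 \<subseteq> I \<and> (\<forall>F. finite F \<longrightarrow> F \<subseteq> I \<longrightarrow> F \<inter> F0 = {} \<longrightarrow> sum g F < \<epsilon>)"
proof -
  obtain F0 where F0: "finite F0" "F0 \<subseteq> I" "dist (sum g F0) (infsum g I) \<le> \<epsilon> / 2"
    using infsum_finite_approximation[OF assms(1), of "\<epsilon> / 2"] assms(3) by auto
  have "sum g F < \<epsilon>" if F: "finite F" "F \<subseteq> I" "F \<inter> F0 = {}" for F
  proof -
    have "sum g F + sum g F0 = sum g (F \<union> F0)" using F F0 by (simp add: sum.union_disjoint)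
    also have "\<dots> \<le> infsum g I"
      by (rule finite_sum_le_infsum[OF assms(1)]) (use F F0 assms in auto)
    finally show ?thesis using F0(3) assms(3) unfolding dist_real_def by linarith
  qed
  with F0 show ?thesis by blast
qed

text \<open>Orthonormality turns the Cauchy criterion for the series into the tail estimate for the
  squared coefficients. Coefficients and norm then pass to the limit along the finite index sets by
  continuity.\<close>

lemma orthonormal_Riesz_Fischer:
  assumes "orthonormal e I" "(\<lambda>i. (cmod (c i))\<^sup>2) summable_on I"
  shows "(\<lambda>i. c i *\<^sub>C e i) summable_on I"
    and "j \<in> I \<Longrightarrow> cinner_L2 (\<Sum>\<^sub>\<infinity>i\<in>I. c i *\<^sub>C e i) (e j) = c j"
    and "(norm (\<Sum>\<^sub>\<infinity>i\<in>I. c i *\<^sub>C e i))\<^sup>2 = (\<Sum>\<^sub>\<infinity>i\<in>I. (cmod (c i))\<^sup>2)"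
proof -
  show s: "(\<lambda>i. c i *\<^sub>C e i) summable_on I"
  proof (rule summable_on_banach_Cauchy)
    fix \<epsilon> :: real assume \<epsilon>: "\<epsilon> > 0"
    have "\<exists>F0. finite F0 \<and> F0 \<subseteq> I \<and>
        (\<forall>F. finite F \<longrightarrow> F \<subseteq> I \<longrightarrow> F \<inter> F0 = {} \<longrightarrow> (\<Sum>i\<in>F. (cmod (c i))\<^sup>2) < \<epsilon>\<^sup>2)"
      by (rule summable_on_tail_small[OF assms(2)]) (use \<epsilon> in auto)
    then obtain F0 where F0: "finite F0" "F0 \<subseteq> I"
      "\<And>F. finite F \<Longrightarrow> F \<subseteq> I \<Longrightarrow> F \<inter> F0 = {} \<Longrightarrow> (\<Sum>i\<in>F. (cmod (c i))\<^sup>2) < \<epsilon>\<^sup>2"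
      by blast
    have "norm (\<Sum>i\<in>F. c i *\<^sub>C e i) < \<epsilon>" if "finite F" "F \<subseteq> I" "F \<inter> F0 = {}" for F
      by (rule power2_less_imp_less) (use F0(3)[OF that] \<epsilon> in \<open>auto simp: orthonormal_norm_sum[OF assms(1) that(1,2)]\<close>)
    then show "\<exists>F0. finite F0 \<and> F0 \<subseteq> I \<and>
        (\<forall>F. finite F \<longrightarrow> F \<subseteq> I \<longrightarrow> F \<inter> F0 = {} \<longrightarrow> norm (\<Sum>i\<in>F. c i *\<^sub>C e i) < \<epsilon>)"
      using F0 by blast
  qed
  then have hs: "((\<lambda>F. \<Sum>i\<in>F. c i *\<^sub>C e i) \<longlongrightarrow> (\<Sum>\<^sub>\<infinity>i\<in>I. c i *\<^sub>C e i)) (finite_subsets_at_top I)"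
    by (simp add: has_sum_infsum flip: has_sum_def)
  show "cinner_L2 (\<Sum>\<^sub>\<infinity>i\<in>I. c i *\<^sub>C e i) (e j) = c j" if "j \<in> I"
  proof -
    have "((\<lambda>F. cinner_L2 (\<Sum>i\<in>F. c i *\<^sub>C e i) (e j)) \<longlongrightarrow>
        cinner_L2 (\<Sum>\<^sub>\<infinity>i\<in>I. c i *\<^sub>C e i) (e j)) (finite_subsets_at_top I)"
      by (intro tendsto_intros hs)
    moreover have "((\<lambda>F. cinner_L2 (\<Sum>i\<in>F. c i *\<^sub>C e i) (e j)) \<longlongrightarrow> c j) (finite_subsets_at_top I)"
    proof (rule tendsto_eventually)
      show "\<forall>\<^sub>F F in finite_subsets_at_top I. cinner_L2 (\<Sum>i\<in>F. c i *\<^sub>C e i) (e j) = c j"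
        unfolding eventually_finite_subsets_at_top
        by (rule exI[of _ "{j}"]) (use that orthonormal_cinner_sum[OF assms(1)] in auto)
    qed
    ultimately show ?thesis using tendsto_unique finite_subsets_at_top_neq_bot by blast
  qed
  have "((\<lambda>F. (norm (\<Sum>i\<in>F. c i *\<^sub>C e i))\<^sup>2) \<longlongrightarrow> (norm (\<Sum>\<^sub>\<infinity>i\<in>I. c i *\<^sub>C e i))\<^sup>2) (finite_subsets_at_top I)"
    by (intro tendsto_intros hs)
  moreover have "((\<lambda>F. \<Sum>i\<in>F. (cmod (c i))\<^sup>2) \<longlongrightarrow> (\<Sum>\<^sub>\<infinity>i\<in>I. (cmod (c i))\<^sup>2)) (finite_subsets_at_top I)"
    using assms(2) by (simp add: has_sum_infsum flip: has_sum_def)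
  moreover have ev: "\<forall>\<^sub>F F in finite_subsets_at_top I.
      (norm (\<Sum>i\<in>F. c i *\<^sub>C e i))\<^sup>2 = (\<Sum>i\<in>F. (cmod (c i))\<^sup>2)"
    unfolding eventually_finite_subsets_at_top
    using orthonormal_norm_sum[OF assms(1)] by blast
  ultimately show "(norm (\<Sum>\<^sub>\<infinity>i\<in>I. c i *\<^sub>C e i))\<^sup>2 = (\<Sum>\<^sub>\<infinity>i\<in>I. (cmod (c i))\<^sup>2)"
    unfolding tendsto_cong[OF ev] using tendsto_unique[OF finite_subsets_at_top_neq_bot] by blast
qed

text \<open>The diagonal operator with entries \<open>m\<close>. For an incomplete family it also
  projects onto the closed span of \<open>e\<close>, which is how \<open>proj\<close> arises from
  the constant entry 1.\<close>

definition multiplier :: "('i \<Rightarrow> L2) \<Rightarrow> 'i set \<Rightarrow> ('i \<Rightarrow> complex) \<Rightarrow> L2 \<Rightarrow> L2" where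
  "multiplier e I m f = (\<Sum>\<^sub>\<infinity>i\<in>I. (m i * cinner_L2 f (e i)) *\<^sub>C e i)"

lemma multiplier_sq_summable:
  assumes "orthonormal e I" "\<And>i. i \<in> I \<Longrightarrow> cmod (m i) \<le> B"
  shows "(\<lambda>i. (cmod (m i * cinner_L2 f (e i)))\<^sup>2) summable_on I"
    and "(\<Sum>\<^sub>\<infinity>i\<in>I. (cmod (m i * cinner_L2 f (e i)))\<^sup>2) \<le> (B * norm f)\<^sup>2"
proof -
  have "(\<Sum>i\<in>F. (cmod (m i * cinner_L2 f (e i)))\<^sup>2) \<le> (B * norm f)\<^sup>2"
    if "finite F" "F \<subseteq> I" for F
  proof -
    have "(\<Sum>i\<in>F. (cmod (m i * cinner_L2 f (e i)))\<^sup>2) \<le> (\<Sum>i\<in>F. B\<^sup>2 * (cmod (cinner_L2 f (e i)))\<^sup>2)"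
      by (rule sum_mono)
        (use assms(2) that in \<open>auto simp: norm_mult power_mult_distrib intro!: mult_right_mono power_mono\<close>)
    also have "\<dots> \<le> B\<^sup>2 * (norm f)\<^sup>2"
      unfolding sum_distrib_left[symmetric]
      by (rule mult_left_mono) (auto intro: orthonormal_Bessel_finite[OF assms(1) that])
    finally show ?thesis by (simp add: power_mult_distrib)
  qed
  then show "(\<lambda>i. (cmod (m i * cinner_L2 f (e i)))\<^sup>2) summable_on I"
    "(\<Sum>\<^sub>\<infinity>i\<in>I. (cmod (m i * cinner_L2 f (e i)))\<^sup>2) \<le> (B * norm f)\<^sup>2"
    using nonneg_summable_on_bounded[of I "\<lambda>i. (cmod (m i * cinner_L2 f (e i)))\<^sup>2"] by auto
qed

lemma cinner_multiplier:
  assumes "orthonormal e I" "\<And>i. i \<in> I \<Longrightarrow> cmod (m i) \<le> B" "j \<in> I"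
  shows "cinner_L2 (multiplier e I m f) (e j) = m j * cinner_L2 f (e j)"
  unfolding multiplier_def
  by (rule orthonormal_Riesz_Fischer(2)[OF assms(1) multiplier_sq_summable(1)]) (use assms in auto)

lemma norm_multiplier:
  assumes "orthonormal e I" "\<And>i. i \<in> I \<Longrightarrow> cmod (m i) \<le> B" "0 \<le> B"
  shows "norm (multiplier e I m f) \<le> B * norm f"
proof (rule power2_le_imp_le)
  show "(norm (multiplier e I m f))\<^sup>2 \<le> (B * norm f)\<^sup>2"
    unfolding multiplier_def
    by (subst orthonormal_Riesz_Fischer(3)[OF assms(1) multiplier_sq_summable(1)[OF assms(1)]])
      (use assms multiplier_sq_summable[OF assms(1)] in auto)
qed (use assms in auto)

lemma has_sum_multiplier:
  assumes "orthonormal e I" "\<And>i. i \<in> I \<Longrightarrow> cmod (m i) \<le> B"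
  shows "((\<lambda>i. (m i * cinner_L2 f (e i)) *\<^sub>C e i) has_sum multiplier e I m f) I"
  unfolding multiplier_def
  by (intro has_sum_infsum orthonormal_Riesz_Fischer(1)[OF assms(1)] multiplier_sq_summable(1)[OF assms(1)])
    (use assms in auto)

lemma bounded_linear_multiplier:
  assumes "orthonormal e I" "\<And>i. i \<in> I \<Longrightarrow> cmod (m i) \<le> B" "0 \<le> B"
  shows "bounded_linear (multiplier e I m)"
proof (rule bounded_linear_intro[where K = B])
  have hs: "((\<lambda>i. (m i * cinner_L2 f (e i)) *\<^sub>C e i) has_sum multiplier e I m f) I" for f
    by (rule has_sum_multiplier[OF assms(1,2)])
  show "multiplier e I m (f + g) = multiplier e I m f + multiplier e I m g" for f g
    using has_sum_add[OF hs[where f = f] hs[where f = g]] hs[where f = "f + g"]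
    by (simp add: cinner_L2_add_left distrib_left scaleC_L2_add_left has_sum_unique)
  show "multiplier e I m (r *\<^sub>R f) = r *\<^sub>R multiplier e I m f" for r f
  proof -
    have "((\<lambda>i. r *\<^sub>R ((m i * cinner_L2 f (e i)) *\<^sub>C e i)) has_sum r *\<^sub>R multiplier e I m f) I"
      by (rule has_sum_bounded_linear[OF bounded_linear_scaleR_right hs])
    then show ?thesis
      using hs[where f = "r *\<^sub>R f"] by (simp add: cinner_L2_scaleR_left has_sum_unique flip: scaleC_L2_scaleR_left)
  qed
  show "norm (multiplier e I m f) \<le> norm f * B" for f
    using norm_multiplier[OF assms] by (simp add: mult.commute)
qed

section \<open>Trigonometric families\<close>

text \<open>Bridge between the open intervals of the definitions and the closed intervals of
  integration theory. The end points form a null set, and completeness of Lebesgue measure lets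
  measurability pass as well.\<close>

lemma lebesgue_on_Ioo_Icc:
  fixes f :: "real \<Rightarrow> 'b::euclidean_space"
  shows "integrable (lebesgue_on {a<..<b}) f \<longleftrightarrow> integrable (lebesgue_on {a..b}) f"
    and "integral\<^sup>L (lebesgue_on {a<..<b}) f = integral\<^sup>L (lebesgue_on {a..b}) f"
    and "f \<in> borel_measurable (lebesgue_on {a<..<b}) \<longleftrightarrow> f \<in> borel_measurable (lebesgue_on {a..b})"
proof -
  have ae: "AE x in lebesgue. indicator {a<..<b} x *\<^sub>R f x = indicator {a..b} x *\<^sub>R f x"
  proof (rule AE_I')
    show "{a, b} \<in> null_sets lebesgue" by (simp add: finite_imp_null_set_lborel null_sets_completionI)
    show "{x \<in> space lebesgue. indicator {a<..<b} x *\<^sub>R f x \<noteq> indicator {a..b} x *\<^sub>R f x} \<subseteq> {a, b}"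
      by (auto simp: indicator_def split: if_splits)
  qed
  have m: "(\<lambda>x. indicator {a<..<b} x *\<^sub>R f x) \<in> borel_measurable lebesgue \<longleftrightarrow>
      (\<lambda>x. indicator {a..b} x *\<^sub>R f x) \<in> borel_measurable lebesgue"
    by (intro iffI) (erule borel_measurable_AE[OF _ ae] borel_measurable_AE[OF _ AE_symmetric[OF ae]])+
  show "f \<in> borel_measurable (lebesgue_on {a<..<b}) \<longleftrightarrow> f \<in> borel_measurable (lebesgue_on {a..b})"
    using m by (simp add: borel_measurable_restrict_space_iff)
  show "integrable (lebesgue_on {a<..<b}) f \<longleftrightarrow> integrable (lebesgue_on {a..b}) f"
  proof (cases "(\<lambda>x. indicator {a..b} x *\<^sub>R f x) \<in> borel_measurable lebesgue")
    case True
    then show ?thesis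
      using m ae by (simp add: integrable_restrict_space) (rule integrable_cong_AE; simp)
  next
    case False
    then show ?thesis
      using m by (auto simp: integrable_restrict_space dest: borel_measurable_integrable)
  qed
  show "integral\<^sup>L (lebesgue_on {a<..<b}) f = integral\<^sup>L (lebesgue_on {a..b}) f"
  proof (cases "(\<lambda>x. indicator {a..b} x *\<^sub>R f x) \<in> borel_measurable lebesgue")
    case True
    then show ?thesis
      using m ae by (simp add: integral_restrict_space) (rule integral_cong_AE; simp)
  next
    case False
    then show ?thesis
      using m by (auto simp: integral_restrict_space)
        (metis (no_types, lifting) borel_measurable_integrable not_integrable_integral_eq)
  qed
qed

lemma integral_lebesgue_on_FTC:
  fixes f :: "real \<Rightarrow> 'b::euclidean_space"
  assumes "a \<le> b" "continuous_on {a..b} f"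
    "\<And>x. x \<in> {a..b} \<Longrightarrow> (F has_vector_derivative f x) (at x within {a..b})"
  shows "integrable (lebesgue_on {a<..<b}) f" "integral\<^sup>L (lebesgue_on {a<..<b}) f = F b - F a"
proof -
  have i: "integrable (lebesgue_on {a..b}) f" by (rule continuous_imp_integrable_real[OF assms(2)])
  then show "integrable (lebesgue_on {a<..<b}) f" by (simp add: lebesgue_on_Ioo_Icc)
  have "(f has_integral (F b - F a)) {a..b}"
    by (rule fundamental_theorem_of_calculus) (use assms in auto)
  then show "integral\<^sup>L (lebesgue_on {a<..<b}) f = F b - F a"
    using lebesgue_integral_eq_integral[OF i] by (simp add: lebesgue_on_Ioo_Icc(2) integral_unique)
qed

lemma continuous_sq_integrable:
  fixes f :: "real \<Rightarrow> 'b::euclidean_space"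
  assumes "continuous_on {a..b} f"
  shows "f sq_integrable_on {a<..<b}"
proof -
  have "integrable (lebesgue_on {a..b}) f" "integrable (lebesgue_on {a..b}) (\<lambda>x. (norm (f x))\<^sup>2)"
    by (intro continuous_imp_integrable_real continuous_intros assms)+
  then show ?thesis
    unfolding sq_integrable_on_def lebesgue_on_Ioo_Icc
    by (auto dest: borel_measurable_integrable)
qed

lemma continuous_sq_integrable01:
  fixes f :: "real \<Rightarrow> 'b::euclidean_space"
  assumes "continuous_on UNIV f"
  shows "f sq_integrable_on {0<..<1}"
  by (rule continuous_sq_integrable[OF continuous_on_subset[OF assms]]) auto

definition sinf :: "nat \<Rightarrow> real \<Rightarrow> real" where
  "sinf k x = sqrt 2 * sin (real k * pi * x)"

definition cosf :: "nat \<Rightarrow> real \<Rightarrow> real" where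
  "cosf k x = sqrt 2 * cos (real k * pi * x)"

text \<open>Normalised to period 1, hence orthonormal on the unit interval. These exponentials are
  functions of rescaled time, whereas \<open>sinf\<close> and \<open>cosf\<close> are functions of
  space.\<close>

definition expf :: "int \<Rightarrow> real \<Rightarrow> complex" where
  "expf m x = cis (2 * pi * of_int m * x)"

lemma continuous_on_sinf [continuous_intros]: "continuous_on S (sinf k)"
  unfolding sinf_def by (intro continuous_intros)

lemma continuous_on_cosf [continuous_intros]: "continuous_on S (cosf k)"
  unfolding cosf_def by (intro continuous_intros)

lemma continuous_on_expf [continuous_intros]: "continuous_on S (expf m)"
  unfolding expf_def by (intro continuous_intros)

lemma sinf_bound: "\<bar>sinf k x\<bar> \<le> sqrt 2"
  by (simp add: sinf_def abs_mult abs_sin_le_one)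

lemma cosf_bound: "\<bar>cosf k x\<bar> \<le> sqrt 2"
  by (simp add: cosf_def abs_mult abs_cos_le_one)

lemma norm_expf [simp]: "cmod (expf m x) = 1"
  by (simp add: expf_def)

lemma sq_integrable_sinf: "(\<lambda>x. complex_of_real (sinf k x)) sq_integrable_on {0<..<1}"
  by (intro continuous_sq_integrable01 continuous_intros)

lemma sq_integrable_cosf: "(\<lambda>x. complex_of_real (cosf k x)) sq_integrable_on {0<..<1}"
  by (intro continuous_sq_integrable01 continuous_intros)

lemma sq_integrable_expf: "expf m sq_integrable_on {0<..<1}"
  by (intro continuous_sq_integrable01 continuous_intros)

definition cosb :: "nat \<Rightarrow> L2" where "cosb k = to_L2 (\<lambda>x. complex_of_real (cosf k x))"

definition expb :: "int \<Rightarrow> L2" where "expb m = to_L2 (expf m)"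

lemma phi_eq_sinf: "phi k = to_L2 (\<lambda>x. complex_of_real (sinf k x))"
  by (simp add: phi_def sinf_def)

lemma integral_cos_int:
  "integral\<^sup>L leb01 (\<lambda>x. cos (of_int n * pi * x)) = (if n = 0 then 1 else 0)"
proof (cases "n = 0")
  case True
  then show ?thesis by (simp add: measure_restrict_space)
next
  case False
  have "integral\<^sup>L leb01 (\<lambda>x. cos (of_int n * pi * x))
      = sin (of_int n * pi * 1) / (of_int n * pi) - sin (of_int n * pi * 0) / (of_int n * pi)"
    by (rule integral_lebesgue_on_FTC(2))
      (use False in \<open>auto intro!: continuous_intros derivative_eq_intros
        simp flip: has_real_derivative_iff_has_vector_derivative\<close>)
  then show ?thesis using False sin_int_times_real[of n] by (simp add: sin_integer_2pi mult.commute)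
qed

lemma integrable_cos_int: "integrable leb01 (\<lambda>x. cos (of_int n * pi * x))"
  unfolding lebesgue_on_Ioo_Icc
  by (intro continuous_imp_integrable_real continuous_intros)

text \<open>The product of two sines is a difference of cosines with frequencies
  \<open>j - k\<close> and \<open>j + k\<close>; for positive indices only the first can have
  frequency 0, and all others integrate to 0.\<close>

lemma orthonormal_phi: "orthonormal phi {1..}"
  unfolding orthonormal_def
proof (intro ballI)
  fix j k :: nat assume jk: "j \<in> {1..}" "k \<in> {1..}"
  have "cinner_L2 (phi j) (phi k) = integral\<^sup>L leb01 (\<lambda>x. complex_of_real (sinf j x * sinf k x))"
    unfolding phi_eq_sinf by (subst cinner_to_L2[OF sq_integrable_sinf sq_integrable_sinf]) simp
  also have "\<dots> = complex_of_real (integral\<^sup>L leb01 (\<lambda>x. sinf j x * sinf k x))"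
    by (rule integral_complex_of_real)
  also have "(\<lambda>x. sinf j x * sinf k x) =
      (\<lambda>x. cos (of_int (int j - int k) * pi * x) - cos (of_int (int j + int k) * pi * x))"
    by (auto simp: sinf_def cos_add cos_diff algebra_simps fun_eq_iff)
  also have "integral\<^sup>L leb01 \<dots> = (if j = k then 1 else 0)"
    using jk by (subst Bochner_Integration.integral_diff[OF integrable_cos_int integrable_cos_int])
      (auto simp: integral_cos_int simp del: of_int_add of_int_diff)
  finally show "cinner_L2 (phi j) (phi k) = (if j = k then 1 else 0)" by simp
qed

lemma orthonormal_cosb: "orthonormal cosb {1..}"
  unfolding orthonormal_def
proof (intro ballI)
  fix j k :: nat assume jk: "j \<in> {1..}" "k \<in> {1..}"
  have "cinner_L2 (cosb j) (cosb k) = integral\<^sup>L leb01 (\<lambda>x. complex_of_real (cosf j x * cosf k x))"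
    unfolding cosb_def by (subst cinner_to_L2[OF sq_integrable_cosf sq_integrable_cosf]) simp
  also have "\<dots> = complex_of_real (integral\<^sup>L leb01 (\<lambda>x. cosf j x * cosf k x))"
    by (rule integral_complex_of_real)
  also have "(\<lambda>x. cosf j x * cosf k x) =
      (\<lambda>x. cos (of_int (int j - int k) * pi * x) + cos (of_int (int j + int k) * pi * x))"
    by (auto simp: cosf_def cos_add cos_diff algebra_simps fun_eq_iff)
  also have "integral\<^sup>L leb01 \<dots> = (if j = k then 1 else 0)"
    using jk by (subst Bochner_Integration.integral_add[OF integrable_cos_int integrable_cos_int])
      (auto simp: integral_cos_int simp del: of_int_add of_int_diff)
  finally show "cinner_L2 (cosb j) (cosb k) = (if j = k then 1 else 0)" by simp
qed

lemma integral_cis: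
  assumes "\<omega> \<noteq> 0" "a \<le> b"
  shows "integral\<^sup>L (lebesgue_on {a<..<b}) (\<lambda>x. cis (\<omega> * x)) = (cis (\<omega> * b) - cis (\<omega> * a)) / (\<i> * \<omega>)"
proof -
  have "((\<lambda>x. (\<lambda>z. exp (\<i> * \<omega> * z) / (\<i> * \<omega>)) (complex_of_real x)) has_vector_derivative
      exp (\<i> * \<omega> * complex_of_real x)) (at x within S)" for x S
    by (rule has_vector_derivative_real_field)
      (use assms in \<open>auto intro!: derivative_eq_intros simp: mult_ac\<close>)
  then have "((\<lambda>x. cis (\<omega> * x) / (\<i> * \<omega>)) has_vector_derivative cis (\<omega> * x)) (at x within S)" for x S
    by (simp add: cis_conv_exp mult.assoc)
  then have "integral\<^sup>L (lebesgue_on {a<..<b}) (\<lambda>x. cis (\<omega> * x))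
      = cis (\<omega> * b) / (\<i> * \<omega>) - cis (\<omega> * a) / (\<i> * \<omega>)"
    by (intro integral_lebesgue_on_FTC(2) assms continuous_intros)
  then show ?thesis by (simp add: diff_divide_distrib)
qed

lemma expf_mult_cnj: "expf m x * cnj (expf n x) = expf (m - n) x"
  by (simp add: expf_def cis_cnj cis_mult algebra_simps)

lemma cnj_expf: "cnj (expf m x) = expf (- m) x"
  by (simp add: expf_def cis_cnj)

lemma orthonormal_expb: "orthonormal expb UNIV"
  unfolding orthonormal_def
proof (intro ballI)
  fix m n :: int
  have "cinner_L2 (expb m) (expb n) = integral\<^sup>L leb01 (\<lambda>x. cis (2 * pi * of_int (m - n) * x))"
    unfolding expb_def cinner_to_L2[OF sq_integrable_expf sq_integrable_expf] expf_mult_cnj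
    by (simp add: expf_def)
  also have "\<dots> = (if m = n then 1 else 0)"
  proof (cases "m = n")
    case True
    then show ?thesis by (simp add: measure_restrict_space)
  next
    case False
    have "cis (2 * pi * of_int (m - n)) = 1" by (rule cis_multiple_2pi) auto
    then show ?thesis using False by (subst integral_cis) auto
  qed
  finally show "cinner_L2 (expb m) (expb n) = (if m = n then 1 else 0)" .
qed

subsection \<open>Completeness of the sine family\<close>

lemma phi_0 [simp]: "phi 0 = 0"
  using to_L2_zero by (simp add: phi_def)

lemma ess_bounded_continuous:
  assumes "continuous_on UNIV \<mu>" "\<And>x. \<bar>\<mu> x\<bar> \<le> B"
  shows "ess_bounded B \<mu>"
  unfolding ess_bounded_def
  using order_trans[OF abs_ge_zero assms(2)[of 0]] assms
  by (auto intro!: continuous_imp_measurable_on_sets_lebesgue intro: continuous_on_subset)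

lemma ess_bounded_cos: "ess_bounded 1 (\<lambda>x. cos (pi * x))"
  by (intro ess_bounded_continuous continuous_intros) (simp add: abs_cos_le_one)

lemma ess_bounded_sinf: "ess_bounded (sqrt 2) (sinf k)"
  by (intro ess_bounded_continuous continuous_intros sinf_bound)

text \<open>Multiplication by the first cosine shifts the index up and down by one. Orthogonality to
  all \<open>phi k\<close> is therefore inherited by the product with any power of the cosine, which
  drives the completeness proof.\<close>

lemma mult_cos_phi:
  assumes "k \<ge> 1"
  shows "mult_L2 (\<lambda>x. cos (pi * x)) (phi k) = (1/2) *\<^sub>R (phi (k + 1) + phi (k - 1))"
proof -
  have "mult_L2 (\<lambda>x. cos (pi * x)) (phi k) = to_L2 (\<lambda>x. complex_of_real (cos (pi * x)) * complex_of_real (sinf k x))"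
    unfolding phi_eq_sinf by (rule mult_L2_to_L2[OF ess_bounded_cos sq_integrable_sinf])
  also have "(\<lambda>x. complex_of_real (cos (pi * x)) * complex_of_real (sinf k x)) =
      (\<lambda>x. (1/2) * (complex_of_real (sinf (k + 1) x) + complex_of_real (sinf (k - 1) x)))"
  proof
    fix x
    have "sin (real (k + 1) * pi * x) + sin (real (k - 1) * pi * x) = 2 * (cos (pi * x) * sin (real k * pi * x))"
      using assms by (simp add: of_nat_diff algebra_simps sin_add sin_diff)
    then have "2 * (cos (pi * x) * sinf k x) = sqrt 2 * (sin (real (k + 1) * pi * x) + sin (real (k - 1) * pi * x))"
      by (simp only: sinf_def mult_ac)
    also have "\<dots> = sinf (k + 1) x + sinf (k - 1) x"
      by (simp only: sinf_def distrib_left)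
    finally have "2 * (cos (pi * x) * sinf k x) = sinf (k + 1) x + sinf (k - 1) x" .
    then have "cos (pi * x) * sinf k x = (1/2) * (sinf (k + 1) x + sinf (k - 1) x)"
      by simp
    then show "complex_of_real (cos (pi * x)) * complex_of_real (sinf k x) =
      (1/2) * (complex_of_real (sinf (k + 1) x) + complex_of_real (sinf (k - 1) x))"
      by (metis of_real_1 of_real_add of_real_divide of_real_mult of_real_numeral)
  qed
  also have "to_L2 \<dots> = (1/2) *\<^sub>C (phi (k + 1) + phi (k - 1))"
    unfolding phi_eq_sinf
    by (simp only: to_L2_cmult[OF sq_integrable_on_add[OF sq_integrable_sinf sq_integrable_sinf]]
        to_L2_add[OF sq_integrable_sinf sq_integrable_sinf])
  finally show ?thesis by (simp add: scaleR_L2_scaleC)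
qed

text \<open>By the shift relation, all products of \<open>f\<close> with powers of
  \<open>cos (pi * x)\<close> stay orthogonal to \<open>phi 1\<close>. Hence \<open>g\<close>, the
  product of \<open>f\<close> with the first sine, is orthogonal to every polynomial in
  \<open>cos (pi * x)\<close>. As the cosine is injective on the unit interval, Stone-Weierstrass
  makes these dense among continuous functions, so \<open>g\<close> vanishes, and so does
  \<open>f\<close> because the sine is positive inside the interval.\<close>

lemma phi_orthogonal_imp_zero:
  assumes "\<And>k. k \<ge> 1 \<Longrightarrow> cinner_L2 f (phi k) = 0"
  shows "f = 0"
proof -
  define M where "M = mult_L2 (\<lambda>x. cos (pi * x))"
  define s where "s = sinf 1"
  define g where "g = mult_L2 s f"
  have es: "ess_bounded (sqrt 2) s" unfolding s_def by (rule ess_bounded_sinf)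
  have Mn: "\<forall>k\<ge>1. cinner_L2 ((M ^^ n) f) (phi k) = 0" for n
  proof (induction n)
    case (Suc n)
    have "cinner_L2 ((M ^^ Suc n) f) (phi k) = 0" if "k \<ge> 1" for k
    proof -
      have "cinner_L2 ((M ^^ Suc n) f) (phi k) = cinner_L2 ((M ^^ n) f) (M (phi k))"
        by (simp add: M_def cinner_mult_L2[OF ess_bounded_cos])
      also have "\<dots> = (1/2) *\<^sub>R (cinner_L2 ((M ^^ n) f) (phi (k + 1)) + cinner_L2 ((M ^^ n) f) (phi (k - 1)))"
        using that by (simp add: M_def mult_cos_phi cinner_L2_scaleR_right cinner_L2_add_right)
      also have "\<dots> = 0"
        \<comment> \<open>For \<open>k = 1\<close> the lower neighbour is \<open>phi 0\<close>,
          which is 0 and so needs no orthogonality.\<close>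
        using Suc that by (cases "k = 1") auto
      finally show ?thesis .
    qed
    then show ?case by blast
  qed (use assms in auto)
  have c2: "(\<lambda>x. complex_of_real (cos (pi * x)) ^ n) sq_integrable_on {0<..<1}" for n
    by (intro continuous_sq_integrable01 continuous_intros)
  have Mc: "(M ^^ n) (phi 1) = mult_L2 s (to_L2 (\<lambda>x. complex_of_real (cos (pi * x)) ^ n))" for n
  proof (induction n)
    case 0
    have "(\<lambda>x. 1::complex) sq_integrable_on {0<..<1}" using c2[of 0] by simp
    then show ?case by (simp add: phi_eq_sinf s_def mult_L2_to_L2[OF ess_bounded_sinf])
  next
    case (Suc n)
    have "(M ^^ Suc n) (phi 1) = M (to_L2 (\<lambda>x. complex_of_real (s x) * complex_of_real (cos (pi * x)) ^ n))"
      using Suc by (simp add: mult_L2_to_L2[OF es c2])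
    also have "\<dots> = to_L2 (\<lambda>x. complex_of_real (cos (pi * x)) * (complex_of_real (s x) * complex_of_real (cos (pi * x)) ^ n))"
      unfolding M_def by (rule mult_L2_to_L2[OF ess_bounded_cos ess_bounded_mult(1)[OF es c2]])
    also have "\<dots> = to_L2 (\<lambda>x. complex_of_real (s x) * complex_of_real (cos (pi * x)) ^ Suc n)"
      by (simp add: mult_ac)
    also have "\<dots> = mult_L2 s (to_L2 (\<lambda>x. complex_of_real (cos (pi * x)) ^ Suc n))"
      by (rule mult_L2_to_L2[OF es c2, symmetric])
    finally show ?case .
  qed
  have M_adj: "cinner_L2 ((M ^^ n) f) h = cinner_L2 f ((M ^^ n) h)" for n h
  proof (induction n arbitrary: h)
    case (Suc n)
    have "cinner_L2 ((M ^^ Suc n) f) h = cinner_L2 ((M ^^ n) f) (M h)"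
      by (simp add: M_def cinner_mult_L2[OF ess_bounded_cos])
    also have "\<dots> = cinner_L2 f ((M ^^ Suc n) h)" by (simp only: Suc funpow_Suc_right o_apply)
    finally show ?case .
  qed simp
  have g_pow: "cinner_L2 g (to_L2 (\<lambda>x. complex_of_real (cos (pi * x)) ^ n)) = 0" for n
    using Mn[of n] M_adj[of n "phi 1", unfolded Mc] by (simp add: g_def cinner_mult_L2[OF es])
  have g_real: "cinner_L2 g (to_L2 (\<lambda>x. complex_of_real (h x))) = 0" if h: "continuous_on UNIV h" for h :: "real \<Rightarrow> real"
  proof -
    have h2: "(\<lambda>x. complex_of_real (h x)) sq_integrable_on {0<..<1}"
      by (intro continuous_sq_integrable01 continuous_intros h)
    have "cmod (cinner_L2 g (to_L2 (\<lambda>x. complex_of_real (h x)))) \<le> norm g * e" if e: "e > 0" for e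
    proof -
      \<comment> \<open>The substitution \<open>y = cos (pi * x)\<close> carries approximation by
        polynomials in the cosine to ordinary polynomial approximation on
        \<open>{-1..1}\<close>.\<close>
      have "continuous_on {-1..1} (\<lambda>y. h (arccos y / pi))"
        by (intro continuous_on_compose2[OF h] continuous_intros) auto
      then obtain p where p: "real_polynomial_function p" "\<And>y. y \<in> {-1..1} \<Longrightarrow> \<bar>h (arccos y / pi) - p y\<bar> < e"
        using Stone_Weierstrass_real_polynomial_function[of "{-1..1}" "\<lambda>y. h (arccos y / pi)" e] e by (metis compact_Icc)
      obtain a n where pa: "p = (\<lambda>x. \<Sum>i\<le>n. a i * x ^ i)"
        using p(1) by (auto simp: real_polynomial_function_iff_sum)
      have pc: "(\<lambda>x. complex_of_real (p (cos (pi * x)))) =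
          (\<lambda>x. \<Sum>i\<le>n. complex_of_real (a i) * complex_of_real (cos (pi * x)) ^ i)"
        by (simp add: pa)
      have p2: "(\<lambda>x. complex_of_real (p (cos (pi * x)))) sq_integrable_on {0<..<1}"
        unfolding pc by (intro sq_integrable_on_sum sq_integrable_on_cmult c2)
      have "cinner_L2 g (to_L2 (\<lambda>x. complex_of_real (p (cos (pi * x))))) = 0"
        unfolding pc
        by (simp add: to_L2_sum sq_integrable_on_cmult c2 to_L2_cmult cinner_L2_sum_right
            cinner_L2_scaleC_right g_pow)
      then have "cinner_L2 g (to_L2 (\<lambda>x. complex_of_real (h x))) =
          cinner_L2 g (to_L2 (\<lambda>x. complex_of_real (h x) - complex_of_real (p (cos (pi * x)))))"
        by (simp add: to_L2_diff(1)[OF h2 p2, symmetric] cinner_L2_diff_right)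
      also have "cmod \<dots> \<le> norm g * norm (to_L2 (\<lambda>x. complex_of_real (h x) - complex_of_real (p (cos (pi * x)))))"
        by (rule cinner_L2_Cauchy_Schwarz)
      also have "\<dots> \<le> norm g * e"
      proof (rule mult_left_mono)
        have [measurable]: "(\<lambda>x. complex_of_real (h x) - complex_of_real (p (cos (pi * x)))) \<in> borel_measurable leb01"
          using to_L2_diff(2)[OF h2 p2] by (simp add: sq_integrable_on_def)
        show "norm (to_L2 (\<lambda>x. complex_of_real (h x) - complex_of_real (p (cos (pi * x))))) \<le> e"
        proof (rule bounded_sq_integrable_leb01(2))
          fix x :: real assume x: "0 < x" "x < 1"
          have "arccos (cos (pi * x)) = pi * x" by (rule arccos_cos) (use x in auto)
          then have "\<bar>h x - p (cos (pi * x))\<bar> < e" using p(2)[of "cos (pi * x)"] by simp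
          then show "cmod (complex_of_real (h x) - complex_of_real (p (cos (pi * x)))) \<le> e"
            by (metis less_imp_le norm_of_real of_real_diff)
        qed measurable
      qed simp
      finally show ?thesis .
    qed
    then have le: "cmod (cinner_L2 g (to_L2 (\<lambda>x. complex_of_real (h x)))) \<le> norm g * e" if "e > 0" for e
      using that by blast
    have "cmod (cinner_L2 g (to_L2 (\<lambda>x. complex_of_real (h x)))) \<le> 0 + e" if "e > 0" for e
    proof -
      have "norm g * (e / (norm g + 1)) \<le> e"
        using that add_nonneg_pos[OF norm_ge_zero[of g] zero_less_one] by (simp add: field_simps)
      then show ?thesis using le[of "e / (norm g + 1)"] that
        by (smt (verit) divide_pos_pos norm_ge_zero)
    qed
    then have "cmod (cinner_L2 g (to_L2 (\<lambda>x. complex_of_real (h x)))) \<le> 0"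
      by (rule field_le_epsilon)
    then show ?thesis by simp
  qed
  have g_cont: "cinner_L2 g (to_L2 h) = 0" if h: "continuous_on UNIV h" for h :: "real \<Rightarrow> complex"
  proof -
    have c: "continuous_on UNIV (\<lambda>x. Re (h x))" "continuous_on UNIV (\<lambda>x. Im (h x))"
      by (intro continuous_intros h)+
    have 2: "(\<lambda>x. complex_of_real (Re (h x))) sq_integrable_on {0<..<1}"
      "(\<lambda>x. complex_of_real (Im (h x))) sq_integrable_on {0<..<1}"
      by (intro continuous_sq_integrable01 continuous_intros h)+
    have "to_L2 h = to_L2 (\<lambda>x. complex_of_real (Re (h x)) + \<i> * complex_of_real (Im (h x)))"
      using complex_eq by simp
    also have "\<dots> = to_L2 (\<lambda>x. complex_of_real (Re (h x))) + \<i> *\<^sub>C to_L2 (\<lambda>x. complex_of_real (Im (h x)))"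
      using 2 by (simp add: to_L2_add sq_integrable_on_cmult to_L2_cmult)
    finally show ?thesis
      using g_real[OF c(1)] g_real[OF c(2)] by (simp add: cinner_L2_add_right cinner_L2_scaleC_right)
  qed
  have "norm g \<le> 0 + e" if e: "e > 0" for e
  proof -
    obtain h where h: "continuous_on UNIV h" "norm (g - to_L2 h) < e"
      using L2_dense_continuous[OF e, of g] by blast
    have "complex_of_real ((norm g)\<^sup>2) = cinner_L2 g (g - to_L2 h)"
      using g_cont[OF h(1)] by (simp only: cinner_L2_norm[symmetric] cinner_L2_diff_right) simp
    then have "(norm g)\<^sup>2 = cmod (cinner_L2 g (g - to_L2 h))"
      by (metis abs_of_nonneg norm_of_real zero_le_power2)
    also have "\<dots> \<le> norm g * norm (g - to_L2 h)" by (rule cinner_L2_Cauchy_Schwarz)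
    finally have "norm g \<le> norm (g - to_L2 h)"
      by (cases "norm g = 0") (auto simp: power2_eq_square)
    then show ?thesis using h by simp
  qed
  then have "norm g \<le> 0" by (rule field_le_epsilon)
  then have g0: "to_L2 (\<lambda>x. complex_of_real (s x) * rep_L2 f x) = to_L2 (\<lambda>x. 0)"
    by (simp add: g_def mult_L2_def to_L2_zero)
  have "AE x in leb01. complex_of_real (s x) * rep_L2 f x = 0"
    using g0 by (subst (asm) to_L2_eq_iff[OF ess_bounded_mult(1)[OF es sq_integrable_rep_L2] sq_integrable_on_zero])
  then have "AE x in leb01. rep_L2 f x = 0"
    using AE_space
  proof eventually_elim
    case (elim x)
    then have "sin (pi * x) > 0" by (intro sin_gt_zero) auto
    then show ?case using elim by (simp add: s_def sinf_def)
  qed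
  then have "to_L2 (rep_L2 f) = to_L2 (\<lambda>x. 0)"
    by (subst to_L2_eq_iff[OF sq_integrable_rep_L2 sq_integrable_on_zero])
  then show ?thesis by (simp add: to_L2_zero)
qed

lemma L2_eqI:
  assumes "\<And>k. k \<ge> 1 \<Longrightarrow> cinner_L2 f (phi k) = cinner_L2 g (phi k)"
  shows "f = g"
  using phi_orthogonal_imp_zero[of "f - g"] assms by (simp add: cinner_L2_diff_left)

lemma multiplier_phi_one: "multiplier phi {1..} (\<lambda>k. 1) f = f"
  by (rule L2_eqI) (use cinner_multiplier[OF orthonormal_phi, of "\<lambda>k. 1" 1] in simp)

lemma has_sum_phi: "((\<lambda>k. cinner_L2 f (phi k) *\<^sub>C phi k) has_sum f) {1..}"
  using has_sum_multiplier[OF orthonormal_phi, of "\<lambda>k. 1" 1 f]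
  unfolding multiplier_phi_one mult_1_left by simp

lemma Parseval_phi:
  "(\<lambda>k. (cmod (cinner_L2 f (phi k)))\<^sup>2) summable_on {1..}"
  "(norm f)\<^sup>2 = (\<Sum>\<^sub>\<infinity>k\<in>{1..}. (cmod (cinner_L2 f (phi k)))\<^sup>2)"
proof -
  show s: "(\<lambda>k. (cmod (cinner_L2 f (phi k)))\<^sup>2) summable_on {1..}"
    by (rule orthonormal_Bessel(1)[OF orthonormal_phi])
  show "(norm f)\<^sup>2 = (\<Sum>\<^sub>\<infinity>k\<in>{1..}. (cmod (cinner_L2 f (phi k)))\<^sup>2)"
    using orthonormal_Riesz_Fischer(3)[OF orthonormal_phi s] has_sum_phi[of f] by (simp add: infsumI)
qed

section \<open>Cut-off functions and the characterisation of H10\<close>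

text \<open>The derivative is an explicit argument, so that sums and products of test functions come
  with formulas for their derivatives that can be integrated directly.\<close>

definition C1_deriv :: "(real \<Rightarrow> 'b::real_normed_vector) \<Rightarrow> (real \<Rightarrow> 'b) \<Rightarrow> bool" where
  "C1_deriv \<theta> D \<longleftrightarrow> (\<forall>x. (\<theta> has_vector_derivative D x) (at x)) \<and> continuous_on UNIV D"

lemma C1_deriv_continuous: "C1_deriv \<theta> D \<Longrightarrow> continuous_on UNIV \<theta>"
  unfolding C1_deriv_def
  by (auto intro!: continuous_at_imp_continuous_on has_vector_derivative_continuous)

lemma test_funI:
  assumes "C1_deriv \<theta> D" "closure {x. \<theta> x \<noteq> 0} \<subseteq> {a<..<b}"
  shows "test_fun a b \<theta>"
  using assms by (auto simp: test_fun_def C1_differentiable_on_def C1_deriv_def)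

lemma test_funD:
  assumes "test_fun a b \<theta>"
  shows "C1_deriv \<theta> (\<lambda>x. vector_derivative \<theta> (at x))" "\<theta> a = 0" "\<theta> b = 0"
proof -
  show "C1_deriv \<theta> (\<lambda>x. vector_derivative \<theta> (at x))"
    using assms unfolding test_fun_def C1_deriv_def C1_differentiable_on_eq
    by (auto simp: vector_derivative_works)
  have "{x. \<theta> x \<noteq> 0} \<subseteq> {a<..<b}"
    by (rule order_trans[OF closure_subset]) (use assms in \<open>simp add: test_fun_def\<close>)
  then show "\<theta> a = 0" "\<theta> b = 0" by auto
qed

lemma C1_deriv_vector_derivative: "C1_deriv \<theta> D \<Longrightarrow> vector_derivative \<theta> (at x) = D x"
  by (simp add: C1_deriv_def vector_derivative_at)

lemma C1_deriv_mult:
  fixes f g :: "real \<Rightarrow> 'b::real_normed_algebra"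
  assumes "C1_deriv f f'" "C1_deriv g g'"
  shows "C1_deriv (\<lambda>x. f x * g x) (\<lambda>x. f x * g' x + f' x * g x)"
  using assms C1_deriv_continuous[OF assms(1)] C1_deriv_continuous[OF assms(2)]
  unfolding C1_deriv_def
  by (auto intro!: has_vector_derivative_mult continuous_intros)

lemma C1_deriv_cmult:
  fixes f :: "real \<Rightarrow> 'b::real_normed_algebra"
  assumes "C1_deriv f f'"
  shows "C1_deriv (\<lambda>x. c * f x) (\<lambda>x. c * f' x)"
  using assms unfolding C1_deriv_def
  by (auto intro!: continuous_intros bounded_linear.has_vector_derivative[OF bounded_linear_mult_right])

lemma C1_deriv_add:
  assumes "C1_deriv f f'" "C1_deriv g g'"
  shows "C1_deriv (\<lambda>x. f x + g x) (\<lambda>x. f' x + g' x)"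
  using assms unfolding C1_deriv_def by (auto intro!: has_vector_derivative_add continuous_intros)

lemma C1_deriv_diff:
  assumes "C1_deriv f f'" "C1_deriv g g'"
  shows "C1_deriv (\<lambda>x. f x - g x) (\<lambda>x. f' x - g' x)"
  using assms unfolding C1_deriv_def by (auto intro!: has_vector_derivative_diff continuous_intros)

lemma C1_deriv_zero: "C1_deriv (\<lambda>x. 0) (\<lambda>x. 0)"
  by (auto simp: C1_deriv_def)

lemma C1_deriv_sum:
  assumes "\<And>i. i \<in> I \<Longrightarrow> C1_deriv (f i) (f' i)"
  shows "C1_deriv (\<lambda>x. \<Sum>i\<in>I. f i x) (\<lambda>x. \<Sum>i\<in>I. f' i x)"
  using assms by (induction I rule: infinite_finite_induct) (auto intro: C1_deriv_add C1_deriv_zero)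

lemma C1_deriv_of_real:
  assumes "C1_deriv f f'"
  shows "C1_deriv (\<lambda>x. complex_of_real (f x)) (\<lambda>x. complex_of_real (f' x))"
  using assms unfolding C1_deriv_def
  by (auto intro!: continuous_intros bounded_linear.has_vector_derivative[OF bounded_linear_of_real])

lemma C1_deriv_sinf: "C1_deriv (sinf k) (\<lambda>x. real k * pi * cosf k x)"
  unfolding C1_deriv_def sinf_def cosf_def
  by (auto intro!: continuous_intros derivative_eq_intros
      simp flip: has_real_derivative_iff_has_vector_derivative)

lemma C1_deriv_cosf: "C1_deriv (cosf k) (\<lambda>x. - (real k * pi * sinf k x))"
  unfolding C1_deriv_def sinf_def cosf_def
  by (auto intro!: continuous_intros derivative_eq_intros
      simp flip: has_real_derivative_iff_has_vector_derivative)

lemma integral_C1_deriv: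
  fixes \<theta> :: "real \<Rightarrow> 'b::euclidean_space"
  assumes "C1_deriv \<theta> D" "a \<le> b"
  shows "integral\<^sup>L (lebesgue_on {a<..<b}) D = \<theta> b - \<theta> a"
  by (rule integral_lebesgue_on_FTC(2))
    (use assms in \<open>auto simp: C1_deriv_def intro: continuous_on_subset has_vector_derivative_at_within\<close>)

lemma integrable_C1_deriv:
  fixes \<theta> :: "real \<Rightarrow> 'b::euclidean_space"
  assumes "C1_deriv \<theta> D"
  shows "integrable (lebesgue_on {a<..<b}) \<theta>" "integrable (lebesgue_on {a<..<b}) D"
  using assms C1_deriv_continuous[OF assms] unfolding lebesgue_on_Ioo_Icc C1_deriv_def
  by (auto intro!: continuous_imp_integrable_real intro: continuous_on_subset)

text \<open>Squaring removes the kink of the positive part at 0; this is why the cut-off is built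
  from squares.\<close>

lemma DERIV_max_square:
  "((\<lambda>y::real. (max 0 y)\<^sup>2) has_real_derivative 2 * max 0 y) (at y)"
proof -
  consider "y > 0" | "y < 0" | "y = 0" by linarith
  then show ?thesis
  proof cases
    case 1
    have "((\<lambda>y::real. y\<^sup>2) has_real_derivative 2 * max 0 y) (at y)"
      using 1 by (auto intro!: derivative_eq_intros)
    then show ?thesis
      by (rule DERIV_cong_ev[THEN iffD1, rotated -1])
        (use 1 in \<open>auto intro!: eventually_mono[OF eventually_nhds_in_open[of "{0<..}"]]\<close>)
  next
    case 2
    have "((\<lambda>y::real. 0) has_real_derivative 2 * max 0 y) (at y)"
      using 2 by (auto intro!: derivative_eq_intros)
    then show ?thesis
      by (rule DERIV_cong_ev[THEN iffD1, rotated -1])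
        (use 2 in \<open>auto intro!: eventually_mono[OF eventually_nhds_in_open[of "{..<0}"]]\<close>)
  next
    case 3
    have "((\<lambda>h::real. (max 0 h)\<^sup>2 / h) \<longlongrightarrow> 0) (at 0)"
    proof (rule Lim_null_comparison)
      show "\<forall>\<^sub>F h in at 0. norm ((max 0 h)\<^sup>2 / h) \<le> \<bar>h\<bar>"
        by (intro always_eventually) (auto simp: max_def power2_eq_square)
      show "((\<lambda>h::real. \<bar>h\<bar>) \<longlongrightarrow> 0) (at 0)" by (rule tendsto_rabs_zero) (rule tendsto_ident_at)
    qed
    then show ?thesis using 3 by (simp add: DERIV_def)
  qed
qed

text \<open>A cut-off of class C1 in closed form: it vanishes for \<open>y \<le> \<epsilon>\<close>,
  stays between 0 and 1, and tends to 1 for each fixed \<open>y > 0\<close> as \<epsilon> tends to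
  0.\<close>

definition ramp :: "real \<Rightarrow> real \<Rightarrow> real" where
  "ramp \<epsilon> y = (max 0 (y - \<epsilon>))\<^sup>2 / (\<epsilon>\<^sup>2 + (max 0 (y - \<epsilon>))\<^sup>2)"

definition ramp' :: "real \<Rightarrow> real \<Rightarrow> real" where
  "ramp' \<epsilon> y = 2 * max 0 (y - \<epsilon>) * \<epsilon>\<^sup>2 / (\<epsilon>\<^sup>2 + (max 0 (y - \<epsilon>))\<^sup>2)\<^sup>2"

lemma ramp_denominator_pos: "\<epsilon> > 0 \<Longrightarrow> \<epsilon>\<^sup>2 + (max 0 (y - \<epsilon>))\<^sup>2 > (0::real)"
  by (simp add: add_pos_nonneg)

lemma DERIV_ramp:
  assumes "\<epsilon> > 0"
  shows "(ramp \<epsilon> has_real_derivative ramp' \<epsilon> y) (at y)"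
proof -
  have "((\<lambda>y. (max 0 (y - \<epsilon>))\<^sup>2) has_real_derivative 2 * max 0 (y - \<epsilon>) * 1) (at y)"
    by (rule DERIV_chain2[where f = "\<lambda>y. (max 0 y)\<^sup>2" and g = "\<lambda>y. y - \<epsilon>", OF DERIV_max_square])
      (auto intro!: derivative_eq_intros)
  then have m: "((\<lambda>y. (max 0 (y - \<epsilon>))\<^sup>2) has_real_derivative 2 * max 0 (y - \<epsilon>)) (at y)" by simp
  have "\<epsilon>\<^sup>2 + (max 0 (y - \<epsilon>))\<^sup>2 \<noteq> 0"
    using ramp_denominator_pos[OF assms, of y] by (rule less_imp_neq[THEN not_sym])
  moreover have "(2 * M * (E + m) - m * (0 + 2 * M)) / ((E + m) * (E + m)) = 2 * M * E / (E + m)\<^sup>2" for M E m :: real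
    by (simp add: power2_eq_square algebra_simps)
  ultimately show ?thesis
    using DERIV_divide[OF m DERIV_add[OF DERIV_const m], of "\<epsilon>\<^sup>2"]
    unfolding ramp_def[abs_def] ramp'_def by simp
qed

text \<open>The last bound is the essential one: although the derivative is of size
  \<open>1 / \<epsilon>\<close>, it is so only where \<open>y\<close> is comparable to \<epsilon>,
  hence its product with \<open>y\<close> is bounded uniformly in \<epsilon>.\<close>

lemma ramp_bounds:
  assumes "\<epsilon> > 0"
  shows "0 \<le> ramp \<epsilon> y" "ramp \<epsilon> y \<le> 1" "0 \<le> ramp' \<epsilon> y" "ramp' \<epsilon> y * y \<le> 4"
proof -
  define t where "t = max 0 (y - \<epsilon>)"
  have d: "\<epsilon>\<^sup>2 + t\<^sup>2 > 0" using ramp_denominator_pos[OF assms] by (simp add: t_def)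
  have t0: "0 \<le> t" by (simp add: t_def)
  show "0 \<le> ramp \<epsilon> y" "ramp \<epsilon> y \<le> 1" "0 \<le> ramp' \<epsilon> y"
    using d t0 by (auto simp: ramp_def ramp'_def simp flip: t_def intro!: divide_nonneg_nonneg)
  show "ramp' \<epsilon> y * y \<le> 4"
  proof (cases "t = 0")
    case False
    then have y: "y = t + \<epsilon>" by (auto simp: t_def max_def split: if_splits)
    have "2 * t * y = 2 * t\<^sup>2 + 2 * t * \<epsilon>" by (simp add: y power2_eq_square algebra_simps)
    also have "\<dots> \<le> 2 * t\<^sup>2 + (t\<^sup>2 + \<epsilon>\<^sup>2)" by (intro add_left_mono sum_squares_bound)
    also have "\<dots> \<le> 4 * (\<epsilon>\<^sup>2 + t\<^sup>2)" by (simp add: algebra_simps)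
    finally have "2 * t * y \<le> 4 * (\<epsilon>\<^sup>2 + t\<^sup>2)" .
    moreover have "\<epsilon>\<^sup>2 \<le> \<epsilon>\<^sup>2 + t\<^sup>2" by simp
    ultimately have "(2 * t * y) * \<epsilon>\<^sup>2 \<le> (4 * (\<epsilon>\<^sup>2 + t\<^sup>2)) * (\<epsilon>\<^sup>2 + t\<^sup>2)"
      by (rule mult_mono) (use d in auto)
    then have "(2 * t * y) * \<epsilon>\<^sup>2 \<le> 4 * (\<epsilon>\<^sup>2 + t\<^sup>2)\<^sup>2"
      by (simp only: power2_eq_square[of "\<epsilon>\<^sup>2 + t\<^sup>2"] mult.assoc)
    moreover have "ramp' \<epsilon> y * y = ((2 * t * y) * \<epsilon>\<^sup>2) / (\<epsilon>\<^sup>2 + t\<^sup>2)\<^sup>2"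
      by (simp add: ramp'_def flip: t_def)
    moreover have "(\<epsilon>\<^sup>2 + t\<^sup>2)\<^sup>2 > 0" using d by (rule zero_less_power)
    ultimately show ?thesis by (simp only: pos_divide_le_eq)
  qed (simp add: ramp'_def flip: t_def)
qed

lemma continuous_on_ramp': "\<epsilon> > 0 \<Longrightarrow> continuous_on S (ramp' \<epsilon>)"
  unfolding ramp'_def using ramp_denominator_pos[of \<epsilon>]
  by (intro continuous_intros) (auto simp: less_imp_neq)

lemma ramp_tendsto:
  assumes "y > 0"
  shows "(\<lambda>n. ramp (1 / real (Suc n)) y) \<longlonglongrightarrow> 1" "(\<lambda>n. ramp' (1 / real (Suc n)) y) \<longlonglongrightarrow> 0"
proof -
  have e: "(\<lambda>n. 1 / real (Suc n)) \<longlonglongrightarrow> 0" by (rule LIMSEQ_Suc) (rule lim_1_over_n)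
  have "(\<lambda>n. ramp (1 / real (Suc n)) y) \<longlonglongrightarrow> (max 0 (y - 0))\<^sup>2 / (0\<^sup>2 + (max 0 (y - 0))\<^sup>2)"
    unfolding ramp_def by (intro tendsto_intros e) (use assms in auto)
  then show "(\<lambda>n. ramp (1 / real (Suc n)) y) \<longlonglongrightarrow> 1" using assms by simp
  have "(\<lambda>n. ramp' (1 / real (Suc n)) y) \<longlonglongrightarrow> 2 * max 0 (y - 0) * 0\<^sup>2 / (0\<^sup>2 + (max 0 (y - 0))\<^sup>2)\<^sup>2"
    unfolding ramp'_def by (intro tendsto_intros e) (use assms in auto)
  then show "(\<lambda>n. ramp' (1 / real (Suc n)) y) \<longlonglongrightarrow> 0" using assms by simp
qed

text \<open>The constant is \<open>2 * K\<close> from the oscillation of \<open>D\<close> in the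
  linearisation error plus \<open>K\<close> from the linear term; its size is immaterial.\<close>

lemma C1_deriv_lipschitz:
  fixes \<theta> :: "real \<Rightarrow> 'b::euclidean_space"
  assumes "C1_deriv \<theta> D" "\<And>x. x \<in> {a..b} \<Longrightarrow> norm (D x) \<le> K" "x \<in> {a..b}" "y \<in> {a..b}"
  shows "norm (\<theta> y - \<theta> x) \<le> 3 * K * \<bar>y - x\<bar>"
proof -
  have "norm (\<theta> y - \<theta> x - (y - x) *\<^sub>R D x) \<le> norm (y - x) * (2 * K)"
  proof (rule vector_differentiable_bound_linearization[where S = "{a..b}"])
    show "norm (D z - D x) \<le> 2 * K" if "z \<in> {a..b}" for z
      using norm_triangle_ineq4[of "D z" "D x"] assms(2)[of x] assms(2)[OF that] assms(3) by simp
  qed (use assms in \<open>auto simp: C1_deriv_def closed_segment_eq_real_ivl intro: has_vector_derivative_at_within\<close>)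
  moreover have "norm ((y - x) *\<^sub>R D x) \<le> \<bar>y - x\<bar> * K"
    using assms by (auto intro!: mult_left_mono)
  ultimately show ?thesis
    using norm_triangle_ineq[of "\<theta> y - \<theta> x - (y - x) *\<^sub>R D x" "(y - x) *\<^sub>R D x"]
    by (simp add: algebra_simps)
qed

text \<open>The cut-off \<open>ramp \<epsilon> ((x - a) * (b - x))\<close> has a derivative of size \<open>1 / \<epsilon>\<close> near the end
  points, which is compensated by the zeros of \<open>\<theta>\<close> there.\<close>

lemma test_fun_approx:
  fixes \<theta> :: "real \<Rightarrow> 'b::euclidean_space"
  assumes "C1_deriv \<theta> D" "a < b" "\<theta> a = 0" "\<theta> b = 0"
  obtains \<Theta> \<Theta>' M where "\<And>n::nat. test_fun a b (\<Theta> n)" "\<And>n. C1_deriv (\<Theta> n) (\<Theta>' n)"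
    "\<And>x. x \<in> {a<..<b} \<Longrightarrow> (\<lambda>n. \<Theta> n x) \<longlonglongrightarrow> \<theta> x" "\<And>x. x \<in> {a<..<b} \<Longrightarrow> (\<lambda>n. \<Theta>' n x) \<longlonglongrightarrow> D x"
    "\<And>n x. x \<in> {a<..<b} \<Longrightarrow> norm (\<Theta> n x) \<le> M" "\<And>n x. x \<in> {a<..<b} \<Longrightarrow> norm (\<Theta>' n x) \<le> M"
    "\<And>x. x \<in> {a<..<b} \<Longrightarrow> norm (\<theta> x) \<le> M" "\<And>x. x \<in> {a<..<b} \<Longrightarrow> norm (D x) \<le> M"
proof -
  define w where "w x = (x - a) * (b - x)" for x
  define w' where "w' x = a + b - 2 * x" for x
  define e where "e n = 1 / real (Suc n)" for n
  have e: "e n > 0" for n by (simp add: e_def)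
  define \<Theta> where "\<Theta> n x = ramp (e n) (w x) *\<^sub>R \<theta> x" for n x
  define \<Theta>' where "\<Theta>' n x = ramp (e n) (w x) *\<^sub>R D x + (ramp' (e n) (w x) * w' x) *\<^sub>R \<theta> x" for n x
  note c\<theta> = C1_deriv_continuous[OF assms(1)]
  have cD: "continuous_on UNIV D" and dD: "(\<theta> has_vector_derivative D x) (at x)" for x
    using assms by (auto simp: C1_deriv_def)
  have "bounded (D ` {a..b})" "bounded (\<theta> ` {a..b})"
    by (intro compact_imp_bounded compact_continuous_image continuous_on_subset[OF cD]
        continuous_on_subset[OF c\<theta>]; simp)+
  then obtain K K0 where K: "\<And>x. x \<in> {a..b} \<Longrightarrow> norm (D x) \<le> K" and K0: "\<And>x. x \<in> {a..b} \<Longrightarrow> norm (\<theta> x) \<le> K0"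
    unfolding bounded_iff by blast
  have K_nonneg: "0 \<le> K" using K[of a] assms(2) order_trans[OF norm_ge_zero] by fastforce
  have w_pos: "w x > 0" if "x \<in> {a<..<b}" for x using that by (simp add: w_def)
  have dw: "((\<lambda>x. ramp (e n) (w x)) has_real_derivative ramp' (e n) (w x) * w' x) (at x)" for n x
    by (rule DERIV_chain2[OF DERIV_ramp[OF e]])
      (auto simp: w_def w'_def intro!: derivative_eq_intros)
  have cramp: "continuous_on UNIV (\<lambda>x. ramp (e n) (w x))" for n
    using dw by (auto intro!: continuous_at_imp_continuous_on DERIV_isCont)
  have C1: "C1_deriv (\<Theta> n) (\<Theta>' n)" for n
    unfolding C1_deriv_def
  proof
    show "\<forall>x. (\<Theta> n has_vector_derivative \<Theta>' n x) (at x)"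
      unfolding \<Theta>_def[abs_def] \<Theta>'_def[abs_def]
      using has_vector_derivative_scaleR[OF dw dD] by (simp add: add.commute)
    have "continuous_on UNIV (\<lambda>x. ramp' (e n) (w x))"
      by (rule continuous_on_compose2[OF continuous_on_ramp'[OF e, of UNIV]])
        (auto simp: w_def intro!: continuous_intros)
    then show "continuous_on UNIV (\<Theta>' n)"
      unfolding \<Theta>'_def[abs_def] w'_def by (intro continuous_intros cD c\<theta> cramp)
  qed
  have lip: "norm (\<theta> x) \<le> 3 * K * (x - a)" "norm (\<theta> x) \<le> 3 * K * (b - x)" if "x \<in> {a<..<b}" for x
    using C1_deriv_lipschitz[OF assms(1) K, where x = a and y = x]
      C1_deriv_lipschitz[OF assms(1) K, where x = b and y = x] that assms by auto
  \<comment> \<open>As \<theta> vanishes at both ends it is at most \<open>3 * K\<close> times the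
    distance to the nearer end, while the distance to the other end is at least half of
    \<open>b - a\<close>. So \<theta> is dominated by the product \<open>w\<close> of the two
    distances.\<close>
  have bd: "norm (\<theta> x) * (b - a) \<le> 6 * K * w x" if x: "x \<in> {a<..<b}" for x
  proof (cases "x - a \<le> b - x")
    case True
    have "norm (\<theta> x) * (b - a) \<le> (3 * K * (x - a)) * (2 * (b - x))"
      using True x lip(1)[OF x] assms K_nonneg by (intro mult_mono) auto
    then show ?thesis by (simp add: w_def algebra_simps)
  next
    case False
    have "norm (\<theta> x) * (b - a) \<le> (3 * K * (b - x)) * (2 * (x - a))"
      using False x lip(2)[OF x] assms K_nonneg by (intro mult_mono) auto
    then show ?thesis by (simp add: w_def algebra_simps)
  qed
  \<comment> \<open>The factor 24 is \<open>6 * K\<close> from the previous bound times 4 from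
    \<open>ramp_bounds\<close>: the zeros of \<theta> absorb the steep derivative of the
    cut-off.\<close>
  have bd2: "norm ((ramp' (e n) (w x) * w' x) *\<^sub>R \<theta> x) \<le> 24 * K" if x: "x \<in> {a<..<b}" for n x
  proof -
    have "\<bar>w' x\<bar> \<le> b - a" using x by (auto simp: w'_def abs_le_iff)
    then have "\<bar>w' x\<bar> * norm (\<theta> x) \<le> (b - a) * norm (\<theta> x)" by (intro mult_right_mono) auto
    also have "\<dots> \<le> 6 * K * w x" using bd[OF x] by (simp add: mult.commute)
    finally have "ramp' (e n) (w x) * (\<bar>w' x\<bar> * norm (\<theta> x)) \<le> ramp' (e n) (w x) * (6 * K * w x)"
      by (rule mult_left_mono) (rule ramp_bounds(3)[OF e])
    also have "\<dots> = 6 * K * (ramp' (e n) (w x) * w x)" by simp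
    also have "\<dots> \<le> 6 * K * 4"
      by (intro mult_left_mono ramp_bounds(4)[OF e]) (use K_nonneg in auto)
    finally show ?thesis using ramp_bounds(3)[OF e, of n "w x"] by (simp add: abs_mult mult.assoc)
  qed
  have supp: "closure {x. \<Theta> n x \<noteq> 0} \<subseteq> {a<..<b}" for n
  proof -
    have "{x. \<Theta> n x \<noteq> 0} \<subseteq> {x. e n \<le> w x}"
      by (auto simp: \<Theta>_def ramp_def max_def split: if_splits)
    moreover have "closed {x. e n \<le> w x}"
      unfolding w_def by (intro closed_Collect_le continuous_intros)
    ultimately have "closure {x. \<Theta> n x \<noteq> 0} \<subseteq> {x. e n \<le> w x}" by (rule closure_minimal)
    moreover have "{x. e n \<le> w x} \<subseteq> {a<..<b}"
    proof safe
      fix x assume "e n \<le> w x"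
      then have "0 < w x" using e[of n] by linarith
      then show "x \<in> {a<..<b}" using assms(2) by (auto simp: w_def zero_less_mult_iff)
    qed
    ultimately show ?thesis by blast
  qed
  define M where "M = K0 + K + 24 * K"
  have K0_nonneg: "0 \<le> K0" using K0[of a] assms(2) order_trans[OF norm_ge_zero] by fastforce
  show thesis
  proof (rule that[of \<Theta> \<Theta>' M])
    fix n x assume x: "x \<in> {a<..<b}"
    show "(\<lambda>n. \<Theta> n x) \<longlonglongrightarrow> \<theta> x"
      unfolding \<Theta>_def e_def using tendsto_scaleR[OF ramp_tendsto(1)[OF w_pos[OF x]] tendsto_const[of "\<theta> x"]] by simp
    have "(\<lambda>n. \<Theta>' n x) \<longlonglongrightarrow> 1 *\<^sub>R D x + (0 * w' x) *\<^sub>R \<theta> x"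
      unfolding \<Theta>'_def e_def by (intro tendsto_intros ramp_tendsto[OF w_pos[OF x]])
    then show "(\<lambda>n. \<Theta>' n x) \<longlonglongrightarrow> D x" by simp
    have r: "norm (ramp (e n) (w x) *\<^sub>R v) \<le> norm v" for v :: 'b
      using ramp_bounds(1,2)[OF e, of n "w x"] by (simp add: mult_left_le_one_le)
    show "norm (\<Theta> n x) \<le> M"
      using r[of "\<theta> x"] K0[of x] x K_nonneg by (simp add: \<Theta>_def M_def)
    show "norm (\<Theta>' n x) \<le> M"
      unfolding \<Theta>'_def
      by (rule order_trans[OF norm_triangle_ineq])
        (use r[of "D x"] K[of x] bd2[OF x, of n] x K0_nonneg in \<open>simp add: M_def\<close>)
    show "norm (\<theta> x) \<le> M" "norm (D x) \<le> M"
      using K[of x] K0[of x] x K_nonneg K0_nonneg by (auto simp: M_def)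
  qed (use C1 supp in \<open>auto intro: test_funI\<close>)
qed

lemma to_L2_tendsto_bounded:
  fixes f :: "nat \<Rightarrow> real \<Rightarrow> complex"
  assumes "\<And>n. continuous_on UNIV (f n)" "continuous_on UNIV g"
    "\<And>x. x \<in> {0<..<1} \<Longrightarrow> (\<lambda>n. f n x) \<longlonglongrightarrow> g x"
    "\<And>n x. x \<in> {0<..<1} \<Longrightarrow> cmod (f n x) \<le> M" "\<And>x. x \<in> {0<..<1} \<Longrightarrow> cmod (g x) \<le> M"
  shows "(\<lambda>n. to_L2 (f n)) \<longlonglongrightarrow> to_L2 g"
proof -
  note f2 = continuous_sq_integrable01[OF assms(1)] and g2 = continuous_sq_integrable01[OF assms(2)]
  have [measurable]: "f n \<in> borel_measurable leb01" "g \<in> borel_measurable leb01" for n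
    using f2 g2 by (auto simp: sq_integrable_on_def)
  have "(\<lambda>n. integral\<^sup>L leb01 (\<lambda>x. (cmod (f n x - g x))\<^sup>2)) \<longlonglongrightarrow> integral\<^sup>L leb01 (\<lambda>x. 0::real)"
  proof (rule integral_dominated_convergence[where w = "\<lambda>x. (2 * M)\<^sup>2"])
    show "AE x in leb01. (\<lambda>n. (cmod (f n x - g x))\<^sup>2) \<longlonglongrightarrow> 0"
    proof (rule AE_I2)
      fix x assume "x \<in> space leb01"
      then have "(\<lambda>n. (cmod (f n x - g x))\<^sup>2) \<longlonglongrightarrow> (cmod (g x - g x))\<^sup>2"
        by (intro tendsto_intros assms(3)) auto
      then show "(\<lambda>n. (cmod (f n x - g x))\<^sup>2) \<longlonglongrightarrow> 0" by simp
    qed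
    show "AE x in leb01. norm ((cmod (f n x - g x))\<^sup>2) \<le> (2 * M)\<^sup>2" for n
    proof (rule AE_I2)
      fix x assume "x \<in> space leb01"
      then have "cmod (f n x - g x) \<le> 2 * M"
        using norm_triangle_ineq4[of "f n x" "g x"] assms(4)[of x n] assms(5)[of x] by simp
      then show "norm ((cmod (f n x - g x))\<^sup>2) \<le> (2 * M)\<^sup>2"
        by (simp only: real_norm_def abs_power2) (intro power_mono, auto)
    qed
  qed (auto simp: finite_measure.integrable_const[OF finite_measure_leb01])
  then have "(\<lambda>n. sqrt (integral\<^sup>L leb01 (\<lambda>x. (cmod (f n x - g x))\<^sup>2))) \<longlonglongrightarrow> sqrt 0"
    by (intro tendsto_real_sqrt) simp
  then have "(\<lambda>n. norm (to_L2 (f n) - to_L2 g)) \<longlonglongrightarrow> 0"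
    using to_L2_diff[OF f2 g2] by (simp add: norm_to_L2)
  then show ?thesis by (simp add: tendsto_norm_zero_iff LIM_zero_iff)
qed

subsection \<open>H10 as a space of coefficients\<close>

text \<open>The factor \<open>pi\<close> is dropped from the inverse square root of the Laplacian,
  which makes this map an isometry from \<open>L2\<close> onto \<open>H10\<close> with
  \<open>H10_norm\<close>.\<close>

definition Linv :: "L2 \<Rightarrow> L2" where
  "Linv = multiplier phi {1..} (\<lambda>k. 1 / of_nat k)"

lemma Linv_bound: "k \<in> {1..} \<Longrightarrow> cmod (1 / of_nat k) \<le> 1"
  by (simp add: norm_divide)

lemma cinner_Linv: "k \<ge> 1 \<Longrightarrow> cinner_L2 (Linv x) (phi k) = cinner_L2 x (phi k) / of_nat k"
  unfolding Linv_def
  using cinner_multiplier[OF orthonormal_phi, of "\<lambda>k. 1 / of_nat k" 1 k x] Linv_bound by simp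

lemma bounded_linear_Linv: "bounded_linear Linv"
  unfolding Linv_def by (rule bounded_linear_multiplier[OF orthonormal_phi Linv_bound]) auto

lemma norm_Linv: "norm (Linv x) \<le> norm x"
  unfolding Linv_def
  using norm_multiplier[OF orthonormal_phi Linv_bound, where f = x] by simp

lemma H10_norm_Linv: "H10_norm (Linv x) = norm x"
proof -
  have "(\<Sum>\<^sub>\<infinity>k\<in>{1..}. (cmod (of_nat k * cinner_L2 (phi k) (Linv x)))\<^sup>2) =
      (\<Sum>\<^sub>\<infinity>k\<in>{1..}. (cmod (cinner_L2 x (phi k)))\<^sup>2)"
  proof (rule infsum_cong)
    fix k :: nat assume "k \<in> {1..}"
    then show "(cmod (of_nat k * cinner_L2 (phi k) (Linv x)))\<^sup>2 = (cmod (cinner_L2 x (phi k)))\<^sup>2"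
      by (subst cinner_L2_commute) (simp add: cinner_Linv norm_mult norm_divide)
  qed
  then show ?thesis
    by (simp only: H10_norm_def Parseval_phi(2)[symmetric] real_sqrt_abs abs_norm_cancel)
qed

text \<open>Integration by parts against a cosine; the boundary terms vanish with the test function.
  The weight \<open>k\<close> on sine coefficients thus becomes a cosine coefficient of the
  derivative, to which Bessel's inequality applies.\<close>

lemma test_fun_coeff:
  fixes \<theta> :: "real \<Rightarrow> complex"
  assumes "test_fun 0 1 \<theta>"
  shows "cinner_L2 (to_L2 (\<lambda>x. vector_derivative \<theta> (at x))) (cosb k) = (of_nat k * pi) * cinner_L2 (to_L2 \<theta>) (phi k)"
proof -
  define D where "D x = vector_derivative \<theta> (at x)" for x
  note d = test_funD[OF assms, folded D_def]
  have cD: "continuous_on UNIV D" using d(1) by (simp add: C1_deriv_def)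
  note s = continuous_sq_integrable01[OF cD] continuous_sq_integrable01[OF C1_deriv_continuous[OF d(1)]]
  have "C1_deriv (\<lambda>x. \<theta> x * complex_of_real (cosf k x))
      (\<lambda>x. \<theta> x * complex_of_real (- (real k * pi * sinf k x)) + D x * complex_of_real (cosf k x))"
    by (intro C1_deriv_mult C1_deriv_of_real C1_deriv_cosf d(1))
  from integral_C1_deriv[OF this, of 0 1] d
  have "0 = integral\<^sup>L leb01 (\<lambda>x. D x * complex_of_real (cosf k x) - (of_nat k * pi) * (\<theta> x * complex_of_real (sinf k x)))"
    by (simp add: algebra_simps)
  also have "\<dots> = integral\<^sup>L leb01 (\<lambda>x. D x * complex_of_real (cosf k x)) -
      (of_nat k * pi) * integral\<^sup>L leb01 (\<lambda>x. \<theta> x * complex_of_real (sinf k x))"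
    using sq_integrable_on_mult_cnj[OF s(1) sq_integrable_cosf[of k]] sq_integrable_on_mult_cnj[OF s(2) sq_integrable_sinf[of k]]
    by (subst Bochner_Integration.integral_diff) auto
  finally show ?thesis
    unfolding cosb_def phi_eq_sinf D_def[symmetric] cinner_to_L2[OF s(1) sq_integrable_cosf]
      cinner_to_L2[OF s(2) sq_integrable_sinf] by simp
qed

text \<open>The relation between the coefficients of a test function and of its derivative survives
  the limit in the definition of \<open>H10\<close>. Bessel's inequality for the cosines then makes
  the weighted coefficients \<open>c\<close> square summable, and Riesz-Fischer produces the
  preimage.\<close>

lemma H10_imp_Linv:
  assumes "\<psi> \<in> H10"
  obtains x where "\<psi> = Linv x"
proof -
  obtain f g where f: "\<psi> = to_L2 f" and
    ap: "\<And>\<epsilon>. \<epsilon> > 0 \<Longrightarrow> \<exists>\<theta> :: real \<Rightarrow> complex. test_fun 0 1 \<theta> \<and>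
          norm (to_L2 f - to_L2 \<theta>) < \<epsilon> \<and>
          norm (to_L2 g - to_L2 (\<lambda>x. vector_derivative \<theta> (at x))) < \<epsilon>"
    using assms unfolding H10_def by blast
  define G where "G = to_L2 g"
  have "\<forall>n. \<exists>\<theta> :: real \<Rightarrow> complex. test_fun 0 1 \<theta> \<and>
          norm (to_L2 \<theta> - \<psi>) < 1 / real (Suc n) \<and>
          norm (to_L2 (\<lambda>x. vector_derivative \<theta> (at x)) - G) < 1 / real (Suc n)"
    using ap unfolding f G_def by (simp add: norm_minus_commute)
  then obtain \<theta> :: "nat \<Rightarrow> real \<Rightarrow> complex" where \<theta>: "\<And>n. test_fun 0 1 (\<theta> n)"
    "\<And>n. norm (to_L2 (\<theta> n) - \<psi>) < 1 / real (Suc n)"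
    "\<And>n. norm (to_L2 (\<lambda>x. vector_derivative (\<theta> n) (at x)) - G) < 1 / real (Suc n)"
    by metis
  have lim: "X \<longlonglongrightarrow> L" if "\<And>n. norm (X n - L) < 1 / real (Suc n)" for X :: "nat \<Rightarrow> L2" and L
  proof (rule LIM_zero_cancel, rule Lim_null_comparison)
    show "\<forall>\<^sub>F n in sequentially. norm (X n - L) \<le> 1 / real (Suc n)"
      using that by (intro always_eventually) (auto intro: less_imp_le)
    show "(\<lambda>n. 1 / real (Suc n)) \<longlonglongrightarrow> 0" by (rule LIMSEQ_Suc) (rule lim_1_over_n)
  qed
  have coeff: "cinner_L2 G (cosb k) = (of_nat k * pi) * cinner_L2 \<psi> (phi k)" for k
  proof (rule LIMSEQ_unique)
    show "(\<lambda>n. cinner_L2 (to_L2 (\<lambda>x. vector_derivative (\<theta> n) (at x))) (cosb k)) \<longlonglongrightarrow> cinner_L2 G (cosb k)"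
      by (intro tendsto_intros lim \<theta>)
    show "(\<lambda>n. cinner_L2 (to_L2 (\<lambda>x. vector_derivative (\<theta> n) (at x))) (cosb k)) \<longlonglongrightarrow>
        (of_nat k * pi) * cinner_L2 \<psi> (phi k)"
      unfolding test_fun_coeff[OF \<theta>(1)] by (intro tendsto_intros lim \<theta>)
  qed
  define c where "c k = of_nat k * cinner_L2 \<psi> (phi k)" for k
  have "c = (\<lambda>k. cinner_L2 G (cosb k) / pi)" by (auto simp: coeff c_def)
  then have "(\<lambda>k. (cmod (c k))\<^sup>2) = (\<lambda>k. (1 / pi\<^sup>2) * (cmod (cinner_L2 G (cosb k)))\<^sup>2)"
    by (simp add: norm_divide power_divide)
  then have "(\<lambda>k. (cmod (c k))\<^sup>2) summable_on {1..}"
    by (simp only:) (intro summable_on_cmult_right orthonormal_Bessel(1)[OF orthonormal_cosb])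
  from orthonormal_Riesz_Fischer(2)[OF orthonormal_phi this]
  have "\<psi> = Linv (\<Sum>\<^sub>\<infinity>k\<in>{1..}. c k *\<^sub>C phi k)"
    by (intro L2_eqI) (simp add: cinner_Linv c_def)
  then show thesis by (rule that)
qed

text \<open>\<open>G x\<close> is the termwise derivative of the sine series of
  \<open>Linv x\<close>. A common truncation approximates both series; the resulting sine polynomial
  vanishes at 0 and 1, so it can be cut off there with little change in value and
  derivative.\<close>

lemma Linv_approx:
  assumes "\<epsilon> > 0"
  defines "G \<equiv> (\<lambda>x. \<Sum>\<^sub>\<infinity>k\<in>{1..}. (pi * cinner_L2 x (phi k)) *\<^sub>C cosb k)"
  shows "\<exists>\<theta> :: real \<Rightarrow> complex. test_fun 0 1 \<theta> \<and> norm (Linv x - to_L2 \<theta>) < \<epsilon> \<and>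
          norm (G x - to_L2 (\<lambda>x. vector_derivative \<theta> (at x))) < \<epsilon>"
proof -
  define c where "c k = cinner_L2 x (phi k)" for k
  have "((\<lambda>k. (c k / of_nat k) *\<^sub>C phi k) has_sum Linv x) {1..}"
    using has_sum_multiplier[OF orthonormal_phi Linv_bound, where f = x]
    by (simp add: Linv_def c_def)
  then have 1: "\<forall>\<^sub>F F in finite_subsets_at_top {1..}. dist (\<Sum>k\<in>F. (c k / of_nat k) *\<^sub>C phi k) (Linv x) < \<epsilon> / 2"
    unfolding has_sum_def by (rule tendstoD) (use assms in simp)
  have "(\<lambda>k. (pi\<^sup>2) * (cmod (c k))\<^sup>2) summable_on {1..}"
    unfolding c_def by (intro summable_on_cmult_right Parseval_phi)
  then have "(\<lambda>k. (cmod (pi * c k))\<^sup>2) summable_on {1..}"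
    by (simp add: norm_mult power_mult_distrib)
  then have "((\<lambda>k. (pi * c k) *\<^sub>C cosb k) has_sum G x) {1..}"
    unfolding G_def c_def by (intro has_sum_infsum orthonormal_Riesz_Fischer(1)[OF orthonormal_cosb])
  then have 2: "\<forall>\<^sub>F F in finite_subsets_at_top {1..}. dist (\<Sum>k\<in>F. (pi * c k) *\<^sub>C cosb k) (G x) < \<epsilon> / 2"
    unfolding has_sum_def by (rule tendstoD) (use assms in simp)
  have "\<forall>\<^sub>F F in finite_subsets_at_top {1::nat..}. finite F \<and> F \<subseteq> {1..}"
    unfolding eventually_finite_subsets_at_top by (intro exI[of _ "{}"]) auto
  then obtain F where F: "finite F" "F \<subseteq> {1..}" "dist (\<Sum>k\<in>F. (c k / of_nat k) *\<^sub>C phi k) (Linv x) < \<epsilon> / 2"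
    "dist (\<Sum>k\<in>F. (pi * c k) *\<^sub>C cosb k) (G x) < \<epsilon> / 2"
    using eventually_happens'[OF finite_subsets_at_top_neq_bot eventually_conj[OF 1 eventually_conj[OF 2]]]
    by blast
  define p where "p x = (\<Sum>k\<in>F. (c k / of_nat k) * complex_of_real (sinf k x))" for x
  define p' where "p' x = (\<Sum>k\<in>F. (c k / of_nat k) * complex_of_real (real k * pi * cosf k x))" for x
  have C1: "C1_deriv p p'"
    unfolding p_def p'_def by (intro C1_deriv_sum C1_deriv_cmult C1_deriv_of_real C1_deriv_sinf)
  have p0: "p 0 = 0" "p 1 = 0"
    by (auto simp: p_def sinf_def intro!: sum.neutral)
  have p_L2: "to_L2 p = (\<Sum>k\<in>F. (c k / of_nat k) *\<^sub>C phi k)"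
    unfolding p_def phi_eq_sinf
    by (simp only: to_L2_sum sq_integrable_on_cmult sq_integrable_sinf to_L2_cmult)
  have "p' = (\<lambda>x. \<Sum>k\<in>F. (pi * c k) * complex_of_real (cosf k x))"
    unfolding p'_def using F(2) by (intro ext sum.cong) (auto simp: field_simps)
  then have p'_L2: "to_L2 p' = (\<Sum>k\<in>F. (pi * c k) *\<^sub>C cosb k)"
    unfolding cosb_def
    by (simp only: to_L2_sum sq_integrable_on_cmult sq_integrable_cosf to_L2_cmult)
  obtain \<Theta> \<Theta>' M where \<Theta>: "\<And>n::nat. test_fun 0 1 (\<Theta> n)" "\<And>n. C1_deriv (\<Theta> n) (\<Theta>' n)"
    "\<And>x. x \<in> {0<..<1} \<Longrightarrow> (\<lambda>n. \<Theta> n x) \<longlonglongrightarrow> p x" "\<And>x. x \<in> {0<..<1} \<Longrightarrow> (\<lambda>n. \<Theta>' n x) \<longlonglongrightarrow> p' x"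
    "\<And>n x. x \<in> {0<..<1} \<Longrightarrow> norm (\<Theta> n x) \<le> M" "\<And>n x. x \<in> {0<..<1} \<Longrightarrow> norm (\<Theta>' n x) \<le> M"
    "\<And>x. x \<in> {0<..<1} \<Longrightarrow> norm (p x) \<le> M" "\<And>x. x \<in> {0<..<1} \<Longrightarrow> norm (p' x) \<le> M"
    by (rule test_fun_approx[OF C1 zero_less_one p0]) (rule that)
  have l: "(\<lambda>n. to_L2 (\<Theta> n)) \<longlonglongrightarrow> to_L2 p" "(\<lambda>n. to_L2 (\<Theta>' n)) \<longlonglongrightarrow> to_L2 p'"
  proof -
    have c: "continuous_on UNIV (\<Theta>' n)" "continuous_on UNIV (\<Theta> n)" "continuous_on UNIV p" "continuous_on UNIV p'" for n
      using \<Theta>(2)[of n] C1 C1_deriv_continuous[OF \<Theta>(2)] C1_deriv_continuous[OF C1]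
      by (auto simp: C1_deriv_def)
    show "(\<lambda>n. to_L2 (\<Theta> n)) \<longlonglongrightarrow> to_L2 p"
      by (rule to_L2_tendsto_bounded[OF c(2,3) \<Theta>(3,5,7)])
    show "(\<lambda>n. to_L2 (\<Theta>' n)) \<longlonglongrightarrow> to_L2 p'"
      by (rule to_L2_tendsto_bounded[OF c(1,4) \<Theta>(4,6,8)])
  qed
  have "\<forall>\<^sub>F n in sequentially. dist (to_L2 (\<Theta> n)) (to_L2 p) < \<epsilon> / 2"
    "\<forall>\<^sub>F n in sequentially. dist (to_L2 (\<Theta>' n)) (to_L2 p') < \<epsilon> / 2"
    by (rule tendstoD[OF l(1)], use assms in simp, rule tendstoD[OF l(2)], use assms in simp)
  from eventually_happens'[OF sequentially_bot eventually_conj[OF this]]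
  obtain n where n: "dist (to_L2 (\<Theta> n)) (to_L2 p) < \<epsilon> / 2" "dist (to_L2 (\<Theta>' n)) (to_L2 p') < \<epsilon> / 2"
    by blast
  have "(\<lambda>x. vector_derivative (\<Theta> n) (at x)) = \<Theta>' n"
    using C1_deriv_vector_derivative[OF \<Theta>(2)] by blast
  moreover have "dist (Linv x) (to_L2 (\<Theta> n)) < \<epsilon>" "dist (G x) (to_L2 (\<Theta>' n)) < \<epsilon>"
    using n F(3,4) unfolding p_L2[symmetric] p'_L2[symmetric]
    by (metis dist_commute dist_triangle_half_r)+
  ultimately show ?thesis
    using \<Theta>(1)[of n] by (auto simp: dist_norm)
qed

text \<open>Besides the approximation by test functions, a weak derivative is required: the identity
  of integration by parts holds exactly for each approximating test function and is continuous in
  the \<open>L2\<close> norms of function and derivative, so it passes to the limit.\<close>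

lemma Linv_in_H10: "Linv x \<in> H10"
proof -
  define G where "G = (\<Sum>\<^sub>\<infinity>k\<in>{1..}. (pi * cinner_L2 x (phi k)) *\<^sub>C cosb k)"
  define f where "f = rep_L2 (Linv x)"
  define g where "g = rep_L2 G"
  have f: "to_L2 f = Linv x" "f sq_integrable_on {0<..<1}" and g: "to_L2 g = G" "g sq_integrable_on {0<..<1}"
    by (auto simp: f_def g_def sq_integrable_rep_L2)
  have ap: "\<exists>\<theta> :: real \<Rightarrow> complex. test_fun 0 1 \<theta> \<and> norm (to_L2 f - to_L2 \<theta>) < \<epsilon> \<and>
          norm (to_L2 g - to_L2 (\<lambda>x. vector_derivative \<theta> (at x))) < \<epsilon>" if "\<epsilon> > 0" for \<epsilon>
    using Linv_approx[OF that, of x] unfolding f g G_def .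
  have "has_weak_deriv 0 1 f g"
    unfolding has_weak_deriv_def
  proof (intro allI impI)
    fix \<eta> :: "real \<Rightarrow> real" assume \<eta>: "test_fun 0 1 \<eta>"
    define E where "E x = vector_derivative \<eta> (at x)" for x
    note d\<eta> = test_funD[OF \<eta>, folded E_def]
    have c\<eta>: "continuous_on UNIV (\<lambda>x. complex_of_real (\<eta> x))" "continuous_on UNIV (\<lambda>x. complex_of_real (E x))"
      using C1_deriv_continuous[OF d\<eta>(1)] d\<eta>(1) by (auto simp: C1_deriv_def intro!: continuous_intros)
    note s\<eta> = c\<eta>[THEN continuous_sq_integrable01]
    define P where "P = to_L2 (\<lambda>x. complex_of_real (E x))"
    define Q where "Q = to_L2 (\<lambda>x. complex_of_real (\<eta> x))"
    have main: "cinner_L2 (to_L2 \<theta>) P = - cinner_L2 (to_L2 (\<lambda>x. vector_derivative \<theta> (at x))) Q"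
      if \<theta>: "test_fun 0 1 \<theta>" for \<theta>
    proof -
      define D where "D x = vector_derivative \<theta> (at x)" for x
      note d = test_funD[OF \<theta>, folded D_def]
      have cD: "continuous_on UNIV D" using d(1) by (simp add: C1_deriv_def)
      note s = continuous_sq_integrable01[OF cD] continuous_sq_integrable01[OF C1_deriv_continuous[OF d(1)]]
      have "C1_deriv (\<lambda>x. \<theta> x * complex_of_real (\<eta> x)) (\<lambda>x. \<theta> x * complex_of_real (E x) + D x * complex_of_real (\<eta> x))"
        by (intro C1_deriv_mult C1_deriv_of_real d d\<eta>)
      from integral_C1_deriv[OF this, of 0 1] d
      have "0 = integral\<^sup>L leb01 (\<lambda>x. \<theta> x * complex_of_real (E x) + D x * complex_of_real (\<eta> x))"
        by simp
      also have "\<dots> = integral\<^sup>L leb01 (\<lambda>x. \<theta> x * complex_of_real (E x)) + integral\<^sup>L leb01 (\<lambda>x. D x * complex_of_real (\<eta> x))"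
        using sq_integrable_on_mult_cnj[OF s(2) s\<eta>(2)] sq_integrable_on_mult_cnj[OF s(1) s\<eta>(1)]
        by (subst Bochner_Integration.integral_add) auto
      finally show ?thesis
        unfolding P_def Q_def D_def[symmetric] cinner_to_L2[OF s(1) s\<eta>(1)] cinner_to_L2[OF s(2) s\<eta>(2)]
        by (simp add: eq_neg_iff_add_eq_0)
    qed
    have "cmod (cinner_L2 (to_L2 f) P + cinner_L2 (to_L2 g) Q) \<le> 0 + e" if e: "e > 0" for e
    proof -
      \<comment> \<open>Chosen so that the two Cauchy-Schwarz errors add up to at most
        \<open>e\<close>; the 1 keeps the denominator positive.\<close>
      define \<epsilon> where "\<epsilon> = e / (norm P + norm Q + 1)"
      have pos: "norm P + norm Q + 1 > 0" by (simp add: add_nonneg_pos)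
      have "\<epsilon> > 0" unfolding \<epsilon>_def by (intro divide_pos_pos e pos)
      from ap[OF this] obtain \<theta> :: "real \<Rightarrow> complex" where \<theta>: "test_fun 0 1 \<theta>"
        "norm (to_L2 f - to_L2 \<theta>) < \<epsilon>"
        "norm (to_L2 g - to_L2 (\<lambda>x. vector_derivative \<theta> (at x))) < \<epsilon>" by blast
      have "cinner_L2 (to_L2 f) P + cinner_L2 (to_L2 g) Q = cinner_L2 (to_L2 f - to_L2 \<theta>) P
          + cinner_L2 (to_L2 g - to_L2 (\<lambda>x. vector_derivative \<theta> (at x))) Q"
        using main[OF \<theta>(1)] by (simp add: cinner_L2_diff_left)
      also have "cmod \<dots> \<le> cmod (cinner_L2 (to_L2 f - to_L2 \<theta>) P)
          + cmod (cinner_L2 (to_L2 g - to_L2 (\<lambda>x. vector_derivative \<theta> (at x))) Q)"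
        by (rule norm_triangle_ineq)
      also have "\<dots> \<le> \<epsilon> * norm P + \<epsilon> * norm Q"
        by (intro add_mono order_trans[OF cinner_L2_Cauchy_Schwarz] mult_right_mono less_imp_le[OF \<theta>(2)]
            less_imp_le[OF \<theta>(3)]) auto
      also have "\<dots> \<le> \<epsilon> * (norm P + norm Q + 1)" using \<open>\<epsilon> > 0\<close> by (simp add: algebra_simps)
      also have "\<dots> = e" using pos by (simp add: \<epsilon>_def)
      finally show ?thesis by simp
    qed
    then have "cmod (cinner_L2 (to_L2 f) P + cinner_L2 (to_L2 g) Q) \<le> 0" by (rule field_le_epsilon)
    then have "cinner_L2 (to_L2 f) P = - cinner_L2 (to_L2 g) Q"
      by (simp add: eq_neg_iff_add_eq_0)
    then show "integral\<^sup>L leb01 (\<lambda>x. vector_derivative \<eta> (at x) *\<^sub>R f x) = - integral\<^sup>L leb01 (\<lambda>x. \<eta> x *\<^sub>R g x)"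
      unfolding P_def Q_def cinner_to_L2[OF f(2) s\<eta>(2)] cinner_to_L2[OF g(2) s\<eta>(1)]
      by (simp add: scaleR_conv_of_real mult.commute E_def)
  qed
  then show ?thesis
    unfolding H10_def f(1)[symmetric] using f(2) g(2) ap by blast
qed

lemma H10_iff: "\<psi> \<in> H10 \<longleftrightarrow> (\<exists>x. \<psi> = Linv x)"
  using H10_imp_Linv Linv_in_H10 by metis

section \<open>Integration by parts against piecewise H1 functions\<close>

lemma sq_integrable_imp_integrable:
  fixes f :: "real \<Rightarrow> 'b::{banach, second_countable_topology}"
  assumes "f sq_integrable_on {a<..<b}"
  shows "integrable (lebesgue_on {a<..<b}) f"
proof (rule Bochner_Integration.integrable_bound[where f = "\<lambda>x. 1 + (norm (f x))\<^sup>2"])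
  interpret finite_measure "lebesgue_on {a<..<b}" by (rule finite_measure_lebesgue_on) simp
  show "integrable (lebesgue_on {a<..<b}) (\<lambda>x. 1 + (norm (f x))\<^sup>2)"
    using assms by (auto simp: sq_integrable_on_def)
  show "AE x in lebesgue_on {a<..<b}. norm (f x) \<le> norm (1 + (norm (f x))\<^sup>2)"
  proof (rule AE_I2)
    fix x
    have "2 * norm (f x) \<le> (norm (f x))\<^sup>2 + 1"
      using sum_squares_bound[of "norm (f x)" 1] by simp
    then have "norm (f x) \<le> 1 + (norm (f x))\<^sup>2" using norm_ge_zero[of "f x"] by linarith
    then show "norm (f x) \<le> norm (1 + (norm (f x))\<^sup>2)" by simp
  qed
qed (use assms in \<open>simp add: sq_integrable_on_def\<close>)

lemma integrable_continuous_mult: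
  fixes f g :: "real \<Rightarrow> 'b::{real_normed_field, euclidean_space}"
  assumes "integrable (lebesgue_on {a<..<b}) f" "continuous_on UNIV g"
  shows "integrable (lebesgue_on {a<..<b}) (\<lambda>x. g x * f x)"
proof -
  have "bounded (g ` {a..b})"
    by (intro compact_imp_bounded compact_continuous_image continuous_on_subset[OF assms(2)]) auto
  then obtain K where K: "\<And>x. x \<in> {a..b} \<Longrightarrow> norm (g x) \<le> K" unfolding bounded_iff by blast
  have [measurable]: "f \<in> borel_measurable (lebesgue_on {a<..<b})" "g \<in> borel_measurable (lebesgue_on {a<..<b})"
    using assms(1) by (auto intro!: continuous_imp_measurable_on_sets_lebesgue continuous_on_subset[OF assms(2)])
  show ?thesis
  proof (rule Bochner_Integration.integrable_bound[where f = "\<lambda>x. K * norm (f x)"])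
    show "AE x in lebesgue_on {a<..<b}. norm (g x * f x) \<le> norm (K * norm (f x))"
    proof (rule AE_I2)
      fix x assume "x \<in> space (lebesgue_on {a<..<b})"
      then have "norm (g x) \<le> \<bar>K\<bar>" using K[of x] by auto
      then show "norm (g x * f x) \<le> norm (K * norm (f x))"
        by (simp add: norm_mult abs_mult mult_right_mono)
    qed
  qed (use assms in auto)
qed

lemma integral_dominated_mult:
  fixes f :: "real \<Rightarrow> real" and G :: "nat \<Rightarrow> real \<Rightarrow> real"
  assumes "integrable (lebesgue_on {a<..<b}) f" "\<And>n. continuous_on UNIV (G n)" "continuous_on UNIV g"
    "\<And>x. x \<in> {a<..<b} \<Longrightarrow> (\<lambda>n. G n x) \<longlonglongrightarrow> g x" "\<And>n x. x \<in> {a<..<b} \<Longrightarrow> norm (G n x) \<le> M"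
  shows "(\<lambda>n. integral\<^sup>L (lebesgue_on {a<..<b}) (\<lambda>x. G n x * f x)) \<longlonglongrightarrow>
    integral\<^sup>L (lebesgue_on {a<..<b}) (\<lambda>x. g x * f x)"
proof (rule integral_dominated_convergence[where w = "\<lambda>x. M * norm (f x)"])
  show "AE x in lebesgue_on {a<..<b}. (\<lambda>n. G n x * f x) \<longlonglongrightarrow> g x * f x"
    by (rule AE_I2) (auto intro!: tendsto_intros assms(4))
  show "AE x in lebesgue_on {a<..<b}. norm (G n x * f x) \<le> M * norm (f x)" for n
    by (rule AE_I2) (use assms(5) in \<open>auto simp: abs_mult intro!: mult_right_mono\<close>)
qed (use integrable_continuous_mult[OF assms(1,2)] integrable_continuous_mult[OF assms(1,3)] assms(1) in auto)

text \<open>The defect \<open>L\<close> of integration by parts is linear and vanishes on functions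
  that are 0 at both ends, by approximation with test functions. So it depends only on the two
  boundary values, and its values on the affine functions \<open>p\<close> and \<open>q\<close>
  serve as the boundary traces of \<open>f\<close>. No continuous representative is
  constructed.\<close>

lemma H1_by_parts:
  fixes f :: "real \<Rightarrow> real"
  assumes "f \<in> H1 a b" "a < b"
  shows "\<exists>g ca cb. g sq_integrable_on {a<..<b} \<and> (\<forall>\<theta> D. C1_deriv \<theta> D \<longrightarrow>
    integral\<^sup>L (lebesgue_on {a<..<b}) (\<lambda>x. D x * f x) =
      cb * \<theta> b - ca * \<theta> a - integral\<^sup>L (lebesgue_on {a<..<b}) (\<lambda>x. \<theta> x * g x))"
proof -
  obtain g where f2: "f sq_integrable_on {a<..<b}" and g2: "g sq_integrable_on {a<..<b}"
    and wd: "has_weak_deriv a b f g"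
    using assms(1) by (auto simp: H1_def)
  note fi = sq_integrable_imp_integrable[OF f2] and gi = sq_integrable_imp_integrable[OF g2]
  let ?I = "lebesgue_on {a<..<b}"
  define L where "L \<theta> D = integral\<^sup>L ?I (\<lambda>x. D x * f x) + integral\<^sup>L ?I (\<lambda>x. \<theta> x * g x)" for \<theta> D
  have i: "integrable ?I (\<lambda>x. D x * f x)" "integrable ?I (\<lambda>x. \<theta> x * g x)" if "C1_deriv \<theta> D" for \<theta> D
    using integrable_continuous_mult[OF fi] integrable_continuous_mult[OF gi] that
      C1_deriv_continuous[OF that] by (auto simp: C1_deriv_def)
  have L0: "L \<theta> D = 0" if \<theta>: "C1_deriv \<theta> D" "\<theta> a = 0" "\<theta> b = 0" for \<theta> D
  proof -
    obtain \<Theta> \<Theta>' M where \<Theta>: "\<And>n::nat. test_fun a b (\<Theta> n)" "\<And>n. C1_deriv (\<Theta> n) (\<Theta>' n)"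
      "\<And>x. x \<in> {a<..<b} \<Longrightarrow> (\<lambda>n. \<Theta> n x) \<longlonglongrightarrow> \<theta> x" "\<And>x. x \<in> {a<..<b} \<Longrightarrow> (\<lambda>n. \<Theta>' n x) \<longlonglongrightarrow> D x"
      "\<And>n x. x \<in> {a<..<b} \<Longrightarrow> norm (\<Theta> n x) \<le> M" "\<And>n x. x \<in> {a<..<b} \<Longrightarrow> norm (\<Theta>' n x) \<le> M"
      "\<And>x. x \<in> {a<..<b} \<Longrightarrow> norm (\<theta> x) \<le> M" "\<And>x. x \<in> {a<..<b} \<Longrightarrow> norm (D x) \<le> M"
      by (rule test_fun_approx[OF \<theta>(1) assms(2) \<theta>(2,3)]) (rule that)
    have c: "continuous_on UNIV (\<Theta>' n)" "continuous_on UNIV (\<Theta> n)" "continuous_on UNIV \<theta>" "continuous_on UNIV D" for n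
      using \<Theta>(2)[of n] \<theta>(1) C1_deriv_continuous[OF \<Theta>(2)] C1_deriv_continuous[OF \<theta>(1)]
      by (auto simp: C1_deriv_def)
    have "(\<lambda>n. L (\<Theta> n) (\<Theta>' n)) \<longlonglongrightarrow> L \<theta> D"
      unfolding L_def
      by (intro tendsto_add integral_dominated_mult[OF fi c(1,4) \<Theta>(4,6)] integral_dominated_mult[OF gi c(2,3) \<Theta>(3,5)])
    moreover have "L (\<Theta> n) (\<Theta>' n) = 0" for n
      using wd[unfolded has_weak_deriv_def, rule_format, OF \<Theta>(1)[of n]]
      by (simp add: L_def C1_deriv_vector_derivative[OF \<Theta>(2)])
    ultimately show ?thesis by (simp add: LIMSEQ_const_iff)
  qed
  \<comment> \<open>The affine functions with boundary values 1, 0 and 0, 1; subtracting their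
    combination from \<theta> leaves a function vanishing at both ends.\<close>
  define p where "p x = (b - x) / (b - a)" for x
  define q where "q x = (x - a) / (b - a)" for x
  have p: "C1_deriv p (\<lambda>x. - 1 / (b - a))" and q: "C1_deriv q (\<lambda>x. 1 / (b - a))"
    unfolding C1_deriv_def p_def q_def
    by (auto intro!: derivative_eq_intros continuous_intros simp: divide_inverse
        simp flip: has_real_derivative_iff_has_vector_derivative)
  have "integral\<^sup>L ?I (\<lambda>x. D x * f x) = L q (\<lambda>x. 1 / (b - a)) * \<theta> b - (- L p (\<lambda>x. - 1 / (b - a))) * \<theta> a - integral\<^sup>L ?I (\<lambda>x. \<theta> x * g x)"
    if \<theta>: "C1_deriv \<theta> D" for \<theta> D
  proof -
    note ip = i[OF p] and iq = i[OF q] and i\<theta> = i[OF \<theta>]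
    have lin: "integral\<^sup>L ?I (\<lambda>x. F x - (r * G x + s * H x)) =
        integral\<^sup>L ?I F - (r * integral\<^sup>L ?I G + s * integral\<^sup>L ?I H)"
      if "integrable ?I F" "integrable ?I G" "integrable ?I H" for F G H and r s :: real
      using that by simp
    define \<theta>0 where "\<theta>0 x = \<theta> x - (\<theta> a * p x + \<theta> b * q x)" for x
    define D0 where "D0 x = D x - (\<theta> a * (- 1 / (b - a)) + \<theta> b * (1 / (b - a)))" for x
    have "C1_deriv \<theta>0 D0"
      unfolding \<theta>0_def[abs_def] D0_def[abs_def] by (intro C1_deriv_diff C1_deriv_add C1_deriv_cmult \<theta> p q)
    moreover have "\<theta>0 a = 0" "\<theta>0 b = 0" using assms(2) by (auto simp: \<theta>0_def p_def q_def)
    ultimately have "L \<theta>0 D0 = 0" by (rule L0)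
    moreover have "integral\<^sup>L ?I (\<lambda>x. D0 x * f x) = integral\<^sup>L ?I (\<lambda>x. D x * f x)
        - (\<theta> a * integral\<^sup>L ?I (\<lambda>x. - 1 / (b - a) * f x) + \<theta> b * integral\<^sup>L ?I (\<lambda>x. 1 / (b - a) * f x))"
    proof -
      have "(\<lambda>x. D0 x * f x) = (\<lambda>x. D x * f x - (\<theta> a * (- 1 / (b - a) * f x) + \<theta> b * (1 / (b - a) * f x)))"
        by (simp add: D0_def algebra_simps)
      then show ?thesis
        by (simp only: lin[OF i\<theta>(1) ip(1) iq(1)])
    qed
    moreover have "integral\<^sup>L ?I (\<lambda>x. \<theta>0 x * g x) = integral\<^sup>L ?I (\<lambda>x. \<theta> x * g x)
        - (\<theta> a * integral\<^sup>L ?I (\<lambda>x. p x * g x) + \<theta> b * integral\<^sup>L ?I (\<lambda>x. q x * g x))"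
    proof -
      have "(\<lambda>x. \<theta>0 x * g x) = (\<lambda>x. \<theta> x * g x - (\<theta> a * (p x * g x) + \<theta> b * (q x * g x)))"
        by (simp add: \<theta>0_def algebra_simps)
      then show ?thesis
        by (simp only: lin[OF i\<theta>(2) ip(2) iq(2)])
    qed
    ultimately show ?thesis unfolding L_def by (simp add: algebra_simps)
  qed
  then show ?thesis using g2 by blast
qed

lemma integral_split_Ioo:
  fixes f :: "real \<Rightarrow> 'b::euclidean_space"
  assumes "integrable (lebesgue_on {a<..<b}) f" "a \<le> c" "c \<le> b"
  shows "integral\<^sup>L (lebesgue_on {a<..<b}) f =
    integral\<^sup>L (lebesgue_on {a<..<c}) f + integral\<^sup>L (lebesgue_on {c<..<b}) f"
  using assms unfolding lebesgue_on_Ioo_Icc by (rule integral_combine)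

lemma sq_integrable_combine:
  fixes f :: "real \<Rightarrow> 'b::euclidean_space"
  assumes "f sq_integrable_on {a<..<c}" "f sq_integrable_on {c<..<b}" "a \<le> c" "c \<le> b"
  shows "f sq_integrable_on {a<..<b}"
proof -
  note i = sq_integrable_imp_integrable[OF assms(1)] sq_integrable_imp_integrable[OF assms(2)]
  have "integrable (lebesgue_on {a<..<b}) f"
    unfolding lebesgue_on_Ioo_Icc
    by (rule integrable_combine[OF i[unfolded lebesgue_on_Ioo_Icc] assms(3,4)])
  moreover have "integrable (lebesgue_on {a..c}) (\<lambda>x. (norm (f x))\<^sup>2)" "integrable (lebesgue_on {c..b}) (\<lambda>x. (norm (f x))\<^sup>2)"
    using assms(1,2) by (auto simp: sq_integrable_on_def lebesgue_on_Ioo_Icc)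
  then have "integrable (lebesgue_on {a<..<b}) (\<lambda>x. (norm (f x))\<^sup>2)"
    unfolding lebesgue_on_Ioo_Icc by (rule integrable_combine[OF _ _ assms(3,4)])
  ultimately show ?thesis by (auto simp: sq_integrable_on_def)
qed

lemma sq_integrable_cong:
  assumes "f sq_integrable_on S" "\<And>x. x \<in> S \<Longrightarrow> f x = g x"
  shows "g sq_integrable_on S"
proof -
  have "f \<in> borel_measurable (lebesgue_on S) \<longleftrightarrow> g \<in> borel_measurable (lebesgue_on S)"
    by (rule measurable_cong) (use assms in simp)
  moreover have "integrable (lebesgue_on S) (\<lambda>x. (norm (f x))\<^sup>2) \<longleftrightarrow> integrable (lebesgue_on S) (\<lambda>x. (norm (g x))\<^sup>2)"
    by (rule Bochner_Integration.integrable_cong) (use assms in auto)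
  ultimately show ?thesis using assms(1) by (simp add: sq_integrable_on_def)
qed

lemma sq_integrable_subset:
  fixes f :: "real \<Rightarrow> 'b::euclidean_space"
  assumes "f sq_integrable_on S" "T \<subseteq> S" "S \<in> sets lebesgue" "T \<in> sets lebesgue"
  shows "f sq_integrable_on T"
proof -
  have "set_integrable lebesgue S (\<lambda>x. (norm (f x))\<^sup>2)"
    using assms by (simp add: set_integrable_def integrable_restrict_space sq_integrable_on_def)
  from set_integrable_subset[OF this assms(4,2)]
  have "integrable (lebesgue_on T) (\<lambda>x. (norm (f x))\<^sup>2)"
    using assms by (simp add: set_integrable_def integrable_restrict_space)
  moreover have "f \<in> borel_measurable (lebesgue_on T)"
    using assms(1) measurable_restrict_mono[OF _ assms(2)] by (auto simp: sq_integrable_on_def)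
  ultimately show ?thesis by (simp add: sq_integrable_on_def)
qed

text \<open>The gaps are glued from left to right, by induction on the number of points of
  \<open>A\<close> to the left of \<open>b\<close>. At each point the traces from both sides combine
  into one coefficient of \<open>c\<close>, the jump there, and the weak derivatives of the pieces
  form \<open>g\<close>.\<close>

lemma H1_piecewise_by_parts_real:
  assumes "finite A" "A \<subseteq> {0<..<1}" "\<mu> \<in> H1_piecewise A" "b \<in> A \<union> {1}"
  shows "\<exists>g c. g sq_integrable_on {0<..<b} \<and> (\<forall>\<theta> D. C1_deriv \<theta> D \<longrightarrow>
    integral\<^sup>L (lebesgue_on {0<..<b}) (\<lambda>x. D x * \<mu> x) =
      (\<Sum>a\<in>A \<union> {0, 1}. c a * \<theta> a) - integral\<^sup>L (lebesgue_on {0<..<b}) (\<lambda>x. \<theta> x * g x))"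
  using assms(4)
proof (induction "card (A \<inter> {..<b})" arbitrary: b rule: less_induct)
  case less
  define S where "S = A \<union> {0, 1}"
  have fS: "finite S" using assms(1) by (simp add: S_def)
  have b: "0 < b" "b \<le> 1" "b \<in> S" using less.prems assms(2) by (auto simp: S_def)
  have \<mu>2: "\<mu> sq_integrable_on {0<..<1}" using assms(3) by (simp add: H1_piecewise_def)
  have \<mu>b: "\<mu> sq_integrable_on {0<..<b}"
    by (rule sq_integrable_subset[OF \<mu>2]) (use b in auto)
  \<comment> \<open>The predecessor of \<open>b\<close> in \<open>A\<close> together with 0, so that
    the open interval from \<open>a\<close> to \<open>b\<close> is one of the gaps.\<close>
  define a where "a = Max (insert 0 (A \<inter> {..<b}))"
  have fin: "finite (insert 0 (A \<inter> {..<b}))" using assms(1) by simp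
  have a_in: "a \<in> insert 0 (A \<inter> {..<b})" unfolding a_def by (rule Max_in[OF fin]) simp
  have a_max: "x \<le> a" if "x \<in> A" "x < b" for x
    unfolding a_def by (rule Max_ge[OF fin]) (use that in simp)
  have a: "0 \<le> a" "a < b" "a \<in> S" using a_in b assms(2) by (auto simp: S_def)
  have "{a<..<b} \<inter> A = {}" using a_max by fastforce
  then have "\<mu> \<in> H1 a b" using assms(3) a b unfolding H1_piecewise_def S_def by blast
  from H1_by_parts[OF this a(2)] obtain g2 ca cb where g2: "g2 sq_integrable_on {a<..<b}"
    and bp2: "\<And>\<theta> D. C1_deriv \<theta> D \<Longrightarrow> integral\<^sup>L (lebesgue_on {a<..<b}) (\<lambda>x. D x * \<mu> x) =
      cb * \<theta> b - ca * \<theta> a - integral\<^sup>L (lebesgue_on {a<..<b}) (\<lambda>x. \<theta> x * g2 x)"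
    by blast
  have "\<exists>g c. g sq_integrable_on {0<..<a} \<and> (\<forall>\<theta> D. C1_deriv \<theta> D \<longrightarrow>
    integral\<^sup>L (lebesgue_on {0<..<a}) (\<lambda>x. D x * \<mu> x) =
      (\<Sum>a\<in>S. c a * \<theta> a) - integral\<^sup>L (lebesgue_on {0<..<a}) (\<lambda>x. \<theta> x * g x))"
  proof (cases "a = 0")
    case True
    show ?thesis
      by (rule exI[of _ "\<lambda>x. 0"], rule exI[of _ "\<lambda>x. 0"]) (auto simp: True sq_integrable_on_zero)
  next
    case False
    then have aA: "a \<in> A" "a < b" using a_in by auto
    have "A \<inter> {..<a} \<subset> A \<inter> {..<b}" using aA by auto
    then have "card (A \<inter> {..<a}) < card (A \<inter> {..<b})" using assms(1) by (intro psubset_card_mono) auto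
    then show ?thesis unfolding S_def using less.hyps aA by blast
  qed
  then obtain g1 c1 where g1: "g1 sq_integrable_on {0<..<a}"
    and bp1: "\<And>\<theta> D. C1_deriv \<theta> D \<Longrightarrow> integral\<^sup>L (lebesgue_on {0<..<a}) (\<lambda>x. D x * \<mu> x) =
      (\<Sum>a\<in>S. c1 a * \<theta> a) - integral\<^sup>L (lebesgue_on {0<..<a}) (\<lambda>x. \<theta> x * g1 x)"
    by blast
  define g where "g x = (if x < a then g1 x else g2 x)" for x
  have ga: "g sq_integrable_on {0<..<a}" "g sq_integrable_on {a<..<b}"
    by (rule sq_integrable_cong[OF g1], simp add: g_def, rule sq_integrable_cong[OF g2], simp add: g_def)
  have g: "g sq_integrable_on {0<..<b}"
    by (rule sq_integrable_combine[OF ga]) (use a in auto)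
  \<comment> \<open>The last gap contributes its right trace at \<open>b\<close> and minus its left
    trace at \<open>a\<close>.\<close>
  define c where "c x = c1 x + (if x = b then cb else 0) - (if x = a then ca else 0)" for x
  have "integral\<^sup>L (lebesgue_on {0<..<b}) (\<lambda>x. D x * \<mu> x) =
      (\<Sum>a\<in>S. c a * \<theta> a) - integral\<^sup>L (lebesgue_on {0<..<b}) (\<lambda>x. \<theta> x * g x)" if \<theta>: "C1_deriv \<theta> D" for \<theta> D
  proof -
    have cont: "continuous_on UNIV D" "continuous_on UNIV \<theta>"
      using \<theta> C1_deriv_continuous[OF \<theta>] by (auto simp: C1_deriv_def)
    have "integral\<^sup>L (lebesgue_on {0<..<b}) (\<lambda>x. D x * \<mu> x) =
        integral\<^sup>L (lebesgue_on {0<..<a}) (\<lambda>x. D x * \<mu> x) + integral\<^sup>L (lebesgue_on {a<..<b}) (\<lambda>x. D x * \<mu> x)"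
      by (rule integral_split_Ioo)
        (use a integrable_continuous_mult[OF sq_integrable_imp_integrable[OF \<mu>b] cont(1)] in auto)
    moreover have "integral\<^sup>L (lebesgue_on {0<..<b}) (\<lambda>x. \<theta> x * g x) =
        integral\<^sup>L (lebesgue_on {0<..<a}) (\<lambda>x. \<theta> x * g x) + integral\<^sup>L (lebesgue_on {a<..<b}) (\<lambda>x. \<theta> x * g x)"
      by (rule integral_split_Ioo)
        (use a integrable_continuous_mult[OF sq_integrable_imp_integrable[OF g] cont(2)] in auto)
    moreover have "integral\<^sup>L (lebesgue_on {0<..<a}) (\<lambda>x. \<theta> x * g x) = integral\<^sup>L (lebesgue_on {0<..<a}) (\<lambda>x. \<theta> x * g1 x)"
      "integral\<^sup>L (lebesgue_on {a<..<b}) (\<lambda>x. \<theta> x * g x) = integral\<^sup>L (lebesgue_on {a<..<b}) (\<lambda>x. \<theta> x * g2 x)"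
      by (auto intro!: Bochner_Integration.integral_cong simp: g_def)
    moreover have "(\<Sum>x\<in>S. c x * \<theta> x) = (\<Sum>a\<in>S. c1 a * \<theta> a) + cb * \<theta> b - ca * \<theta> a"
    proof -
      have "(\<Sum>x\<in>S. c x * \<theta> x) = (\<Sum>x\<in>S. c1 x * \<theta> x + (if x = b then cb * \<theta> b else 0) - (if x = a then ca * \<theta> a else 0))"
        by (rule sum.cong) (auto simp: c_def algebra_simps)
      then show ?thesis using a(3) b(3) fS by (simp add: sum.distrib sum_subtractf)
    qed
    ultimately show ?thesis using bp1[OF \<theta>] bp2[OF \<theta>] by simp
  qed
  then show ?case using g unfolding S_def by blast
qed

lemma integral_Re_Im:
  assumes "integrable M f"
  shows "integral\<^sup>L M f = complex_of_real (integral\<^sup>L M (\<lambda>x. Re (f x))) + \<i> * complex_of_real (integral\<^sup>L M (\<lambda>x. Im (f x)))"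
  using assms by (simp add: complex_eq_iff)

lemma H1_piecewise_by_parts:
  assumes "finite A" "A \<subseteq> {0<..<1}" "\<mu> \<in> H1_piecewise A"
  obtains g c where "g sq_integrable_on {0<..<1}" "\<And>\<theta> D :: real \<Rightarrow> complex. C1_deriv \<theta> D \<Longrightarrow>
    integral\<^sup>L leb01 (\<lambda>x. D x * complex_of_real (\<mu> x)) =
      (\<Sum>a\<in>A \<union> {0, 1}. complex_of_real (c a) * \<theta> a) - integral\<^sup>L leb01 (\<lambda>x. \<theta> x * complex_of_real (g x))"
proof -
  obtain g c where g: "g sq_integrable_on {0<..<1}" and bp: "\<And>\<theta> D. C1_deriv \<theta> D \<Longrightarrow>
    integral\<^sup>L leb01 (\<lambda>x. D x * \<mu> x) =
      (\<Sum>a\<in>A \<union> {0, 1}. c a * \<theta> a) - integral\<^sup>L leb01 (\<lambda>x. \<theta> x * g x)"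
    using H1_piecewise_by_parts_real[OF assms, of 1] by blast
  show thesis
  proof (rule that[OF g])
    fix \<theta> D :: "real \<Rightarrow> complex" assume \<theta>: "C1_deriv \<theta> D"
    have \<mu>2: "\<mu> sq_integrable_on {0<..<1}" using assms(3) by (simp add: H1_piecewise_def)
    have cont: "continuous_on UNIV D" "continuous_on UNIV \<theta>"
      using \<theta> C1_deriv_continuous[OF \<theta>] by (auto simp: C1_deriv_def)
    have i: "integrable leb01 (\<lambda>x. D x * complex_of_real (\<mu> x))" "integrable leb01 (\<lambda>x. \<theta> x * complex_of_real (g x))"
      by (intro integrable_continuous_mult cont integrable_of_real sq_integrable_imp_integrable \<mu>2 g)+
    have "C1_deriv (\<lambda>x. Re (\<theta> x)) (\<lambda>x. Re (D x))" "C1_deriv (\<lambda>x. Im (\<theta> x)) (\<lambda>x. Im (D x))"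
      using \<theta> unfolding C1_deriv_def
      by (auto intro!: continuous_intros bounded_linear.has_vector_derivative[OF bounded_linear_Re]
          bounded_linear.has_vector_derivative[OF bounded_linear_Im])
    from this[THEN bp]
    show "integral\<^sup>L leb01 (\<lambda>x. D x * complex_of_real (\<mu> x)) =
      (\<Sum>a\<in>A \<union> {0, 1}. complex_of_real (c a) * \<theta> a) - integral\<^sup>L leb01 (\<lambda>x. \<theta> x * complex_of_real (g x))"
      unfolding integral_Re_Im[OF i(1)] integral_Re_Im[OF i(2)]
      by (simp add: complex_eq_iff)
  qed
qed

subsection \<open>Piecewise H1 functions are bounded\<close>

lemma sq_integrable_of_real:
  "f sq_integrable_on S \<Longrightarrow> (\<lambda>x. complex_of_real (f x)) sq_integrable_on S"
  by (auto simp: sq_integrable_on_def)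

text \<open>A pairing bounded by the L1 norm on continuous functions is so on all square integrable
  ones by density. Testing with the sign of \<mu> on the set where its modulus exceeds
  \<open>B\<close> shows that this set is null.\<close>

lemma ess_bounded_by_duality:
  fixes \<mu> :: "real \<Rightarrow> real"
  assumes "\<mu> sq_integrable_on {0<..<1}" "0 \<le> B"
    and "\<And>\<eta> :: real \<Rightarrow> complex. continuous_on UNIV \<eta> \<Longrightarrow>
      cmod (integral\<^sup>L leb01 (\<lambda>x. \<eta> x * complex_of_real (\<mu> x))) \<le> B * integral\<^sup>L leb01 (\<lambda>x. cmod (\<eta> x))"
  shows "ess_bounded B \<mu>"
proof -
  define m where "m = to_L2 (\<lambda>x. complex_of_real (\<mu> x))"
  note m2 = sq_integrable_of_real[OF assms(1)]
  have [measurable]: "\<mu> \<in> borel_measurable leb01" using assms(1) by (simp add: sq_integrable_on_def)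
  have cont: "cmod (cinner_L2 (to_L2 \<eta>) m) \<le> B * integral\<^sup>L leb01 (\<lambda>x. cmod (\<eta> x))"
    if "continuous_on UNIV \<eta>" for \<eta>
    using assms(3)[OF that] unfolding m_def cinner_to_L2[OF continuous_sq_integrable01[OF that] m2] by simp
  have gen: "cmod (cinner_L2 (to_L2 f) m) \<le> B * integral\<^sup>L leb01 (\<lambda>x. cmod (f x))"
    if f: "f sq_integrable_on {0<..<1}" for f
  proof (rule field_le_epsilon)
    fix e :: real assume e: "e > 0"
    define \<epsilon> where "\<epsilon> = e / (norm m + B + 1)"
    have pos: "norm m + B + 1 > 0" using assms(2) by (simp add: add_nonneg_pos)
    have e0: "\<epsilon> > 0" unfolding \<epsilon>_def by (intro divide_pos_pos e pos)
    obtain h where h: "continuous_on UNIV h" "norm (to_L2 f - to_L2 h) < \<epsilon>" "h sq_integrable_on {0<..<1}"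
      using L2_dense_continuous[OF e0, of "to_L2 f"] by blast
    note d = to_L2_diff[OF f h(3)]
    have "norm (to_L2 (\<lambda>x. f x - h x)) < \<epsilon>" using h(2) d(1) by simp
    note i1 = integrable_norm_leb01(2)[OF d(2) e0 this]
    have "integral\<^sup>L leb01 (\<lambda>x. cmod (h x)) \<le> integral\<^sup>L leb01 (\<lambda>x. cmod (f x) + cmod (f x - h x))"
    proof (rule integral_mono)
      show "cmod (h x) \<le> cmod (f x) + cmod (f x - h x)" for x
        using norm_triangle_ineq[of "f x" "h x - f x"] by (simp add: norm_minus_commute)
    qed (use integrable_norm_leb01(1)[OF f] integrable_norm_leb01(1)[OF h(3)] integrable_norm_leb01(1)[OF d(2)] in auto)
    also have "\<dots> = integral\<^sup>L leb01 (\<lambda>x. cmod (f x)) + integral\<^sup>L leb01 (\<lambda>x. cmod (f x - h x))"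
      using integrable_norm_leb01(1)[OF f] integrable_norm_leb01(1)[OF d(2)] by simp
    finally have h1: "integral\<^sup>L leb01 (\<lambda>x. cmod (h x)) \<le> integral\<^sup>L leb01 (\<lambda>x. cmod (f x)) + \<epsilon>"
      using i1 by simp
    have "cmod (cinner_L2 (to_L2 f) m) \<le> cmod (cinner_L2 (to_L2 f - to_L2 h) m) + cmod (cinner_L2 (to_L2 h) m)"
      using norm_triangle_ineq[of "cinner_L2 (to_L2 f - to_L2 h) m" "cinner_L2 (to_L2 h) m"]
      by (simp add: cinner_L2_diff_left)
    also have "\<dots> \<le> \<epsilon> * norm m + B * (integral\<^sup>L leb01 (\<lambda>x. cmod (f x)) + \<epsilon>)"
    proof (rule add_mono)
      show "cmod (cinner_L2 (to_L2 f - to_L2 h) m) \<le> \<epsilon> * norm m"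
        by (rule order_trans[OF cinner_L2_Cauchy_Schwarz]) (use h(2) in \<open>auto intro: mult_right_mono\<close>)
      show "cmod (cinner_L2 (to_L2 h) m) \<le> B * (integral\<^sup>L leb01 (\<lambda>x. cmod (f x)) + \<epsilon>)"
        by (rule order_trans[OF cont[OF h(1)]]) (intro mult_left_mono h1 assms(2))
    qed
    also have "\<dots> \<le> B * integral\<^sup>L leb01 (\<lambda>x. cmod (f x)) + \<epsilon> * (norm m + B + 1)"
      using e0 by (simp add: algebra_simps)
    also have "\<epsilon> * (norm m + B + 1) = e" using pos by (simp add: \<epsilon>_def)
    finally show "cmod (cinner_L2 (to_L2 f) m) \<le> B * integral\<^sup>L leb01 (\<lambda>x. cmod (f x)) + e" .
  qed
  \<comment> \<open>With this choice the integrand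
    \<open>s x * \<mu> x - B * \<bar>s x\<bar>\<close> is nonnegative and strictly positive exactly
    where the bound fails.\<close>
  define s :: "real \<Rightarrow> real" where "s x = (if \<mu> x > B then 1 else if \<mu> x < - B then -1 else 0)" for x
  have [measurable]: "s \<in> borel_measurable leb01" unfolding s_def by measurable
  have s2: "(\<lambda>x. complex_of_real (s x)) sq_integrable_on {0<..<1}"
    by (rule bounded_sq_integrable_leb01(1)[where B = 1]) (auto simp: s_def)
  have si: "integrable leb01 (\<lambda>x. \<bar>s x\<bar>)" "integrable leb01 (\<lambda>x. s x * \<mu> x)"
    using integrable_norm[OF integrable_norm_leb01(1)[OF s2]] sq_integrable_on_mult_cnj[OF s2 m2]
    by (auto simp flip: of_real_mult simp: complex_of_real_integrable_eq)
  have "cinner_L2 (to_L2 (\<lambda>x. complex_of_real (s x))) m = complex_of_real (integral\<^sup>L leb01 (\<lambda>x. s x * \<mu> x))"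
    unfolding m_def cinner_to_L2[OF s2 m2] by (simp flip: of_real_mult integral_complex_of_real)
  then have "integral\<^sup>L leb01 (\<lambda>x. s x * \<mu> x) \<le> B * integral\<^sup>L leb01 (\<lambda>x. \<bar>s x\<bar>)"
    using gen[OF s2] by simp
  then have le: "integral\<^sup>L leb01 (\<lambda>x. s x * \<mu> x - B * \<bar>s x\<bar>) \<le> 0"
    using si by simp
  have nn: "0 \<le> s x * \<mu> x - B * \<bar>s x\<bar>" for x by (auto simp: s_def)
  then have "integral\<^sup>L leb01 (\<lambda>x. s x * \<mu> x - B * \<bar>s x\<bar>) = 0"
    using le by (intro antisym le integral_nonneg_AE) auto
  then have "AE x in leb01. s x * \<mu> x - B * \<bar>s x\<bar> = 0"
    using nn si by (subst (asm) integral_nonneg_eq_0_iff_AE) auto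
  then have "AE x in leb01. \<bar>\<mu> x\<bar> \<le> B"
    by eventually_elim (use assms(2) in \<open>auto simp: s_def split: if_splits\<close>)
  then show ?thesis using assms(2) by (simp add: ess_bounded_def)
qed

text \<open>The one-dimensional Sobolev embedding, by duality: the antiderivative of \<eta> starting
  at 0 is bounded by the L1 norm of \<eta>, and integration by parts expresses the integral of
  \<open>\<eta> * \<mu>\<close> through this antiderivative.\<close>

lemma H1_piecewise_ess_bounded:
  assumes "finite A" "A \<subseteq> {0<..<1}" "\<mu> \<in> H1_piecewise A"
  shows "\<exists>B. ess_bounded B \<mu>"
proof -
  obtain g c where g: "g sq_integrable_on {0<..<1}" and bp: "\<And>\<theta> D :: real \<Rightarrow> complex. C1_deriv \<theta> D \<Longrightarrow>
    integral\<^sup>L leb01 (\<lambda>x. D x * complex_of_real (\<mu> x)) =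
      (\<Sum>a\<in>A \<union> {0, 1}. complex_of_real (c a) * \<theta> a) - integral\<^sup>L leb01 (\<lambda>x. \<theta> x * complex_of_real (g x))"
    by (rule H1_piecewise_by_parts[OF assms]) (rule that)
  define B where "B = (\<Sum>a\<in>A \<union> {0, 1}. \<bar>c a\<bar>) + integral\<^sup>L leb01 (\<lambda>x. \<bar>g x\<bar>)"
  note gi = sq_integrable_imp_integrable[OF g]
  have "0 \<le> B" unfolding B_def by (intro add_nonneg_nonneg sum_nonneg integral_nonneg_AE) auto
  moreover have "cmod (integral\<^sup>L leb01 (\<lambda>x. \<eta> x * complex_of_real (\<mu> x))) \<le> B * integral\<^sup>L leb01 (\<lambda>x. cmod (\<eta> x))"
    if \<eta>: "continuous_on UNIV \<eta>" for \<eta> :: "real \<Rightarrow> complex"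
  proof -
    define N where "N = integral\<^sup>L leb01 (\<lambda>x. cmod (\<eta> x))"
    have "\<exists>F. \<forall>x::real. -\<infinity> < ereal x \<longrightarrow> ereal x < \<infinity> \<longrightarrow> (F has_vector_derivative \<eta> x) (at x)"
      by (rule einterval_antiderivative) (use \<eta> in \<open>auto simp: continuous_on_eq_continuous_at\<close>)
    then obtain F where F: "\<And>x. (F has_vector_derivative \<eta> x) (at x)" by auto
    define \<theta> where "\<theta> x = F x - F 0" for x
    have \<theta>: "C1_deriv \<theta> \<eta>"
      unfolding C1_deriv_def \<theta>_def[abs_def] using F \<eta> by (auto intro!: derivative_eq_intros)
    have ni: "integrable leb01 (\<lambda>x. cmod (\<eta> x))"
      using integrable_C1_deriv(2)[OF \<theta>] by simp
    have \<theta>N: "cmod (\<theta> x) \<le> N" if x: "x \<in> {0..1}" for x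
    proof -
      have "\<theta> x = integral\<^sup>L (lebesgue_on {0<..<x}) \<eta>"
        using integral_C1_deriv[OF \<theta>, of 0 x] x by (simp add: \<theta>_def)
      then have "cmod (\<theta> x) \<le> integral\<^sup>L (lebesgue_on {0<..<x}) (\<lambda>x. cmod (\<eta> x))" by simp
      also have "\<dots> \<le> N"
        unfolding N_def using integral_split_Ioo[OF ni, of x] x
        by (simp add: integral_nonneg_AE)
      finally show ?thesis .
    qed
    have "cmod (integral\<^sup>L leb01 (\<lambda>x. \<eta> x * complex_of_real (\<mu> x))) \<le>
        cmod (\<Sum>a\<in>A \<union> {0, 1}. complex_of_real (c a) * \<theta> a) + cmod (integral\<^sup>L leb01 (\<lambda>x. \<theta> x * complex_of_real (g x)))"
      unfolding bp[OF \<theta>] by (rule norm_triangle_ineq4)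
    also have "\<dots> \<le> (\<Sum>a\<in>A \<union> {0, 1}. \<bar>c a\<bar> * N) + integral\<^sup>L leb01 (\<lambda>x. N * \<bar>g x\<bar>)"
    proof (rule add_mono)
      show "cmod (\<Sum>a\<in>A \<union> {0, 1}. complex_of_real (c a) * \<theta> a) \<le> (\<Sum>a\<in>A \<union> {0, 1}. \<bar>c a\<bar> * N)"
        by (rule sum_norm_le) (use assms(2) \<theta>N in \<open>auto simp: norm_mult intro!: mult_left_mono\<close>)
      have "cmod (integral\<^sup>L leb01 (\<lambda>x. \<theta> x * complex_of_real (g x))) \<le> integral\<^sup>L leb01 (\<lambda>x. cmod (\<theta> x * complex_of_real (g x)))"
        by simp
      also have "\<dots> \<le> integral\<^sup>L leb01 (\<lambda>x. N * \<bar>g x\<bar>)"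
      proof (rule integral_mono)
        show "integrable leb01 (\<lambda>x. cmod (\<theta> x * complex_of_real (g x)))"
          by (intro integrable_norm integrable_continuous_mult integrable_of_real gi C1_deriv_continuous[OF \<theta>])
        show "cmod (\<theta> x * complex_of_real (g x)) \<le> N * \<bar>g x\<bar>" if "x \<in> space leb01" for x
          using \<theta>N[of x] that by (auto simp: norm_mult intro!: mult_right_mono)
      qed (use gi in auto)
      finally show "cmod (integral\<^sup>L leb01 (\<lambda>x. \<theta> x * complex_of_real (g x))) \<le> integral\<^sup>L leb01 (\<lambda>x. N * \<bar>g x\<bar>)" .
    qed
    also have "\<dots> = B * N"
      by (simp add: B_def algebra_simps sum_distrib_left)
    finally show ?thesis by (simp add: N_def)
  qed
  ultimately show ?thesis
    using ess_bounded_by_duality[of \<mu> B] assms(3) by (auto simp: H1_piecewise_def)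
qed

section \<open>The Fourier coefficients of a product with a piecewise H1 function\<close>

text \<open>Comparison with the telescoping sum of \<open>1 / n - 1 / (n + 1)\<close>; an explicit
  constant is all that the later estimates need.\<close>

lemma sum_inverse_squares_le:
  assumes "finite F" "F \<subseteq> {1::nat..}"
  shows "(\<Sum>k\<in>F. 1 / (real k)\<^sup>2) \<le> 2"
proof -
  have step: "(\<Sum>k\<in>{1..n}. 1 / (real k)\<^sup>2) \<le> 2 - 1 / real n" if "n \<ge> 1" for n
    using that
  proof (induction n rule: dec_induct)
    case (step n)
    have "1 / (real (Suc n))\<^sup>2 \<le> 1 / (real n * real (Suc n))"
      using step.hyps by (intro divide_left_mono) (auto simp: power2_eq_square)
    also have "\<dots> = 1 / real n - 1 / real (Suc n)"
      using step.hyps by (simp add: field_simps)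
    finally show ?case using step by simp
  qed simp
  have "(\<Sum>k\<in>F. 1 / (real k)\<^sup>2) \<le> (\<Sum>k\<in>{1..Suc (Max (insert 0 F))}. 1 / (real k)\<^sup>2)"
  proof (rule sum_mono2)
    show "F \<subseteq> {1..Suc (Max (insert 0 F))}"
      using assms Max_ge[of "insert 0 F"] by (fastforce intro: le_SucI)
  qed auto
  also have "\<dots> \<le> 2 - 1 / real (Suc (Max (insert 0 F)))" by (rule step) simp
  also have "\<dots> \<le> 2" by simp
  finally show ?thesis .
qed

text \<open>\<open>Linv y\<close> evaluated at the point \<open>x\<close> is \<open>cinner_L2 y (eval_at x)\<close>.\<close>

definition eval_at :: "real \<Rightarrow> L2" where
  "eval_at x = (\<Sum>\<^sub>\<infinity>k\<in>{1..}. complex_of_real (sinf k x / real k) *\<^sub>C phi k)"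

lemma eval_at_summable:
  "(\<lambda>k. (cmod (complex_of_real (sinf k x / real k)))\<^sup>2) summable_on {1..}"
  "(\<Sum>\<^sub>\<infinity>k\<in>{1..}. (cmod (complex_of_real (sinf k x / real k)))\<^sup>2) \<le> 4"
proof -
  have "(\<Sum>k\<in>F. (cmod (complex_of_real (sinf k x / real k)))\<^sup>2) \<le> 4"
    if F: "finite F" "F \<subseteq> {1..}" for F
  proof -
    have "(\<Sum>k\<in>F. (cmod (complex_of_real (sinf k x / real k)))\<^sup>2) \<le> (\<Sum>k\<in>F. 2 * (1 / (real k)\<^sup>2))"
    proof (rule sum_mono)
      fix k
      have "(sinf k x)\<^sup>2 \<le> (sqrt 2)\<^sup>2" by (rule power2_le_iff_abs_le[THEN iffD2]) (use sinf_bound in auto)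
      then show "(cmod (complex_of_real (sinf k x / real k)))\<^sup>2 \<le> 2 * (1 / (real k)\<^sup>2)"
        by (simp add: power_divide divide_right_mono flip: of_real_divide)
    qed
    also have "\<dots> \<le> 2 * 2"
      unfolding sum_distrib_left[symmetric] by (intro mult_left_mono sum_inverse_squares_le F) simp
    finally show ?thesis by simp
  qed
  from nonneg_summable_on_bounded[of "{1..}" "\<lambda>k. (cmod (complex_of_real (sinf k x / real k)))\<^sup>2", OF _ this]
  show "(\<lambda>k. (cmod (complex_of_real (sinf k x / real k)))\<^sup>2) summable_on {1..}"
    "(\<Sum>\<^sub>\<infinity>k\<in>{1..}. (cmod (complex_of_real (sinf k x / real k)))\<^sup>2) \<le> 4" by auto
qed

lemma norm_eval_at: "norm (eval_at x) \<le> 2"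
proof (rule power2_le_imp_le)
  show "(norm (eval_at x))\<^sup>2 \<le> 2\<^sup>2"
    unfolding eval_at_def orthonormal_Riesz_Fischer(3)[OF orthonormal_phi eval_at_summable(1)]
    using eval_at_summable(2)[of x] by simp
qed simp

lemma cinner_eval_at_sum:
  assumes "finite F" "F \<subseteq> {1..}"
  shows "cinner_L2 (\<Sum>k\<in>F. y k *\<^sub>C phi k) (eval_at x) = (\<Sum>k\<in>F. (y k / of_nat k) * complex_of_real (sinf k x))"
proof -
  have "cinner_L2 (phi k) (eval_at x) = complex_of_real (sinf k x / real k)" if "k \<in> {1..}" for k
    unfolding eval_at_def
    by (subst cinner_L2_commute, subst orthonormal_Riesz_Fischer(2)[OF orthonormal_phi eval_at_summable(1) that]) simp
  then show ?thesis
    using assms(2) by (auto simp: cinner_L2_sum_left cinner_L2_scaleC_left intro!: sum.cong)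
qed

lemma norm_to_L2_mult_bounded:
  fixes f h :: "real \<Rightarrow> complex"
  assumes "f sq_integrable_on {0<..<1}" "continuous_on UNIV h" "\<And>x. x \<in> {0<..<1} \<Longrightarrow> cmod (h x) \<le> M" "0 \<le> M"
  shows "(\<lambda>x. f x * h x) sq_integrable_on {0<..<1}" "norm (to_L2 (\<lambda>x. f x * h x)) \<le> M * norm (to_L2 f)"
proof -
  have [measurable]: "f \<in> borel_measurable leb01" "h \<in> borel_measurable leb01"
    using assms(1) continuous_sq_integrable01[OF assms(2)] by (auto simp: sq_integrable_on_def)
  have i: "integrable leb01 (\<lambda>x. (cmod (f x))\<^sup>2)" using assms(1) by (simp add: sq_integrable_on_def)
  have bd: "AE x in leb01. (cmod (f x * h x))\<^sup>2 \<le> M\<^sup>2 * (cmod (f x))\<^sup>2"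
  proof (rule AE_I2)
    fix x assume "x \<in> space leb01"
    then have "cmod (f x) * cmod (h x) \<le> cmod (f x) * M"
      using assms(3)[of x] by (intro mult_left_mono) auto
    then have "cmod (f x * h x) \<le> M * cmod (f x)" by (simp add: norm_mult mult.commute)
    then show "(cmod (f x * h x))\<^sup>2 \<le> M\<^sup>2 * (cmod (f x))\<^sup>2"
      by (metis norm_ge_zero power_mono power_mult_distrib)
  qed
  have ib: "integrable leb01 (\<lambda>x. (cmod (f x * h x))\<^sup>2)"
    by (rule Bochner_Integration.integrable_bound[where f = "\<lambda>x. M\<^sup>2 * (cmod (f x))\<^sup>2"])
      (use i bd in auto)
  then show s: "(\<lambda>x. f x * h x) sq_integrable_on {0<..<1}" by (simp add: sq_integrable_on_def)
  have "integral\<^sup>L leb01 (\<lambda>x. (cmod (f x * h x))\<^sup>2) \<le> integral\<^sup>L leb01 (\<lambda>x. M\<^sup>2 * (cmod (f x))\<^sup>2)"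
    by (rule integral_mono_AE) (use ib i bd in auto)
  then have "sqrt (integral\<^sup>L leb01 (\<lambda>x. (cmod (f x * h x))\<^sup>2)) \<le> sqrt (M\<^sup>2 * integral\<^sup>L leb01 (\<lambda>x. (cmod (f x))\<^sup>2))"
    by simp
  then show "norm (to_L2 (\<lambda>x. f x * h x)) \<le> M * norm (to_L2 f)"
    using assms(4) by (simp add: norm_to_L2[OF s] norm_to_L2[OF assms(1)] real_sqrt_mult)
qed

text \<open>Integrating by parts once, the coefficients of \<open>\<mu> \<psi>\<close> are of order \<open>1 / k\<close>: a finite sum of
  jump terms, oscillating in \<open>k\<close>, and a square summable part. The jump terms prevent \<open>\<mu> \<psi>\<close> from
  being in \<open>H10\<close>.\<close>

definition reg_coeff :: "(real \<Rightarrow> real) \<Rightarrow> real set \<Rightarrow> (real \<Rightarrow> real) \<Rightarrow> L2 \<Rightarrow> nat \<Rightarrow> complex" where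
  "reg_coeff \<mu> S c y k = of_nat k * cinner_L2 (mult_L2 \<mu> (Linv y)) (phi k) +
     (\<Sum>a\<in>S. complex_of_real (c a * cosf k a / pi) * cinner_L2 y (eval_at a))"

text \<open>For a finite sine sum \<open>p\<close>, integrating by parts against the product of
  \<open>p\<close> and \<open>cosf k\<close> identifies the regular part with the cosine coefficient
  of \<open>\<mu> * p' + g * p\<close> divided by \<open>pi\<close>; the jump terms are exactly
  those added in \<open>reg_coeff\<close>. Bessel's inequality for the cosines concludes, and finite
  sums are dense.\<close>

lemma reg_coeff_bound:
  assumes "finite A" "A \<subseteq> {0<..<1}" "\<mu> \<in> H1_piecewise A"
  obtains c C where "0 \<le> C" "\<And>y K. finite K \<Longrightarrow> K \<subseteq> {1..} \<Longrightarrow>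
    (\<Sum>k\<in>K. (cmod (reg_coeff \<mu> (A \<union> {0, 1}) c y k))\<^sup>2) \<le> (C * norm y)\<^sup>2"
proof -
  obtain B where B: "ess_bounded B \<mu>" using H1_piecewise_ess_bounded[OF assms] by blast
  obtain g c where g: "g sq_integrable_on {0<..<1}" and bp: "\<And>\<theta> D :: real \<Rightarrow> complex. C1_deriv \<theta> D \<Longrightarrow>
    integral\<^sup>L leb01 (\<lambda>x. D x * complex_of_real (\<mu> x)) =
      (\<Sum>a\<in>A \<union> {0, 1}. complex_of_real (c a) * \<theta> a) - integral\<^sup>L leb01 (\<lambda>x. \<theta> x * complex_of_real (g x))"
    by (rule H1_piecewise_by_parts[OF assms]) (rule that)
  define S where "S = A \<union> {0, 1}"
  define b where "b = reg_coeff \<mu> S c"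
  define gL where "gL = norm (to_L2 (\<lambda>x. complex_of_real (g x)))"
  define C where "C = (B * pi + 2 * gL) / pi"
  have B0: "0 \<le> B" using B by (simp add: ess_bounded_def)
  then have C0: "0 \<le> C" by (simp add: C_def gL_def)
  note g2 = sq_integrable_of_real[OF g]
  have fin: "(\<Sum>k\<in>K. (cmod (b y k))\<^sup>2) \<le> (C * norm y)\<^sup>2"
    if F: "finite F" "F \<subseteq> {1..}" "y = (\<Sum>k\<in>F. z k *\<^sub>C phi k)" and K: "finite K" "K \<subseteq> {1..}" for y F z K
  proof -
    define p where "p x = (\<Sum>k\<in>F. (z k / of_nat k) * complex_of_real (sinf k x))" for x
    define p' where "p' x = (\<Sum>k\<in>F. (z k / of_nat k) * complex_of_real (real k * pi * cosf k x))" for x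
    have C1: "C1_deriv p p'"
      unfolding p_def p'_def by (intro C1_deriv_sum C1_deriv_cmult C1_deriv_of_real C1_deriv_sinf)
    have cont: "continuous_on UNIV p" "continuous_on UNIV p'"
      using C1 C1_deriv_continuous[OF C1] by (auto simp: C1_deriv_def)
    note p2 = continuous_sq_integrable01[OF cont(1)] continuous_sq_integrable01[OF cont(2)]
    have "to_L2 p = (\<Sum>k\<in>F. (z k / of_nat k) *\<^sub>C phi k)"
      unfolding p_def phi_eq_sinf
      by (simp only: to_L2_sum sq_integrable_on_cmult sq_integrable_sinf to_L2_cmult)
    then have p_L2: "Linv y = to_L2 p"
      by (intro L2_eqI) (simp add: cinner_Linv F(3) orthonormal_cinner_sum[OF orthonormal_phi F(1,2)])
    have "p' = (\<lambda>x. \<Sum>k\<in>F. (pi * z k) * complex_of_real (cosf k x))"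
      unfolding p'_def using F(2) by (intro ext sum.cong) (auto simp: field_simps)
    then have p'_L2: "to_L2 p' = (\<Sum>k\<in>F. (pi * z k) *\<^sub>C cosb k)"
      unfolding cosb_def
      by (simp only: to_L2_sum sq_integrable_on_cmult sq_integrable_cosf to_L2_cmult)
    have "(norm (to_L2 p'))\<^sup>2 = (pi * norm y)\<^sup>2"
      unfolding p'_L2 F(3) power_mult_distrib orthonormal_norm_sum[OF orthonormal_phi F(1,2)]
        orthonormal_norm_sum[OF orthonormal_cosb F(1,2)]
      by (simp add: norm_mult power_mult_distrib sum_distrib_left)
    then have np': "norm (to_L2 p') = pi * norm y" by (simp add: power2_eq_iff_nonneg)
    have p_ev: "p x = cinner_L2 y (eval_at x)" for x
      unfolding F(3) cinner_eval_at_sum[OF F(1,2)] p_def ..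
    have p_bd: "cmod (p x) \<le> 2 * norm y" for x
      unfolding p_ev using cinner_L2_Cauchy_Schwarz[of y "eval_at x"] mult_left_mono[OF norm_eval_at[of x] norm_ge_zero[of y]]
      by simp
    \<comment> \<open>The derivative of the product away from the jumps. Its first term is bounded
      through \<open>norm (to_L2 p') = pi * norm y\<close>, its second through the pointwise bound
      \<open>2 * norm y\<close> on \<open>p\<close>.\<close>
    define h where "h x = complex_of_real (\<mu> x) * p' x + complex_of_real (g x) * p x" for x
    note h1 = ess_bounded_mult[OF B p2(2)]
      and h2 = norm_to_L2_mult_bounded[OF g2 cont(1), of "2 * norm y"]
    have h2s: "(\<lambda>x. complex_of_real (g x) * p x) sq_integrable_on {0<..<1}"
      and h2n: "norm (to_L2 (\<lambda>x. complex_of_real (g x) * p x)) \<le> 2 * norm y * gL"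
      using h2 p_bd by (auto simp: gL_def)
    have hs: "h sq_integrable_on {0<..<1}"
      unfolding h_def by (intro sq_integrable_on_add h1 h2s)
    have "norm (to_L2 h) \<le> norm (to_L2 (\<lambda>x. complex_of_real (\<mu> x) * p' x)) + norm (to_L2 (\<lambda>x. complex_of_real (g x) * p x))"
      unfolding h_def to_L2_add[OF h1(1) h2s] by (rule norm_triangle_ineq)
    also have "\<dots> \<le> B * (pi * norm y) + 2 * norm y * gL"
      using h1(2) h2n np' by simp
    also have "\<dots> = (pi * C) * norm y" by (simp add: C_def) (simp add: algebra_simps)
    also have "\<dots> = pi * (C * norm y)" by simp
    finally have hn: "norm (to_L2 h) \<le> pi * (C * norm y)" .
    have bk: "b y k = cinner_L2 (to_L2 h) (cosb k) / pi" if k: "k \<ge> 1" for k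
    proof -
      define X where "X = cinner_L2 (mult_L2 \<mu> (Linv y)) (phi k)"
      have ms: "(\<lambda>x. complex_of_real (\<mu> x) * p x) sq_integrable_on {0<..<1}"
        by (rule ess_bounded_mult(1)[OF B p2(1)])
      have X: "X = integral\<^sup>L leb01 (\<lambda>x. complex_of_real (\<mu> x) * p x * complex_of_real (sinf k x))"
        unfolding X_def p_L2 mult_L2_to_L2[OF B p2(1)] phi_eq_sinf
        by (subst cinner_to_L2[OF ms sq_integrable_sinf]) simp
      have iX: "integrable leb01 (\<lambda>x. complex_of_real (\<mu> x) * p x * complex_of_real (sinf k x))"
        using sq_integrable_on_mult_cnj[OF ms sq_integrable_sinf[of k]] by simp
      have i1: "integrable leb01 (\<lambda>x. complex_of_real (\<mu> x) * p' x * complex_of_real (cosf k x))"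
        using sq_integrable_on_mult_cnj[OF h1(1) sq_integrable_cosf[of k]] by simp
      have i2: "integrable leb01 (\<lambda>x. complex_of_real (g x) * p x * complex_of_real (cosf k x))"
        using sq_integrable_on_mult_cnj[OF h2s sq_integrable_cosf[of k]] by simp
      have "C1_deriv (\<lambda>x. p x * complex_of_real (cosf k x))
          (\<lambda>x. p x * complex_of_real (- (real k * pi * sinf k x)) + p' x * complex_of_real (cosf k x))"
        by (intro C1_deriv_mult C1_deriv_of_real C1_deriv_cosf C1)
      from bp[OF this]
      have "integral\<^sup>L leb01 (\<lambda>x. complex_of_real (\<mu> x) * p' x * complex_of_real (cosf k x)
            - (of_nat k * pi) * (complex_of_real (\<mu> x) * p x * complex_of_real (sinf k x))) =
          (\<Sum>a\<in>S. complex_of_real (c a) * (p a * complex_of_real (cosf k a)))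
            - integral\<^sup>L leb01 (\<lambda>x. complex_of_real (g x) * p x * complex_of_real (cosf k x))"
        unfolding S_def by (simp add: algebra_simps)
      then have "(of_nat k * pi) * X + (\<Sum>a\<in>S. complex_of_real (c a) * (p a * complex_of_real (cosf k a))) =
          integral\<^sup>L leb01 (\<lambda>x. complex_of_real (\<mu> x) * p' x * complex_of_real (cosf k x))
          + integral\<^sup>L leb01 (\<lambda>x. complex_of_real (g x) * p x * complex_of_real (cosf k x))"
        using i1 iX by (simp add: X algebra_simps)
      also have "\<dots> = integral\<^sup>L leb01 (\<lambda>x. h x * complex_of_real (cosf k x))"
        using i1 i2 by (simp add: h_def distrib_right)
      also have "\<dots> = cinner_L2 (to_L2 h) (cosb k)"
        unfolding cosb_def cinner_to_L2[OF hs sq_integrable_cosf] by simp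
      finally have "cinner_L2 (to_L2 h) (cosb k) / pi = of_nat k * X + (\<Sum>a\<in>S. complex_of_real (c a) * (p a * complex_of_real (cosf k a))) / pi"
        by (simp add: field_simps)
      also have "(\<Sum>a\<in>S. complex_of_real (c a) * (p a * complex_of_real (cosf k a))) / pi =
          (\<Sum>a\<in>S. complex_of_real (c a * cosf k a / pi) * cinner_L2 y (eval_at a))"
        unfolding sum_divide_distrib p_ev by (intro sum.cong) auto
      finally show ?thesis by (simp add: b_def reg_coeff_def X_def)
    qed
    have "(\<Sum>k\<in>K. (cmod (b y k))\<^sup>2) = (\<Sum>k\<in>K. (cmod (cinner_L2 (to_L2 h) (cosb k)))\<^sup>2) / pi\<^sup>2"
      unfolding sum_divide_distrib
      by (rule sum.cong) (use K bk in \<open>auto simp: norm_divide power_divide\<close>)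
    also have "\<dots> \<le> (norm (to_L2 h))\<^sup>2 / pi\<^sup>2"
      by (intro divide_right_mono orthonormal_Bessel_finite[OF orthonormal_cosb] K) auto
    also have "\<dots> \<le> (pi * (C * norm y))\<^sup>2 / pi\<^sup>2"
      by (intro divide_right_mono power_mono hn) auto
    finally show ?thesis by (simp add: power_mult_distrib)
  qed
  have blm: "bounded_linear (\<lambda>y. cinner_L2 (mult_L2 \<mu> (Linv y)) v)" for v
    by (rule bounded_linear_compose[OF bounded_linear_cinner_L2_left])
      (rule bounded_linear_compose[OF bounded_linear_mult_L2[OF B] bounded_linear_Linv])
  \<comment> \<open>For a fixed finite \<open>K\<close> both sides are continuous in
    \<open>y\<close>, so the bound for finite expansions extends to their limits.\<close>
  have "(\<Sum>k\<in>K. (cmod (b y k))\<^sup>2) \<le> (C * norm y)\<^sup>2" if K: "finite K" "K \<subseteq> {1..}" for y K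
  proof (rule tendsto_le[OF finite_subsets_at_top_neq_bot])
    let ?s = "\<lambda>F. \<Sum>k\<in>F. cinner_L2 y (phi k) *\<^sub>C phi k"
    have s: "(?s \<longlongrightarrow> y) (finite_subsets_at_top {1..})"
      using has_sum_phi[of y] by (simp add: has_sum_def)
    show "((\<lambda>F. (C * norm (?s F))\<^sup>2) \<longlongrightarrow> (C * norm y)\<^sup>2) (finite_subsets_at_top {1..})"
      by (intro tendsto_intros s)
    have "((\<lambda>F. b (?s F) k) \<longlongrightarrow> b y k) (finite_subsets_at_top {1..})" for k
      unfolding b_def reg_coeff_def
      by (intro tendsto_intros bounded_linear.tendsto[OF blm] s)
    then show "((\<lambda>F. \<Sum>k\<in>K. (cmod (b (?s F) k))\<^sup>2) \<longlongrightarrow> (\<Sum>k\<in>K. (cmod (b y k))\<^sup>2)) (finite_subsets_at_top {1..})"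
      by (intro tendsto_intros)
    show "\<forall>\<^sub>F F in finite_subsets_at_top {1..}. (\<Sum>k\<in>K. (cmod (b (?s F) k))\<^sup>2) \<le> (C * norm (?s F))\<^sup>2"
      unfolding eventually_finite_subsets_at_top
      by (rule exI[of _ "{}"], safe) (rule fin[OF _ _ refl K])
  qed
  then show thesis using that[OF C0] unfolding b_def S_def by blast
qed

section \<open>The Schroedinger group\<close>

lemma schroedinger_multiplier:
  "schroedinger t = multiplier phi {1..} (\<lambda>k. cis (- (eigenval k * t)))"
  by (rule ext) (simp add: schroedinger_def multiplier_def cis_conv_exp)

lemma cinner_schroedinger:
  "k \<ge> 1 \<Longrightarrow> cinner_L2 (schroedinger t f) (phi k) = cis (- (eigenval k * t)) * cinner_L2 f (phi k)"
  unfolding schroedinger_multiplier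
  by (rule cinner_multiplier[OF orthonormal_phi, where B = 1]) auto

lemma bounded_linear_schroedinger: "bounded_linear (schroedinger t)"
  unfolding schroedinger_multiplier
  by (rule bounded_linear_multiplier[OF orthonormal_phi, where B = 1]) auto

lemma schroedinger_schroedinger: "schroedinger s (schroedinger t f) = schroedinger (s + t) f"
  by (rule L2_eqI) (simp add: cinner_schroedinger cis_mult algebra_simps flip: mult.assoc)

lemma schroedinger_zero [simp]: "schroedinger 0 f = f"
  by (rule L2_eqI) (simp add: cinner_schroedinger)

lemma norm_schroedinger_le: "norm (schroedinger t f) \<le> norm f"
  unfolding schroedinger_multiplier
  using norm_multiplier[OF orthonormal_phi, of "\<lambda>k. cis (- (eigenval k * t))" 1 f] by simp

lemma norm_schroedinger [simp]: "norm (schroedinger t f) = norm f"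
  using norm_schroedinger_le[of t f] norm_schroedinger_le[of "- t" "schroedinger t f"]
  by (simp add: schroedinger_schroedinger)

lemma Linv_schroedinger: "Linv (schroedinger t f) = schroedinger t (Linv f)"
  by (rule L2_eqI) (simp add: cinner_Linv cinner_schroedinger)

text \<open>The group acts isometrically, so the finite expansions converge uniformly in time; for
  each of them continuity is that of finitely many exponentials.\<close>

lemma continuous_on_schroedinger_const: "continuous_on UNIV (\<lambda>t. schroedinger t f)"
proof (rule uniform_limit_theorem[OF _ _ finite_subsets_at_top_neq_bot])
  let ?s = "\<lambda>F. \<Sum>k\<in>F. cinner_L2 f (phi k) *\<^sub>C phi k"
  show "uniform_limit UNIV (\<lambda>F t. schroedinger t (?s F)) (\<lambda>t. schroedinger t f) (finite_subsets_at_top {1..})"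
  proof (rule uniform_limitI)
    fix e :: real assume "e > 0"
    have "(?s \<longlongrightarrow> f) (finite_subsets_at_top {1..})"
      using has_sum_phi[of f] by (simp add: has_sum_def)
    from tendstoD[OF this \<open>e > 0\<close>]
    show "\<forall>\<^sub>F F in finite_subsets_at_top {1..}. \<forall>t\<in>UNIV. dist (schroedinger t (?s F)) (schroedinger t f) < e"
      by eventually_elim
        (simp add: dist_norm flip: bounded_linear.linear[OF bounded_linear_schroedinger, THEN linear_diff])
  qed
  show "\<forall>\<^sub>F F in finite_subsets_at_top {1..}. continuous_on UNIV (\<lambda>t. schroedinger t (?s F))"
    unfolding eventually_finite_subsets_at_top
  proof (rule exI[of _ "{}"], safe)
    fix F :: "nat set" assume F: "finite F" "F \<subseteq> {1..}"
    have "schroedinger t (?s F) = (\<Sum>k\<in>F. (cis (- (eigenval k * t)) * cinner_L2 f (phi k)) *\<^sub>C phi k)" for t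
      by (rule L2_eqI) (auto simp: cinner_schroedinger orthonormal_cinner_sum[OF orthonormal_phi F])
    then show "continuous_on UNIV (\<lambda>t. schroedinger t (?s F))"
      by (simp only:) (intro continuous_intros)
  qed
qed

text \<open>Joint continuity follows from strong continuity because replacing \<open>f z\<close> by
  \<open>f s\<close> costs \<open>norm (f z - f s)\<close> whatever the time is.\<close>

lemma continuous_on_schroedinger [continuous_intros]:
  assumes "continuous_on A a" "continuous_on A f"
  shows "continuous_on A (\<lambda>s. schroedinger (a s) (f s))"
  unfolding continuous_on_def
proof
  fix s assume s: "s \<in> A"
  have "((\<lambda>z. schroedinger (a z) (f z - f s)) \<longlongrightarrow> 0) (at s within A)"
  proof (rule Lim_null_comparison)
    show "\<forall>\<^sub>F z in at s within A. norm (schroedinger (a z) (f z - f s)) \<le> norm (f z - f s)" by simp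
    have "((\<lambda>z. norm (f z - f s)) \<longlongrightarrow> norm (f s - f s)) (at s within A)"
      using assms(2) s by (intro tendsto_intros) (auto simp: continuous_on_def)
    then show "((\<lambda>z. norm (f z - f s)) \<longlongrightarrow> 0) (at s within A)" by simp
  qed
  moreover have "((\<lambda>z. schroedinger (a z) (f s)) \<longlongrightarrow> schroedinger (a s) (f s)) (at s within A)"
    using assms(1) s continuous_on_schroedinger_const[of "f s"]
    by (intro isCont_tendsto_compose[where g = "\<lambda>t. schroedinger t (f s)"])
      (auto simp: continuous_on_def isCont_def)
  ultimately have "((\<lambda>z. schroedinger (a z) (f z - f s) + schroedinger (a z) (f s)) \<longlongrightarrow> 0 + schroedinger (a s) (f s)) (at s within A)"
    by (rule tendsto_add)
  then show "((\<lambda>z. schroedinger (a z) (f z)) \<longlongrightarrow> schroedinger (a s) (f s)) (at s within A)"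
    by (simp flip: bounded_linear.linear[OF bounded_linear_schroedinger, THEN linear_add])
qed

section \<open>Scalar integral inequalities\<close>

text \<open>Cauchy-Schwarz with the constant 1, read off from the fact that the integral of the
  squared deviation from the mean \<open>c\<close> is nonnegative.\<close>

lemma integral_square_le:
  fixes f :: "real \<Rightarrow> real"
  assumes "f sq_integrable_on {r..t}" "integrable (lebesgue_on {r..t}) f" "r \<le> t"
  shows "(integral\<^sup>L (lebesgue_on {r..t}) f)\<^sup>2 \<le> (t - r) * integral\<^sup>L (lebesgue_on {r..t}) (\<lambda>x. (f x)\<^sup>2)"
proof (cases "r = t")
  case True
  have "{t} \<in> null_sets lebesgue" by (simp add: finite_imp_null_set_lborel null_sets_completionI)
  then have "integral\<^sup>L (lebesgue_on {r..t}) f = 0" using True by (simp add: integral_eq_zero_null_sets)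
  then show ?thesis using True by simp
next
  case False
  then have rt: "t - r > 0" using assms(3) by simp
  interpret finite_measure "lebesgue_on {r..t}" by (rule finite_measure_lebesgue_on) simp
  define I where "I = integral\<^sup>L (lebesgue_on {r..t}) f"
  define c where "c = I / (t - r)"
  have i2: "integrable (lebesgue_on {r..t}) (\<lambda>x. (f x)\<^sup>2)" using assms by (simp add: sq_integrable_on_def)
  have "0 \<le> integral\<^sup>L (lebesgue_on {r..t}) (\<lambda>x. (f x - c)\<^sup>2)" by (simp add: integral_nonneg_AE)
  also have "(\<lambda>x. (f x - c)\<^sup>2) = (\<lambda>x. (f x)\<^sup>2 - 2 * c * f x + c\<^sup>2)" by (simp add: power2_diff algebra_simps)
  also have "integral\<^sup>L (lebesgue_on {r..t}) \<dots> = integral\<^sup>L (lebesgue_on {r..t}) (\<lambda>x. (f x)\<^sup>2) - 2 * c * I + c\<^sup>2 * (t - r)"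
    using i2 assms by (simp add: I_def measure_restrict_space)
  also have "2 * c * I = 2 * (c\<^sup>2 * (t - r))" using rt by (simp add: c_def power2_eq_square)
  finally have "c\<^sup>2 * (t - r) \<le> integral\<^sup>L (lebesgue_on {r..t}) (\<lambda>x. (f x)\<^sup>2)" by linarith
  then have "(t - r) * (c\<^sup>2 * (t - r)) \<le> (t - r) * integral\<^sup>L (lebesgue_on {r..t}) (\<lambda>x. (f x)\<^sup>2)"
    using rt by (intro mult_left_mono) auto
  moreover have "(t - r) * (c\<^sup>2 * (t - r)) = I\<^sup>2" using rt by (simp add: c_def power2_eq_square)
  ultimately show ?thesis by (simp add: I_def)
qed

text \<open>The differences of the frequencies \<open>eigenval k\<close> are multiples of \<open>pi\<^sup>2\<close>, so the exponentials are
  orthogonal on every interval whose length is a multiple of the period \<open>2 / pi\<close>.\<close>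

lemma eigenval_Bessel:
  fixes G :: "real \<Rightarrow> complex" and n :: nat
  defines "L \<equiv> 2 * real n / pi"
  assumes "G sq_integrable_on {0<..<L}" "n \<ge> 1" "finite K"
  shows "(\<Sum>k\<in>K. (cmod (integral\<^sup>L (lebesgue_on {0<..<L}) (\<lambda>s. cis (eigenval k * s) * G s)))\<^sup>2)
    \<le> L * integral\<^sup>L (lebesgue_on {0<..<L}) (\<lambda>s. (cmod (G s))\<^sup>2)"
proof -
  let ?M = "lebesgue_on {0<..<L}"
  define e where "e k s = cis (eigenval k * s)" for k s
  define a where "a k = integral\<^sup>L ?M (\<lambda>s. e k s * G s)" for k
  \<comment> \<open>The orthogonal projection of \<open>G\<close> onto the conjugate exponentials;
    the division by \<open>L\<close> is there because each has squared norm \<open>L\<close> on the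
    interval. Expanding the squared norm of \<open>G - P\<close> gives Bessel's inequality.\<close>
  define P where "P s = (\<Sum>k\<in>K. (a k / L) * cnj (e k s))" for s
  define \<Sigma> where "\<Sigma> = (\<Sum>k\<in>K. (cmod (a k))\<^sup>2)"
  have L: "L > 0" using assms(3) by (simp add: L_def)
  have ce: "continuous_on UNIV (e k)" "continuous_on UNIV (\<lambda>s. cnj (e k s))" for k
    unfolding e_def by (intro continuous_intros)+
  have Gi: "integrable ?M G" by (rule sq_integrable_imp_integrable[OF assms(2)])
  have ei: "integrable ?M (\<lambda>s. e k s * G s)" for k
    by (rule integrable_continuous_mult[OF Gi ce(1)])
  have P_cont: "continuous_on UNIV P" unfolding P_def by (intro continuous_intros ce)
  note P2 = continuous_sq_integrable[OF continuous_on_subset[OF P_cont], of 0 L, simplified]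
  have orth: "integral\<^sup>L ?M (\<lambda>s. e j s * cnj (e k s)) = (if j = k then of_real L else 0)" for j k
  proof (cases "j = k")
    case True
    then show ?thesis using L by (simp add: e_def cis_cnj cis_mult measure_restrict_space scaleR_conv_of_real)
  next
    case False
    define \<omega> where "\<omega> = eigenval j - eigenval k"
    have "(real j)\<^sup>2 \<noteq> (real k)\<^sup>2" using False by simp
    then have \<omega>: "\<omega> \<noteq> 0" by (simp add: \<omega>_def eigenval_def)
    have "\<omega> * L = 2 * pi * of_int (int n * ((int j)\<^sup>2 - (int k)\<^sup>2))"
      by (simp add: \<omega>_def eigenval_def L_def power2_eq_square field_simps)
    then have "cis (\<omega> * L) = 1" by (simp only:) (rule cis_multiple_2pi, simp)
    then have "integral\<^sup>L ?M (\<lambda>s. cis (\<omega> * s)) = 0"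
      using \<omega> L by (subst integral_cis) auto
    then show ?thesis using False by (simp add: e_def cis_cnj cis_mult \<omega>_def algebra_simps)
  qed
  have GP: "integral\<^sup>L ?M (\<lambda>s. G s * cnj (P s)) = of_real (\<Sigma> / L)"
  proof -
    have "(\<lambda>s. G s * cnj (P s)) = (\<lambda>s. \<Sum>k\<in>K. (cnj (a k) / L) * (e k s * G s))"
      by (auto simp: P_def sum_distrib_left algebra_simps)
    then have "integral\<^sup>L ?M (\<lambda>s. G s * cnj (P s)) = (\<Sum>k\<in>K. (cnj (a k) / L) * a k)"
      using ei by (simp add: a_def)
    also have "\<dots> = of_real (\<Sigma> / L)"
      by (simp add: \<Sigma>_def sum_divide_distrib complex_norm_square mult.commute del: of_real_power)
    finally show ?thesis .
  qed
  have PP: "integral\<^sup>L ?M (\<lambda>s. P s * cnj (P s)) = of_real (\<Sigma> / L)"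
  proof -
    have i: "integrable ?M (\<lambda>s. e j s * cnj (e k s))" for j k
      by (rule integrable_continuous_mult[OF _ ce(1)])
        (rule sq_integrable_imp_integrable[OF continuous_sq_integrable[OF continuous_on_subset[OF ce(2) subset_UNIV]]])
    have "(\<lambda>s. P s * cnj (P s)) = (\<lambda>s. \<Sum>k\<in>K. \<Sum>j\<in>K. (a k / L) * (cnj (a j) / L) * (e j s * cnj (e k s)))"
      by (auto simp: P_def sum_product algebra_simps)
    then have "integral\<^sup>L ?M (\<lambda>s. P s * cnj (P s)) = (\<Sum>k\<in>K. \<Sum>j\<in>K. (a k / L) * (cnj (a j) / L) * (if j = k then of_real L else 0))"
      using i by (simp add: orth)
    also have "\<dots> = (\<Sum>k\<in>K. (a k / L) * (cnj (a k) / L) * of_real L)"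
    proof (rule sum.cong)
      fix k assume k: "k \<in> K"
      have "(\<lambda>j. (a k / L) * (cnj (a j) / L) * (if j = k then of_real L else 0)) =
          (\<lambda>j. if j = k then (a k / L) * (cnj (a k) / L) * of_real L else 0)" by auto
      then show "(\<Sum>j\<in>K. (a k / L) * (cnj (a j) / L) * (if j = k then of_real L else 0)) =
          (a k / L) * (cnj (a k) / L) * of_real L"
        using assms(4) k by (simp only:) simp
    qed simp
    also have "\<dots> = of_real (\<Sigma> / L)"
      using L by (simp add: \<Sigma>_def sum_divide_distrib complex_norm_square del: of_real_power)
    finally show ?thesis .
  qed
  have "0 \<le> integral\<^sup>L ?M (\<lambda>s. (cmod (G s - P s))\<^sup>2)" by (simp add: integral_nonneg_AE)
  also have "(\<lambda>s. (cmod (G s - P s))\<^sup>2) = (\<lambda>s. (cmod (G s))\<^sup>2 - 2 * Re (G s * cnj (P s)) + Re (P s * cnj (P s)))"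
    unfolding cmod_power2 by (auto simp: power2_eq_square algebra_simps)
  also have "integral\<^sup>L ?M \<dots> = integral\<^sup>L ?M (\<lambda>s. (cmod (G s))\<^sup>2) - 2 * Re (integral\<^sup>L ?M (\<lambda>s. G s * cnj (P s)))
      + Re (integral\<^sup>L ?M (\<lambda>s. P s * cnj (P s)))"
  proof -
    have lin: "integral\<^sup>L ?M (\<lambda>s. A s - 2 * Re (U s) + Re (V s)) =
        integral\<^sup>L ?M A - 2 * Re (integral\<^sup>L ?M U) + Re (integral\<^sup>L ?M V)"
      if "integrable ?M A" "integrable ?M U" "integrable ?M V" for A :: "real \<Rightarrow> real" and U V :: "real \<Rightarrow> complex"
      using that by simp
    have "integrable ?M (\<lambda>s. (cmod (G s))\<^sup>2)" using assms(2) by (simp add: sq_integrable_on_def)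
    then show ?thesis
      by (rule lin) (rule sq_integrable_on_mult_cnj[OF assms(2) P2] sq_integrable_on_mult_cnj[OF P2 P2])+
  qed
  also have "\<dots> = integral\<^sup>L ?M (\<lambda>s. (cmod (G s))\<^sup>2) - \<Sigma> / L"
    unfolding GP PP by simp
  finally show ?thesis using L by (simp add: \<Sigma>_def a_def e_def field_simps)
qed

section \<open>The Duhamel term\<close>

lemma integrable_Icc_continuous_mult:
  fixes f g :: "real \<Rightarrow> 'b::{real_normed_field, euclidean_space}"
  assumes "integrable (lebesgue_on {a..b}) f" "continuous_on {a..b} g"
  shows "integrable (lebesgue_on {a..b}) (\<lambda>x. f x * g x)"
proof (cases "a \<le> b")
  case True
  have "continuous_on UNIV (\<lambda>x. g (max a (min b x)))"
    by (rule continuous_on_compose2[OF assms(2)]) (use True in \<open>auto intro!: continuous_intros\<close>)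
  then have "integrable (lebesgue_on {a..b}) (\<lambda>x. g (max a (min b x)) * f x)"
    using integrable_continuous_mult[of a b f] assms(1) by (simp add: lebesgue_on_Ioo_Icc)
  then show ?thesis
    by (rule Bochner_Integration.integrable_cong[THEN iffD1, rotated 2]) (auto simp: max_def min_def)
qed simp

lemma control_integrable:
  fixes u :: "real \<Rightarrow> real"
  assumes "u sq_integrable_on UNIV"
  shows "integrable (lebesgue_on {r..t}) u" "integrable (lebesgue_on {r..t}) (\<lambda>s. (u s)\<^sup>2)"
proof -
  have *: "u sq_integrable_on {r<..<t}" by (rule sq_integrable_subset[OF assms]) auto
  then show "integrable (lebesgue_on {r..t}) u"
    using sq_integrable_imp_integrable[OF *] by (simp add: lebesgue_on_Ioo_Icc)
  show "integrable (lebesgue_on {r..t}) (\<lambda>s. (u s)\<^sup>2)"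
    using * by (simp add: sq_integrable_on_def lebesgue_on_Ioo_Icc)
qed

lemma control_mult_integrable:
  fixes u :: "real \<Rightarrow> real" and h :: "real \<Rightarrow> complex"
  assumes "u sq_integrable_on UNIV" "continuous_on {r..t} h"
  shows "integrable (lebesgue_on {r..t}) (\<lambda>s. complex_of_real (u s) * h s)"
    and "integrable (lebesgue_on {r..t}) (\<lambda>s. (u s)\<^sup>2 * (cmod (h s))\<^sup>2)"
  by (intro integrable_Icc_continuous_mult integrable_of_real control_integrable assms continuous_intros)+

lemma control_mult_integral_square:
  fixes u :: "real \<Rightarrow> real" and h :: "real \<Rightarrow> complex"
  assumes "u sq_integrable_on UNIV" "continuous_on {r..t} h" "r \<le> t"
  shows "(cmod (integral\<^sup>L (lebesgue_on {r..t}) (\<lambda>s. complex_of_real (u s) * h s)))\<^sup>2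
    \<le> (t - r) * integral\<^sup>L (lebesgue_on {r..t}) (\<lambda>s. (u s)\<^sup>2 * (cmod (h s))\<^sup>2)"
proof -
  note i = control_mult_integrable[OF assms(1,2)]
  let ?f = "\<lambda>s. cmod (complex_of_real (u s) * h s)"
  have f: "integrable (lebesgue_on {r..t}) ?f" using i(1) by (rule integrable_norm)
  have f2: "(\<lambda>s. (?f s)\<^sup>2) = (\<lambda>s. (u s)\<^sup>2 * (cmod (h s))\<^sup>2)" by (simp add: norm_mult power_mult_distrib)
  have "?f sq_integrable_on {r..t}" using f i(2) f2 by (auto simp: sq_integrable_on_def)
  have "(cmod (integral\<^sup>L (lebesgue_on {r..t}) (\<lambda>s. complex_of_real (u s) * h s)))\<^sup>2 \<le> (integral\<^sup>L (lebesgue_on {r..t}) ?f)\<^sup>2"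
    by (intro power_mono integral_norm_bound norm_ge_zero)
  also have "\<dots> \<le> (t - r) * integral\<^sup>L (lebesgue_on {r..t}) (\<lambda>s. (?f s)\<^sup>2)"
    by (rule integral_square_le) fact+
  finally show ?thesis unfolding f2 .
qed

text \<open>The integrand is extended by 0 from \<open>{r..t}\<close> to a whole number
  \<open>n\<close> of periods. One \<open>n\<close> serves all subintervals of a bounded time
  interval, so the constant is independent of \<open>r\<close> and \<open>t\<close>.\<close>

lemma control_Bessel:
  fixes u :: "real \<Rightarrow> real" and h :: "real \<Rightarrow> complex"
  assumes "u sq_integrable_on UNIV" "continuous_on {r..t} h" "0 \<le> r" "t < 2 * real n / pi" "n \<ge> 1" "finite K"
  shows "(\<Sum>k\<in>K. (cmod (integral\<^sup>L (lebesgue_on {r..t}) (\<lambda>s. complex_of_real (u s) * (cis (eigenval k * s) * h s))))\<^sup>2)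
    \<le> 2 * real n / pi * integral\<^sup>L (lebesgue_on {r..t}) (\<lambda>s. (u s)\<^sup>2 * (cmod (h s))\<^sup>2)"
proof -
  define L where "L = 2 * real n / pi"
  define G where "G s = (if s \<in> {r..t} then complex_of_real (u s) * h s else 0)" for s
  note i = control_mult_integrable[OF assms(1,2)]
  have sub: "{r..t} \<subseteq> {0..L}" using assms by (auto simp: L_def)
  have G2: "(\<lambda>s. (cmod (G s))\<^sup>2) = (\<lambda>s. if s \<in> {r..t} then (u s)\<^sup>2 * (cmod (h s))\<^sup>2 else 0)"
    by (auto simp: G_def norm_mult power_mult_distrib)
  have ir: "integrable (lebesgue_on {0..L}) (\<lambda>s. if s \<in> {r..t} then f s else 0)"
    if "integrable (lebesgue_on {r..t}) f" for f :: "real \<Rightarrow> 'z::euclidean_space"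
  proof -
    have "(\<lambda>s. indicat_real {0..L} s *\<^sub>R (if s \<in> {r..t} then f s else 0)) = (\<lambda>s. indicat_real {r..t} s *\<^sub>R f s)"
      using sub by (auto simp: indicator_def)
    then show ?thesis using that by (simp add: integrable_restrict_space)
  qed
  have Gi: "integrable (lebesgue_on {0..L}) G" "integrable (lebesgue_on {0..L}) (\<lambda>s. (cmod (G s))\<^sup>2)"
    unfolding G2 unfolding G_def by (rule ir, rule i)+
  then have "G sq_integrable_on {0<..<L}"
    by (auto simp: sq_integrable_on_def lebesgue_on_Ioo_Icc)
  from eigenval_Bessel[of G n K, folded L_def, OF this assms(5,6)]
  have "(\<Sum>k\<in>K. (cmod (integral\<^sup>L (lebesgue_on {0..L}) (\<lambda>s. cis (eigenval k * s) * G s)))\<^sup>2)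
    \<le> L * integral\<^sup>L (lebesgue_on {0..L}) (\<lambda>s. (cmod (G s))\<^sup>2)"
    by (simp add: lebesgue_on_Ioo_Icc)
  also have "integral\<^sup>L (lebesgue_on {0..L}) (\<lambda>s. (cmod (G s))\<^sup>2) =
      integral\<^sup>L (lebesgue_on {r..t}) (\<lambda>s. (u s)\<^sup>2 * (cmod (h s))\<^sup>2)"
    unfolding G2 by (rule integral_restrict[OF sub]) auto
  also have "(\<lambda>k. integral\<^sup>L (lebesgue_on {0..L}) (\<lambda>s. cis (eigenval k * s) * G s)) =
      (\<lambda>k. integral\<^sup>L (lebesgue_on {r..t}) (\<lambda>s. complex_of_real (u s) * (cis (eigenval k * s) * h s)))"
  proof
    fix k
    have "(\<lambda>s. cis (eigenval k * s) * G s) =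
        (\<lambda>s. if s \<in> {r..t} then complex_of_real (u s) * (cis (eigenval k * s) * h s) else 0)"
      by (auto simp: G_def)
    then show "integral\<^sup>L (lebesgue_on {0..L}) (\<lambda>s. cis (eigenval k * s) * G s) =
      integral\<^sup>L (lebesgue_on {r..t}) (\<lambda>s. complex_of_real (u s) * (cis (eigenval k * s) * h s))"
      using integral_restrict[OF sub, of "\<lambda>s. complex_of_real (u s) * (cis (eigenval k * s) * h s)"] by simp
  qed
  finally show ?thesis by (simp add: L_def)
qed

text \<open>The rotation back by \<open>schroedinger (- s)\<close> is left out; on the
  \<open>k\<close>-th coefficient it is the factor \<open>cis (eigenval k * s)\<close> of
  \<open>duh_integrand\<close>.\<close>

definition pot :: "(real \<Rightarrow> real) \<Rightarrow> real \<Rightarrow> L2 \<Rightarrow> L2" where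
  "pot \<mu> s y = mult_L2 \<mu> (Linv (schroedinger s y))"

text \<open>In the interaction picture, a solution is written as \<open>\<psi> t = schroedinger t (Linv (x t))\<close>;
  \<open>duh_coeff\<close> is the \<open>k\<close>-th coefficient of the increment of \<open>x\<close> over \<open>{r..t}\<close>.\<close>

definition duh_integrand :: "(real \<Rightarrow> real) \<Rightarrow> (real \<Rightarrow> L2) \<Rightarrow> nat \<Rightarrow> real \<Rightarrow> complex" where
  "duh_integrand \<mu> x k s = cis (eigenval k * s) * cinner_L2 (pot \<mu> s (x s)) (phi k)"

definition duh_coeff :: "(real \<Rightarrow> real) \<Rightarrow> (real \<Rightarrow> real) \<Rightarrow> (real \<Rightarrow> L2) \<Rightarrow> real \<Rightarrow> real \<Rightarrow> nat \<Rightarrow> complex" where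
  "duh_coeff \<mu> u x r t k = - \<i> * of_nat k *
     integral\<^sup>L (lebesgue_on {r..t}) (\<lambda>s. complex_of_real (u s) * duh_integrand \<mu> x k s)"

lemma bounded_linear_mult_Linv:
  assumes "ess_bounded B \<mu>"
  shows "bounded_linear (\<lambda>y. mult_L2 \<mu> (Linv y))"
  by (rule bounded_linear_compose[OF bounded_linear_mult_L2[OF assms] bounded_linear_Linv])

lemma continuous_on_pot:
  assumes "ess_bounded B \<mu>" "continuous_on S x"
  shows "continuous_on S (\<lambda>s. pot \<mu> s (x s))"
  unfolding pot_def
  by (intro bounded_linear.continuous_on[OF bounded_linear_mult_Linv[OF assms(1)]] continuous_intros assms(2))

lemma continuous_on_duh_integrand:
  assumes "ess_bounded B \<mu>" "continuous_on S x"
  shows "continuous_on S (duh_integrand \<mu> x k)"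
  unfolding duh_integrand_def[abs_def] by (intro continuous_intros continuous_on_pot[OF assms])

lemma power2_sum_le_card:
  fixes f :: "'i \<Rightarrow> real"
  shows "(\<Sum>i\<in>S. c i * f i)\<^sup>2 \<le> (\<Sum>i\<in>S. (c i)\<^sup>2) * (\<Sum>i\<in>S. (f i)\<^sup>2)"
  by (rule Cauchy_Schwarz_ineq_sum)

lemma power2_norm_diff_le:
  fixes a b :: complex
  shows "(cmod (a - b))\<^sup>2 \<le> 2 * (cmod a)\<^sup>2 + 2 * (cmod b)\<^sup>2"
proof -
  have "(cmod (a - b))\<^sup>2 \<le> (cmod a + cmod b)\<^sup>2"
    by (intro power_mono norm_triangle_ineq4 norm_ge_zero)
  also have "\<dots> \<le> 2 * (cmod a)\<^sup>2 + 2 * (cmod b)\<^sup>2"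
    using sum_squares_bound[of "cmod a" "cmod b"] by (simp add: power2_sum)
  finally show ?thesis .
qed

text \<open>The factor \<open>k\<close> in \<open>duh_coeff\<close> is affordable for two different
  reasons. The regular part is square summable at each time, so Cauchy-Schwarz in time suffices.
  Each jump term has no decay in \<open>k\<close>, but up to bounded weights its coefficients are
  the moments of one scalar function of time against the exponentials, which
  \<open>control_Bessel\<close> sums.\<close>

lemma duh_coeff_bound:
  assumes A: "finite A" "A \<subseteq> {0<..<1}" "\<mu> \<in> H1_piecewise A" and T: "T > 0"
  obtains \<kappa> where "0 \<le> \<kappa>" "\<And>u x r t K. u sq_integrable_on UNIV \<Longrightarrow> continuous_on {0..T} x \<Longrightarrow>
    0 \<le> r \<Longrightarrow> r \<le> t \<Longrightarrow> t \<le> T \<Longrightarrow> finite K \<Longrightarrow> K \<subseteq> {1..} \<Longrightarrow>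
    (\<Sum>k\<in>K. (cmod (duh_coeff \<mu> u x r t k))\<^sup>2) \<le>
      \<kappa> * integral\<^sup>L (lebesgue_on {r..t}) (\<lambda>s. (u s)\<^sup>2 * (norm (x s))\<^sup>2)"
proof -
  obtain B where B: "ess_bounded B \<mu>" using H1_piecewise_ess_bounded[OF A] by blast
  obtain c C where C': "0 \<le> C" "\<And>y K. finite K \<Longrightarrow> K \<subseteq> {1..} \<Longrightarrow>
    (\<Sum>k\<in>K. (cmod (reg_coeff \<mu> (A \<union> {0, 1}) c y k))\<^sup>2) \<le> (C * norm y)\<^sup>2"
    by (rule reg_coeff_bound[OF A]) (rule that)
  define S where "S = A \<union> {0, 1}"
  note C = C'[folded S_def]
  \<comment> \<open>So many periods of length \<open>2 / pi\<close> that they cover the whole time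
    interval.\<close>
  obtain n :: nat where n: "T * pi / 2 < real n" using reals_Archimedean2 by blast
  define L where "L = 2 * real n / pi"
  have TL: "T < L" using n pi_gt_zero by (simp add: L_def field_simps)
  have n1: "n \<ge> 1"
  proof -
    have "0 < T * pi / 2" using T by simp
    then have "0 < real n" using n by linarith
    then show ?thesis by simp
  qed
  define W where "W = (\<Sum>a\<in>S. (c a)\<^sup>2)"
  \<comment> \<open>The first summand stems from the regular part, the second from the jump terms:
    \<open>W\<close> from Cauchy-Schwarz over the finite set \<open>S\<close>, and the 4 from
    \<open>norm (eval_at a) \<le> 2\<close>.\<close>
  define \<kappa> where "\<kappa> = 2 * (T * C\<^sup>2) + 2 * (W * (\<Sum>a\<in>S. L * 4))"
  have L0: "0 \<le> L" and W0: "0 \<le> W" by (auto simp: L_def W_def intro: sum_nonneg)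
  have "0 \<le> \<kappa>" using T L0 W0 by (auto simp: \<kappa>_def intro!: add_nonneg_nonneg mult_nonneg_nonneg sum_nonneg)
  moreover have "(\<Sum>k\<in>K. (cmod (duh_coeff \<mu> u x r t k))\<^sup>2) \<le>
      \<kappa> * integral\<^sup>L (lebesgue_on {r..t}) (\<lambda>s. (u s)\<^sup>2 * (norm (x s))\<^sup>2)"
    if u: "u sq_integrable_on UNIV" and x: "continuous_on {0..T} x"
      and rt: "0 \<le> r" "r \<le> t" "t \<le> T" and K: "finite K" "K \<subseteq> {1..}" for u x r t K
  proof -
    let ?M = "lebesgue_on {r..t}"
    define E where "E = integral\<^sup>L ?M (\<lambda>s. (u s)\<^sup>2 * (norm (x s))\<^sup>2)"
    have cx: "continuous_on {r..t} x" by (rule continuous_on_subset[OF x]) (use rt in auto)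
    define y where "y s = schroedinger s (x s)" for s
    have cy: "continuous_on {r..t} y" unfolding y_def by (intro continuous_intros cx)
    have ny: "norm (y s) = norm (x s)" for s by (simp add: y_def)
    define J where "J a s = cinner_L2 (y s) (eval_at a)" for a s
    define R where "R k s = reg_coeff \<mu> S c (y s) k" for k s
    have cJ: "continuous_on {r..t} (J a)" for a
      unfolding J_def by (intro continuous_intros cy)
    have cR: "continuous_on {r..t} (R k)" for k
      unfolding R_def reg_coeff_def
      by (intro continuous_intros cy bounded_linear.continuous_on[OF bounded_linear_mult_Linv[OF B]])
    have cR': "continuous_on {r..t} (\<lambda>s. cis (eigenval k * s) * R k s)" for k
      by (intro continuous_intros cR)
    define IR where "IR k = integral\<^sup>L ?M (\<lambda>s. complex_of_real (u s) * (cis (eigenval k * s) * R k s))" for k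
    define IJ where "IJ k a = integral\<^sup>L ?M (\<lambda>s. complex_of_real (u s) * (cis (eigenval k * s) * J a s))" for k a
    define w where "w k a = c a * cosf k a / pi" for k a
    have iE: "integrable ?M (\<lambda>s. (u s)\<^sup>2 * (norm (x s))\<^sup>2)"
      by (intro integrable_Icc_continuous_mult control_integrable[OF u] continuous_intros cx)
    have duh: "duh_coeff \<mu> u x r t k = - \<i> * (IR k - (\<Sum>a\<in>S. complex_of_real (w k a) * IJ k a))" for k
    proof -
      have "of_nat k * duh_integrand \<mu> x k s = cis (eigenval k * s) * R k s
          - (\<Sum>a\<in>S. complex_of_real (w k a) * (cis (eigenval k * s) * J a s))" for s
        by (simp add: duh_integrand_def R_def reg_coeff_def J_def w_def y_def pot_def sum_distrib_left algebra_simps)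
      then have eq: "of_nat k * (complex_of_real (u s) * duh_integrand \<mu> x k s) = complex_of_real (u s) * (cis (eigenval k * s) * R k s)
          - (\<Sum>a\<in>S. complex_of_real (w k a) * (complex_of_real (u s) * (cis (eigenval k * s) * J a s)))" for s
        by (simp add: mult.left_commute[of "of_nat k"] right_diff_distrib sum_distrib_left mult_ac)
      have "duh_coeff \<mu> u x r t k = - \<i> * integral\<^sup>L ?M (\<lambda>s. of_nat k * (complex_of_real (u s) * duh_integrand \<mu> x k s))"
        by (simp add: duh_coeff_def)
      also have "integral\<^sup>L ?M (\<lambda>s. of_nat k * (complex_of_real (u s) * duh_integrand \<mu> x k s)) =
          IR k - (\<Sum>a\<in>S. complex_of_real (w k a) * IJ k a)"
        unfolding eq IR_def IJ_def
        using control_mult_integrable(1)[OF u cR'] control_mult_integrable(1)[OF u continuous_on_mult[OF _ cJ], of "\<lambda>s. cis (eigenval k * s)"]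
        by (simp add: continuous_intros)
      finally show ?thesis .
    qed
    \<comment> \<open>The oscillating weight \<open>cosf k a / pi\<close> has modulus at most 1,
      since \<open>sqrt 2 \<le> pi\<close>; its dependence on \<open>k\<close> is thereby
      discarded.\<close>
    have w_le: "\<bar>w k a\<bar> \<le> \<bar>c a\<bar>" for k a
    proof -
      have "sqrt 2 \<le> pi" using pi_gt3 real_le_lsqrt[of 2 2] by simp
      then have "\<bar>cosf k a\<bar> \<le> pi" using cosf_bound[of k a] by linarith
      then have "\<bar>c a\<bar> * \<bar>cosf k a\<bar> \<le> \<bar>c a\<bar> * pi" by (intro mult_left_mono) auto
      then show ?thesis by (simp add: w_def abs_mult pos_divide_le_eq)
    qed
    have pk: "(cmod (duh_coeff \<mu> u x r t k))\<^sup>2 \<le> 2 * (cmod (IR k))\<^sup>2 + 2 * (W * (\<Sum>a\<in>S. (cmod (IJ k a))\<^sup>2))" for k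
    proof -
      have "(cmod (duh_coeff \<mu> u x r t k))\<^sup>2 \<le> 2 * (cmod (IR k))\<^sup>2 + 2 * (cmod (\<Sum>a\<in>S. complex_of_real (w k a) * IJ k a))\<^sup>2"
        unfolding duh using power2_norm_diff_le by (simp add: norm_mult)
      also have "(cmod (\<Sum>a\<in>S. complex_of_real (w k a) * IJ k a))\<^sup>2 \<le> (\<Sum>a\<in>S. \<bar>c a\<bar> * cmod (IJ k a))\<^sup>2"
        by (intro power_mono sum_norm_le norm_ge_zero) (auto simp: norm_mult intro!: mult_right_mono w_le)
      also have "\<dots> \<le> W * (\<Sum>a\<in>S. (cmod (IJ k a))\<^sup>2)"
        using power2_sum_le_card[of "\<lambda>a. \<bar>c a\<bar>" "\<lambda>a. cmod (IJ k a)" S] by (simp add: W_def)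
      finally show ?thesis by simp
    qed
    have sumR: "(\<Sum>k\<in>K. (cmod (IR k))\<^sup>2) \<le> T * C\<^sup>2 * E"
    proof -
      have "(\<Sum>k\<in>K. (cmod (IR k))\<^sup>2) \<le> (\<Sum>k\<in>K. (t - r) * integral\<^sup>L ?M (\<lambda>s. (u s)\<^sup>2 * (cmod (R k s))\<^sup>2))"
        unfolding IR_def
        by (intro sum_mono order_trans[OF control_mult_integral_square[OF u cR' rt(2)]]) (simp add: norm_mult)
      also have "\<dots> = (t - r) * integral\<^sup>L ?M (\<lambda>s. \<Sum>k\<in>K. (u s)\<^sup>2 * (cmod (R k s))\<^sup>2)"
        using control_mult_integrable(2)[OF u cR] by (simp add: sum_distrib_left)
      also have "\<dots> \<le> (t - r) * integral\<^sup>L ?M (\<lambda>s. C\<^sup>2 * ((u s)\<^sup>2 * (norm (x s))\<^sup>2))"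
      proof (intro mult_left_mono integral_mono)
        show "(\<Sum>k\<in>K. (u s)\<^sup>2 * (cmod (R k s))\<^sup>2) \<le> C\<^sup>2 * ((u s)\<^sup>2 * (norm (x s))\<^sup>2)" for s
          using mult_left_mono[OF C(2)[OF K, of "y s"], of "(u s)\<^sup>2"]
          by (simp add: R_def ny sum_distrib_left power_mult_distrib mult_ac)
      qed (use iE control_mult_integrable(2)[OF u cR] rt in auto)
      also have "\<dots> = (t - r) * (C\<^sup>2 * E)" by (simp add: E_def)
      also have "\<dots> \<le> T * (C\<^sup>2 * E)"
        using rt by (intro mult_right_mono) (auto simp: E_def integral_nonneg_AE)
      finally show ?thesis by simp
    qed
    have sumJ: "(\<Sum>k\<in>K. (cmod (IJ k a))\<^sup>2) \<le> L * 4 * E" for a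
    proof -
      have "(\<Sum>k\<in>K. (cmod (IJ k a))\<^sup>2) \<le> L * integral\<^sup>L ?M (\<lambda>s. (u s)\<^sup>2 * (cmod (J a s))\<^sup>2)"
        unfolding IJ_def L_def
        by (rule control_Bessel[OF u cJ rt(1) _ n1 K(1)]) (use rt TL in \<open>simp add: L_def\<close>)
      also have "\<dots> \<le> L * integral\<^sup>L ?M (\<lambda>s. 4 * ((u s)\<^sup>2 * (norm (x s))\<^sup>2))"
      proof (intro mult_left_mono integral_mono)
        fix s
        have "cmod (J a s) \<le> 2 * norm (x s)"
          unfolding J_def using cinner_L2_Cauchy_Schwarz[of "y s" "eval_at a"] mult_left_mono[OF norm_eval_at[of a] norm_ge_zero[of "y s"]]
          by (simp add: ny)
        then have "(cmod (J a s))\<^sup>2 \<le> 4 * (norm (x s))\<^sup>2"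
          using power_mono[of "cmod (J a s)" "2 * norm (x s)" 2] by (simp add: power_mult_distrib)
        from mult_left_mono[OF this, of "(u s)\<^sup>2"]
        show "(u s)\<^sup>2 * (cmod (J a s))\<^sup>2 \<le> 4 * ((u s)\<^sup>2 * (norm (x s))\<^sup>2)" by simp
      qed (use iE control_mult_integrable(2)[OF u cJ] L0 in auto)
      finally show ?thesis by (simp add: E_def)
    qed
    have "(\<Sum>k\<in>K. (cmod (duh_coeff \<mu> u x r t k))\<^sup>2) \<le>
        (\<Sum>k\<in>K. 2 * (cmod (IR k))\<^sup>2 + 2 * (W * (\<Sum>a\<in>S. (cmod (IJ k a))\<^sup>2)))"
      by (intro sum_mono pk)
    also have "\<dots> = 2 * (\<Sum>k\<in>K. (cmod (IR k))\<^sup>2) + 2 * (W * (\<Sum>a\<in>S. \<Sum>k\<in>K. (cmod (IJ k a))\<^sup>2))"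
      by (simp add: sum.distrib sum_distrib_left) (rule sum.swap)
    also have "\<dots> \<le> 2 * (T * C\<^sup>2 * E) + 2 * (W * (\<Sum>a\<in>S. L * 4 * E))"
      by (intro add_mono mult_left_mono sum_mono sumR sumJ) (use W0 in auto)
    also have "\<dots> = \<kappa> * E" by (simp add: \<kappa>_def algebra_simps)
    finally show ?thesis by (simp add: E_def)
  qed
  ultimately show thesis by (rule that)
qed

section \<open>Well-posedness in the interaction picture\<close>

text \<open>Split the squared control at a level \<open>N\<close>. The part above has small integral
  by dominated convergence and is paired with the largest weight; the part below is at most
  \<open>N\<close>, and integrating the weight over it gains
  \<open>1 / (2 * \<gamma>)\<close>.\<close>

lemma control_weight:
  fixes u :: "real \<Rightarrow> real"
  assumes u: "u sq_integrable_on UNIV" and "\<epsilon> > 0"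
  obtains \<gamma> where "\<gamma> > 0" "\<And>t. t \<in> {0..T} \<Longrightarrow>
    integral\<^sup>L (lebesgue_on {0..t}) (\<lambda>s. (u s)\<^sup>2 * (exp (\<gamma> * s))\<^sup>2) \<le> \<epsilon> * (exp (\<gamma> * t))\<^sup>2"
proof -
  note i2 = control_integrable(2)[OF u]
  let ?M = "lebesgue_on {0..T}"
  have "(\<lambda>n. integral\<^sup>L ?M (\<lambda>s. max 0 ((u s)\<^sup>2 - real n))) \<longlonglongrightarrow> integral\<^sup>L ?M (\<lambda>s. 0::real)"
  proof (rule integral_dominated_convergence[where w = "\<lambda>s. (u s)\<^sup>2"])
    have [measurable]: "(\<lambda>s. (u s)\<^sup>2) \<in> borel_measurable ?M" using i2 by auto
    show "(\<lambda>s. max 0 ((u s)\<^sup>2 - real n)) \<in> borel_measurable ?M" for n by measurable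
    show "AE s in ?M. (\<lambda>n. max 0 ((u s)\<^sup>2 - real n)) \<longlonglongrightarrow> 0"
    proof (rule AE_I2)
      fix s
      obtain N where N: "(u s)\<^sup>2 \<le> real N" using real_arch_simple by blast
      have "eventually (\<lambda>n. max 0 ((u s)\<^sup>2 - real n) = 0) sequentially"
        using eventually_ge_at_top[of N] by eventually_elim (use N in auto)
      then show "(\<lambda>n. max 0 ((u s)\<^sup>2 - real n)) \<longlonglongrightarrow> 0" by (rule tendsto_eventually)
    qed
  qed (use i2 in auto)
  from order_tendstoD(2)[OF this, of "\<epsilon> / 2"] assms(2)
  obtain N where N: "integral\<^sup>L ?M (\<lambda>s. max 0 ((u s)\<^sup>2 - real N)) < \<epsilon> / 2"
    by (auto simp: eventually_sequentially)
  \<comment> \<open>Makes \<open>N / (2 * \<gamma>)\<close> at most \<open>\<epsilon> / 2\<close>;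
    the added 1 keeps \<gamma> positive when \<open>N\<close> is 0.\<close>
  define \<gamma> where "\<gamma> = real N / \<epsilon> + 1"
  have \<gamma>: "\<gamma> > 0" using assms(2) by (simp add: \<gamma>_def add_nonneg_pos)
  have N\<gamma>: "real N / (2 * \<gamma>) \<le> \<epsilon> / 2"
  proof -
    have "real N \<le> \<gamma> * \<epsilon>" using assms(2) by (simp add: \<gamma>_def field_simps)
    then show ?thesis using \<gamma> by (simp add: field_simps)
  qed
  show thesis
  proof (rule that[OF \<gamma>])
    fix t assume t: "t \<in> {0..T}"
    let ?I = "lebesgue_on {0..t}"
    have im: "integrable (lebesgue_on {0..\<tau>}) (\<lambda>s. max 0 ((u s)\<^sup>2 - real N))" for \<tau>
    proof (rule Bochner_Integration.integrable_bound[OF i2[of 0 \<tau>]])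
      have [measurable]: "(\<lambda>s. (u s)\<^sup>2) \<in> borel_measurable (lebesgue_on {0..\<tau>})" using i2 by auto
      show "(\<lambda>s. max 0 ((u s)\<^sup>2 - real N)) \<in> borel_measurable (lebesgue_on {0..\<tau>})" by measurable
    qed auto
    have ie: "integrable ?I (\<lambda>s. real N * (exp (\<gamma> * s))\<^sup>2)"
      by (intro continuous_imp_integrable_real continuous_intros)
    have "integral\<^sup>L ?I (\<lambda>s. (u s)\<^sup>2 * (exp (\<gamma> * s))\<^sup>2) \<le>
        integral\<^sup>L ?I (\<lambda>s. max 0 ((u s)\<^sup>2 - real N) * (exp (\<gamma> * t))\<^sup>2 + real N * (exp (\<gamma> * s))\<^sup>2)"
    proof (rule integral_mono)
      show "integrable ?I (\<lambda>s. (u s)\<^sup>2 * (exp (\<gamma> * s))\<^sup>2)"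
        by (intro integrable_Icc_continuous_mult i2 continuous_intros)
      show "integrable ?I (\<lambda>s. max 0 ((u s)\<^sup>2 - real N) * (exp (\<gamma> * t))\<^sup>2 + real N * (exp (\<gamma> * s))\<^sup>2)"
        using im ie by (intro Bochner_Integration.integrable_add integrable_mult_left) auto
      show "(u s)\<^sup>2 * (exp (\<gamma> * s))\<^sup>2 \<le> max 0 ((u s)\<^sup>2 - real N) * (exp (\<gamma> * t))\<^sup>2 + real N * (exp (\<gamma> * s))\<^sup>2"
        if "s \<in> space ?I" for s
      proof -
        have "(exp (\<gamma> * s))\<^sup>2 \<le> (exp (\<gamma> * t))\<^sup>2" using that \<gamma> by (intro power_mono) auto
        then have "max 0 ((u s)\<^sup>2 - real N) * (exp (\<gamma> * s))\<^sup>2 \<le> max 0 ((u s)\<^sup>2 - real N) * (exp (\<gamma> * t))\<^sup>2"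
          by (intro mult_left_mono) auto
        moreover have "(u s)\<^sup>2 * (exp (\<gamma> * s))\<^sup>2 \<le> (max 0 ((u s)\<^sup>2 - real N) + real N) * (exp (\<gamma> * s))\<^sup>2"
          by (intro mult_right_mono) auto
        ultimately show ?thesis by (simp add: distrib_right)
      qed
    qed
    also have "\<dots> = integral\<^sup>L ?I (\<lambda>s. max 0 ((u s)\<^sup>2 - real N)) * (exp (\<gamma> * t))\<^sup>2 + integral\<^sup>L ?I (\<lambda>s. real N * (exp (\<gamma> * s))\<^sup>2)"
      using im ie by (subst Bochner_Integration.integral_add) auto
    also have "\<dots> \<le> (\<epsilon> / 2) * (exp (\<gamma> * t))\<^sup>2 + (\<epsilon> / 2) * (exp (\<gamma> * t))\<^sup>2"
    proof (rule add_mono)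
      have "integral\<^sup>L ?I (\<lambda>s. max 0 ((u s)\<^sup>2 - real N)) \<le> integral\<^sup>L ?M (\<lambda>s. max 0 ((u s)\<^sup>2 - real N))"
        using integral_combine[OF im[of T], of t] t by (simp add: integral_nonneg_AE)
      then show "integral\<^sup>L ?I (\<lambda>s. max 0 ((u s)\<^sup>2 - real N)) * (exp (\<gamma> * t))\<^sup>2 \<le> (\<epsilon> / 2) * (exp (\<gamma> * t))\<^sup>2"
        using N by (intro mult_right_mono) auto
      have "integral\<^sup>L (lebesgue_on {0<..<t}) (\<lambda>s. real N * (exp (\<gamma> * s))\<^sup>2) =
          real N * (exp (\<gamma> * t))\<^sup>2 / (2 * \<gamma>) - real N * (exp (\<gamma> * 0))\<^sup>2 / (2 * \<gamma>)"
        by (rule integral_lebesgue_on_FTC(2))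
          (use t \<gamma> in \<open>auto intro!: continuous_intros derivative_eq_intros
            simp: power2_eq_square field_simps simp flip: has_real_derivative_iff_has_vector_derivative\<close>)
      also have "\<dots> \<le> real N / (2 * \<gamma>) * (exp (\<gamma> * t))\<^sup>2" using \<gamma> by simp
      also have "\<dots> \<le> (\<epsilon> / 2) * (exp (\<gamma> * t))\<^sup>2" by (intro mult_right_mono N\<gamma>) auto
      finally show "integral\<^sup>L ?I (\<lambda>s. real N * (exp (\<gamma> * s))\<^sup>2) \<le> (\<epsilon> / 2) * (exp (\<gamma> * t))\<^sup>2"
        by (simp add: lebesgue_on_Ioo_Icc)
    qed
    also have "\<dots> = \<epsilon> * (exp (\<gamma> * t))\<^sup>2" by simp
    finally show "integral\<^sup>L ?I (\<lambda>s. (u s)\<^sup>2 * (exp (\<gamma> * s))\<^sup>2) \<le> \<epsilon> * (exp (\<gamma> * t))\<^sup>2" .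
  qed
qed

definition duh :: "(real \<Rightarrow> real) \<Rightarrow> (real \<Rightarrow> real) \<Rightarrow> (real \<Rightarrow> L2) \<Rightarrow> real \<Rightarrow> real \<Rightarrow> L2" where
  "duh \<mu> u x r t = (\<Sum>\<^sub>\<infinity>k\<in>{1..}. duh_coeff \<mu> u x r t k *\<^sub>C phi k)"

text \<open>From here on the piecewise regularity of \<mu> enters only through these facts:
  multiplication by \<mu> is bounded, and the Duhamel coefficients satisfy the gain of one
  derivative with a constant independent of control and trajectory.\<close>

locale control_system =
  fixes \<mu> :: "real \<Rightarrow> real" and T B \<kappa> :: real
  assumes ess: "ess_bounded B \<mu>" and T_pos: "0 < T" and \<kappa>_nonneg: "0 \<le> \<kappa>"
    and duh_coeff_le: "u sq_integrable_on UNIV \<Longrightarrow> continuous_on {0..T} x \<Longrightarrow>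
      0 \<le> r \<Longrightarrow> r \<le> t \<Longrightarrow> t \<le> T \<Longrightarrow> finite K \<Longrightarrow> K \<subseteq> {1..} \<Longrightarrow>
      (\<Sum>k\<in>K. (cmod (duh_coeff \<mu> u x r t k))\<^sup>2) \<le>
        \<kappa> * integral\<^sup>L (lebesgue_on {r..t}) (\<lambda>s. (u s)\<^sup>2 * (norm (x s))\<^sup>2)"
begin

definition solution :: "(real \<Rightarrow> real) \<Rightarrow> L2 \<Rightarrow> (real \<Rightarrow> L2) \<Rightarrow> bool" where
  "solution u x0 x \<longleftrightarrow> continuous_on {0..T} x \<and> (\<forall>t\<in>{0..T}. x t = x0 + duh \<mu> u x 0 t)"

section \<open>Estimates for the Duhamel increment of a continuous curve\<close>

context
  fixes u :: "real \<Rightarrow> real" and x :: "real \<Rightarrow> L2"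
  assumes u: "u sq_integrable_on UNIV" and x: "continuous_on {0..T} x"
begin

lemma duh_summable:
  assumes "0 \<le> r" "r \<le> t" "t \<le> T"
  shows "(\<lambda>k. (cmod (duh_coeff \<mu> u x r t k))\<^sup>2) summable_on {1..}"
    and "(\<Sum>\<^sub>\<infinity>k\<in>{1..}. (cmod (duh_coeff \<mu> u x r t k))\<^sup>2) \<le>
      \<kappa> * integral\<^sup>L (lebesgue_on {r..t}) (\<lambda>s. (u s)\<^sup>2 * (norm (x s))\<^sup>2)"
  using nonneg_summable_on_bounded[of "{1..}" "\<lambda>k. (cmod (duh_coeff \<mu> u x r t k))\<^sup>2", OF _ duh_coeff_le[OF u x assms]]
  by auto

lemma cinner_duh:
  assumes "0 \<le> r" "r \<le> t" "t \<le> T" "k \<ge> 1"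
  shows "cinner_L2 (duh \<mu> u x r t) (phi k) = duh_coeff \<mu> u x r t k"
  unfolding duh_def using assms
  by (intro orthonormal_Riesz_Fischer(2)[OF orthonormal_phi] duh_summable) auto

lemma norm_duh_square:
  assumes "0 \<le> r" "r \<le> t" "t \<le> T"
  shows "(norm (duh \<mu> u x r t))\<^sup>2 \<le> \<kappa> * integral\<^sup>L (lebesgue_on {r..t}) (\<lambda>s. (u s)\<^sup>2 * (norm (x s))\<^sup>2)"
  unfolding duh_def orthonormal_Riesz_Fischer(3)[OF orthonormal_phi duh_summable(1)[OF assms]]
  by (rule duh_summable(2)[OF assms])

lemma continuous_on_sub: "0 \<le> r \<Longrightarrow> t \<le> T \<Longrightarrow> continuous_on {r..t} x"
  by (rule continuous_on_subset[OF x]) auto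

lemma integrable_duh_integrand:
  assumes "0 \<le> r" "t \<le> T"
  shows "integrable (lebesgue_on {r..t}) (\<lambda>s. complex_of_real (u s) * duh_integrand \<mu> x k s)"
  by (intro control_mult_integrable(1) u continuous_on_duh_integrand[OF ess] continuous_on_sub assms)

lemma integrable_energy:
  assumes "0 \<le> r" "t \<le> T"
  shows "integrable (lebesgue_on {r..t}) (\<lambda>s. (u s)\<^sup>2 * (norm (x s))\<^sup>2)"
  by (intro integrable_Icc_continuous_mult control_integrable u continuous_intros continuous_on_sub assms)

lemma norm_duh_le:
  assumes "0 \<le> r" "r \<le> t" "t \<le> T" "\<And>s. s \<in> {r..t} \<Longrightarrow> norm (x s) \<le> M"
  shows "norm (duh \<mu> u x r t) \<le> sqrt \<kappa> * M * sqrt (integral\<^sup>L (lebesgue_on {r..t}) (\<lambda>s. (u s)\<^sup>2))"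
proof -
  have M: "0 \<le> M" using assms(4)[of r] assms(2) order_trans[OF norm_ge_zero] by fastforce
  have "integral\<^sup>L (lebesgue_on {r..t}) (\<lambda>s. (u s)\<^sup>2 * (norm (x s))\<^sup>2) \<le> integral\<^sup>L (lebesgue_on {r..t}) (\<lambda>s. (u s)\<^sup>2 * M\<^sup>2)"
    by (intro integral_mono integrable_energy integrable_mult_left control_integrable u mult_left_mono power_mono)
      (use assms in auto)
  then have "(norm (duh \<mu> u x r t))\<^sup>2 \<le> \<kappa> * (integral\<^sup>L (lebesgue_on {r..t}) (\<lambda>s. (u s)\<^sup>2) * M\<^sup>2)"
    using norm_duh_square[OF assms(1-3)] mult_left_mono[OF _ \<kappa>_nonneg] by fastforce
  also have "\<dots> = (sqrt \<kappa> * M * sqrt (integral\<^sup>L (lebesgue_on {r..t}) (\<lambda>s. (u s)\<^sup>2)))\<^sup>2"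
    using \<kappa>_nonneg by (simp add: power_mult_distrib integral_nonneg_AE)
  finally show ?thesis
    by (rule power2_le_imp_le) (use M \<kappa>_nonneg in \<open>auto simp: integral_nonneg_AE\<close>)
qed

lemma duh_add:
  assumes "0 \<le> r" "r \<le> t" "t \<le> T"
  shows "duh \<mu> u x 0 t = duh \<mu> u x 0 r + duh \<mu> u x r t"
proof (rule L2_eqI)
  fix k :: nat assume k: "k \<ge> 1"
  have "integral\<^sup>L (lebesgue_on {0..t}) (\<lambda>s. complex_of_real (u s) * duh_integrand \<mu> x k s) =
      integral\<^sup>L (lebesgue_on {0..r}) (\<lambda>s. complex_of_real (u s) * duh_integrand \<mu> x k s) +
      integral\<^sup>L (lebesgue_on {r..t}) (\<lambda>s. complex_of_real (u s) * duh_integrand \<mu> x k s)"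
    by (rule integral_combine[OF integrable_duh_integrand]) (use assms in auto)
  then have "duh_coeff \<mu> u x 0 t k = duh_coeff \<mu> u x 0 r k + duh_coeff \<mu> u x r t k"
    by (simp add: duh_coeff_def algebra_simps)
  then show "cinner_L2 (duh \<mu> u x 0 t) (phi k) = cinner_L2 (duh \<mu> u x 0 r + duh \<mu> u x r t) (phi k)"
    using assms k by (simp add: cinner_L2_add_left cinner_duh)
qed

text \<open>The increment over \<open>{r..t}\<close> is bounded by the square root of the energy of
  the control there, and the energy \<open>V\<close> is a continuous function of its end
  point.\<close>

lemma continuous_on_duh: "continuous_on {0..T} (\<lambda>t. duh \<mu> u x 0 t)"
proof -
  have "bounded (x ` {0..T})" by (intro compact_imp_bounded compact_continuous_image x) auto
  then obtain M where M: "\<And>s. s \<in> {0..T} \<Longrightarrow> norm (x s) \<le> M" unfolding bounded_iff by blast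
  define V where "V t = integral\<^sup>L (lebesgue_on {0..t}) (\<lambda>s. (u s)\<^sup>2)" for t
  have V: "continuous_on {0..T} V"
    unfolding V_def by (rule indefinite_integral_continuous_real) (rule control_integrable[OF u])
  have le: "norm (duh \<mu> u x 0 t - duh \<mu> u x 0 r) \<le> sqrt \<kappa> * M * sqrt \<bar>V t - V r\<bar>"
    if "0 \<le> r" "r \<le> t" "t \<le> T" for r t
  proof -
    have "V t = V r + integral\<^sup>L (lebesgue_on {r..t}) (\<lambda>s. (u s)\<^sup>2)"
      unfolding V_def by (rule integral_combine[OF control_integrable(2)[OF u]]) (use that in auto)
    then have "\<bar>V t - V r\<bar> = integral\<^sup>L (lebesgue_on {r..t}) (\<lambda>s. (u s)\<^sup>2)" by (simp add: integral_nonneg_AE)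
    moreover have "norm (duh \<mu> u x r t) \<le> sqrt \<kappa> * M * sqrt (integral\<^sup>L (lebesgue_on {r..t}) (\<lambda>s. (u s)\<^sup>2))"
      by (rule norm_duh_le[OF that]) (use M that in auto)
    ultimately show ?thesis using duh_add[OF that] by simp
  qed
  show ?thesis
    unfolding continuous_on_def
  proof
    fix t assume t: "t \<in> {0..T}"
    show "((\<lambda>t. duh \<mu> u x 0 t) \<longlongrightarrow> duh \<mu> u x 0 t) (at t within {0..T})"
    proof (rule LIM_zero_cancel, rule Lim_null_comparison)
      show "\<forall>\<^sub>F r in at t within {0..T}. norm (duh \<mu> u x 0 r - duh \<mu> u x 0 t) \<le> sqrt \<kappa> * M * sqrt \<bar>V r - V t\<bar>"
        unfolding eventually_at_filter
      proof (intro always_eventually allI impI)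
        fix r assume "r \<in> {0..T}"
        then show "norm (duh \<mu> u x 0 r - duh \<mu> u x 0 t) \<le> sqrt \<kappa> * M * sqrt \<bar>V r - V t\<bar>"
          using le[of r t] le[of t r] t by (cases "r \<le> t") (auto simp: norm_minus_commute abs_minus_commute)
      qed
      have "((\<lambda>r. sqrt \<kappa> * M * sqrt \<bar>V r - V t\<bar>) \<longlongrightarrow> sqrt \<kappa> * M * sqrt \<bar>V t - V t\<bar>) (at t within {0..T})"
        using V t by (intro tendsto_intros) (auto simp: continuous_on_def)
      then show "((\<lambda>r. sqrt \<kappa> * M * sqrt \<bar>V r - V t\<bar>) \<longlongrightarrow> 0) (at t within {0..T})" by simp
    qed
  qed
qed

end

section \<open>Linearity in trajectory and control, contraction, well-posedness\<close>

lemma duh_integrand_diff: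
  "duh_integrand \<mu> (\<lambda>s. x s - y s) k s = duh_integrand \<mu> x k s - duh_integrand \<mu> y k s"
  unfolding duh_integrand_def pot_def
  by (simp add: linear_diff[OF bounded_linear.linear, OF bounded_linear_schroedinger] linear_diff[OF bounded_linear.linear, OF bounded_linear_mult_Linv[OF ess]]
      cinner_L2_diff_left algebra_simps)

lemma duh_diff:
  assumes "u sq_integrable_on UNIV" "continuous_on {0..T} x" "continuous_on {0..T} y" "0 \<le> r" "r \<le> t" "t \<le> T"
  shows "duh \<mu> u x r t - duh \<mu> u y r t = duh \<mu> u (\<lambda>s. x s - y s) r t"
proof (rule L2_eqI)
  fix k :: nat assume k: "k \<ge> 1"
  note c = continuous_on_diff[OF assms(2,3)]
  have "duh_coeff \<mu> u (\<lambda>s. x s - y s) r t k = duh_coeff \<mu> u x r t k - duh_coeff \<mu> u y r t k"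
    using integrable_duh_integrand[OF assms(1,2,4,6), of k] integrable_duh_integrand[OF assms(1,3,4,6), of k]
    unfolding duh_coeff_def duh_integrand_diff right_diff_distrib
    by (subst Bochner_Integration.integral_diff) (auto simp: algebra_simps)
  then show "cinner_L2 (duh \<mu> u x r t - duh \<mu> u y r t) (phi k) = cinner_L2 (duh \<mu> u (\<lambda>s. x s - y s) r t) (phi k)"
    using assms k by (simp add: cinner_L2_diff_left cinner_duh c)
qed

lemma duh_diff_control:
  assumes "u sq_integrable_on UNIV" "v sq_integrable_on UNIV" "(\<lambda>s. u s - v s) sq_integrable_on UNIV"
    "continuous_on {0..T} x" "0 \<le> r" "r \<le> t" "t \<le> T"
  shows "duh \<mu> u x r t - duh \<mu> v x r t = duh \<mu> (\<lambda>s. u s - v s) x r t"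
proof (rule L2_eqI)
  fix k :: nat assume k: "k \<ge> 1"
  have "duh_coeff \<mu> (\<lambda>s. u s - v s) x r t k = duh_coeff \<mu> u x r t k - duh_coeff \<mu> v x r t k"
    using integrable_duh_integrand[OF assms(1,4,5,7), of k] integrable_duh_integrand[OF assms(2,4,5,7), of k]
    unfolding duh_coeff_def of_real_diff left_diff_distrib
    by (subst Bochner_Integration.integral_diff) (auto simp: algebra_simps)
  then show "cinner_L2 (duh \<mu> u x r t - duh \<mu> v x r t) (phi k) = cinner_L2 (duh \<mu> (\<lambda>s. u s - v s) x r t) (phi k)"
    using assms k by (simp add: cinner_L2_diff_left cinner_duh)
qed

text \<open>The exponential weight makes the Duhamel term a contraction on the whole interval for a
  control of any size; \<gamma> depends on \<open>u\<close> itself and not only on its norm, as it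
  measures how concentrated the energy is.\<close>

lemma weighted_contraction:
  assumes u: "u sq_integrable_on UNIV"
  shows "\<exists>\<gamma>>0. \<forall>x m t. continuous_on {0..T} x \<longrightarrow> t \<in> {0..T} \<longrightarrow>
    (\<forall>s\<in>{0..t}. norm (x s) \<le> m * exp (\<gamma> * s)) \<longrightarrow> norm (duh \<mu> u x 0 t) \<le> m / 2 * exp (\<gamma> * t)"
proof -
  \<comment> \<open>Gives \<open>\<kappa> * \<epsilon> \<le> 1 / 4\<close>, the square of the
    contraction factor.\<close>
  define \<epsilon> where "\<epsilon> = 1 / (4 * (\<kappa> + 1))"
  have e: "\<epsilon> > 0" and \<kappa>e: "\<kappa> * \<epsilon> \<le> 1 / 4" using \<kappa>_nonneg by (auto simp: \<epsilon>_def field_simps)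
  obtain \<gamma> where \<gamma>: "\<gamma> > 0" "\<And>t. t \<in> {0..T} \<Longrightarrow>
    integral\<^sup>L (lebesgue_on {0..t}) (\<lambda>s. (u s)\<^sup>2 * (exp (\<gamma> * s))\<^sup>2) \<le> \<epsilon> * (exp (\<gamma> * t))\<^sup>2"
    by (rule control_weight[OF u e]) (rule that)
  show ?thesis
  proof (intro exI[of _ \<gamma>] conjI allI impI \<gamma>(1))
    fix x :: "real \<Rightarrow> L2" and m t assume x: "continuous_on {0..T} x" and t: "t \<in> {0..T}"
      and "\<forall>s\<in>{0..t}. norm (x s) \<le> m * exp (\<gamma> * s)"
    then have m: "norm (x s) \<le> m * exp (\<gamma> * s)" if "s \<in> {0..t}" for s using that by blast
    have m0: "0 \<le> m"
      using m[of 0] t order_trans[OF norm_ge_zero[of "x 0"]] by fastforce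
    have "(norm (duh \<mu> u x 0 t))\<^sup>2 \<le> \<kappa> * integral\<^sup>L (lebesgue_on {0..t}) (\<lambda>s. (u s)\<^sup>2 * (norm (x s))\<^sup>2)"
      by (rule norm_duh_square[OF u x]) (use t in auto)
    also have "\<dots> \<le> \<kappa> * integral\<^sup>L (lebesgue_on {0..t}) (\<lambda>s. m\<^sup>2 * ((u s)\<^sup>2 * (exp (\<gamma> * s))\<^sup>2))"
    proof (intro mult_left_mono integral_mono \<kappa>_nonneg)
      show "integrable (lebesgue_on {0..t}) (\<lambda>s. (u s)\<^sup>2 * (norm (x s))\<^sup>2)"
        by (rule integrable_energy[OF u x]) (use t in auto)
      show "integrable (lebesgue_on {0..t}) (\<lambda>s. m\<^sup>2 * ((u s)\<^sup>2 * (exp (\<gamma> * s))\<^sup>2))"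
        by (intro integrable_mult_right integrable_Icc_continuous_mult control_integrable u continuous_intros)
      fix s assume "s \<in> space (lebesgue_on {0..t})"
      then have "(norm (x s))\<^sup>2 \<le> (m * exp (\<gamma> * s))\<^sup>2" by (intro power_mono m) auto
      then have "(u s)\<^sup>2 * (norm (x s))\<^sup>2 \<le> (u s)\<^sup>2 * (m * exp (\<gamma> * s))\<^sup>2" by (intro mult_left_mono) auto
      then show "(u s)\<^sup>2 * (norm (x s))\<^sup>2 \<le> m\<^sup>2 * ((u s)\<^sup>2 * (exp (\<gamma> * s))\<^sup>2)"
        by (simp add: power_mult_distrib mult_ac)
    qed
    also have "\<dots> \<le> \<kappa> * (m\<^sup>2 * (\<epsilon> * (exp (\<gamma> * t))\<^sup>2))"
      using \<gamma>(2)[OF t] \<kappa>_nonneg by (auto intro!: mult_left_mono)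
    also have "\<dots> = (\<kappa> * \<epsilon>) * (m * exp (\<gamma> * t))\<^sup>2" by (simp add: power_mult_distrib)
    also have "\<dots> \<le> (1 / 4) * (m * exp (\<gamma> * t))\<^sup>2" by (intro mult_right_mono \<kappa>e) auto
    also have "\<dots> = (m / 2 * exp (\<gamma> * t))\<^sup>2" by (simp add: power_mult_distrib power_divide)
    finally show "norm (duh \<mu> u x 0 t) \<le> m / 2 * exp (\<gamma> * t)"
      by (rule power2_le_imp_le) (use m0 in auto)
  qed
qed

text \<open>The difference of two solutions is its own Duhamel term; at a time where its weighted
  norm is largest, the contraction estimate bounds it by half of itself.\<close>

lemma solution_unique:
  assumes u: "u sq_integrable_on UNIV" and "solution u x0 x" "solution u x0 y" "t \<in> {0..T}"
  shows "x t = y t"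
proof -
  obtain \<gamma> where \<gamma>: "\<gamma> > 0" "\<And>(x :: real \<Rightarrow> L2) m t. continuous_on {0..T} x \<Longrightarrow> t \<in> {0..T} \<Longrightarrow>
    \<forall>s\<in>{0..t}. norm (x s) \<le> m * exp (\<gamma> * s) \<Longrightarrow> norm (duh \<mu> u x 0 t) \<le> m / 2 * exp (\<gamma> * t)"
    using weighted_contraction[OF u] by blast
  have c: "continuous_on {0..T} x" "continuous_on {0..T} y" using assms by (auto simp: solution_def)
  define d where "d s = x s - y s" for s
  have cd: "continuous_on {0..T} d" unfolding d_def by (intro continuous_intros c)
  have d: "d s = duh \<mu> u d 0 s" if "s \<in> {0..T}" for s
    unfolding d_def using assms(2,3) that duh_diff[OF u c, of 0 s] by (simp add: solution_def)
  have "\<exists>s\<in>{0..T}. \<forall>r\<in>{0..T}. norm (d r) * exp (- \<gamma> * r) \<le> norm (d s) * exp (- \<gamma> * s)"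
    by (rule continuous_attains_sup) (use T_pos in \<open>auto intro!: continuous_intros cd\<close>)
  then obtain s where s: "s \<in> {0..T}" "\<And>r. r \<in> {0..T} \<Longrightarrow> norm (d r) * exp (- \<gamma> * r) \<le> norm (d s) * exp (- \<gamma> * s)"
    by blast
  define m where "m = norm (d s) * exp (- \<gamma> * s)"
  have m: "norm (d r) \<le> m * exp (\<gamma> * r)" if "r \<in> {0..T}" for r
    using s(2)[OF that] by (simp add: m_def exp_minus field_simps)
  have "norm (d s) \<le> m / 2 * exp (\<gamma> * s)"
    unfolding d[OF s(1)] by (rule \<gamma>(2)[OF cd s(1)]) (use m s(1) in auto)
  also have "\<dots> = norm (d s) / 2" by (simp add: m_def exp_minus)
  finally have "m = 0" by (simp add: m_def)
  then show ?thesis using m[OF assms(4)] by (simp add: d_def)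
qed

lemma solution_exists:
  assumes u: "u sq_integrable_on UNIV"
  shows "\<exists>x. solution u x0 x"
proof -
  obtain \<gamma> where \<gamma>: "\<gamma> > 0" "\<And>(x :: real \<Rightarrow> L2) m t. continuous_on {0..T} x \<Longrightarrow> t \<in> {0..T} \<Longrightarrow>
    \<forall>s\<in>{0..t}. norm (x s) \<le> m * exp (\<gamma> * s) \<Longrightarrow> norm (duh \<mu> u x 0 t) \<le> m / 2 * exp (\<gamma> * t)"
    using weighted_contraction[OF u] by blast
  \<comment> \<open>Freezing time outside the interval extends curves to the real line, so that the
    complete space of bounded continuous functions can carry the fixed point argument.\<close>
  define c where "c t = max 0 (min T t)" for t :: real
  have c: "c t \<in> {0..T}" for t using T_pos by (auto simp: c_def)
  have cc: "continuous_on UNIV c" unfolding c_def by (intro continuous_intros)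
  \<comment> \<open>The unknown \<open>z\<close> is the trajectory divided by the weight, so the
    supremum norm of \<open>z\<close> is the weighted norm of the trajectory.\<close>
  define w where "w z s = exp (\<gamma> * s) *\<^sub>R apply_bcontfun z s" for z :: "real \<Rightarrow>\<^sub>C L2" and s
  have cw: "continuous_on S (w z)" for z S
    unfolding w_def by (intro continuous_intros continuous_on_apply_bcontfun)
  define \<Phi>0 where "\<Phi>0 z t = exp (- \<gamma> * c t) *\<^sub>R (x0 + duh \<mu> u (w z) 0 (c t))" for z t
  have "\<Phi>0 z \<in> bcontfun" for z
  proof -
    have c1: "continuous_on {0..T} (\<lambda>t. exp (- \<gamma> * t) *\<^sub>R (x0 + duh \<mu> u (w z) 0 t))" (is "continuous_on _ ?h")
      by (intro continuous_intros continuous_on_duh[OF u cw])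
    have "continuous_on UNIV (\<lambda>t. ?h (c t))"
      by (rule continuous_on_compose2[OF c1 cc]) (use c in auto)
    moreover have "bounded (?h ` {0..T})" by (intro compact_imp_bounded compact_continuous_image c1) auto
    then have "bounded (range (\<lambda>t. ?h (c t)))"
      by (rule bounded_subset) (use c in auto)
    ultimately show ?thesis by (simp add: bcontfun_def \<Phi>0_def)
  qed
  define \<Phi> where "\<Phi> z = Bcontfun (\<Phi>0 z)" for z
  have \<Phi>: "apply_bcontfun (\<Phi> z) = \<Phi>0 z" for z
    unfolding \<Phi>_def by (rule Bcontfun_inverse) fact
  have "\<exists>!z. \<Phi> z = z"
  proof (rule banach_fix_type[where c = "1/2"])
    show "\<forall>z z'. dist (\<Phi> z) (\<Phi> z') \<le> 1 / 2 * dist z z'"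
    proof (intro allI dist_bound)
      fix z z' t
      have d: "norm (w z s - w z' s) \<le> dist z z' * exp (\<gamma> * s)" for s
        using mult_right_mono[OF dist_bounded[of z s z'], of "exp (\<gamma> * s)"]
        by (simp add: w_def dist_norm mult.commute flip: scaleR_diff_right)
      have "dist (apply_bcontfun (\<Phi> z) t) (apply_bcontfun (\<Phi> z') t)
          = exp (- \<gamma> * c t) * norm (duh \<mu> u (w z) 0 (c t) - duh \<mu> u (w z') 0 (c t))"
        by (simp add: \<Phi> \<Phi>0_def dist_norm flip: scaleR_diff_right)
      also have "\<dots> = exp (- \<gamma> * c t) * norm (duh \<mu> u (\<lambda>s. w z s - w z' s) 0 (c t))"
        using c[of t] by (subst duh_diff[OF u cw cw]) auto
      also have "\<dots> \<le> exp (- \<gamma> * c t) * (dist z z' / 2 * exp (\<gamma> * c t))"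
        by (intro mult_left_mono \<gamma>(2) ballI continuous_on_diff cw c d) auto
      also have "\<dots> = 1 / 2 * dist z z'" by (simp add: exp_minus)
      finally show "dist (apply_bcontfun (\<Phi> z) t) (apply_bcontfun (\<Phi> z') t) \<le> 1 / 2 * dist z z'" .
    qed
  qed auto
  then obtain z where z: "\<Phi> z = z" by blast
  have "w z t = x0 + duh \<mu> u (w z) 0 t" if "t \<in> {0..T}" for t
  proof -
    have "c t = t" using that by (auto simp: c_def)
    have "w z t = exp (\<gamma> * t) *\<^sub>R \<Phi>0 z t" by (simp add: w_def flip: \<Phi>) (simp add: z)
    also have "\<dots> = x0 + duh \<mu> u (w z) 0 t" by (simp add: \<Phi>0_def \<open>c t = t\<close> exp_minus)
    finally show ?thesis .
  qed
  then have "solution u x0 (w z)" using cw by (simp add: solution_def)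
  then show ?thesis by blast
qed

text \<open>For a control with this smallness the Duhamel term is at most half of the supremum norm
  and is absorbed on the left. The reference curve \<open>a\<close> is later either the constant
  eigenstate or a second trajectory.\<close>

lemma solution_bound:
  assumes u: "u sq_integrable_on UNIV" and sol: "solution u x0 x"
    and small: "sqrt \<kappa> * sqrt (integral\<^sup>L (lebesgue_on {0..T}) (\<lambda>s. (u s)\<^sup>2)) \<le> 1 / 2"
    and y: "\<And>t. t \<in> {0..T} \<Longrightarrow> x t - a t = b t + duh \<mu> u (\<lambda>s. x s - a s) 0 t"
    and a: "continuous_on {0..T} a" and b: "\<And>t. t \<in> {0..T} \<Longrightarrow> norm (b t) \<le> \<beta>"
    and t: "t \<in> {0..T}"
  shows "norm (x t - a t) \<le> 2 * \<beta>"
proof -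
  have x: "continuous_on {0..T} x" using sol by (simp add: solution_def)
  define d where "d s = x s - a s" for s
  have cd: "continuous_on {0..T} d" unfolding d_def by (intro continuous_intros x a)
  have "\<exists>s\<in>{0..T}. \<forall>r\<in>{0..T}. norm (d r) \<le> norm (d s)"
    by (rule continuous_attains_sup) (use T_pos in \<open>auto intro!: continuous_intros cd\<close>)
  then obtain s where s: "s \<in> {0..T}" "\<And>r. r \<in> {0..T} \<Longrightarrow> norm (d r) \<le> norm (d s)" by blast
  define q where "q = sqrt \<kappa> * sqrt (integral\<^sup>L (lebesgue_on {0..T}) (\<lambda>s. (u s)\<^sup>2))"
  have mono: "integral\<^sup>L (lebesgue_on {0..s}) (\<lambda>s. (u s)\<^sup>2) \<le> integral\<^sup>L (lebesgue_on {0..T}) (\<lambda>s. (u s)\<^sup>2)"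
    using integral_combine[OF control_integrable(2)[OF u, of 0 T], of s] s(1) by (simp add: integral_nonneg_AE)
  have "norm (duh \<mu> u d 0 s) \<le> sqrt \<kappa> * norm (d s) * sqrt (integral\<^sup>L (lebesgue_on {0..s}) (\<lambda>s. (u s)\<^sup>2))"
    by (rule norm_duh_le[OF u cd]) (use s in auto)
  also have "\<dots> \<le> sqrt \<kappa> * norm (d s) * sqrt (integral\<^sup>L (lebesgue_on {0..T}) (\<lambda>s. (u s)\<^sup>2))"
    using mono \<kappa>_nonneg by (intro mult_left_mono) auto
  also have "\<dots> = q * norm (d s)" by (simp add: q_def)
  also have "\<dots> \<le> 1 / 2 * norm (d s)" using small by (intro mult_right_mono) (auto simp: q_def)
  finally have "norm (d s) \<le> \<beta> + 1 / 2 * norm (d s)"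
    using y[OF s(1)] b[OF s(1)] norm_triangle_ineq[of "b s" "duh \<mu> u d 0 s"] by (simp add: d_def[abs_def])
  then show ?thesis using s(2)[OF t] by (simp add: d_def)
qed

section \<open>Conservation of the L2 norm\<close>

lemma has_sum_cinner:
  "((\<lambda>k. cinner_L2 f (phi k) * cnj (cinner_L2 g (phi k))) has_sum cinner_L2 f g) {1..}"
  using has_sum_bounded_linear[OF bounded_bilinear.bounded_linear_right[OF bounded_bilinear_cinner_L2] has_sum_phi, of f g]
  by (simp add: cinner_L2_scaleC_right mult.commute)

lemma cinner_schroedinger_adjoint: "cinner_L2 (schroedinger (- s) f) g = cinner_L2 f (schroedinger s g)"
proof -
  have "((\<lambda>k. cinner_L2 (schroedinger (- s) f) (phi k) * cnj (cinner_L2 g (phi k))) has_sum cinner_L2 f (schroedinger s g)) {1..}"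
    by (rule has_sum_cong[THEN iffD1, OF _ has_sum_cinner]) (simp add: cinner_schroedinger cis_cnj mult_ac)
  then show ?thesis using has_sum_cinner has_sum_unique by blast
qed

lemma integrable_control_scaleR:
  fixes g :: "real \<Rightarrow> L2"
  assumes "integrable (lebesgue_on {r..t}) u" "continuous_on {r..t} g"
  shows "integrable (lebesgue_on {r..t}) (\<lambda>s. u s *\<^sub>R g s)"
proof -
  have "bounded (g ` {r..t})" by (intro compact_imp_bounded compact_continuous_image assms) auto
  then obtain M where M: "\<And>s. s \<in> {r..t} \<Longrightarrow> norm (g s) \<le> M" unfolding bounded_iff by blast
  have [measurable]: "g \<in> borel_measurable (lebesgue_on {r..t})" "u \<in> borel_measurable (lebesgue_on {r..t})"
    using assms by (auto intro: continuous_imp_measurable_on_sets_lebesgue)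
  show ?thesis
  proof (rule Bochner_Integration.integrable_bound[where f = "\<lambda>s. \<bar>M\<bar> * u s"])
    show "AE s in lebesgue_on {r..t}. norm (u s *\<^sub>R g s) \<le> norm (\<bar>M\<bar> * u s)"
    proof (rule AE_I2)
      fix s assume "s \<in> space (lebesgue_on {r..t})"
      then have "norm (g s) \<le> \<bar>M\<bar>" using M[of s] by auto
      from mult_left_mono[OF this, of "\<bar>u s\<bar>"] show "norm (u s *\<^sub>R g s) \<le> norm (\<bar>M\<bar> * u s)"
        by (simp add: abs_mult mult.commute)
    qed
  qed (use assms in auto)
qed

text \<open>On a partition into equal steps the differences of \<open>V\<close> telescope while each
  carries the square root of the step length, so the total is of order \<open>1 / sqrt n\<close> and
  vanishes under refinement. This replaces showing that the derivative of \<open>N\<close> is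
  0.\<close>

lemma telescope_zero:
  fixes N V :: "real \<Rightarrow> real"
  assumes "t \<ge> 0" "\<And>r s. 0 \<le> r \<Longrightarrow> r \<le> s \<Longrightarrow> s \<le> t \<Longrightarrow> \<bar>N s - N r\<bar> \<le> C * sqrt (s - r) * (V s - V r)"
  shows "N t = N 0"
proof -
  have le: "\<bar>N t - N 0\<bar> \<le> C * sqrt (t / real (Suc n)) * (V t - V 0)" for n
  proof -
    define p where "p i = real i * (t / real (Suc n))" for i
    have p: "p 0 = 0" "p (Suc n) = t" by (auto simp: p_def simp del: of_nat_Suc)
    have p_diff: "p (Suc i) - p i = t / real (Suc n)" for i
      by (simp only: p_def left_diff_distrib[symmetric]) simp
    have "\<bar>N t - N 0\<bar> = \<bar>\<Sum>i<Suc n. N (p (Suc i)) - N (p i)\<bar>"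
      by (simp only: sum_lessThan_telescope[of "\<lambda>i. N (p i)" "Suc n"] p)
    also have "\<dots> \<le> (\<Sum>i<Suc n. \<bar>N (p (Suc i)) - N (p i)\<bar>)" by (rule sum_abs)
    also have "\<dots> \<le> (\<Sum>i<Suc n. C * sqrt (t / real (Suc n)) * (V (p (Suc i)) - V (p i)))"
    proof (rule sum_mono)
      fix i assume i: "i \<in> {..<Suc n}"
      have "p (Suc i) \<le> p (Suc n)" using i assms(1) unfolding p_def by (intro mult_right_mono) auto
      then have le: "p (Suc i) \<le> t" using p by simp
      have ge: "0 \<le> p i" "p i \<le> p (Suc i)" using assms(1) by (auto simp: p_def intro!: divide_right_mono mult_right_mono)
      show "\<bar>N (p (Suc i)) - N (p i)\<bar> \<le> C * sqrt (t / real (Suc n)) * (V (p (Suc i)) - V (p i))"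
        using assms(2)[OF ge le] unfolding p_diff .
    qed
    also have "\<dots> = C * sqrt (t / real (Suc n)) * (V t - V 0)"
      by (simp only: sum_distrib_left[symmetric] sum_lessThan_telescope[of "\<lambda>i. V (p i)" "Suc n"] p)
    finally show ?thesis .
  qed
  have "(\<lambda>n. C * sqrt (t / real (Suc n)) * (V t - V 0)) \<longlonglongrightarrow> C * sqrt 0 * (V t - V 0)"
    by (intro tendsto_intros) (rule LIMSEQ_Suc, rule lim_const_over_n)
  then have "(\<lambda>n. C * sqrt (t / real (Suc n)) * (V t - V 0)) \<longlonglongrightarrow> 0" by simp
  from LIMSEQ_le_const[OF this] le have "\<bar>N t - N 0\<bar> \<le> 0" by blast
  then show ?thesis by simp
qed

text \<open>After applying \<open>Linv\<close> the factor \<open>k\<close> in the coefficients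
  cancels, and the increment becomes an ordinary Bochner integral in \<open>L2\<close>.\<close>

lemma solution_increment:
  assumes u: "u sq_integrable_on UNIV" and sol: "solution u x0 x" and rt: "0 \<le> r" "r \<le> t" "t \<le> T"
  shows "x t - x r = duh \<mu> u x r t"
    "Linv (x t) - Linv (x r) = - (\<i> *\<^sub>C integral\<^sup>L (lebesgue_on {r..t}) (\<lambda>s. u s *\<^sub>R schroedinger (- s) (pot \<mu> s (x s))))"
proof -
  have x: "continuous_on {0..T} x" using sol by (simp add: solution_def)
  have cx: "continuous_on {r..t} x" using continuous_on_sub[OF u x] rt by simp
  have "x t = x0 + duh \<mu> u x 0 t" "x r = x0 + duh \<mu> u x 0 r" using sol rt by (auto simp: solution_def)
  then show eq: "x t - x r = duh \<mu> u x r t" using duh_add[OF u x rt] by simp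
  let ?F = "\<lambda>s. u s *\<^sub>R schroedinger (- s) (pot \<mu> s (x s))"
  have iF: "integrable (lebesgue_on {r..t}) ?F"
    by (intro integrable_control_scaleR control_integrable u continuous_intros continuous_on_pot[OF ess] cx)
  show "Linv (x t) - Linv (x r) = - (\<i> *\<^sub>C integral\<^sup>L (lebesgue_on {r..t}) ?F)"
  proof (rule L2_eqI)
    fix k :: nat assume k: "k \<ge> 1"
    have "cinner_L2 (integral\<^sup>L (lebesgue_on {r..t}) ?F) (phi k) = integral\<^sup>L (lebesgue_on {r..t}) (\<lambda>s. cinner_L2 (?F s) (phi k))"
      by (rule integral_bounded_linear[OF bounded_linear_cinner_L2_left iF, symmetric])
    also have "(\<lambda>s. cinner_L2 (?F s) (phi k)) = (\<lambda>s. complex_of_real (u s) * duh_integrand \<mu> x k s)"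
      using k by (simp add: cinner_L2_scaleR_left cinner_schroedinger duh_integrand_def scaleR_conv_of_real)
    finally show "cinner_L2 (Linv (x t) - Linv (x r)) (phi k) = cinner_L2 (- (\<i> *\<^sub>C integral\<^sup>L (lebesgue_on {r..t}) ?F)) (phi k)"
      using k rt by (simp add: cinner_Linv cinner_L2_minus_left cinner_L2_scaleC_left cinner_duh[OF u x] eq duh_coeff_def
          flip: linear_diff[OF bounded_linear.linear, OF bounded_linear_Linv])
  qed
qed

text \<open>The increment of the squared norm is the product of the increment of \<open>p\<close>
  with \<open>p t + p r\<close>. Replacing the latter by \<open>2 * p s\<close> under the integral
  leaves 0, since \<mu> is real. The error is an oscillation of \<open>p\<close> of order
  \<open>sqrt D\<close> times an integral of the modulus of \<open>u\<close> of order
  \<open>sqrt (t - r) * sqrt D\<close>, as \<open>telescope_zero\<close> requires.\<close>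

lemma solution_norm:
  assumes u: "u sq_integrable_on UNIV" and sol: "solution u x0 x" and t: "t \<in> {0..T}"
  shows "norm (Linv (x t)) = norm (Linv x0)"
proof -
  have x: "continuous_on {0..T} x" using sol by (simp add: solution_def)
  have B0: "0 \<le> B" using ess by (simp add: ess_bounded_def)
  have "bounded (x ` {0..T})" by (intro compact_imp_bounded compact_continuous_image x) auto
  then obtain M where M: "\<And>s. s \<in> {0..T} \<Longrightarrow> norm (x s) \<le> M" unfolding bounded_iff by blast
  have M0: "0 \<le> M" using M[of 0] T_pos order_trans[OF norm_ge_zero] by fastforce
  define V where "V t = integral\<^sup>L (lebesgue_on {0..t}) (\<lambda>s. (u s)\<^sup>2)" for t
  have Vd: "V t - V r = integral\<^sup>L (lebesgue_on {r..t}) (\<lambda>s. (u s)\<^sup>2)" if "0 \<le> r" "r \<le> t" for r t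
    unfolding V_def using integral_combine[OF control_integrable(2)[OF u, of 0 t], of r] that by simp
  define p where "p s = Linv (x s)" for s
  define C where "C = 2 * (B * M) * (sqrt \<kappa> * M)"
  have main: "\<bar>(norm (p t))\<^sup>2 - (norm (p r))\<^sup>2\<bar> \<le> C * sqrt (t - r) * (V t - V r)"
    if rt: "0 \<le> r" "r \<le> t" "t \<le> T" for r t
  proof -
    let ?M = "lebesgue_on {r..t}"
    define D where "D = V t - V r"
    have D0: "0 \<le> D" unfolding D_def Vd[OF rt(1,2)] by (simp add: integral_nonneg_AE)
    have cx: "continuous_on {r..t} x" using continuous_on_sub[OF u x] rt by simp
    define F where "F s = u s *\<^sub>R schroedinger (- s) (pot \<mu> s (x s))" for s
    have iF: "integrable ?M F"
      unfolding F_def by (intro integrable_control_scaleR control_integrable u continuous_intros continuous_on_pot[OF ess] cx)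
    have pF: "p t - p r = - (\<i> *\<^sub>C integral\<^sup>L ?M F)"
      unfolding p_def F_def by (rule solution_increment(2)[OF u sol rt])
    \<comment> \<open>The oscillation is measured in the stronger norm of \<open>x\<close>, where
      the gain estimate yields the square root of the energy on the subinterval.\<close>
    have osc: "norm (p \<tau> - p s) \<le> sqrt \<kappa> * M * sqrt D" if s: "r \<le> s" "s \<le> \<tau>" "\<tau> \<le> t" for s \<tau>
    proof -
      have s': "0 \<le> s" "s \<le> \<tau>" "\<tau> \<le> T" using s rt by auto
      have "norm (p \<tau> - p s) \<le> norm (x \<tau> - x s)"
        unfolding p_def using norm_Linv by (simp flip: linear_diff[OF bounded_linear.linear, OF bounded_linear_Linv])
      also have "\<dots> = norm (duh \<mu> u x s \<tau>)" by (simp add: solution_increment(1)[OF u sol s'])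
      also have "\<dots> \<le> sqrt \<kappa> * M * sqrt (integral\<^sup>L (lebesgue_on {s..\<tau>}) (\<lambda>s. (u s)\<^sup>2))"
        by (rule norm_duh_le[OF u x s']) (use M s' in auto)
      also have "\<dots> \<le> sqrt \<kappa> * M * sqrt D"
      proof -
        have "V \<tau> - V s \<le> D"
          unfolding D_def using Vd[of r s] Vd[of \<tau> t] s s' rt
          by (smt (verit) integral_nonneg_AE AE_I2 zero_le_power2)
        then show ?thesis
          using Vd[of s \<tau>] s s' M0 \<kappa>_nonneg by (intro mult_left_mono real_sqrt_le_mono) auto
      qed
      finally show ?thesis .
    qed
    define f where "f s = inner (- (\<i> *\<^sub>C F s)) (p t + p r)" for s
    have nF: "norm (F s) \<le> \<bar>u s\<bar> * (B * M)" if s: "s \<in> {r..t}" for s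
    proof -
      have "norm (pot \<mu> s (x s)) \<le> B * norm (Linv (schroedinger s (x s)))"
        unfolding pot_def by (rule norm_mult_L2[OF ess])
      also have "\<dots> \<le> B * M"
        using B0 norm_Linv[of "schroedinger s (x s)"] M[of s] s rt by (intro mult_left_mono) auto
      finally show ?thesis by (simp add: F_def mult_left_mono)
    qed
    \<comment> \<open>Multiplication by a real function is symmetric, so \<open>c\<close> is real
      and its product with the imaginary unit has real part 0.\<close>
    have zero: "inner (- (\<i> *\<^sub>C F s)) (p s) = 0" for s
    proof -
      define \<psi> where "\<psi> = Linv (schroedinger s (x s))"
      define c where "c = cinner_L2 (mult_L2 \<mu> \<psi>) \<psi>"
      have "c = cnj c" unfolding c_def by (metis cinner_mult_L2[OF ess] cinner_L2_commute)
      then have "Im c = 0" by (simp add: complex_eq_iff)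
      have "cinner_L2 (schroedinger (- s) (pot \<mu> s (x s))) (p s) = c"
        unfolding cinner_schroedinger_adjoint p_def c_def pot_def \<psi>_def Linv_schroedinger ..
      then show ?thesis
        using \<open>Im c = 0\<close> by (simp add: inner_L2_def F_def cinner_L2_minus_left cinner_L2_scaleC_left cinner_L2_scaleR_left)
    qed
    have f_le: "\<bar>f s\<bar> \<le> (2 * (sqrt \<kappa> * M * sqrt D) * (B * M)) * \<bar>u s\<bar>" if s: "s \<in> {r..t}" for s
    proof -
      \<comment> \<open>Subtracts \<open>2 * p s\<close> from \<open>p t + p r\<close>, which is
        free by orthogonality and leaves two differences controlled by \<open>osc\<close>.\<close>
      have "f s = inner (- (\<i> *\<^sub>C F s)) ((p t - p s) - (p s - p r))"
        using zero[of s] by (simp add: f_def inner_diff_right inner_add_right)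
      also have "\<bar>\<dots>\<bar> \<le> norm (- (\<i> *\<^sub>C F s)) * norm ((p t - p s) - (p s - p r))" by (rule Cauchy_Schwarz_ineq2)
      also have "\<dots> \<le> (\<bar>u s\<bar> * (B * M)) * (sqrt \<kappa> * M * sqrt D + sqrt \<kappa> * M * sqrt D)"
        by (intro mult_mono order_trans[OF norm_triangle_ineq4] add_mono osc)
          (use s nF[OF s] B0 M0 in \<open>auto simp: norm_scaleC_L2\<close>)
      finally show ?thesis by (simp add: mult_ac)
    qed
    have bl: "bounded_linear (\<lambda>h. inner (- (\<i> *\<^sub>C h)) (p t + p r))"
      by (intro bounded_linear_compose[OF bounded_linear_inner_left] bounded_linear_minus bounded_linear_scaleC_L2)
    have fi: "integrable ?M f" and fI: "integral\<^sup>L ?M f = inner (- (\<i> *\<^sub>C integral\<^sup>L ?M F)) (p t + p r)"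
      unfolding f_def[abs_def]
      by (rule integrable_bounded_linear[OF bl iF], rule integral_bounded_linear[OF bl iF])
    note ui = control_integrable[OF u, of r t]
    have "(norm (p t))\<^sup>2 - (norm (p r))\<^sup>2 = inner (p t - p r) (p t + p r)"
      by (simp add: power2_norm_eq_inner algebra_simps inner_commute)
    also have "\<dots> = integral\<^sup>L ?M f" unfolding pF fI ..
    also have "\<bar>\<dots>\<bar> \<le> integral\<^sup>L ?M (\<lambda>s. (2 * (sqrt \<kappa> * M * sqrt D) * (B * M)) * \<bar>u s\<bar>)"
      by (rule order_trans[OF integral_abs_bound]) (intro integral_mono, use fi ui f_le in auto)
    also have "\<dots> = (2 * (sqrt \<kappa> * M * sqrt D) * (B * M)) * integral\<^sup>L ?M (\<lambda>s. \<bar>u s\<bar>)" by simp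
    also have "\<dots> \<le> (2 * (sqrt \<kappa> * M * sqrt D) * (B * M)) * (sqrt (t - r) * sqrt D)"
    proof (rule mult_left_mono)
      have "(integral\<^sup>L ?M (\<lambda>s. \<bar>u s\<bar>))\<^sup>2 \<le> (t - r) * integral\<^sup>L ?M (\<lambda>s. (\<bar>u s\<bar>)\<^sup>2)"
        by (rule integral_square_le) (use ui rt in \<open>auto simp: sq_integrable_on_def\<close>)
      also have "\<dots> = (t - r) * D" using Vd[OF rt(1,2)] by (simp add: D_def)
      finally have "sqrt ((integral\<^sup>L ?M (\<lambda>s. \<bar>u s\<bar>))\<^sup>2) \<le> sqrt ((t - r) * D)" by (rule real_sqrt_le_mono)
      then show "integral\<^sup>L ?M (\<lambda>s. \<bar>u s\<bar>) \<le> sqrt (t - r) * sqrt D"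
        by (simp add: real_sqrt_mult)
    qed (use D0 M0 B0 \<kappa>_nonneg in auto)
    also have "\<dots> = C * sqrt (t - r) * (sqrt D * sqrt D)" by (simp add: C_def mult_ac)
    also have "sqrt D * sqrt D = D" using D0 by simp
    finally show ?thesis by (simp add: D_def)
  qed
  have "(norm (p t))\<^sup>2 = (norm (p 0))\<^sup>2"
    by (rule telescope_zero[where C = C and V = V]) (use t main in auto)
  moreover have "x 0 = x0"
  proof -
    have "(norm (duh \<mu> u x 0 0))\<^sup>2 \<le> \<kappa> * integral\<^sup>L (lebesgue_on {0..0}) (\<lambda>s. (u s)\<^sup>2 * (norm (x s))\<^sup>2)"
      by (rule norm_duh_square[OF u x]) (use T_pos in auto)
    also have "integral\<^sup>L (lebesgue_on {0..0}) (\<lambda>s. (u s)\<^sup>2 * (norm (x s))\<^sup>2) = 0"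
      by (simp add: integral_eq_zero_null_sets finite_imp_null_set_lborel null_sets_completionI)
    finally have "duh \<mu> u x 0 0 = 0" by simp
    then show ?thesis using sol T_pos by (simp add: solution_def)
  qed
  ultimately show ?thesis by (simp add: p_def power2_eq_iff_nonneg)
qed

end

section \<open>Mild solutions\<close>

text \<open>Controls of the theorem are constrained only on the open time interval; extending by 0
  gives a square integrable function on the whole line, the form in which the estimates are
  stated.\<close>

definition zero_ext :: "real \<Rightarrow> (real \<Rightarrow> real) \<Rightarrow> real \<Rightarrow> real" where
  "zero_ext T u s = (if s \<in> {0<..<T} then u s else 0)"

lemma zero_ext_sq_integrable:
  assumes "u sq_integrable_on {0<..<T}"
  shows "zero_ext T u sq_integrable_on UNIV"
proof -
  have 1: "zero_ext T u = (\<lambda>s. indicator {0<..<T} s *\<^sub>R u s)"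
    "(\<lambda>s. (norm (zero_ext T u s))\<^sup>2) = (\<lambda>s. indicator {0<..<T} s *\<^sub>R (norm (u s))\<^sup>2)"
    by (auto simp: zero_ext_def)
  have "u \<in> borel_measurable (lebesgue_on {0<..<T})" "integrable (lebesgue_on {0<..<T}) (\<lambda>s. (norm (u s))\<^sup>2)"
    using assms by (auto simp: sq_integrable_on_def)
  then show ?thesis
    unfolding sq_integrable_on_def lebesgue_on_UNIV_eq 1(2)
    unfolding 1(1)
    by (simp add: borel_measurable_restrict_space_iff integrable_restrict_space)
qed

lemma integral_zero_ext:
  fixes h :: "real \<Rightarrow> complex"
  assumes "t \<le> T"
  shows "integral\<^sup>L (lebesgue_on {0..t}) (\<lambda>s. complex_of_real (zero_ext T u s) * h s) =
    integral\<^sup>L (lebesgue_on {0..t}) (\<lambda>s. complex_of_real (u s) * h s)"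
  unfolding lebesgue_on_Ioo_Icc(2)[symmetric]
  by (rule Bochner_Integration.integral_cong) (use assms in \<open>auto simp: zero_ext_def\<close>)

lemma control_system_exists:
  assumes "finite A" "A \<subseteq> {0<..<1}" "\<mu> \<in> H1_piecewise A" "T > 0"
  shows "\<exists>B \<kappa>. control_system \<mu> T B \<kappa>"
proof -
  obtain B where B: "ess_bounded B \<mu>" using H1_piecewise_ess_bounded[OF assms(1-3)] by blast
  obtain \<kappa> where \<kappa>: "0 \<le> \<kappa>" "\<And>u x r t K. u sq_integrable_on UNIV \<Longrightarrow> continuous_on {0..T} x \<Longrightarrow>
    0 \<le> r \<Longrightarrow> r \<le> t \<Longrightarrow> t \<le> T \<Longrightarrow> finite K \<Longrightarrow> K \<subseteq> {1..} \<Longrightarrow>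
    (\<Sum>k\<in>K. (cmod (duh_coeff \<mu> u x r t k))\<^sup>2) \<le>
      \<kappa> * integral\<^sup>L (lebesgue_on {r..t}) (\<lambda>s. (u s)\<^sup>2 * (norm (x s))\<^sup>2)"
    by (rule duh_coeff_bound[OF assms]) (rule that)
  show ?thesis
    by (intro exI[of _ B] exI[of _ \<kappa>], unfold_locales) (use B \<kappa> assms(4) in auto)
qed

lemma Linv_inject: "Linv x = Linv y \<longleftrightarrow> x = y"
proof
  assume eq: "Linv x = Linv y"
  show "x = y"
  proof (rule L2_eqI)
    fix k :: nat assume "k \<ge> 1"
    then show "cinner_L2 x (phi k) = cinner_L2 y (phi k)"
      using arg_cong[OF eq, of "\<lambda>z. cinner_L2 z (phi k)"] by (simp add: cinner_Linv)
  qed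
qed simp

section \<open>Mild solutions and the interaction picture\<close>

context control_system
begin

context
  fixes u :: "real \<Rightarrow> real"
  assumes u: "u sq_integrable_on {0<..<T}"
begin

lemma duhamel_integrable:
  assumes "continuous_on {0..T} x" "t \<in> {0..T}"
    "\<And>s. s \<in> {0..T} \<Longrightarrow> \<psi> s = schroedinger s (Linv (x s))"
  shows "integrable (lebesgue_on {0..t}) (\<lambda>s. schroedinger (t - s) (u s *\<^sub>R mult_L2 \<mu> (\<psi> s)))"
    and "k \<ge> 1 \<Longrightarrow> cinner_L2 (integral\<^sup>L (lebesgue_on {0..t}) (\<lambda>s. schroedinger (t - s) (u s *\<^sub>R mult_L2 \<mu> (\<psi> s)))) (phi k) =
      cis (- (eigenval k * t)) * integral\<^sup>L (lebesgue_on {0..t}) (\<lambda>s. complex_of_real (zero_ext T u s) * duh_integrand \<mu> x k s)"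
proof -
  let ?F = "\<lambda>s. u s *\<^sub>R schroedinger (t - s) (pot \<mu> s (x s))"
  have eq: "schroedinger (t - s) (u s *\<^sub>R mult_L2 \<mu> (\<psi> s)) = ?F s" if "s \<in> {0..t}" for s
    using that assms(2,3) by (simp add: pot_def Linv_schroedinger linear_scale[OF bounded_linear.linear[OF bounded_linear_schroedinger]])
  have "integrable (lebesgue_on {0<..<T}) u" by (rule sq_integrable_imp_integrable[OF u])
  then have "integrable (lebesgue_on {0..T}) u" by (simp add: lebesgue_on_Ioo_Icc)
  then have ui: "integrable (lebesgue_on {0..t}) u" by (rule integrable_subinterval) (use assms(2) in auto)
  have cx: "continuous_on {0..t} x" by (rule continuous_on_subset[OF assms(1)]) (use assms(2) in auto)
  have iF: "integrable (lebesgue_on {0..t}) ?F"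
    by (intro integrable_control_scaleR ui continuous_intros continuous_on_pot[OF ess] cx)
  then show "integrable (lebesgue_on {0..t}) (\<lambda>s. schroedinger (t - s) (u s *\<^sub>R mult_L2 \<mu> (\<psi> s)))"
    by (rule Bochner_Integration.integrable_cong[THEN iffD2, rotated 2]) (auto simp: eq)
  assume k: "k \<ge> 1"
  have "integral\<^sup>L (lebesgue_on {0..t}) (\<lambda>s. schroedinger (t - s) (u s *\<^sub>R mult_L2 \<mu> (\<psi> s))) = integral\<^sup>L (lebesgue_on {0..t}) ?F"
    by (rule Bochner_Integration.integral_cong) (auto simp: eq)
  then have "cinner_L2 (integral\<^sup>L (lebesgue_on {0..t}) (\<lambda>s. schroedinger (t - s) (u s *\<^sub>R mult_L2 \<mu> (\<psi> s)))) (phi k)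
      = integral\<^sup>L (lebesgue_on {0..t}) (\<lambda>s. cinner_L2 (?F s) (phi k))"
    by (simp only: integral_bounded_linear[OF bounded_linear_cinner_L2_left iF])
  also have "(\<lambda>s. cinner_L2 (?F s) (phi k)) = (\<lambda>s. cis (- (eigenval k * t)) * (complex_of_real (u s) * duh_integrand \<mu> x k s))"
  proof
    fix s
    have "cis (- (eigenval k * (t - s))) = cis (- (eigenval k * t)) * cis (eigenval k * s)"
      by (simp add: cis_mult algebra_simps)
    then show "cinner_L2 (?F s) (phi k) = cis (- (eigenval k * t)) * (complex_of_real (u s) * duh_integrand \<mu> x k s)"
      using k by (simp add: cinner_L2_scaleR_left cinner_schroedinger duh_integrand_def scaleR_conv_of_real mult_ac)
  qed
  also have "integral\<^sup>L (lebesgue_on {0..t}) \<dots> = cis (- (eigenval k * t)) * integral\<^sup>L (lebesgue_on {0..t}) (\<lambda>s. complex_of_real (u s) * duh_integrand \<mu> x k s)"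
    by simp
  finally show "cinner_L2 (integral\<^sup>L (lebesgue_on {0..t}) (\<lambda>s. schroedinger (t - s) (u s *\<^sub>R mult_L2 \<mu> (\<psi> s)))) (phi k) =
      cis (- (eigenval k * t)) * integral\<^sup>L (lebesgue_on {0..t}) (\<lambda>s. complex_of_real (zero_ext T u s) * duh_integrand \<mu> x k s)"
    using assms(2) by (simp add: integral_zero_ext)
qed

text \<open>Compared coefficient by coefficient, the factor \<open>k\<close> of
  \<open>duh_coeff\<close> cancels against the division in \<open>Linv\<close>, and the phase at
  time \<open>t\<close> factors out. Injectivity of \<open>Linv\<close> and of the group gives the
  converse direction.\<close>

lemma duhamel_iff:
  assumes "continuous_on {0..T} x" "t \<in> {0..T}"
    "\<And>s. s \<in> {0..T} \<Longrightarrow> \<psi> s = schroedinger s (Linv (x s))"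
  shows "\<psi> t = schroedinger t (Linv x0) -
      \<i> *\<^sub>C integral\<^sup>L (lebesgue_on {0..t}) (\<lambda>s. schroedinger (t - s) (u s *\<^sub>R mult_L2 \<mu> (\<psi> s))) \<longleftrightarrow>
    x t = x0 + duh \<mu> (zero_ext T u) x 0 t" (is "_ = ?R \<longleftrightarrow> _")
proof -
  note u0 = zero_ext_sq_integrable[OF u]
  have "?R = schroedinger t (Linv (x0 + duh \<mu> (zero_ext T u) x 0 t))"
  proof (rule L2_eqI)
    fix k :: nat assume k: "k \<ge> 1"
    then have "c * ((a + - \<i> * of_nat k * I) / of_nat k) = c * (a / of_nat k) - \<i> * (c * I)" for c a I
      by (simp add: field_simps)
    moreover have "cinner_L2 (duh \<mu> (zero_ext T u) x 0 t) (phi k) = duh_coeff \<mu> (zero_ext T u) x 0 t k"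
      using assms(2) k by (intro cinner_duh[OF u0 assms(1)]) auto
    ultimately show "cinner_L2 ?R (phi k) = cinner_L2 (schroedinger t (Linv (x0 + duh \<mu> (zero_ext T u) x 0 t))) (phi k)"
      by (simp only: cinner_L2_diff_left cinner_L2_scaleC_left cinner_schroedinger[OF k] cinner_Linv[OF k] cinner_L2_add_left
          duh_coeff_def duhamel_integrable(2)[OF assms k])
  qed
  moreover have "schroedinger t (Linv (x t)) = schroedinger t (Linv z) \<longleftrightarrow> x t = z" for z
    by (metis Linv_inject add.left_inverse schroedinger_schroedinger schroedinger_zero)
  ultimately show ?thesis using assms(2,3) by simp
qed

lemma solution_imp_mild:
  assumes "solution (zero_ext T u) x0 x" "\<And>t. t \<in> {0..T} \<Longrightarrow> \<psi> t = schroedinger t (Linv (x t))"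
  shows "mild_solution T \<mu> (Linv x0) u \<psi>"
proof -
  have x: "continuous_on {0..T} x" and eq: "\<And>t. t \<in> {0..T} \<Longrightarrow> x t = x0 + duh \<mu> (zero_ext T u) x 0 t"
    using assms(1) by (auto simp: solution_def)
  have \<psi>: "\<psi> s = Linv (schroedinger s (x s))" if "s \<in> {0..T}" for s
    using assms(2)[OF that] by (simp add: Linv_schroedinger)
  have cs: "continuous_on {0..T} (\<lambda>s. schroedinger s (x s))" by (intro continuous_intros x)
  have "continuous_into_H10 T \<psi>"
    unfolding continuous_into_H10_def
  proof (intro ballI conjI)
    fix t assume t: "t \<in> {0..T}"
    show "\<psi> t \<in> H10" using \<psi>[OF t] Linv_in_H10 by simp
    have "((\<lambda>s. norm (schroedinger s (x s) - schroedinger t (x t))) \<longlongrightarrow> norm (schroedinger t (x t) - schroedinger t (x t))) (at t within {0..T})"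
      using cs t by (intro tendsto_intros) (auto simp: continuous_on_def)
    then have "((\<lambda>s. norm (schroedinger s (x s) - schroedinger t (x t))) \<longlongrightarrow> 0) (at t within {0..T})" by simp
    then show "((\<lambda>s. H10_norm (\<psi> s - \<psi> t)) \<longlongrightarrow> 0) (at t within {0..T})"
    proof (rule Lim_transform_eventually)
      show "\<forall>\<^sub>F s in at t within {0..T}. norm (schroedinger s (x s) - schroedinger t (x t)) = H10_norm (\<psi> s - \<psi> t)"
        unfolding eventually_at_filter
        by (intro always_eventually allI impI)
          (use t in \<open>simp add: \<psi> H10_norm_Linv flip: linear_diff[OF bounded_linear.linear[OF bounded_linear_Linv]]\<close>)
    qed
  qed
  then show ?thesis
    unfolding mild_solution_def
    using duhamel_integrable(1)[OF x _ assms(2)] duhamel_iff[OF x _ assms(2)] eq by blast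
qed

text \<open>Since \<open>Linv\<close> is an isometry for \<open>H10_norm\<close>, continuity in
  \<open>H10\<close> is \<open>L2\<close> continuity of the preimage \<open>X\<close>; rotating back
  by \<open>schroedinger (- s)\<close> gives the interaction picture.\<close>

lemma mild_imp_solution:
  assumes "mild_solution T \<mu> (Linv x0) u \<psi>"
  obtains x where "solution (zero_ext T u) x0 x" "\<And>t. t \<in> {0..T} \<Longrightarrow> \<psi> t = schroedinger t (Linv (x t))"
proof -
  have cH: "continuous_into_H10 T \<psi>" using assms by (simp add: mild_solution_def)
  then have "\<forall>t\<in>{0..T}. \<exists>X. \<psi> t = Linv X" unfolding continuous_into_H10_def H10_iff by blast
  then obtain X where X: "\<And>t. t \<in> {0..T} \<Longrightarrow> \<psi> t = Linv (X t)" by metis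
  have "continuous_on {0..T} X"
    unfolding continuous_on_def
  proof
    fix t assume t: "t \<in> {0..T}"
    have "((\<lambda>s. H10_norm (\<psi> s - \<psi> t)) \<longlongrightarrow> 0) (at t within {0..T})"
      using cH t by (simp add: continuous_into_H10_def)
    then have "((\<lambda>s. norm (X s - X t)) \<longlongrightarrow> 0) (at t within {0..T})"
    proof (rule Lim_transform_eventually)
      show "\<forall>\<^sub>F s in at t within {0..T}. H10_norm (\<psi> s - \<psi> t) = norm (X s - X t)"
        unfolding eventually_at_filter
        by (intro always_eventually allI impI)
          (use t in \<open>simp add: X H10_norm_Linv flip: linear_diff[OF bounded_linear.linear[OF bounded_linear_Linv]]\<close>)
    qed
    then show "(X \<longlongrightarrow> X t) (at t within {0..T})"
      by (simp add: tendsto_norm_zero_iff LIM_zero_iff)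
  qed
  then have x: "continuous_on {0..T} (\<lambda>s. schroedinger (- s) (X s))" by (intro continuous_intros)
  have \<psi>: "\<psi> t = schroedinger t (Linv (schroedinger (- t) (X t)))" if "t \<in> {0..T}" for t
    using X[OF that] by (simp add: Linv_schroedinger schroedinger_schroedinger)
  have "solution (zero_ext T u) x0 (\<lambda>s. schroedinger (- s) (X s))"
    unfolding solution_def
  proof (intro conjI x ballI)
    fix t assume t: "t \<in> {0..T}"
    show "schroedinger (- t) (X t) = x0 + duh \<mu> (zero_ext T u) (\<lambda>s. schroedinger (- s) (X s)) 0 t"
      by (rule duhamel_iff[OF x t \<psi>, THEN iffD1]) (use assms t in \<open>auto simp: mild_solution_def\<close>)
  qed
  then show thesis using \<psi> by (rule that)
qed

end

lemma mild_well_posed: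
  assumes "\<psi>\<^sub>0 \<in> H10" "u sq_integrable_on {0<..<T}"
  shows "\<exists>\<psi>. mild_solution T \<mu> \<psi>\<^sub>0 u \<psi> \<and>
    (\<forall>\<psi>'. mild_solution T \<mu> \<psi>\<^sub>0 u \<psi>' \<longrightarrow> (\<forall>t\<in>{0..T}. \<psi>' t = \<psi> t))"
proof -
  note u0 = zero_ext_sq_integrable[OF assms(2)]
  obtain x0 where x0: "\<psi>\<^sub>0 = Linv x0" using assms(1) H10_iff by blast
  obtain x where x: "solution (zero_ext T u) x0 x" using solution_exists[OF u0] by blast
  define \<psi> where "\<psi> t = schroedinger t (Linv (x t))" for t
  have "mild_solution T \<mu> \<psi>\<^sub>0 u \<psi>"
    unfolding x0 by (rule solution_imp_mild[OF assms(2) x]) (simp add: \<psi>_def)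
  moreover have "\<psi>' t = \<psi> t" if \<psi>': "mild_solution T \<mu> \<psi>\<^sub>0 u \<psi>'" and t: "t \<in> {0..T}" for \<psi>' t
  proof -
    obtain y where y: "solution (zero_ext T u) x0 y" "\<And>t. t \<in> {0..T} \<Longrightarrow> \<psi>' t = schroedinger t (Linv (y t))"
      by (rule mild_imp_solution[OF assms(2) \<psi>'[unfolded x0]]) (rule that)
    show ?thesis using y(2)[OF t] solution_unique[OF u0 x y(1) t] by (simp add: \<psi>_def)
  qed
  ultimately show ?thesis by blast
qed

end

section \<open>Ingham's inequality\<close>

definition trig :: "(int \<Rightarrow> complex) \<Rightarrow> int set \<Rightarrow> real \<Rightarrow> complex" where
  "trig a F x = (\<Sum>m\<in>F. a m * expf m x)"

lemma continuous_on_trig [continuous_intros]: "continuous_on S (trig a F)"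
  unfolding trig_def[abs_def] by (intro continuous_intros)

text \<open>Ingham's lower bound for the exponentials with frequencies in \<open>V\<close> on an
  interval of length \<tau>. It is stated for finite sums; one constant for all of them makes it
  pass to the closed span.\<close>

definition observable :: "int set \<Rightarrow> real \<Rightarrow> bool" where
  "observable V \<tau> \<longleftrightarrow> (\<exists>c>0. \<forall>F a. finite F \<longrightarrow> F \<subseteq> V \<longrightarrow>
     c * (\<Sum>m\<in>F. (cmod (a m))\<^sup>2) \<le> integral\<^sup>L (lebesgue_on {0<..<\<tau>}) (\<lambda>x. (cmod (trig a F x))\<^sup>2))"

definition separated :: "nat \<Rightarrow> int set \<Rightarrow> bool" where
  "separated G V \<longleftrightarrow> (\<forall>m\<in>V. \<forall>n\<in>V. m \<noteq> n \<longrightarrow> int G \<le> \<bar>m - n\<bar>)"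

lemma div_eq_imp_close:
  fixes a b g :: int
  assumes "0 < g" "0 \<le> a" "0 \<le> b" "nat (a div g) = nat (b div g)"
  shows "\<bar>a - b\<bar> < g"
proof -
  have "0 \<le> a div g" "0 \<le> b div g"
    using assms by (auto simp: pos_imp_zdiv_nonneg_iff)
  then have "a div g = b div g" using assms(4) by (metis int_nat_eq)
  then have "a - b = a mod g - b mod g"
    using div_mult_mod_eq[of a g] div_mult_mod_eq[of b g] by (metis add_diff_cancel_left)
  then show ?thesis
    using pos_mod_bound[OF assms(1), of a] pos_mod_bound[OF assms(1), of b]
      pos_mod_sign[OF assms(1), of a] pos_mod_sign[OF assms(1), of b] by (simp only: abs_less_iff) linarith
qed

text \<open>Dividing distances by \<open>G\<close> and rounding down maps the points injectively to
  positive integers, because two points with the same quotient would be closer than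
  \<open>G\<close>. The sum is then at most the sum of inverse squares divided by the square of
  \<open>G\<close>.\<close>

lemma separated_sum_right:
  assumes "separated G F" "finite F" "m \<in> F" "G \<ge> 1"
  shows "(\<Sum>n\<in>{n\<in>F. m < n}. 1 / (real_of_int (n - m))\<^sup>2) \<le> 2 / (real G)\<^sup>2"
proof -
  define q where "q n = nat ((n - m) div int G)" for n
  let ?S = "{n \<in> F. m < n}"
  have G: "int G > 0" using assms(4) by simp
  have ge: "int G \<le> n - m" if "n \<in> ?S" for n
    using that assms(1,3) unfolding separated_def by fastforce
  have q1: "1 \<le> q n" "int G * int (q n) \<le> n - m" if n: "n \<in> ?S" for n
  proof -
    have "1 \<le> (n - m) div int G" using ge[OF n] G by (simp add: pos_imp_zdiv_pos_iff int_one_le_iff_zero_less)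
    then have q: "int (q n) = (n - m) div int G" and "1 \<le> int (q n)" by (simp_all add: q_def)
    then show "1 \<le> q n" by linarith
    show "int G * int (q n) \<le> n - m"
      unfolding q using mult_div_mod_eq[of "int G" "n - m"] pos_mod_sign[OF G, of "n - m"] by linarith
  qed
  have inj: "inj_on q ?S"
  proof (rule inj_onI)
    fix n n' assume n: "n \<in> ?S" "n' \<in> ?S" and eq: "q n = q n'"
    have "\<bar>(n - m) - (n' - m)\<bar> < int G"
    proof (rule div_eq_imp_close[OF G _ _ eq[unfolded q_def]])
      show "0 \<le> n - m" "0 \<le> n' - m" using ge[OF n(1)] ge[OF n(2)] G by linarith+
    qed
    then have "\<bar>n - n'\<bar> < int G" by simp
    moreover have "n \<in> F" "n' \<in> F" using n by auto
    ultimately show "n = n'"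
      using assms(1)[unfolded separated_def, rule_format, of n n'] by linarith
  qed
  have "(\<Sum>n\<in>?S. 1 / (real_of_int (n - m))\<^sup>2) \<le> (\<Sum>n\<in>?S. (1 / (real G)\<^sup>2) * (1 / (real (q n))\<^sup>2))"
  proof (rule sum_mono)
    fix n assume n: "n \<in> ?S"
    have "real G * real (q n) \<le> real_of_int (n - m)"
      using q1(2)[OF n] by (metis of_int_le_iff of_int_mult of_int_of_nat_eq)
    then have "(real G * real (q n))\<^sup>2 \<le> (real_of_int (n - m))\<^sup>2" by (intro power_mono) auto
    moreover have "0 < (real G * real (q n))\<^sup>2" using q1(1)[OF n] assms(4) by simp
    ultimately have "1 / (real_of_int (n - m))\<^sup>2 \<le> 1 / (real G * real (q n))\<^sup>2"
      by (intro frac_le) auto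
    then show "1 / (real_of_int (n - m))\<^sup>2 \<le> (1 / (real G)\<^sup>2) * (1 / (real (q n))\<^sup>2)"
      by (simp add: power_mult_distrib)
  qed
  also have "\<dots> = (1 / (real G)\<^sup>2) * (\<Sum>k\<in>q ` ?S. 1 / (real k)\<^sup>2)"
    by (simp add: sum_distrib_left sum.reindex[OF inj])
  also have "\<dots> \<le> (1 / (real G)\<^sup>2) * 2"
    by (intro mult_left_mono sum_inverse_squares_le) (use assms(2) q1 in auto)
  finally show ?thesis by simp
qed

text \<open>The points on the left of \<open>m\<close> are the points on the right of
  \<open>- m\<close> in the reflected set, so the one-sided bound is used twice.\<close>

lemma separated_sum:
  assumes "separated G F" "finite F" "m \<in> F" "G \<ge> 1"
  shows "(\<Sum>n\<in>F - {m}. 1 / (real_of_int (n - m))\<^sup>2) \<le> 4 / (real G)\<^sup>2"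
proof -
  have s: "separated G (uminus ` F)" using assms(1) unfolding separated_def by force
  have "(\<Sum>n\<in>{n\<in>uminus ` F. - m < n}. 1 / (real_of_int (n - - m))\<^sup>2) \<le> 2 / (real G)\<^sup>2"
    by (rule separated_sum_right[OF s]) (use assms in auto)
  also have "{n\<in>uminus ` F. - m < n} = uminus ` {n\<in>F. n < m}" by auto
  also have "(\<Sum>n\<in>uminus ` {n\<in>F. n < m}. 1 / (real_of_int (n - - m))\<^sup>2) = (\<Sum>n\<in>{n\<in>F. n < m}. 1 / (real_of_int (n - m))\<^sup>2)"
    by (subst sum.reindex) (auto intro!: sum.cong simp: power2_commute)
  finally have left: "(\<Sum>n\<in>{n\<in>F. n < m}. 1 / (real_of_int (n - m))\<^sup>2) \<le> 2 / (real G)\<^sup>2" .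
  have "F - {m} = {n\<in>F. m < n} \<union> {n\<in>F. n < m}" by auto
  then have "(\<Sum>n\<in>F - {m}. 1 / (real_of_int (n - m))\<^sup>2) =
      (\<Sum>n\<in>{n\<in>F. m < n}. 1 / (real_of_int (n - m))\<^sup>2) + (\<Sum>n\<in>{n\<in>F. n < m}. 1 / (real_of_int (n - m))\<^sup>2)"
    using assms(2) by (simp add: sum.union_disjoint disjoint_iff)
  then show ?thesis using left separated_sum_right[OF assms] by simp
qed

text \<open>The transform of the window \<open>x * (\<tau> - x)\<close> decays quadratically.\<close>

definition window :: "real \<Rightarrow> int \<Rightarrow> complex" where
  "window \<tau> j = integral\<^sup>L (lebesgue_on {0<..<\<tau>}) (\<lambda>x. complex_of_real (x * (\<tau> - x)) * expf j x)"

lemma window_0: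
  assumes "\<tau> > 0"
  shows "window \<tau> 0 = complex_of_real (\<tau>^3 / 6)"
proof -
  have "integral\<^sup>L (lebesgue_on {0<..<\<tau>}) (\<lambda>x. x * (\<tau> - x)) = (\<tau> * \<tau>\<^sup>2 / 2 - \<tau>^3 / 3) - (\<tau> * 0\<^sup>2 / 2 - 0^3 / 3)"
    by (rule integral_lebesgue_on_FTC(2))
      (use assms in \<open>auto intro!: continuous_intros derivative_eq_intros simp: power2_eq_square algebra_simps
        simp flip: has_real_derivative_iff_has_vector_derivative\<close>)
  also have "\<dots> = \<tau>^3 / 6" by (simp add: power2_eq_square power3_eq_cube field_simps)
  finally have "integral\<^sup>L (lebesgue_on {0<..<\<tau>}) (\<lambda>x. x * (\<tau> - x)) = \<tau>^3 / 6" .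
  moreover have "window \<tau> 0 = integral\<^sup>L (lebesgue_on {0<..<\<tau>}) (\<lambda>x. complex_of_real (x * (\<tau> - x)))"
    by (simp add: window_def expf_def del: of_real_mult of_real_diff)
  ultimately show ?thesis by (simp only: integral_complex_of_real)
qed

text \<open>The window vanishes at both ends, so integrating by parts produces boundary terms only
  of second and third order in \<open>1 / \<omega>\<close>. The assumption
  \<open>3 \<le> real G * \<tau>\<close> yields
  \<open>4 \<le> \<tau> * \<bar>\<omega>\<bar>\<close>, so the cubic terms are absorbed into the
  quadratic ones; \<open>\<omega> = 2 * pi * j\<close> and \<open>pi > 3\<close> give the constant
  \<open>1 / 12\<close>.\<close>

lemma window_le:
  assumes "\<tau> > 0" "G \<ge> 1" "3 \<le> real G * \<tau>" "int G \<le> \<bar>j\<bar>"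
  shows "cmod (window \<tau> j) \<le> \<tau> / 12 * (1 / (real_of_int j)\<^sup>2)"
proof -
  define \<omega> where "\<omega> = 2 * pi * real_of_int j"
  define c where "c = \<i> * complex_of_real \<omega>"
  have j0: "j \<noteq> 0" using assms by auto
  then have c0: "c \<noteq> 0" by (simp add: c_def \<omega>_def)
  have nc: "cmod c = \<bar>\<omega>\<bar>" by (simp add: c_def norm_mult)
  define \<alpha> \<beta> \<gamma> where "\<alpha> = 1 / c" and "\<beta> = 1 / c^2" and "\<gamma> = 2 / c^3"
  have c\<alpha>: "c * \<alpha> = 1" "c * \<beta> = \<alpha>" "c * \<gamma> = 2 * \<beta>"
    using c0 by (auto simp: \<alpha>_def \<beta>_def \<gamma>_def power2_eq_square power3_eq_cube)
  \<comment> \<open>\<open>P\<close> times the exponential is the antiderivative obtained from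
    repeated integration by parts; the relations \<open>c\<alpha>\<close> make the lower order terms
    of its derivative cancel.\<close>
  define P where "P x = \<alpha> * (complex_of_real x * (complex_of_real \<tau> - complex_of_real x))
      - \<beta> * (complex_of_real \<tau> - 2 * complex_of_real x) - \<gamma>" for x
  have e: "expf j x = exp (c * complex_of_real x)" for x
    by (simp add: expf_def cis_conv_exp c_def \<omega>_def mult_ac)
  have "window \<tau> j = expf j \<tau> * P \<tau> - expf j 0 * P 0"
    unfolding window_def
  proof (rule integral_lebesgue_on_FTC(2))
    fix x
    have "((\<lambda>x. (\<lambda>z. exp (c * z) * (\<alpha> * (z * (complex_of_real \<tau> - z)) - \<beta> * (complex_of_real \<tau> - 2 * z) - \<gamma>)) (complex_of_real x))
      has_vector_derivative complex_of_real (x * (\<tau> - x)) * exp (c * complex_of_real x)) (at x within {0..\<tau>})"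
    proof (rule has_vector_derivative_real_field)
      let ?z = "complex_of_real x"
      have "((\<lambda>z. exp (c * z) * (\<alpha> * (z * (complex_of_real \<tau> - z)) - \<beta> * (complex_of_real \<tau> - 2 * z) - \<gamma>))
          has_field_derivative
          exp (c * ?z) * ((c * \<alpha>) * (?z * (complex_of_real \<tau> - ?z)) - (c * \<beta>) * (complex_of_real \<tau> - 2 * ?z) - c * \<gamma>
            + \<alpha> * (complex_of_real \<tau> - 2 * ?z) + 2 * \<beta>)) (at ?z)"
        by (auto intro!: derivative_eq_intros simp: algebra_simps)
      then show "((\<lambda>z. exp (c * z) * (\<alpha> * (z * (complex_of_real \<tau> - z)) - \<beta> * (complex_of_real \<tau> - 2 * z) - \<gamma>))
          has_field_derivative complex_of_real (x * (\<tau> - x)) * exp (c * ?z)) (at ?z)"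
        unfolding c\<alpha> by (simp add: mult.commute)
    qed
    then show "((\<lambda>x. expf j x * P x) has_vector_derivative complex_of_real (x * (\<tau> - x)) * expf j x) (at x within {0..\<tau>})"
      by (simp add: e P_def)
  qed (use assms in \<open>auto intro!: continuous_intros\<close>)
  also have "\<dots> = expf j \<tau> * (complex_of_real \<tau> / c^2 - 2 / c^3) - (- (complex_of_real \<tau> / c^2) - 2 / c^3)"
    by (simp add: P_def expf_def \<alpha>_def \<beta>_def \<gamma>_def)
  also have "cmod \<dots> \<le> cmod (expf j \<tau> * (complex_of_real \<tau> / c^2 - 2 / c^3)) + cmod (- (complex_of_real \<tau> / c^2) - 2 / c^3)"
    by (rule norm_triangle_ineq4)
  also have "\<dots> \<le> (\<tau> / \<omega>\<^sup>2 + 2 / \<bar>\<omega>\<bar>^3) + (\<tau> / \<omega>\<^sup>2 + 2 / \<bar>\<omega>\<bar>^3)"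
  proof (rule add_mono)
    have n: "cmod (complex_of_real \<tau> / c^2) = \<tau> / \<omega>\<^sup>2" "cmod (2 / c^3) = 2 / \<bar>\<omega>\<bar>^3"
      using assms(1) by (auto simp: norm_divide norm_power nc)
    show "cmod (expf j \<tau> * (complex_of_real \<tau> / c^2 - 2 / c^3)) \<le> \<tau> / \<omega>\<^sup>2 + 2 / \<bar>\<omega>\<bar>^3"
      using norm_triangle_ineq4[of "complex_of_real \<tau> / c^2" "2 / c^3"] unfolding n by (simp add: norm_mult)
    show "cmod (- (complex_of_real \<tau> / c^2) - 2 / c^3) \<le> \<tau> / \<omega>\<^sup>2 + 2 / \<bar>\<omega>\<bar>^3"
      using norm_triangle_ineq4[of "- (complex_of_real \<tau> / c^2)" "2 / c^3"] unfolding norm_minus_cancel n .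
  qed
  also have "\<dots> \<le> 3 * \<tau> / \<omega>\<^sup>2"
  proof -
    have w0: "\<bar>\<omega>\<bar> > 0" using j0 by (simp add: \<omega>_def)
    have jG: "real G \<le> \<bar>real_of_int j\<bar>" using assms(4) by linarith
    have "4 \<le> 2 * 3 * (real G * \<tau>)" using assms(3) by linarith
    also have "\<dots> \<le> 2 * pi * (\<bar>real_of_int j\<bar> * \<tau>)"
      using jG assms(1,3) pi_gt3 by (intro mult_mono mult_right_mono) auto
    finally have "4 \<le> \<tau> * \<bar>\<omega>\<bar>" by (simp add: \<omega>_def abs_mult mult_ac)
    then have "4 / \<bar>\<omega>\<bar>^3 \<le> (\<tau> * \<bar>\<omega>\<bar>) / \<bar>\<omega>\<bar>^3" by (intro divide_right_mono) auto
    also have "\<dots> = \<tau> / \<omega>\<^sup>2" using w0 by (simp add: power3_eq_cube power2_eq_square field_simps)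
    finally show ?thesis by (simp add: add_divide_distrib[symmetric])
  qed
  also have "\<dots> \<le> \<tau> / 12 * (1 / (real_of_int j)\<^sup>2)"
  proof -
    have "3\<^sup>2 \<le> pi\<^sup>2" using pi_gt3 by (intro power_mono) auto
    then have "36 * (real_of_int j)\<^sup>2 \<le> \<omega>\<^sup>2"
      unfolding \<omega>_def power_mult_distrib by (intro mult_right_mono) auto
    then have "3 * \<tau> / \<omega>\<^sup>2 \<le> 3 * \<tau> / (36 * (real_of_int j)\<^sup>2)"
      using j0 assms(1) c0 by (intro divide_left_mono) (auto simp: \<omega>_def)
    then show ?thesis by simp
  qed
  finally show ?thesis .
qed

lemma cmod_sum_square:
  fixes f :: "'i \<Rightarrow> complex"
  shows "complex_of_real ((cmod (\<Sum>m\<in>F. f m))\<^sup>2) = (\<Sum>m\<in>F. \<Sum>n\<in>F. f m * cnj (f n))"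
  unfolding complex_norm_square by (simp add: sum_product)

text \<open>In the windowed integral the diagonal contributes \<open>\<tau>^3 / 6\<close> times the
  sum of squares, and the decay of \<open>window\<close> together with the separation keeps the
  off-diagonal part below half of that. Since the window is at most
  \<open>\<tau>\<^sup>2 / 4\<close>, removing it leaves the constant
  \<open>\<tau> / 3\<close>.\<close>

lemma Ingham_separated:
  assumes "\<tau> > 0" "separated G V" "G \<ge> 1" "3 \<le> real G * \<tau>"
  shows "observable V \<tau>"
  unfolding observable_def
proof (intro exI[of _ "\<tau> / 3"] conjI allI impI)
  show "\<tau> / 3 > 0" using assms by simp
  fix F a assume F: "finite F" "F \<subseteq> V"
  let ?M = "lebesgue_on {0<..<\<tau>}"
  define \<Sigma> where "\<Sigma> = (\<Sum>m\<in>F. (cmod (a m))\<^sup>2)"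
  define I where "I = integral\<^sup>L ?M (\<lambda>x. (cmod (trig a F x))\<^sup>2)"
  have sF: "separated G F" using assms(2) F(2) by (auto simp: separated_def)
  have ci: "integrable ?M h" if "continuous_on UNIV h" for h :: "real \<Rightarrow> 'z::euclidean_space"
    using continuous_imp_integrable_real[OF continuous_on_subset[OF that subset_UNIV]] by (simp add: lebesgue_on_Ioo_Icc)
  have eq: "complex_of_real (x * (\<tau> - x) * (cmod (trig a F x))\<^sup>2) =
      (\<Sum>m\<in>F. \<Sum>n\<in>F. (a m * cnj (a n)) * (complex_of_real (x * (\<tau> - x)) * expf (m - n) x))" for x
  proof -
    have "complex_of_real (x * (\<tau> - x) * (cmod (trig a F x))\<^sup>2) =
        complex_of_real (x * (\<tau> - x)) * (\<Sum>m\<in>F. \<Sum>n\<in>F. (a m * expf m x) * cnj (a n * expf n x))"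
      unfolding of_real_mult[of "x * (\<tau> - x)"] trig_def cmod_sum_square ..
    also have "\<dots> = (\<Sum>m\<in>F. \<Sum>n\<in>F. (a m * cnj (a n)) * (complex_of_real (x * (\<tau> - x)) * expf (m - n) x))"
      unfolding sum_distrib_left by (intro sum.cong refl) (simp add: mult_ac flip: expf_mult_cnj)
    finally show ?thesis .
  qed
  define J where "J = integral\<^sup>L ?M (\<lambda>x. x * (\<tau> - x) * (cmod (trig a F x))\<^sup>2)"
  have "complex_of_real J = integral\<^sup>L ?M (\<lambda>x. complex_of_real (x * (\<tau> - x) * (cmod (trig a F x))\<^sup>2))"
    unfolding J_def by (rule integral_complex_of_real[symmetric])
  also have "\<dots> = (\<Sum>m\<in>F. \<Sum>n\<in>F. (a m * cnj (a n)) * window \<tau> (m - n))"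
    unfolding eq window_def
    by (simp add: ci continuous_intros)
  also have "\<dots> = (\<Sum>m\<in>F. complex_of_real ((cmod (a m))\<^sup>2 * (\<tau>^3 / 6)) + (\<Sum>n\<in>F - {m}. (a m * cnj (a n)) * window \<tau> (m - n)))"
  proof (rule sum.cong)
    fix m assume "m \<in> F"
    then have "(\<Sum>n\<in>F. (a m * cnj (a n)) * window \<tau> (m - n)) =
        (a m * cnj (a m)) * window \<tau> 0 + (\<Sum>n\<in>F - {m}. (a m * cnj (a n)) * window \<tau> (m - n))"
      using F(1) by (subst sum.remove[of F m]) auto
    then show "(\<Sum>n\<in>F. (a m * cnj (a n)) * window \<tau> (m - n)) =
        complex_of_real ((cmod (a m))\<^sup>2 * (\<tau>^3 / 6)) + (\<Sum>n\<in>F - {m}. (a m * cnj (a n)) * window \<tau> (m - n))"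
      unfolding window_0[OF assms(1)] of_real_mult complex_norm_square .
  qed simp
  also have "\<dots> = complex_of_real (\<Sigma> * (\<tau>^3 / 6)) + (\<Sum>m\<in>F. \<Sum>n\<in>F - {m}. (a m * cnj (a n)) * window \<tau> (m - n))"
    by (simp add: \<Sigma>_def sum.distrib sum_distrib_right)
  finally have J: "complex_of_real (\<Sigma> * (\<tau>^3 / 6) - J) = - (\<Sum>m\<in>F. \<Sum>n\<in>F - {m}. (a m * cnj (a n)) * window \<tau> (m - n))"
    by simp
  have bound: "cmod (\<Sum>m\<in>F. \<Sum>n\<in>F - {m}. (a m * cnj (a n)) * window \<tau> (m - n)) \<le> \<Sigma> * (\<tau>^3 / 12)"
  proof -
    define w where "w m n = \<tau> / 12 * (1 / (real_of_int (m - n))\<^sup>2)" for m n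
    have w_sym: "w m n = w n m" for m n by (simp add: w_def power2_commute)
    have wl: "cmod (window \<tau> (m - n)) \<le> w m n" if "m \<in> F" "n \<in> F - {m}" for m n
      unfolding w_def by (rule window_le[OF assms(1,3,4)]) (use sF that in \<open>auto simp: separated_def\<close>)
    have ws: "(\<Sum>n\<in>F - {m}. w m n) \<le> \<tau>^3 / 12" if m: "m \<in> F" for m
    proof -
      have "(\<Sum>n\<in>F - {m}. w m n) = \<tau> / 12 * (\<Sum>n\<in>F - {m}. 1 / (real_of_int (n - m))\<^sup>2)"
        unfolding sum_distrib_left w_def by (rule sum.cong) (auto simp: power2_commute)
      also have "\<dots> \<le> \<tau> / 12 * (4 / (real G)\<^sup>2)"
        by (intro mult_left_mono separated_sum[OF sF F(1) m assms(3)]) (use assms(1) in auto)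
      also have "\<dots> \<le> \<tau> / 12 * \<tau>\<^sup>2"
      proof (intro mult_left_mono)
        have "3\<^sup>2 \<le> (real G * \<tau>)\<^sup>2" using assms(4) by (intro power_mono) auto
        then have "4 \<le> \<tau>\<^sup>2 * (real G)\<^sup>2" by (simp add: power_mult_distrib mult.commute)
        then show "4 / (real G)\<^sup>2 \<le> \<tau>\<^sup>2" using assms(3) by (simp add: divide_le_eq)
      qed (use assms(1) in auto)
      finally show ?thesis by (simp add: power2_eq_square power3_eq_cube)
    qed
    have "cmod (\<Sum>m\<in>F. \<Sum>n\<in>F - {m}. (a m * cnj (a n)) * window \<tau> (m - n)) \<le>
        (\<Sum>m\<in>F. \<Sum>n\<in>F - {m}. ((cmod (a m))\<^sup>2 / 2 + (cmod (a n))\<^sup>2 / 2) * w m n)"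
    proof (intro sum_norm_le)
      fix m n assume mn: "m \<in> F" "n \<in> F - {m}"
      have "cmod (a m) * cmod (a n) \<le> (cmod (a m))\<^sup>2 / 2 + (cmod (a n))\<^sup>2 / 2"
        using sum_squares_bound[of "cmod (a m)" "cmod (a n)"] by simp
      then show "cmod ((a m * cnj (a n)) * window \<tau> (m - n)) \<le> ((cmod (a m))\<^sup>2 / 2 + (cmod (a n))\<^sup>2 / 2) * w m n"
        unfolding norm_mult complex_mod_cnj by (intro mult_mono wl mn) auto
    qed
    also have "\<dots> = (\<Sum>m\<in>F. \<Sum>n\<in>F - {m}. (cmod (a m))\<^sup>2 / 2 * w m n) + (\<Sum>m\<in>F. \<Sum>n\<in>F - {m}. (cmod (a n))\<^sup>2 / 2 * w m n)"
      by (simp add: distrib_right sum.distrib)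
    \<comment> \<open>Schur test: by symmetry of the weight both halves coincide, so only the row
      sums of \<open>w\<close> matter.\<close>
    also have "(\<Sum>m\<in>F. \<Sum>n\<in>F - {m}. (cmod (a n))\<^sup>2 / 2 * w m n) = (\<Sum>m\<in>F. \<Sum>n\<in>F - {m}. (cmod (a m))\<^sup>2 / 2 * w m n)"
    proof -
      have off: "(\<Sum>n\<in>F - {m}. h n) = (\<Sum>n\<in>F. if n = m then 0 else h n)" for h :: "int \<Rightarrow> real" and m
        by (rule sum.mono_neutral_cong_left) (use F(1) in auto)
      show ?thesis unfolding off by (subst sum.swap) (intro sum.cong refl, auto simp: w_sym)
    qed
    also have "\<dots> + \<dots> = (\<Sum>m\<in>F. (cmod (a m))\<^sup>2 * (\<Sum>n\<in>F - {m}. w m n))"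
      unfolding sum_distrib_left[symmetric] sum.distrib[symmetric] by (intro sum.cong) auto
    also have "\<dots> \<le> (\<Sum>m\<in>F. (cmod (a m))\<^sup>2 * (\<tau>^3 / 12))"
      by (intro sum_mono mult_left_mono ws) auto
    finally show ?thesis by (simp only: \<Sigma>_def sum_distrib_right)
  qed
  have "\<bar>\<Sigma> * (\<tau>^3 / 6) - J\<bar> \<le> \<Sigma> * (\<tau>^3 / 12)"
    using bound unfolding norm_of_real[symmetric, where 'a = complex] J norm_minus_cancel .
  from abs_le_D1[OF this] have "\<Sigma> * (\<tau>^3 / 12) \<le> J" by (simp add: field_simps)
  also have "J \<le> integral\<^sup>L ?M (\<lambda>x. \<tau>\<^sup>2 / 4 * (cmod (trig a F x))\<^sup>2)"
    unfolding J_def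
  proof (rule integral_mono)
    show "x * (\<tau> - x) * (cmod (trig a F x))\<^sup>2 \<le> \<tau>\<^sup>2 / 4 * (cmod (trig a F x))\<^sup>2" for x
    proof (rule mult_right_mono)
      show "x * (\<tau> - x) \<le> \<tau>\<^sup>2 / 4"
        using zero_le_power2[of "x - \<tau> / 2"] by (simp add: power2_eq_square algebra_simps)
    qed simp
  qed (intro ci continuous_intros)+
  also have "\<dots> = \<tau>\<^sup>2 / 4 * I" by (simp add: I_def)
  finally have "\<tau>\<^sup>2 * (\<Sigma> * \<tau> / 3) \<le> \<tau>\<^sup>2 * I" by (simp add: power2_eq_square power3_eq_cube mult_ac)
  then have "\<Sigma> * \<tau> / 3 \<le> I" using assms(1) by simp
  then show "\<tau> / 3 * (\<Sum>m\<in>F. (cmod (a m))\<^sup>2) \<le> integral\<^sup>L ?M (\<lambda>x. (cmod (trig a F x))\<^sup>2)"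
    by (simp add: \<Sigma>_def I_def mult.commute)
qed

section \<open>Adding finitely many frequencies at the cost of length\<close>

lemma integrable_continuous_Ioo:
  fixes h :: "real \<Rightarrow> 'b::euclidean_space"
  assumes "continuous_on UNIV h"
  shows "integrable (lebesgue_on {a<..<b}) h"
  using continuous_imp_integrable_real[OF continuous_on_subset[OF assms subset_UNIV]]
  by (simp add: lebesgue_on_Ioo_Icc)

lemma to_L2_trig: "to_L2 (trig a F) = (\<Sum>m\<in>F. a m *\<^sub>C expb m)"
  unfolding trig_def expb_def
  by (simp only: to_L2_sum sq_integrable_on_cmult sq_integrable_expf to_L2_cmult)

lemma sq_integrable_trig: "trig a F sq_integrable_on {0<..<1}"
  by (intro continuous_sq_integrable01 continuous_intros)

lemma integral_trig_square:
  assumes "finite F"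
  shows "integral\<^sup>L leb01 (\<lambda>x. (cmod (trig a F x))\<^sup>2) = (\<Sum>m\<in>F. (cmod (a m))\<^sup>2)"
proof -
  have "(norm (to_L2 (trig a F)))\<^sup>2 = integral\<^sup>L leb01 (\<lambda>x. (cmod (trig a F x))\<^sup>2)"
    by (simp add: norm_to_L2[OF sq_integrable_trig] integral_nonneg_AE)
  then show ?thesis
    unfolding to_L2_trig orthonormal_norm_sum[OF orthonormal_expb assms subset_UNIV] by simp
qed

lemma integral_square_mono:
  fixes f :: "real \<Rightarrow> complex"
  assumes "continuous_on UNIV f" "0 \<le> \<sigma>" "\<sigma> \<le> \<tau>"
  shows "integral\<^sup>L (lebesgue_on {0<..<\<sigma>}) (\<lambda>x. (cmod (f x))\<^sup>2) \<le> integral\<^sup>L (lebesgue_on {0<..<\<tau>}) (\<lambda>x. (cmod (f x))\<^sup>2)"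
proof -
  have "continuous_on UNIV (\<lambda>x. (cmod (f x))\<^sup>2)" by (intro continuous_intros assms)
  from integral_split_Ioo[OF integrable_continuous_Ioo[OF this, of 0 \<tau>], of \<sigma>] assms
  show ?thesis by (simp add: integral_nonneg_AE)
qed

lemma integral_shift_le:
  fixes g :: "real \<Rightarrow> real"
  assumes "continuous_on UNIV g" "\<And>x. 0 \<le> g x" "0 \<le> x" "0 \<le> \<eta>" "x + \<eta> \<le> \<tau>"
  shows "integral\<^sup>L (lebesgue_on {0<..<\<eta>}) (\<lambda>r. g (x + r)) \<le> integral\<^sup>L (lebesgue_on {0<..<\<tau>}) g"
proof -
  have "\<exists>F. \<forall>x::real. -\<infinity> < ereal x \<longrightarrow> ereal x < \<infinity> \<longrightarrow> (F has_vector_derivative g x) (at x)"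
    by (rule einterval_antiderivative) (use assms(1) in \<open>auto simp: continuous_on_eq_continuous_at\<close>)
  then obtain F where F: "\<And>x. (F has_vector_derivative g x) (at x)" by auto
  then have C1: "C1_deriv F g" using assms(1) by (simp add: C1_deriv_def)
  have C1s: "C1_deriv (\<lambda>r. F (x + r)) (\<lambda>r. g (x + r))"
    unfolding C1_deriv_def
  proof
    show "\<forall>r. ((\<lambda>r. F (x + r)) has_vector_derivative g (x + r)) (at r)"
    proof
      fix r
      have "((\<lambda>r. x + r) has_vector_derivative 1) (at r)"
        unfolding has_real_derivative_iff_has_vector_derivative[symmetric] by (auto intro!: derivative_eq_intros)
      from vector_diff_chain_at[OF this F]
      show "((\<lambda>r. F (x + r)) has_vector_derivative g (x + r)) (at r)" by (simp add: o_def)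
    qed
    show "continuous_on UNIV (\<lambda>r. g (x + r))"
      by (rule continuous_on_compose2[OF assms(1)]) (auto intro!: continuous_intros)
  qed
  have mono: "F a \<le> F b" if "a \<le> b" for a b
  proof -
    have "0 \<le> integral\<^sup>L (lebesgue_on {a<..<b}) g" by (rule integral_nonneg_AE) (simp add: assms(2))
    then show ?thesis using integral_C1_deriv[OF C1 that] by simp
  qed
  have "integral\<^sup>L (lebesgue_on {0<..<\<eta>}) (\<lambda>r. g (x + r)) = F (x + \<eta>) - F (x + 0)"
    by (rule integral_C1_deriv[OF C1s assms(4)])
  also have "\<dots> \<le> F \<tau> - F 0" using mono[of "x + \<eta>" \<tau>] mono[of 0 x] assms by simp
  also have "\<dots> = integral\<^sup>L (lebesgue_on {0<..<\<tau>}) g"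
    using integral_C1_deriv[OF C1, of 0 \<tau>] assms by simp
  finally show ?thesis .
qed

text \<open>The symbol is \<open>1 - (cis z - 1) / (\<i> * z)\<close> with \<open>z\<close>
  proportional to \<open>j\<close>. A zero would force \<open>cos z = 1\<close> and
  \<open>sin z = z\<close>, impossible for \<open>z \<noteq> 0\<close>; for
  \<open>\<bar>z\<bar> \<ge> 4\<close> the modulus is at least \<open>1 / 2\<close>. Only finitely
  many integers lie between, so a positive minimum exists.\<close>

lemma averaging_symbol:
  assumes "\<eta> > 0"
  obtains \<kappa> where "\<kappa> > 0" "\<And>j. j \<noteq> 0 \<Longrightarrow>
    \<kappa> \<le> cmod (1 - integral\<^sup>L (lebesgue_on {0<..<\<eta>}) (expf j) / complex_of_real \<eta>)"
proof -
  define v where "v j = 1 - integral\<^sup>L (lebesgue_on {0<..<\<eta>}) (expf j) / complex_of_real \<eta>" for j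
  define z where "z j = 2 * pi * real_of_int j * \<eta>" for j
  have v: "v j = 1 - (cis (z j) - 1) / (\<i> * complex_of_real (z j))" if "j \<noteq> 0" for j
    unfolding v_def expf_def[abs_def] using that assms by (subst integral_cis) (auto simp: z_def mult_ac)
  have v0: "v j \<noteq> 0" if j: "j \<noteq> 0" for j
  proof
    assume "v j = 0"
    have z0: "z j \<noteq> 0" using j assms by (simp add: z_def)
    then have "cis (z j) - 1 = \<i> * complex_of_real (z j)" using \<open>v j = 0\<close> by (simp add: v[OF j] divide_eq_eq)
    then have "cos (z j) = 1" "sin (z j) = z j" by (auto simp: complex_eq_iff)
    then show False using sin_cos_squared_add[of "z j"] z0 by simp
  qed
  have big: "1 / 2 \<le> cmod (v j)" if j: "j \<noteq> 0" "4 \<le> \<bar>z j\<bar>" for j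
  proof -
    have "cmod ((cis (z j) - 1) / (\<i> * complex_of_real (z j))) \<le> 2 / \<bar>z j\<bar>"
      using norm_triangle_ineq4[of "cis (z j)" 1] by (simp add: norm_divide norm_mult divide_right_mono)
    also have "\<dots> \<le> 2 / 4" using j by (intro divide_left_mono) auto
    finally show ?thesis
      unfolding v[OF j(1)] using norm_triangle_ineq2[of 1 "(cis (z j) - 1) / (\<i> * complex_of_real (z j))"] by simp
  qed
  define J where "J = {j. j \<noteq> 0 \<and> \<bar>z j\<bar> < 4}"
  have "J \<subseteq> {- \<lceil>4 / \<eta>\<rceil>..\<lceil>4 / \<eta>\<rceil>}"
  proof
    fix j assume "j \<in> J"
    then have "\<bar>real_of_int j\<bar> * (2 * pi * \<eta>) < 4" using assms by (simp add: J_def z_def abs_mult mult_ac)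
    moreover have "\<bar>real_of_int j\<bar> * (1 * \<eta>) \<le> \<bar>real_of_int j\<bar> * (2 * pi * \<eta>)"
      using assms pi_gt3 by (intro mult_left_mono mult_right_mono) auto
    ultimately have "\<bar>real_of_int j\<bar> * (1 * \<eta>) < 4" by (rule order.strict_trans1[rotated])
    then have "\<bar>real_of_int j\<bar> < 4 / \<eta>" using assms by (simp add: pos_less_divide_eq)
    then show "j \<in> {- \<lceil>4 / \<eta>\<rceil>..\<lceil>4 / \<eta>\<rceil>}" by (auto simp: abs_less_iff) linarith+
  qed
  then have fJ: "finite J" by (rule finite_subset) simp
  define \<kappa> where "\<kappa> = Min (insert (1 / 2) ((\<lambda>j. cmod (v j)) ` J))"
  have "\<kappa> > 0" unfolding \<kappa>_def using fJ v0 by (subst Min_gr_iff) (auto simp: J_def)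
  moreover have "\<kappa> \<le> cmod (v j)" if "j \<noteq> 0" for j
  proof (cases "j \<in> J")
    case True
    then show ?thesis unfolding \<kappa>_def using fJ by (intro Min_le) auto
  next
    case False
    then have "1 / 2 \<le> cmod (v j)" using big[OF that] that by (auto simp: J_def)
    moreover have "\<kappa> \<le> 1 / 2" unfolding \<kappa>_def using fJ by (intro Min_le) auto
    ultimately show ?thesis by linarith
  qed
  ultimately show thesis unfolding v_def by (rule that)
qed

text \<open>Haraux's argument: subtracting the average of \<open>expf (- m0) r * f (x + r)\<close> over \<open>0 < r < \<eta>\<close>
  annihilates the frequency \<open>m0\<close> and keeps all others, at the cost of shortening the interval.\<close>

lemma observable_insert:
  assumes obs: "observable V \<sigma>" and "m0 \<notin> V" "0 < \<sigma>" "\<sigma> < \<tau>" "\<tau> \<le> 1"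
  shows "observable (insert m0 V) \<tau>"
proof -
  define \<eta> where "\<eta> = \<tau> - \<sigma>"
  have \<eta>: "0 < \<eta>" "\<sigma> + \<eta> = \<tau>" and \<tau>0: "0 < \<tau>" using assms by (auto simp: \<eta>_def)
  obtain c where c: "c > 0" "\<And>F a. finite F \<Longrightarrow> F \<subseteq> V \<Longrightarrow>
     c * (\<Sum>m\<in>F. (cmod (a m))\<^sup>2) \<le> integral\<^sup>L (lebesgue_on {0<..<\<sigma>}) (\<lambda>x. (cmod (trig a F x))\<^sup>2)"
    using obs unfolding observable_def by blast
  obtain \<kappa> where \<kappa>: "\<kappa> > 0" "\<And>j. j \<noteq> 0 \<Longrightarrow>
    \<kappa> \<le> cmod (1 - integral\<^sup>L (lebesgue_on {0<..<\<eta>}) (expf j) / complex_of_real \<eta>)"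
    by (rule averaging_symbol[OF \<eta>(1)]) (rule that)
  define k where "k m = 1 - integral\<^sup>L (lebesgue_on {0<..<\<eta>}) (expf (m - m0)) / complex_of_real \<eta>" for m
  \<comment> \<open>\<open>C\<close> bounds the coefficients other than the one at \<open>m0\<close>
    by the observed energy; the second summand in \<open>c'\<close> is the bound for the coefficient
    at \<open>m0\<close>, recovered by subtracting the others.\<close>
  define C where "C = (2 + 2 / \<eta>) / (c * \<kappa>\<^sup>2)"
  define c' where "c' = 1 / (C + (2 + 2 * C) / \<tau>)"
  have C0: "C > 0" using c(1) \<kappa>(1) \<eta>(1) by (simp add: C_def add_pos_pos)
  then have D0: "C + (2 + 2 * C) / \<tau> > 0" using \<tau>0 by (intro add_pos_pos divide_pos_pos) auto
  have "c' * (\<Sum>m\<in>F. (cmod (a m))\<^sup>2) \<le> integral\<^sup>L (lebesgue_on {0<..<\<tau>}) (\<lambda>x. (cmod (trig a F x))\<^sup>2)"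
    if F: "finite F" "F \<subseteq> insert m0 V" for F a
  proof -
    define E where "E = integral\<^sup>L (lebesgue_on {0<..<\<tau>}) (\<lambda>x. (cmod (trig a F x))\<^sup>2)"
    define F' where "F' = F - {m0}"
    have F': "finite F'" "F' \<subseteq> V" using F by (auto simp: F'_def)
    define \<Sigma> where "\<Sigma> = (\<Sum>m\<in>F'. (cmod (a m))\<^sup>2)"
    define \<alpha> where "\<alpha> = (if m0 \<in> F then a m0 else 0)"
    have E0: "0 \<le> E" by (simp add: E_def integral_nonneg_AE)
    have cf: "continuous_on UNIV (\<lambda>x. (cmod (trig b S x))\<^sup>2)" for b S by (intro continuous_intros)
    have split: "trig a F x = \<alpha> * expf m0 x + trig a F' x" for x
      using F(1) by (auto simp: trig_def F'_def \<alpha>_def sum.remove)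
    \<comment> \<open>Each exponential is an eigenfunction of the modulated average, with symbol
      \<open>k m\<close>; since \<open>k m0 = 0\<close>, only the sum over \<open>F'\<close>
      remains.\<close>
    have Kf: "trig (\<lambda>m. a m * k m) F' x = trig a F x - integral\<^sup>L (lebesgue_on {0<..<\<eta>}) (\<lambda>r. expf (- m0) r * trig a F (x + r)) / \<eta>" for x
    proof -
      have "(\<lambda>r. expf (- m0) r * trig a F (x + r)) = (\<lambda>r. \<Sum>m\<in>F. (a m * expf m x) * expf (m - m0) r)"
        by (rule ext) (simp add: trig_def expf_def sum_distrib_left cis_mult algebra_simps add_divide_distrib)
      then have "integral\<^sup>L (lebesgue_on {0<..<\<eta>}) (\<lambda>r. expf (- m0) r * trig a F (x + r)) =
          (\<Sum>m\<in>F. (a m * expf m x) * integral\<^sup>L (lebesgue_on {0<..<\<eta>}) (expf (m - m0)))"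
        by (simp add: integrable_continuous_Ioo continuous_intros)
      then have "trig a F x - integral\<^sup>L (lebesgue_on {0<..<\<eta>}) (\<lambda>r. expf (- m0) r * trig a F (x + r)) / \<eta>
          = (\<Sum>m\<in>F. (a m * k m) * expf m x)"
        by (simp add: trig_def k_def sum_divide_distrib algebra_simps flip: sum_subtractf)
      moreover have "k m0 = 0"
      proof -
        have "expf 0 = (\<lambda>_. 1)" by (auto simp: expf_def)
        then show ?thesis using \<eta>(1) by (simp add: k_def measure_restrict_space scaleR_conv_of_real)
      qed
      ultimately show ?thesis
        unfolding trig_def F'_def using F(1) by (cases "m0 \<in> F") (simp_all add: sum.remove)
    qed
    have avg: "(cmod (integral\<^sup>L (lebesgue_on {0<..<\<eta>}) (\<lambda>r. expf (- m0) r * trig a F (x + r)) / \<eta>))\<^sup>2 \<le> E / \<eta>"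
      if x: "x \<in> {0<..<\<sigma>}" for x
    proof -
      define h where "h r = cmod (expf (- m0) r * trig a F (x + r))" for r
      have ch: "continuous_on UNIV h"
        unfolding h_def by (intro continuous_intros continuous_on_compose2[OF continuous_on_trig[of UNIV]]) auto
      have "(cmod (integral\<^sup>L (lebesgue_on {0<..<\<eta>}) (\<lambda>r. expf (- m0) r * trig a F (x + r))))\<^sup>2 \<le> (integral\<^sup>L (lebesgue_on {0<..<\<eta>}) h)\<^sup>2"
        unfolding h_def by (intro power_mono integral_norm_bound norm_ge_zero)
      also have "\<dots> \<le> (\<eta> - 0) * integral\<^sup>L (lebesgue_on {0<..<\<eta>}) (\<lambda>r. (h r)\<^sup>2)"
        unfolding lebesgue_on_Ioo_Icc
      proof (rule integral_square_le)
        show "integrable (lebesgue_on {0..\<eta>}) h" "h sq_integrable_on {0..\<eta>}"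
          using integrable_continuous_Ioo[OF ch, of 0 \<eta>] continuous_sq_integrable[OF continuous_on_subset[OF ch], of 0 \<eta>]
          by (auto simp: sq_integrable_on_def lebesgue_on_Ioo_Icc)
      qed (use \<eta> in auto)
      also have "integral\<^sup>L (lebesgue_on {0<..<\<eta>}) (\<lambda>r. (h r)\<^sup>2) = integral\<^sup>L (lebesgue_on {0<..<\<eta>}) (\<lambda>r. (cmod (trig a F (x + r)))\<^sup>2)"
        by (simp add: h_def norm_mult)
      also have "\<dots> \<le> E"
        unfolding E_def by (rule integral_shift_le[OF cf]) (use x \<eta> in auto)
      finally show ?thesis
        using \<eta>(1) by (simp add: norm_divide power_divide divide_le_eq power2_eq_square mult.commute[of E])
    qed
    have "c * (\<Sum>m\<in>F'. (cmod (a m * k m))\<^sup>2) \<le> integral\<^sup>L (lebesgue_on {0<..<\<sigma>}) (\<lambda>x. (cmod (trig (\<lambda>m. a m * k m) F' x))\<^sup>2)"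
      by (rule c(2)[OF F'])
    also have "\<dots> \<le> integral\<^sup>L (lebesgue_on {0<..<\<sigma>}) (\<lambda>x. 2 * (cmod (trig a F x))\<^sup>2 + 2 * (E / \<eta>))"
    proof (rule integral_mono)
      show "integrable (lebesgue_on {0<..<\<sigma>}) (\<lambda>x. 2 * (cmod (trig a F x))\<^sup>2 + 2 * (E / \<eta>))"
        by (intro integrable_continuous_Ioo continuous_intros)
      fix x assume "x \<in> space (lebesgue_on {0<..<\<sigma>})"
      then have x: "x \<in> {0<..<\<sigma>}" by simp
      show "(cmod (trig (\<lambda>m. a m * k m) F' x))\<^sup>2 \<le> 2 * (cmod (trig a F x))\<^sup>2 + 2 * (E / \<eta>)"
        unfolding Kf using avg[OF x] by (intro order_trans[OF power2_norm_diff_le]) simp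
    qed (intro integrable_continuous_Ioo cf)
    also have "\<dots> = 2 * integral\<^sup>L (lebesgue_on {0<..<\<sigma>}) (\<lambda>x. (cmod (trig a F x))\<^sup>2) + 2 * (E / \<eta>) * \<sigma>"
      using assms(3) finite_measure.integrable_const[OF finite_measure_lebesgue_on[of "{0<..<\<sigma>}"]]
      by (subst Bochner_Integration.integral_add) (auto simp: integrable_continuous_Ioo[OF cf] measure_restrict_space)
    also have "\<dots> \<le> 2 * E + 2 * (E / \<eta>) * 1"
      using integral_square_mono[OF continuous_on_trig[of UNIV a F], of \<sigma> \<tau>] \<eta> E0 assms(3-5)
      by (intro add_mono mult_left_mono) (auto simp: E_def)
    also have "\<dots> = (2 + 2 / \<eta>) * E" by (simp add: algebra_simps)
    finally have 1: "c * (\<Sum>m\<in>F'. (cmod (a m * k m))\<^sup>2) \<le> (2 + 2 / \<eta>) * E" .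
    have "\<kappa>\<^sup>2 * \<Sigma> \<le> (\<Sum>m\<in>F'. (cmod (a m * k m))\<^sup>2)"
      unfolding \<Sigma>_def sum_distrib_left
    proof (rule sum_mono)
      fix m assume "m \<in> F'"
      then have "\<kappa> \<le> cmod (k m)" unfolding k_def by (intro \<kappa>(2)) (auto simp: F'_def)
      then have "\<kappa>\<^sup>2 \<le> (cmod (k m))\<^sup>2" using \<kappa>(1) by (intro power_mono) auto
      then have "\<kappa>\<^sup>2 * (cmod (a m))\<^sup>2 \<le> (cmod (k m))\<^sup>2 * (cmod (a m))\<^sup>2" by (rule mult_right_mono) simp
      then show "\<kappa>\<^sup>2 * (cmod (a m))\<^sup>2 \<le> (cmod (a m * k m))\<^sup>2"
        by (simp add: norm_mult power_mult_distrib mult.commute)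
    qed
    then have "c * (\<kappa>\<^sup>2 * \<Sigma>) \<le> (2 + 2 / \<eta>) * E" using 1 c(1) by (meson less_imp_le mult_left_mono order_trans)
    then have \<Sigma>: "\<Sigma> \<le> C * E" using c(1) \<kappa>(1) by (simp add: C_def pos_le_divide_eq mult_ac)
    \<comment> \<open>The single exponential left after removing the other terms has constant
      modulus, so its energy is proportional to the length; the energy of the removed terms is at
      most that on the whole period.\<close>
    have "(cmod \<alpha>)\<^sup>2 * \<tau> = integral\<^sup>L (lebesgue_on {0<..<\<tau>}) (\<lambda>x. (cmod (trig a F x - trig a F' x))\<^sup>2)"
      using \<tau>0 by (simp add: split norm_mult measure_restrict_space)
    also have "\<dots> \<le> integral\<^sup>L (lebesgue_on {0<..<\<tau>}) (\<lambda>x. 2 * (cmod (trig a F x))\<^sup>2 + 2 * (cmod (trig a F' x))\<^sup>2)"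
      by (intro integral_mono integrable_continuous_Ioo continuous_intros power2_norm_diff_le)
    also have "\<dots> = 2 * E + 2 * integral\<^sup>L (lebesgue_on {0<..<\<tau>}) (\<lambda>x. (cmod (trig a F' x))\<^sup>2)"
      by (simp add: E_def integrable_continuous_Ioo[OF cf])
    also have "\<dots> \<le> 2 * E + 2 * \<Sigma>"
      using integral_square_mono[OF continuous_on_trig[of UNIV a F'], of \<tau> 1] \<tau>0 assms(5)
        integral_trig_square[OF F'(1), of a] by (simp add: \<Sigma>_def)
    also have "\<dots> \<le> (2 + 2 * C) * E" using \<Sigma> by (simp add: algebra_simps)
    finally have \<alpha>: "(cmod \<alpha>)\<^sup>2 \<le> (2 + 2 * C) / \<tau> * E" using \<tau>0 by (simp add: field_simps)
    have "(\<Sum>m\<in>F. (cmod (a m))\<^sup>2) = (cmod \<alpha>)\<^sup>2 + \<Sigma>"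
      using F(1) by (auto simp: \<alpha>_def \<Sigma>_def F'_def sum.remove)
    also have "\<dots> \<le> (C + (2 + 2 * C) / \<tau>) * E" using \<alpha> \<Sigma> by (simp add: distrib_right)
    finally show ?thesis
      using D0 by (simp add: c'_def E_def pos_divide_le_eq mult.commute)
  qed
  moreover have "c' > 0" using D0 by (simp add: c'_def)
  ultimately show ?thesis unfolding observable_def by blast
qed

lemma observable_subset:
  assumes "observable W \<tau>" "V \<subseteq> W"
  shows "observable V \<tau>"
proof -
  obtain c where "c > 0" "\<And>F a. finite F \<Longrightarrow> F \<subseteq> W \<Longrightarrow>
     c * (\<Sum>m\<in>F. (cmod (a m))\<^sup>2) \<le> integral\<^sup>L (lebesgue_on {0<..<\<tau>}) (\<lambda>x. (cmod (trig a F x))\<^sup>2)"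
    using assms(1) unfolding observable_def by blast
  then show ?thesis
    unfolding observable_def using order_trans[OF _ assms(2)] by (intro exI[of _ c]) simp
qed

text \<open>Each insertion uses up some length. The statement is for every \<tau> beyond \<sigma>,
  so the remaining frequencies can be treated on the midpoint length \<rho> and the last one on the
  rest.\<close>

lemma observable_Un_finite:
  assumes "observable V \<sigma>" "0 < \<sigma>" "finite S" "\<sigma> < \<tau>" "\<tau> \<le> 1"
  shows "observable (V \<union> S) \<tau>"
  using assms(3-5)
proof (induction S arbitrary: \<tau> rule: finite_induct)
  case empty
  obtain c where c: "c > 0" "\<And>F a. finite F \<Longrightarrow> F \<subseteq> V \<Longrightarrow>
     c * (\<Sum>m\<in>F. (cmod (a m))\<^sup>2) \<le> integral\<^sup>L (lebesgue_on {0<..<\<sigma>}) (\<lambda>x. (cmod (trig a F x))\<^sup>2)"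
    using assms(1) unfolding observable_def by blast
  have "c * (\<Sum>m\<in>F. (cmod (a m))\<^sup>2) \<le> integral\<^sup>L (lebesgue_on {0<..<\<tau>}) (\<lambda>x. (cmod (trig a F x))\<^sup>2)"
    if "finite F" "F \<subseteq> V" for F a
    using c(2)[OF that, of a] integral_square_mono[OF continuous_on_trig[of UNIV a F], of \<sigma> \<tau>] empty assms(2)
    by simp
  then show ?case using c(1) unfolding observable_def by auto
next
  case (insert m S)
  define \<rho> where "\<rho> = (\<sigma> + \<tau>) / 2"
  have "observable (V \<union> S) \<rho>" using insert assms(2) by (intro insert.IH) (auto simp: \<rho>_def)
  then have "observable (insert m (V \<union> S)) \<tau>" if "m \<notin> V \<union> S"
    by (rule observable_insert[OF _ that]) (use insert assms(2) in \<open>auto simp: \<rho>_def\<close>)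
  moreover have "observable (V \<union> S) \<tau>" using insert by (intro insert.IH) auto
  ultimately show ?case by (cases "m \<in> V \<union> S") (auto simp: insert_absorb)
qed

text \<open>Unbounded gaps allow an arbitrarily short observation time: half of the length serves
  the widely separated frequencies, the other half the finitely many exceptional ones.\<close>

theorem Ingham_Haraux:
  assumes "\<And>G::nat. \<exists>S. finite S \<and> separated G (V - S)" "0 < \<tau>" "\<tau> \<le> 1"
  shows "observable V \<tau>"
proof -
  \<comment> \<open>\<open>Ingham_separated\<close> is applied on length \<open>\<tau> / 2\<close>
    and asks for \<open>3 \<le> real G * (\<tau> / 2)\<close>.\<close>
  obtain G :: nat where G: "6 / \<tau> < real G" using reals_Archimedean2 by blast
  have "0 < 6 / \<tau>" using assms(2) by simp
  then have G1: "G \<ge> 1" using G by (cases G) auto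
  obtain S where S: "finite S" "separated G (V - S)" using assms(1) by blast
  have "observable (V - S) (\<tau> / 2)"
    by (rule Ingham_separated[OF _ S(2) G1]) (use G assms(2) in \<open>auto simp: field_simps\<close>)
  from observable_Un_finite[OF this _ S(1), of \<tau>] have "observable (V - S \<union> S) \<tau>" using assms by simp
  then show ?thesis by (rule observable_subset) blast
qed

section \<open>The moment problem on an interval\<close>

text \<open>Restriction to the control interval; in this part elements of \<open>L2\<close> are
  functions of rescaled time.\<close>

definition chi :: "real \<Rightarrow> L2 \<Rightarrow> L2" where
  "chi \<tau> = mult_L2 (indicat_real {0<..<\<tau>})"

lemma ess_bounded_indicator: "ess_bounded 1 (indicat_real {0<..<\<tau>})"
proof -
  have "indicat_real {0<..<\<tau>} \<in> borel_measurable lebesgue" by (rule borel_measurable_indicator) simp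
  then have "indicat_real {0<..<\<tau>} \<in> borel_measurable leb01" by (rule measurable_restrict_space1)
  then show ?thesis by (auto simp: ess_bounded_def indicator_def)
qed

lemma bounded_linear_chi: "bounded_linear (chi \<tau>)"
  unfolding chi_def by (rule bounded_linear_mult_L2[OF ess_bounded_indicator])

lemma cinner_chi: "cinner_L2 (chi \<tau> f) g = cinner_L2 f (chi \<tau> g)"
  unfolding chi_def by (rule cinner_mult_L2[OF ess_bounded_indicator])

lemma chi_chi: "chi \<tau> (chi \<tau> f) = chi \<tau> f"
proof -
  note m = ess_bounded_mult(1)[OF ess_bounded_indicator sq_integrable_rep_L2]
  have "chi \<tau> f = to_L2 (\<lambda>x. complex_of_real (indicat_real {0<..<\<tau>} x) * rep_L2 f x)"
    by (simp add: chi_def mult_L2_def)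
  then have "chi \<tau> (chi \<tau> f) = to_L2 (\<lambda>x. complex_of_real (indicat_real {0<..<\<tau>} x) *
      (complex_of_real (indicat_real {0<..<\<tau>} x) * rep_L2 f x))"
    by (simp add: chi_def mult_L2_to_L2[OF ess_bounded_indicator m])
  also have "(\<lambda>x. complex_of_real (indicat_real {0<..<\<tau>} x) *
      (complex_of_real (indicat_real {0<..<\<tau>} x) * rep_L2 f x)) = (\<lambda>x. complex_of_real (indicat_real {0<..<\<tau>} x) * rep_L2 f x)"
    by (auto simp: indicator_def)
  finally show ?thesis by (simp add: chi_def mult_L2_def)
qed

text \<open>\<open>chi \<tau>\<close> is symmetric and idempotent, hence an orthogonal
  projection.\<close>

lemma norm_chi_Pythagoras: "(norm (f - chi \<tau> f))\<^sup>2 = (norm f)\<^sup>2 - (norm (chi \<tau> f))\<^sup>2"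
proof -
  have "inner f (chi \<tau> f) = (norm (chi \<tau> f))\<^sup>2"
    unfolding power2_norm_eq_inner inner_L2_def cinner_chi chi_chi ..
  then show ?thesis
    by (simp add: power2_norm_eq_inner inner_diff_left inner_diff_right inner_commute)
qed

lemma norm_chi_trig:
  assumes "0 < \<tau>" "\<tau> \<le> 1"
  shows "(norm (chi \<tau> (\<Sum>m\<in>F. a m *\<^sub>C expb m)))\<^sup>2 = integral\<^sup>L (lebesgue_on {0<..<\<tau>}) (\<lambda>x. (cmod (trig a F x))\<^sup>2)"
proof -
  note m = ess_bounded_mult(1)[OF ess_bounded_indicator sq_integrable_trig]
  have "chi \<tau> (\<Sum>m\<in>F. a m *\<^sub>C expb m) = to_L2 (\<lambda>x. complex_of_real (indicat_real {0<..<\<tau>} x) * trig a F x)"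
    unfolding to_L2_trig[symmetric] chi_def by (rule mult_L2_to_L2[OF ess_bounded_indicator sq_integrable_trig])
  then have "(norm (chi \<tau> (\<Sum>m\<in>F. a m *\<^sub>C expb m)))\<^sup>2 =
      integral\<^sup>L leb01 (\<lambda>x. (cmod (complex_of_real (indicat_real {0<..<\<tau>} x) * trig a F x))\<^sup>2)"
    by (simp add: norm_to_L2[OF m] integral_nonneg_AE)
  also have "(\<lambda>x. (cmod (complex_of_real (indicat_real {0<..<\<tau>} x) * trig a F x))\<^sup>2) =
      (\<lambda>x. if x \<in> {0<..<\<tau>} then (cmod (trig a F x))\<^sup>2 else 0)"
    by (auto simp: indicator_def)
  also have "integral\<^sup>L leb01 \<dots> = integral\<^sup>L (lebesgue_on {0<..<\<tau>}) (\<lambda>x. (cmod (trig a F x))\<^sup>2)"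
    by (rule integral_restrict) (use assms in auto)
  finally show ?thesis .
qed

section \<open>Projections onto closed spans of exponentials, and the moment problem\<close>

definition proj :: "int set \<Rightarrow> L2 \<Rightarrow> L2" where
  "proj V = multiplier expb V (\<lambda>m. 1)"

lemma orthonormal_subset: "orthonormal e I \<Longrightarrow> J \<subseteq> I \<Longrightarrow> orthonormal e J"
  unfolding orthonormal_def by blast

lemma orthonormal_expb_on: "orthonormal expb V"
  by (rule orthonormal_subset[OF orthonormal_expb]) simp

lemma bounded_linear_proj: "bounded_linear (proj V)"
  unfolding proj_def by (rule bounded_linear_multiplier[OF orthonormal_expb_on, where B = 1]) auto

lemma norm_proj: "norm (proj V f) \<le> norm f"
  unfolding proj_def using norm_multiplier[OF orthonormal_expb_on, of V "\<lambda>m. 1" 1 f] by simp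

lemma cinner_proj: "m \<in> V \<Longrightarrow> cinner_L2 (proj V f) (expb m) = cinner_L2 f (expb m)"
  unfolding proj_def using cinner_multiplier[OF orthonormal_expb_on, of V "\<lambda>m. 1" 1 m f] by simp

lemma has_sum_proj: "((\<lambda>m. cinner_L2 f (expb m) *\<^sub>C expb m) has_sum proj V f) V"
  unfolding proj_def using has_sum_multiplier[OF orthonormal_expb_on, of V "\<lambda>m. 1" 1 f] by simp

lemma proj_proj: "proj V (proj V f) = proj V f"
proof (rule has_sum_unique[OF has_sum_proj])
  show "((\<lambda>m. cinner_L2 (proj V f) (expb m) *\<^sub>C expb m) has_sum proj V f) V"
    by (rule has_sum_cong[THEN iffD1, OF _ has_sum_proj]) (simp add: cinner_proj)
qed

text \<open>Observability bounds \<open>chi \<tau>\<close> from below on the closed span; by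
  Pythagoras the part of the norm lost outside the control interval is then a fixed fraction less
  than 1.\<close>

lemma observable_proj:
  assumes "observable V \<tau>" "0 < \<tau>" "\<tau> \<le> 1"
  obtains q where "0 \<le> q" "q < 1" "\<And>f. norm (proj V f - chi \<tau> (proj V f)) \<le> q * norm (proj V f)"
proof -
  obtain c where c: "c > 0" "\<And>F a. finite F \<Longrightarrow> F \<subseteq> V \<Longrightarrow>
     c * (\<Sum>m\<in>F. (cmod (a m))\<^sup>2) \<le> integral\<^sup>L (lebesgue_on {0<..<\<tau>}) (\<lambda>x. (cmod (trig a F x))\<^sup>2)"
    using assms(1) unfolding observable_def by blast
  have le: "c * (norm (proj V f))\<^sup>2 \<le> (norm (chi \<tau> (proj V f)))\<^sup>2" for f
  proof (rule tendsto_le[OF finite_subsets_at_top_neq_bot])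
    let ?s = "\<lambda>F. \<Sum>m\<in>F. cinner_L2 f (expb m) *\<^sub>C expb m"
    have s: "(?s \<longlongrightarrow> proj V f) (finite_subsets_at_top V)"
      using has_sum_proj[of f V] by (simp add: has_sum_def)
    show "((\<lambda>F. (norm (chi \<tau> (?s F)))\<^sup>2) \<longlongrightarrow> (norm (chi \<tau> (proj V f)))\<^sup>2) (finite_subsets_at_top V)"
      by (intro tendsto_intros bounded_linear.tendsto[OF bounded_linear_chi] s)
    show "((\<lambda>F. c * (norm (?s F))\<^sup>2) \<longlongrightarrow> c * (norm (proj V f))\<^sup>2) (finite_subsets_at_top V)"
      by (intro tendsto_intros s)
    have "c * (norm (?s F))\<^sup>2 \<le> (norm (chi \<tau> (?s F)))\<^sup>2" if "finite F" "F \<subseteq> V" for F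
      unfolding norm_chi_trig[OF assms(2,3)] orthonormal_norm_sum[OF orthonormal_expb_on that(1) that(2)]
      by (rule c(2)[OF that])
    then show "\<forall>\<^sub>F F in finite_subsets_at_top V. c * (norm (?s F))\<^sup>2 \<le> (norm (chi \<tau> (?s F)))\<^sup>2"
      unfolding eventually_finite_subsets_at_top by (intro exI[of _ "{}"]) auto
  qed
  \<comment> \<open>Reduces the constant so that \<open>1 - b\<close> is positive and its square
    root defined as a contraction factor.\<close>
  define b where "b = min c (1 / 2)"
  have b: "0 < b" "b \<le> c" "b \<le> 1 / 2" using c(1) by (auto simp: b_def)
  have "norm (proj V f - chi \<tau> (proj V f)) \<le> sqrt (1 - b) * norm (proj V f)" for f
  proof (rule power2_le_imp_le)
    have "b * (norm (proj V f))\<^sup>2 \<le> c * (norm (proj V f))\<^sup>2" using b by (intro mult_right_mono) auto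
    then have "(norm (proj V f))\<^sup>2 - (norm (chi \<tau> (proj V f)))\<^sup>2 \<le> (1 - b) * (norm (proj V f))\<^sup>2"
      using le[of f] by (simp add: algebra_simps)
    then show "(norm (proj V f - chi \<tau> (proj V f)))\<^sup>2 \<le> (sqrt (1 - b) * norm (proj V f))\<^sup>2"
      using b by (simp add: norm_chi_Pythagoras power_mult_distrib)
  qed (use b in auto)
  then show thesis using that[of "sqrt (1 - b)"] b by (auto simp: real_sqrt_lt_1_iff)
qed

text \<open>On the range of \<open>proj V\<close> the operator \<open>proj V \<circ> chi \<tau>\<close> differs from the identity by a contraction.\<close>

theorem moment_solver:
  assumes "observable V \<tau>" "0 < \<tau>" "\<tau> \<le> 1"
  obtains R C where "0 \<le> C" "\<And>D. proj V D = D \<Longrightarrow> proj V (R D) = D" "\<And>D. chi \<tau> (R D) = R D"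
    "\<And>D D'. norm (R D - R D') \<le> C * norm (D - D')" "R 0 = 0"
proof -
  obtain q where q: "0 \<le> q" "q < 1" "\<And>f. norm (proj V f - chi \<tau> (proj V f)) \<le> q * norm (proj V f)"
    by (rule observable_proj[OF assms]) (rule that)
  \<comment> \<open>On the range of \<open>proj V\<close> this is the identity minus
    \<open>proj V \<circ> chi \<tau>\<close>; the outer projection keeps its values in the range,
    and solving \<open>D + K f = f\<close> inverts \<open>proj V \<circ> chi \<tau>\<close>.\<close>
  define K where "K f = proj V (proj V f - chi \<tau> (proj V f))" for f
  have blK: "bounded_linear K"
    unfolding K_def
    by (rule bounded_linear_compose[OF bounded_linear_proj])
      (intro bounded_linear_sub bounded_linear_proj bounded_linear_compose[OF bounded_linear_chi bounded_linear_proj])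
  have nK: "norm (K f) \<le> q * norm f" for f
  proof -
    have "norm (K f) \<le> norm (proj V f - chi \<tau> (proj V f))" unfolding K_def by (rule norm_proj)
    also have "\<dots> \<le> q * norm (proj V f)" by (rule q(3))
    also have "\<dots> \<le> q * norm f" by (intro mult_left_mono norm_proj q(1))
    finally show ?thesis .
  qed
  have Kd: "K f - K g = K (f - g)" for f g by (rule linear_diff[OF bounded_linear.linear[OF blK], symmetric])
  have "\<exists>!f. D + K f = f" for D
    by (rule banach_fix_type[OF q(1,2)]) (simp add: dist_norm Kd nK)
  then obtain S where S: "\<And>D. D + K (S D) = S D" by metis
  have lip: "norm (S D - S D') \<le> 1 / (1 - q) * norm (D - D')" for D D'
  proof -
    have "S D - S D' = (D - D') + K (S D - S D')"
      using S[of D] S[of D'] by (simp add: Kd[symmetric] algebra_simps)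
    then have "norm (S D - S D') \<le> norm (D - D') + norm (K (S D - S D'))"
      by (metis norm_triangle_ineq)
    also have "\<dots> \<le> norm (D - D') + q * norm (S D - S D')" using nK by simp
    finally show ?thesis using q(2) by (simp add: field_simps)
  qed
  have "K 0 = 0" by (rule linear_0[OF bounded_linear.linear[OF blK]])
  have "S 0 = 0"
  proof -
    have "norm (S 0) \<le> q * norm (S 0)" using S[of 0] nK[of "S 0"] by simp
    then have "(1 - q) * norm (S 0) \<le> 0" by (simp add: algebra_simps)
    then show ?thesis using q(2) by (simp add: mult_le_0_iff)
  qed
  show thesis
  proof (rule that[of "1 / (1 - q)" "\<lambda>D. chi \<tau> (S D)"])
    show "0 \<le> 1 / (1 - q)" using q(2) by simp
    show "chi \<tau> (chi \<tau> (S D)) = chi \<tau> (S D)" for D by (rule chi_chi)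
    show "chi \<tau> (S 0) = 0"
      unfolding \<open>S 0 = 0\<close> by (rule linear_0[OF bounded_linear.linear[OF bounded_linear_chi]])
    show "norm (chi \<tau> (S D) - chi \<tau> (S D')) \<le> 1 / (1 - q) * norm (D - D')" for D D'
    proof -
      have "norm (chi \<tau> (S D) - chi \<tau> (S D')) = norm (chi \<tau> (S D - S D'))"
        by (simp only: linear_diff[OF bounded_linear.linear[OF bounded_linear_chi]])
      also have "\<dots> \<le> norm (S D - S D')"
        unfolding chi_def using norm_mult_L2[OF ess_bounded_indicator] by simp
      finally show ?thesis using lip[of D D'] by linarith
    qed
    fix D assume D: "proj V D = D"
    have pd: "proj V (f - g) = proj V f - proj V g" for f g
      by (rule linear_diff[OF bounded_linear.linear[OF bounded_linear_proj]])
    have pa: "proj V (f + g) = proj V f + proj V g" for f g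
      by (rule linear_add[OF bounded_linear.linear[OF bounded_linear_proj]])
    \<comment> \<open>Both \<open>D\<close> and the values of \<open>K\<close> lie in the range of
      \<open>proj V\<close>, hence so does the fixed point, and on it \<open>K\<close> has the
      intended form.\<close>
    have PS: "proj V (S D) = S D"
      using arg_cong[OF S[of D], of "proj V"] S[of D] by (simp add: pa D K_def proj_proj)
    have "S D = D + S D - proj V (chi \<tau> (S D))"
      using S[of D] by (simp add: K_def PS pd algebra_simps)
    then show "proj V (chi \<tau> (S D)) = D" by (simp add: algebra_simps)
  qed
qed

section \<open>Controls with prescribed moments\<close>

lemma integral_stretch_Ioo:
  fixes f :: "real \<Rightarrow> 'b::euclidean_space"
  assumes f: "integrable (lebesgue_on {0<..<\<tau>}) f" and m: "m > 0"
  shows "integrable (lebesgue_on {0<..<\<tau> / m}) (\<lambda>s. f (m * s))"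
    and "integral\<^sup>L (lebesgue_on {0<..<\<tau> / m}) (\<lambda>s. f (m * s)) = (1 / m) *\<^sub>R integral\<^sup>L (lebesgue_on {0<..<\<tau>}) f"
proof -
  have im: "(\<lambda>x. x / m) ` {0..\<tau>} = {0..\<tau> / m}"
  proof
    show "{0..\<tau> / m} \<subseteq> (\<lambda>x. x / m) ` {0..\<tau>}"
    proof
      fix y assume "y \<in> {0..\<tau> / m}"
      then have "y = (m * y) / m" "m * y \<in> {0..\<tau>}" using m by (auto simp: field_simps)
      then show "y \<in> (\<lambda>x. x / m) ` {0..\<tau>}" by blast
    qed
  qed (use m in \<open>auto intro: divide_right_mono\<close>)
  have fi: "integrable (lebesgue_on {0..\<tau>}) f" using f by (simp add: lebesgue_on_Ioo_Icc)
  have st: "((\<lambda>s. g (m * s)) has_integral (1 / m) *\<^sub>R integral\<^sup>L (lebesgue_on {0..\<tau>}) g) {0..\<tau> / m}"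
    if "integrable (lebesgue_on {0..\<tau>}) g" for g :: "real \<Rightarrow> 'z::euclidean_space"
    using has_integral_stretch_real[OF has_integral_integral_lebesgue_on[OF that], of m] m im by simp
  have "(\<lambda>s. f (m * s)) absolutely_integrable_on {0..\<tau> / m}"
    unfolding absolutely_integrable_on_def
    using st[OF fi] st[OF integrable_norm[OF fi]] by (auto simp: integrable_on_def)
  then have i: "integrable (lebesgue_on {0..\<tau> / m}) (\<lambda>s. f (m * s))"
    by (simp add: set_integrable_def integrable_restrict_space)
  then show "integrable (lebesgue_on {0<..<\<tau> / m}) (\<lambda>s. f (m * s))" by (simp add: lebesgue_on_Ioo_Icc)
  have "integral\<^sup>L (lebesgue_on {0..\<tau> / m}) (\<lambda>s. f (m * s)) = (1 / m) *\<^sub>R integral\<^sup>L (lebesgue_on {0..\<tau>}) f"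
    using lebesgue_integral_eq_integral[OF i] integral_unique[OF st[OF fi]] by simp
  then show "integral\<^sup>L (lebesgue_on {0<..<\<tau> / m}) (\<lambda>s. f (m * s)) = (1 / m) *\<^sub>R integral\<^sup>L (lebesgue_on {0<..<\<tau>}) f"
    by (simp add: lebesgue_on_Ioo_Icc)
qed

text \<open>The time interval of length \<open>2 / pi\<close>, the common period of the exponentials, is rescaled to
  \<open>(0, 1)\<close>, so that controls are represented by elements of \<open>L2\<close>.\<close>

definition ctl :: "real \<Rightarrow> L2 \<Rightarrow> real \<Rightarrow> real" where
  "ctl \<tau> U = zero_ext (\<tau> / (pi / 2)) (\<lambda>s. pi / 2 * Re (rep_L2 U (pi / 2 * s)))"

context
  fixes \<tau> T :: real
  assumes \<tau>: "0 < \<tau>" "\<tau> \<le> 1" and \<tau>T: "\<tau> / (pi / 2) \<le> T"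
begin

lemma Re_rep_sq_integrable:
  "(\<lambda>x. Re (rep_L2 U x)) sq_integrable_on {0<..<1}" "(\<lambda>x. Re (rep_L2 U x)) sq_integrable_on {0<..<\<tau>}"
proof -
  have 2: "rep_L2 U sq_integrable_on {0<..<1}" by (rule sq_integrable_rep_L2)
  then have [measurable]: "rep_L2 U \<in> borel_measurable leb01" and i: "integrable leb01 (\<lambda>x. (cmod (rep_L2 U x))\<^sup>2)"
    by (auto simp: sq_integrable_on_def)
  have "integrable leb01 (\<lambda>x. (Re (rep_L2 U x))\<^sup>2)"
    by (rule Bochner_Integration.integrable_bound[OF i]) (auto intro!: AE_I2 simp: cmod_power2)
  then show 1: "(\<lambda>x. Re (rep_L2 U x)) sq_integrable_on {0<..<1}" by (simp add: sq_integrable_on_def)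
  show "(\<lambda>x. Re (rep_L2 U x)) sq_integrable_on {0<..<\<tau>}"
    by (rule sq_integrable_subset[OF 1]) (use \<tau> in auto)
qed

lemma ctl_sq_integrable: "ctl \<tau> U sq_integrable_on UNIV"
proof -
  let ?F = "\<lambda>x. Re (rep_L2 U x)"
  let ?M = "lebesgue_on {0<..<\<tau> / (pi / 2)}"
  have F: "?F sq_integrable_on {0<..<\<tau>}" by (rule Re_rep_sq_integrable(2))
  then have F2: "integrable (lebesgue_on {0<..<\<tau>}) (\<lambda>x. (norm (?F x))\<^sup>2)" unfolding sq_integrable_on_def by blast
  have "integrable ?M (\<lambda>s. ?F (pi / 2 * s))"
    by (rule integral_stretch_Ioo(1)[OF sq_integrable_imp_integrable[OF F]]) simp
  then have 1: "(\<lambda>s. pi / 2 * ?F (pi / 2 * s)) \<in> borel_measurable ?M"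
    by (intro borel_measurable_times borel_measurable_const borel_measurable_integrable)
  have "integrable ?M (\<lambda>s. (norm (?F (pi / 2 * s)))\<^sup>2)"
    by (rule integral_stretch_Ioo(1)[OF F2]) simp
  then have "integrable ?M (\<lambda>s. (pi / 2)\<^sup>2 * (norm (?F (pi / 2 * s)))\<^sup>2)" by (rule integrable_mult_right)
  moreover have "(norm (pi / 2 * c))\<^sup>2 = (pi / 2)\<^sup>2 * (norm c)\<^sup>2" for c :: real
    by (simp add: power_mult_distrib power_divide)
  ultimately have "integrable ?M (\<lambda>s. (norm (pi / 2 * ?F (pi / 2 * s)))\<^sup>2)" by (simp only:)
  with 1 have "(\<lambda>s. pi / 2 * ?F (pi / 2 * s)) sq_integrable_on {0<..<\<tau> / (pi / 2)}"
    unfolding sq_integrable_on_def by blast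
  then show ?thesis unfolding ctl_def by (rule zero_ext_sq_integrable)
qed

text \<open>The amplitude factor \<open>pi / 2\<close> enters squared and the change of time
  variable gives back \<open>2 / pi\<close>, which leaves \<open>pi / 2\<close>. It is stated for a
  general representative \<open>f\<close> so that it also covers differences of two
  controls.\<close>

lemma ctl_energy:
  assumes f: "f sq_integrable_on {0<..<1}"
  shows "integral\<^sup>L (lebesgue_on {0..T}) (\<lambda>s. (zero_ext (\<tau> / (pi / 2)) (\<lambda>s. pi / 2 * Re (f (pi / 2 * s))) s)\<^sup>2)
    \<le> pi / 2 * (norm (to_L2 f))\<^sup>2"
proof -
  let ?p = "\<tau> / (pi / 2)"
  define g where "g x = (pi / 2 * Re (f x))\<^sup>2" for x
  have fi: "integrable leb01 (\<lambda>x. (cmod (f x))\<^sup>2)" using f unfolding sq_integrable_on_def by blast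
  have [measurable]: "f \<in> borel_measurable leb01" using f unfolding sq_integrable_on_def by blast
  have gm: "g \<in> borel_measurable leb01" unfolding g_def by measurable
  have gle: "g x \<le> (pi / 2)\<^sup>2 * (cmod (f x))\<^sup>2" for x
    unfolding g_def power_mult_distrib by (intro mult_left_mono) (auto simp: cmod_power2)
  have g0: "0 \<le> g x" for x by (simp add: g_def)
  have fi': "integrable leb01 (\<lambda>x. (pi / 2)\<^sup>2 * (cmod (f x))\<^sup>2)" by (rule integrable_mult_right[OF fi])
  have gi: "integrable leb01 g"
    by (rule Bochner_Integration.integrable_bound[OF fi' gm])
      (rule AE_I2, use gle g0 in \<open>simp add: abs_of_nonneg\<close>)
  have "g absolutely_integrable_on {0<..<1}" using gi by (simp add: set_integrable_def integrable_restrict_space)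
  then have "g absolutely_integrable_on {0<..<\<tau>}" by (rule set_integrable_subset) (use \<tau> in auto)
  then have gi\<tau>: "integrable (lebesgue_on {0<..<\<tau>}) g" by (simp add: set_integrable_def integrable_restrict_space)
  have "(\<lambda>s. (zero_ext ?p (\<lambda>s. pi / 2 * Re (f (pi / 2 * s))) s)\<^sup>2) = (\<lambda>s. if s \<in> {0<..<?p} then g (pi / 2 * s) else 0)"
    by (auto simp: zero_ext_def g_def)
  then have "integral\<^sup>L (lebesgue_on {0..T}) (\<lambda>s. (zero_ext ?p (\<lambda>s. pi / 2 * Re (f (pi / 2 * s))) s)\<^sup>2) =
      integral\<^sup>L (lebesgue_on {0<..<?p}) (\<lambda>s. g (pi / 2 * s))"
    by (simp only:) (rule integral_restrict, use \<tau>T in auto)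
  also have "\<dots> = (1 / (pi / 2)) *\<^sub>R integral\<^sup>L (lebesgue_on {0<..<\<tau>}) g"
    by (rule integral_stretch_Ioo(2)[OF gi\<tau>]) simp
  also have "\<dots> \<le> (1 / (pi / 2)) *\<^sub>R integral\<^sup>L leb01 g"
  proof (rule scaleR_left_mono)
    have "0 \<le> integral\<^sup>L (lebesgue_on {\<tau><..<1}) g" by (rule integral_nonneg_AE) (simp add: g0)
    then show "integral\<^sup>L (lebesgue_on {0<..<\<tau>}) g \<le> integral\<^sup>L leb01 g"
      using integral_split_Ioo[OF gi, of \<tau>] \<tau> by simp
  qed simp
  also have "\<dots> \<le> (1 / (pi / 2)) *\<^sub>R integral\<^sup>L leb01 (\<lambda>x. (pi / 2)\<^sup>2 * (cmod (f x))\<^sup>2)"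
    by (rule scaleR_left_mono, rule integral_mono[OF gi fi' gle]) simp
  also have "integral\<^sup>L leb01 (\<lambda>x. (pi / 2)\<^sup>2 * (cmod (f x))\<^sup>2) = (pi / 2)\<^sup>2 * (norm (to_L2 f))\<^sup>2"
    by (simp only: norm_to_L2[OF f] integral_mult_right_zero) (simp add: integral_nonneg_AE)
  finally show ?thesis by (simp add: power2_eq_square)
qed

lemma ctl_diff:
  "integral\<^sup>L (lebesgue_on {0..T}) (\<lambda>s. (ctl \<tau> U s - ctl \<tau> U' s)\<^sup>2) \<le> pi / 2 * (norm (U - U'))\<^sup>2"
proof -
  note d = to_L2_diff[OF sq_integrable_rep_L2[of U] sq_integrable_rep_L2[of U']]
  have "(\<lambda>s. (ctl \<tau> U s - ctl \<tau> U' s)\<^sup>2) =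
      (\<lambda>s. (zero_ext (\<tau> / (pi / 2)) (\<lambda>s. pi / 2 * Re (rep_L2 U (pi / 2 * s) - rep_L2 U' (pi / 2 * s))) s)\<^sup>2)"
    by (auto simp: ctl_def zero_ext_def algebra_simps)
  then show ?thesis using ctl_energy[OF d(2)] d(1) by simp
qed

lemma ctl_norm: "integral\<^sup>L (lebesgue_on {0..T}) (\<lambda>s. (ctl \<tau> U s)\<^sup>2) \<le> pi / 2 * (norm U)\<^sup>2"
  using ctl_energy[OF sq_integrable_rep_L2[of U]] by (simp add: ctl_def)

text \<open>The substitution \<open>x = pi / 2 * s\<close> turns
  \<open>cis (pi\<^sup>2 * j * s)\<close> into \<open>expf j x\<close>, and the amplitude cancels
  the Jacobian. Taking the real part of \<open>U\<close> averages it with its conjugate, so the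
  coefficients at \<open>- j\<close> and at \<open>j\<close> both appear. The assumption on
  \<open>U\<close> lets integrals over the control interval be read as inner products on the full
  period.\<close>

lemma ctl_moment:
  assumes "chi \<tau> U = U"
  shows "integral\<^sup>L (lebesgue_on {0..T}) (\<lambda>s. complex_of_real (ctl \<tau> U s) * cis (pi\<^sup>2 * of_int j * s)) =
    (cinner_L2 U (expb (- j)) + cnj (cinner_L2 U (expb j))) / 2"
proof -
  let ?p = "\<tau> / (pi / 2)"
  let ?M = "lebesgue_on {0<..<\<tau>}"
  have F: "(\<lambda>x. Re (rep_L2 U x)) sq_integrable_on {0<..<\<tau>}" by (rule Re_rep_sq_integrable(2))
  have r2: "rep_L2 U sq_integrable_on {0<..<\<tau>}"
    by (rule sq_integrable_subset[OF sq_integrable_rep_L2]) (use \<tau> in auto)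
  note ri = sq_integrable_imp_integrable[OF r2]
  define G where "G x = complex_of_real (pi / 2) * (expf j x * complex_of_real (Re (rep_L2 U x)))" for x
  have Gi: "integrable ?M G"
    unfolding G_def
    by (intro integrable_mult_right integrable_continuous_mult integrable_of_real sq_integrable_imp_integrable F continuous_intros)
  have inner: "cinner_L2 U (expb k) = integral\<^sup>L ?M (\<lambda>x. expf (- k) x * rep_L2 U x)" for k
  proof -
    note m = ess_bounded_mult(1)[OF ess_bounded_indicator sq_integrable_rep_L2[of U], of \<tau>]
    have "cinner_L2 U (expb k) = cinner_L2 (chi \<tau> U) (expb k)" by (simp add: assms)
    also have "\<dots> = integral\<^sup>L leb01 (\<lambda>x. (complex_of_real (indicat_real {0<..<\<tau>} x) * rep_L2 U x) * cnj (expf k x))"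
      unfolding chi_def mult_L2_def expb_def by (rule cinner_to_L2[OF m sq_integrable_expf])
    also have "(\<lambda>x. (complex_of_real (indicat_real {0<..<\<tau>} x) * rep_L2 U x) * cnj (expf k x)) =
        (\<lambda>x. if x \<in> {0<..<\<tau>} then expf (- k) x * rep_L2 U x else 0)"
      by (auto simp: indicator_def cnj_expf)
    also have "integral\<^sup>L leb01 \<dots> = integral\<^sup>L ?M (\<lambda>x. expf (- k) x * rep_L2 U x)"
      by (rule integral_restrict) (use \<tau> in auto)
    finally show ?thesis .
  qed
  have "(\<lambda>s. complex_of_real (ctl \<tau> U s) * cis (pi\<^sup>2 * of_int j * s)) = (\<lambda>s. if s \<in> {0<..<?p} then G (pi / 2 * s) else 0)"
    by (auto simp: ctl_def zero_ext_def G_def expf_def power2_eq_square mult_ac)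
  then have "integral\<^sup>L (lebesgue_on {0..T}) (\<lambda>s. complex_of_real (ctl \<tau> U s) * cis (pi\<^sup>2 * of_int j * s)) =
      integral\<^sup>L (lebesgue_on {0<..<?p}) (\<lambda>s. G (pi / 2 * s))"
    by (simp only:) (rule integral_restrict, use \<tau>T in auto)
  also have "\<dots> = (1 / (pi / 2)) *\<^sub>R integral\<^sup>L ?M G"
    by (rule integral_stretch_Ioo(2)[OF Gi]) simp
  also have "\<dots> = integral\<^sup>L ?M (\<lambda>x. expf j x * complex_of_real (Re (rep_L2 U x)))"
    unfolding G_def integral_mult_right_zero by (simp add: scaleR_conv_of_real flip: of_real_mult)
  also have "(\<lambda>x. expf j x * complex_of_real (Re (rep_L2 U x))) =
      (\<lambda>x. (expf j x * rep_L2 U x + cnj (expf (- j) x * rep_L2 U x)) / 2)"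
  proof
    fix x
    have "complex_of_real (Re w) = (w + cnj w) / 2" for w by (simp add: complex_add_cnj)
    from this[of "rep_L2 U x"] show "expf j x * complex_of_real (Re (rep_L2 U x)) = (expf j x * rep_L2 U x + cnj (expf (- j) x * rep_L2 U x)) / 2"
      by (simp only:) (simp add: cnj_expf distrib_left)
  qed
  also have "integral\<^sup>L ?M \<dots> = (integral\<^sup>L ?M (\<lambda>x. expf j x * rep_L2 U x) + cnj (integral\<^sup>L ?M (\<lambda>x. expf (- j) x * rep_L2 U x))) / 2"
    using integrable_continuous_mult[OF ri continuous_on_expf]
    by (simp add: Bochner_Integration.integral_cnj[symmetric] del: Bochner_Integration.integral_cnj complex_cnj_mult)
  finally show ?thesis unfolding inner by simp
qed

end

lemma proj_expb: "m \<in> V \<Longrightarrow> proj V (c *\<^sub>C expb m) = c *\<^sub>C expb m"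
proof (rule has_sum_unique[OF has_sum_proj])
  assume m: "m \<in> V"
  have o: "cinner_L2 (expb m) (expb n) = (if m = n then 1 else 0)" for n
    using orthonormal_expb by (simp add: orthonormal_def)
  show "((\<lambda>n. cinner_L2 (c *\<^sub>C expb m) (expb n) *\<^sub>C expb n) has_sum c *\<^sub>C expb m) V"
    by (rule has_sum_cong_neutral[where T = "{m}" and g = "\<lambda>n. c *\<^sub>C expb m", THEN iffD2])
      (use m in \<open>auto simp: cinner_L2_scaleC_left o intro!: has_sum_finiteI\<close>)
qed

lemma proj_has_sum:
  assumes "((\<lambda>k. c k *\<^sub>C expb (f k)) has_sum D) I" "f ` I \<subseteq> V"
  shows "proj V D = D"
proof (rule has_sum_unique[OF has_sum_bounded_linear[OF bounded_linear_proj assms(1)]])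
  show "((\<lambda>k. proj V (c k *\<^sub>C expb (f k))) has_sum D) I"
    by (rule has_sum_cong[THEN iffD2, OF _ assms(1)]) (use assms(2) proj_expb in auto)
qed

lemma square_gap:
  fixes k k' N :: int
  assumes "N \<le> k" "N \<le> k'" "k \<noteq> k'" "0 \<le> N"
  shows "2 * N \<le> \<bar>k\<^sup>2 - k'\<^sup>2\<bar>"
proof -
  have "\<bar>k\<^sup>2 - k'\<^sup>2\<bar> = \<bar>k - k'\<bar> * (k + k')"
    using assms by (simp add: power2_eq_square square_diff_square_factored abs_mult mult.commute)
  moreover have "1 * (2 * N) \<le> \<bar>k - k'\<bar> * (k + k')"
    using assms by (intro mult_mono) auto
  ultimately show ?thesis by simp
qed

text \<open>Once the indices \<open>k\<close> up to \<open>N = G + l + 1\<close> are removed,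
  frequencies of opposite sign are at distance at least \<open>2 * N\<close> because each has
  modulus at least \<open>N\<close>, and those of equal sign are differences of distinct squares,
  again at least \<open>2 * N\<close> apart.\<close>

lemma frequencies_lacunary:
  fixes l :: nat
  defines "V \<equiv> {(int l)\<^sup>2 - (int k)\<^sup>2 |k. k \<ge> 1} \<union> {(int k)\<^sup>2 - (int l)\<^sup>2 |k. k \<ge> 1}"
  shows "\<exists>S. finite S \<and> separated G (V - S)"
proof -
  define N where "N = G + l + 1"
  define S where "S = (\<lambda>k. (int l)\<^sup>2 - (int k)\<^sup>2) ` {..N} \<union> (\<lambda>k. (int k)\<^sup>2 - (int l)\<^sup>2) ` {..N}"
  have big: "int N \<le> (int k)\<^sup>2 - (int l)\<^sup>2" if "N < k" for k
  proof -
    have "int k \<noteq> int l" "int l \<le> int k" using that by (auto simp: N_def)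
    have "(int k)\<^sup>2 - (int l)\<^sup>2 = (int k - int l) * (int k + int l)"
      by (simp add: power2_eq_square square_diff_square_factored mult.commute)
    moreover have "1 * int N \<le> (int k - int l) * (int k + int l)"
      using that by (intro mult_mono) (auto simp: N_def)
    ultimately show ?thesis by simp
  qed
  have GN: "int G \<le> int N" by (simp add: N_def)
  have form: "\<exists>k>N. m = (int l)\<^sup>2 - (int k)\<^sup>2 \<or> m = (int k)\<^sup>2 - (int l)\<^sup>2" if e: "m \<in> V - S" for m
  proof -
    obtain k where k: "m = (int l)\<^sup>2 - (int k)\<^sup>2 \<or> m = (int k)\<^sup>2 - (int l)\<^sup>2" using e unfolding V_def by blast
    moreover have "\<not> k \<le> N" using e k unfolding S_def by blast
    ultimately show ?thesis by (intro exI[of _ k]) auto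
  qed
  have "separated G (V - S)"
    unfolding separated_def
  proof (intro ballI impI)
    fix m n assume "m \<in> V - S" "n \<in> V - S" and mn: "m \<noteq> n"
    then obtain k k' where k: "k > N" "m = (int l)\<^sup>2 - (int k)\<^sup>2 \<or> m = (int k)\<^sup>2 - (int l)\<^sup>2"
      and k': "k' > N" "n = (int l)\<^sup>2 - (int k')\<^sup>2 \<or> n = (int k')\<^sup>2 - (int l)\<^sup>2"
      using form by meson
    have gap: "2 * int N \<le> \<bar>(int k)\<^sup>2 - (int k')\<^sup>2\<bar>" if "k \<noteq> k'"
      by (rule square_gap) (use k k' that in auto)
    note b = big[OF k(1)] big[OF k'(1)]
    show "int G \<le> \<bar>m - n\<bar>"
    proof (cases "k = k'")
      case True
      then show ?thesis using k(2) k'(2) b GN mn by auto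
    next
      case False
      from gap[OF this] show ?thesis using k(2) k'(2) b GN by auto
    qed
  qed
  moreover have "finite S" by (simp add: S_def)
  ultimately show ?thesis by blast
qed

text \<open>By \<open>ctl_moment\<close> the moment at \<open>g k = - f k\<close> averages the
  coefficient at \<open>f k\<close> with the conjugate of the one at \<open>g k\<close>. So the
  target coefficient is prescribed at \<open>f k\<close> and its conjugate at \<open>g k\<close>.
  Non-resonance makes the two families disjoint apart from the common value 0 at
  \<open>k = l\<close>, where the two demands agree only for a real number; hence the real part in
  the statement.\<close>

theorem moment_control:
  fixes l :: nat
  assumes l: "l \<ge> 1" and T: "T > 0"
    and nonres: "\<And>j k :: nat. j \<ge> 1 \<and> j \<noteq> l \<and> k \<ge> 1 \<and> k \<noteq> l \<Longrightarrow>
      (int j)\<^sup>2 - (int l)\<^sup>2 \<noteq> (int l)\<^sup>2 - (int k)\<^sup>2"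
  obtains u C where "0 \<le> C" "\<And>z :: L2. u z sq_integrable_on UNIV" "\<And>z. zero_ext T (u z) = u z"
    "\<And>z k. k \<ge> 1 \<Longrightarrow> integral\<^sup>L (lebesgue_on {0..T}) (\<lambda>s. complex_of_real (u z s) * cis ((eigenval k - eigenval l) * s)) =
      (if k = l then complex_of_real (Re (cinner_L2 z (phi k))) else cinner_L2 z (phi k))"
    "\<And>z z'. integral\<^sup>L (lebesgue_on {0..T}) (\<lambda>s. (u z s - u z' s)\<^sup>2) \<le> (C * norm (z - z'))\<^sup>2"
    "\<And>z. integral\<^sup>L (lebesgue_on {0..T}) (\<lambda>s. (u z s)\<^sup>2) \<le> (C * norm z)\<^sup>2"
proof -
  \<comment> \<open>Rescaled length of the control interval, capped at one full period; the control
    is 0 afterwards.\<close>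
  define \<tau> where "\<tau> = min 1 (T * (pi / 2))"
  have \<tau>: "0 < \<tau>" "\<tau> \<le> 1" "\<tau> / (pi / 2) \<le> T" using T by (auto simp: \<tau>_def min_def field_simps)
  define V where "V = {(int l)\<^sup>2 - (int k)\<^sup>2 |k. k \<ge> 1} \<union> {(int k)\<^sup>2 - (int l)\<^sup>2 |k. k \<ge> 1}"
  have "observable V \<tau>"
    by (rule Ingham_Haraux[OF _ \<tau>(1,2)]) (unfold V_def, rule frequencies_lacunary)
  then obtain R C where R: "0 \<le> C" "\<And>D. proj V D = D \<Longrightarrow> proj V (R D) = D" "\<And>D. chi \<tau> (R D) = R D"
    "\<And>D D'. norm (R D - R D') \<le> C * norm (D - D')" "R 0 = 0"
    by (rule moment_solver[OF _ \<tau>(1,2)]) (rule that)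
  define d where "d z k = (if k = l then complex_of_real (Re (cinner_L2 z (phi k))) else cinner_L2 z (phi k))" for z k
  define f g where "f k = (int l)\<^sup>2 - (int k)\<^sup>2" and "g k = (int k)\<^sup>2 - (int l)\<^sup>2" for k
  define I where "I = {1::nat..}"
  have injf: "inj_on f UNIV" "inj_on g UNIV"
    by (auto simp: f_def g_def inj_on_def power2_eq_iff)
  have on: "orthonormal (\<lambda>k. expb (f k)) J" "orthonormal (\<lambda>k. expb (g k)) J" for J
    using injf orthonormal_expb unfolding orthonormal_def by (auto simp: inj_on_def)
  have dle: "(cmod (d z k))\<^sup>2 \<le> (cmod (cinner_L2 z (phi k)))\<^sup>2" for z k
    by (simp add: d_def cmod_power2)
  have fin: "(\<Sum>k\<in>F. (cmod (d z k))\<^sup>2) \<le> (norm z)\<^sup>2" if "finite F" "F \<subseteq> I" for F z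
    using sum_mono[of F "\<lambda>k. (cmod (d z k))\<^sup>2", OF dle] orthonormal_Bessel_finite[OF orthonormal_phi that(1), of z] that(2)
    unfolding I_def by (meson order_trans)
  have sm: "(\<lambda>k. (cmod (d z k))\<^sup>2) summable_on I" "(\<Sum>\<^sub>\<infinity>k\<in>I. (cmod (d z k))\<^sup>2) \<le> (norm z)\<^sup>2" for z
    using nonneg_summable_on_bounded[of I "\<lambda>k. (cmod (d z k))\<^sup>2" "(norm z)\<^sup>2"] fin by auto
  have fin': "(\<Sum>k\<in>F. (cmod (cnj (d z k)))\<^sup>2) \<le> (norm z)\<^sup>2" if "finite F" "F \<subseteq> I - {l}" for F z
    using fin[OF that(1), of z] that(2) by auto
  have sm': "(\<lambda>k. (cmod (cnj (d z k)))\<^sup>2) summable_on (I - {l})" "(\<Sum>\<^sub>\<infinity>k\<in>I - {l}. (cmod (cnj (d z k)))\<^sup>2) \<le> (norm z)\<^sup>2" for z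
    using nonneg_summable_on_bounded[of "I - {l}" "\<lambda>k. (cmod (cnj (d z k)))\<^sup>2" "(norm z)\<^sup>2", OF _ fin'] by simp_all
  define D1 where "D1 z = (\<Sum>\<^sub>\<infinity>k\<in>I. d z k *\<^sub>C expb (f k))" for z
  \<comment> \<open>The index \<open>l\<close> is omitted because \<open>f l = g l = 0\<close> is
    already covered by \<open>D1\<close>.\<close>
  define D2 where "D2 z = (\<Sum>\<^sub>\<infinity>k\<in>I - {l}. cnj (d z k) *\<^sub>C expb (g k))" for z
  define D where "D z = D1 z + D2 z" for z
  have hs1: "((\<lambda>k. d z k *\<^sub>C expb (f k)) has_sum D1 z) I" for z
    unfolding D1_def by (intro has_sum_infsum orthonormal_Riesz_Fischer(1)[OF on(1) sm(1)])
  have hs2: "((\<lambda>k. cnj (d z k) *\<^sub>C expb (g k)) has_sum D2 z) (I - {l})" for z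
    unfolding D2_def by (intro has_sum_infsum orthonormal_Riesz_Fischer(1)[OF on(2) sm'(1)])
  have n1: "norm (D1 z) \<le> norm z" for z
    by (rule power2_le_imp_le[OF _ norm_ge_zero]) (use orthonormal_Riesz_Fischer(3)[OF on(1) sm(1), of z] sm(2)[of z] in \<open>simp only: D1_def\<close>)
  have n2: "norm (D2 z) \<le> norm z" for z
    by (rule power2_le_imp_le[OF _ norm_ge_zero]) (use orthonormal_Riesz_Fischer(3)[OF on(2) sm'(1), of z] sm'(2)[of z] in \<open>simp only: D2_def\<close>)
  have d_diff: "d (z - z') k = d z k - d z' k" for z z' k by (simp add: d_def cinner_L2_diff_left)
  have scd: "(a - b) *\<^sub>C h = a *\<^sub>C h - b *\<^sub>C h" for a b and h :: L2
    using scaleC_L2_add_left[of "a - b" b h] by simp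
  have has_sum_sub: "((\<lambda>k. p k - q k) has_sum P - Q) J" if "(p has_sum P) J" "(q has_sum Q) J"
    for p q :: "nat \<Rightarrow> L2" and P Q J
    using has_sum_add[OF that(1), of "\<lambda>k. - q k" "- Q"] that(2) by (simp add: has_sum_uminus)
  have "D1 (z - z') = D1 z - D1 z'" for z z'
    using has_sum_sub[OF hs1[of z] hs1[of z']] hs1[of "z - z'"] by (simp add: d_diff scd has_sum_unique)
  moreover have "D2 (z - z') = D2 z - D2 z'" for z z'
    using has_sum_sub[OF hs2[of z] hs2[of z']] hs2[of "z - z'"] by (simp add: d_diff scd has_sum_unique)
  ultimately have D_diff: "D z - D z' = D (z - z')" for z z' by (simp add: D_def)
  have nD: "norm (D z) \<le> 2 * norm z" for z
    using norm_triangle_ineq[of "D1 z" "D2 z"] n1[of z] n2[of z] by (simp add: D_def)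
  have "proj V (D1 z) = D1 z" "proj V (D2 z) = D2 z" for z
    by (rule proj_has_sum[OF hs1], force simp: V_def f_def I_def, rule proj_has_sum[OF hs2], force simp: V_def g_def I_def)
  then have PD: "proj V (D z) = D z" for z
    by (simp add: D_def linear_add[OF bounded_linear.linear[OF bounded_linear_proj]])
  \<comment> \<open>Ensures that each of the two series contributes nothing at the frequencies
    belonging only to the other.\<close>
  have miss: "cinner_L2 E (expb m) = 0"
    if hs: "((\<lambda>k. c k *\<^sub>C expb (h k)) has_sum E) J" and m: "\<And>k. k \<in> J \<Longrightarrow> h k \<noteq> m" for c and h :: "nat \<Rightarrow> int" and E J m
  proof (rule has_sum_unique)
    show "((\<lambda>k. cinner_L2 (c k *\<^sub>C expb (h k)) (expb m)) has_sum cinner_L2 E (expb m)) J"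
      by (rule has_sum_bounded_linear[OF bounded_bilinear.bounded_linear_left[OF bounded_bilinear_cinner_L2] hs])
    show "((\<lambda>k. cinner_L2 (c k *\<^sub>C expb (h k)) (expb m)) has_sum 0) J"
      by (rule has_sum_0) (use m orthonormal_expb in \<open>auto simp: cinner_L2_scaleC_left orthonormal_def\<close>)
  qed
  have c1: "cinner_L2 (D1 z) (expb (f j)) = d z j" if "j \<in> I" for z j
    unfolding D1_def by (rule orthonormal_Riesz_Fischer(2)[OF on(1) sm(1) that])
  have c2: "cinner_L2 (D2 z) (expb (g j)) = cnj (d z j)" if "j \<in> I - {l}" for z j
    unfolding D2_def by (rule orthonormal_Riesz_Fischer(2)[OF on(2) sm'(1) that])
  have fl: "f k = 0 \<longleftrightarrow> k = l" "g k = 0 \<longleftrightarrow> k = l" for k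
    by (auto simp: f_def g_def power2_eq_iff)
  have fg: "f j \<noteq> g k" if "j \<in> I" "k \<in> I" "k \<noteq> l" for j k
  proof (cases "j = l")
    case True
    then show ?thesis using fl that by metis
  next
    case False
    then show ?thesis using nonres[of k j] that by (auto simp: f_def g_def I_def)
  qed
  have E1: "cinner_L2 (D z) (expb (f j)) = d z j" if "j \<in> I" for z j
    using c1[OF that] miss[OF hs2, of "f j"] fg that by (fastforce simp: D_def cinner_L2_add_left)
  have E2: "cinner_L2 (D z) (expb (g j)) = cnj (d z j)" if "j \<in> I" for z j
  proof (cases "j = l")
    case True
    then have "g j = f j" "cnj (d z j) = d z j" by (simp_all add: f_def g_def d_def)
    then show ?thesis using E1[OF that] by simp
  next
    case False
    then show ?thesis using c2[of j] miss[OF hs1, of "g j"] fg[OF _ that False] that by (simp add: D_def cinner_L2_add_left)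
  qed
  have RE: "cinner_L2 (R (D z)) (expb m) = cinner_L2 (D z) (expb m)" if "m \<in> V" for z m
    using cinner_proj[OF that, of "R (D z)"] R(2)[OF PD] by simp
  have V: "f k \<in> V" "g k \<in> V" if "k \<ge> 1" for k using that by (auto simp: V_def f_def g_def)
  have RD: "norm (R (D z) - R (D z')) \<le> 2 * C * norm (z - z')" for z z'
    using R(4)[of "D z" "D z'"] mult_left_mono[OF nD[of "z - z'"] R(1)] by (simp add: D_diff algebra_simps)
  have RN: "norm (R (D z)) \<le> 2 * C * norm z" for z
    using R(4)[of "D z" 0] mult_left_mono[OF nD[of z] R(1)] by (simp add: R(5) algebra_simps)
  have sq: "pi / 2 * a\<^sup>2 \<le> (sqrt (pi / 2) * (2 * C) * b)\<^sup>2" if "a \<le> 2 * C * b" "0 \<le> a" for a b :: real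
  proof -
    have "pi / 2 * a\<^sup>2 \<le> pi / 2 * (2 * C * b)\<^sup>2" using that by (intro mult_left_mono power_mono) auto
    also have "\<dots> = (sqrt (pi / 2) * (2 * C) * b)\<^sup>2" by (simp add: power_mult_distrib)
    finally show ?thesis .
  qed
  show thesis
  proof (rule that[of "sqrt (pi / 2) * (2 * C)" "\<lambda>z. ctl \<tau> (R (D z))"])
    show "0 \<le> sqrt (pi / 2) * (2 * C)" using R(1) by simp
    show "ctl \<tau> (R (D z)) sq_integrable_on UNIV" for z by (rule ctl_sq_integrable[OF \<tau>])
    show "zero_ext T (ctl \<tau> (R (D z))) = ctl \<tau> (R (D z))" for z
      using \<tau>(3) by (auto simp: ctl_def zero_ext_def)
    show "integral\<^sup>L (lebesgue_on {0..T}) (\<lambda>s. (ctl \<tau> (R (D z)) s - ctl \<tau> (R (D z')) s)\<^sup>2)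
        \<le> (sqrt (pi / 2) * (2 * C) * norm (z - z'))\<^sup>2" for z z'
      by (rule order_trans[OF ctl_diff[OF \<tau>] sq[OF RD norm_ge_zero]])
    show "integral\<^sup>L (lebesgue_on {0..T}) (\<lambda>s. (ctl \<tau> (R (D z)) s)\<^sup>2) \<le> (sqrt (pi / 2) * (2 * C) * norm z)\<^sup>2" for z
      by (rule order_trans[OF ctl_norm[OF \<tau>] sq[OF RN norm_ge_zero]])
    fix z and k :: nat assume k: "k \<ge> 1"
    then have kI: "k \<in> I" by (simp add: I_def)
    have ev: "eigenval k - eigenval l = pi\<^sup>2 * of_int (g k)" by (simp add: eigenval_def g_def algebra_simps)
    have "integral\<^sup>L (lebesgue_on {0..T}) (\<lambda>s. complex_of_real (ctl \<tau> (R (D z)) s) * cis ((eigenval k - eigenval l) * s)) =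
        (cinner_L2 (R (D z)) (expb (- g k)) + cnj (cinner_L2 (R (D z)) (expb (g k)))) / 2"
      unfolding ev by (rule ctl_moment[OF \<tau> R(3)])
    also have "- g k = f k" by (simp add: f_def g_def)
    also have "(cinner_L2 (R (D z)) (expb (f k)) + cnj (cinner_L2 (R (D z)) (expb (g k)))) / 2 = d z k"
      by (simp add: RE V[OF k] E1[OF kI] E2[OF kI])
    finally show "integral\<^sup>L (lebesgue_on {0..T}) (\<lambda>s. complex_of_real (ctl \<tau> (R (D z)) s) * cis ((eigenval k - eigenval l) * s)) =
        (if k = l then complex_of_real (Re (cinner_L2 z (phi k))) else cinner_L2 z (phi k))"
      by (simp only: d_def)
  qed
qed

section \<open>Local exact controllability\<close>

lemma sq_integrable_on_diff_real:
  fixes u v :: "real \<Rightarrow> real"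
  assumes "u sq_integrable_on S" "v sq_integrable_on S"
  shows "(\<lambda>s. u s - v s) sq_integrable_on S"
proof -
  have [measurable]: "u \<in> borel_measurable (lebesgue_on S)" "v \<in> borel_measurable (lebesgue_on S)"
    and i: "integrable (lebesgue_on S) (\<lambda>s. (norm (u s))\<^sup>2)" "integrable (lebesgue_on S) (\<lambda>s. (norm (v s))\<^sup>2)"
    using assms by (auto simp: sq_integrable_on_def)
  have "integrable (lebesgue_on S) (\<lambda>s. (norm (u s - v s))\<^sup>2)"
  proof (rule Bochner_Integration.integrable_bound)
    show "integrable (lebesgue_on S) (\<lambda>s. 2 * (norm (u s))\<^sup>2 + 2 * (norm (v s))\<^sup>2)"
      by (rule Bochner_Integration.integrable_add[OF integrable_mult_right[OF i(1)] integrable_mult_right[OF i(2)]])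
    have "(p - q)\<^sup>2 \<le> 2 * p\<^sup>2 + 2 * q\<^sup>2" for p q :: real
      using zero_le_power2[of "p + q"] by (simp add: power2_eq_square algebra_simps)
    then show "AE s in lebesgue_on S. norm ((norm (u s - v s))\<^sup>2) \<le> norm (2 * (norm (u s))\<^sup>2 + 2 * (norm (v s))\<^sup>2)"
      by (intro AE_I2) simp
  qed measurable
  then show ?thesis by (simp add: sq_integrable_on_def)
qed

context control_system
begin

text \<open>Scaled by \<open>sqrt \<kappa>\<close> so that it is directly a Lipschitz constant of
  the Duhamel term in the supremum norm.\<close>

definition cost :: "(real \<Rightarrow> real) \<Rightarrow> real" where
  "cost u = sqrt \<kappa> * sqrt (integral\<^sup>L (lebesgue_on {0..T}) (\<lambda>s. (u s)\<^sup>2))"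

lemma norm_duh_le_cost:
  assumes "u sq_integrable_on UNIV" "continuous_on {0..T} x" "t \<in> {0..T}"
    "\<And>s. s \<in> {0..T} \<Longrightarrow> norm (x s) \<le> m"
  shows "norm (duh \<mu> u x 0 t) \<le> cost u * m"
proof -
  have m: "0 \<le> m" using assms(4)[OF assms(3)] norm_ge_zero order_trans by blast
  have mono: "integral\<^sup>L (lebesgue_on {0..t}) (\<lambda>s. (u s)\<^sup>2) \<le> integral\<^sup>L (lebesgue_on {0..T}) (\<lambda>s. (u s)\<^sup>2)"
    using integral_combine[OF control_integrable(2)[OF assms(1), of 0 T], of t] assms(3) by (simp add: integral_nonneg_AE)
  have "norm (duh \<mu> u x 0 t) \<le> sqrt \<kappa> * m * sqrt (integral\<^sup>L (lebesgue_on {0..t}) (\<lambda>s. (u s)\<^sup>2))"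
    by (rule norm_duh_le[OF assms(1,2)]) (use assms(3,4) in auto)
  also have "\<dots> \<le> sqrt \<kappa> * m * sqrt (integral\<^sup>L (lebesgue_on {0..T}) (\<lambda>s. (u s)\<^sup>2))"
    using m \<kappa>_nonneg mono by (intro mult_left_mono) auto
  finally show ?thesis by (simp add: cost_def mult_ac)
qed

lemma duh_split:
  assumes u: "u sq_integrable_on UNIV" and v: "v sq_integrable_on UNIV"
    and x: "continuous_on {0..T} x" and y: "continuous_on {0..T} y" and t: "t \<in> {0..T}"
  shows "duh \<mu> u x 0 t - duh \<mu> v y 0 t = duh \<mu> u (\<lambda>s. x s - y s) 0 t + duh \<mu> (\<lambda>s. u s - v s) y 0 t"
proof -
  have "duh \<mu> u x 0 t - duh \<mu> v y 0 t = (duh \<mu> u x 0 t - duh \<mu> u y 0 t) + (duh \<mu> u y 0 t - duh \<mu> v y 0 t)" by simp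
  then show ?thesis
    using duh_diff[OF u x y, of 0 t] duh_diff_control[OF u v sq_integrable_on_diff_real[OF u v] y, of 0 t] t
    by (simp only: atLeastAtMost_iff)
qed

text \<open>Along the trajectory driven by \<open>U z\<close>, the linearised response \<open>duh \<mu> (U z) a\<close> is compared with \<open>z\<close>;
  the remainder is quadratic, so the defect \<open>z\<close> for a prescribed end point is a fixed point of a contraction.\<close>

lemma small_controls:
  fixes a :: L2 and U :: "L2 \<Rightarrow> real \<Rightarrow> real"
  assumes U: "\<And>z. U z sq_integrable_on UNIV" and q: "0 \<le> q"
    and lip: "\<And>z z'. cost (\<lambda>s. U z s - U z' s) \<le> q * norm (z - z')"
    and bd: "\<And>z. cost (U z) \<le> q * norm z" and e: "\<epsilon> > 0"
  shows "\<exists>\<delta>>0. \<forall>x0 x1. norm (x0 - a) < \<delta> \<longrightarrow> norm (x1 - a) < \<delta> \<longrightarrow>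
    (\<exists>z x. solution (U z) x0 x \<and> x T - x1 = duh \<mu> (U z) (\<lambda>s. a) 0 T - z \<and> norm (x T - a) < \<epsilon>)"
proof -
  define M where "M = 1 + q * norm a"
  have M: "M \<ge> 1" using q by (simp add: M_def)
  \<comment> \<open>The sum of all quantities that \<open>\<rho> = 1 / (2 * K)\<close> must make
    small: \<open>r1\<close> for the cost of the controls, \<open>r2\<close> for the size of the
    trajectories, \<open>r3\<close> for mapping the ball into itself, \<open>r4\<close> for the
    contraction and \<open>r5\<close> for the final distance \<epsilon>.\<close>
  define K where "K = q + 2 * M + 4 * (q * M) + 2 * q\<^sup>2 * (norm a + 1) + 2 * M / \<epsilon>"
  define \<rho> where "\<rho> = 1 / (2 * K)"
  have nn: "0 \<le> q * M" "0 \<le> 2 * q\<^sup>2 * (norm a + 1)" "0 < 2 * M / \<epsilon>" using q M e by auto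
  have K: "K > 0" unfolding K_def using nn q M by linarith
  then have \<rho>: "\<rho> > 0" by (simp add: \<rho>_def)
  have le: "X * \<rho> \<le> 1 / 2" if "X \<le> K" for X using that K by (simp add: \<rho>_def field_simps)
  have r1: "q * \<rho> \<le> 1 / 2" by (rule le) (use nn q M in \<open>simp add: K_def\<close>)
  have r2: "2 * M * \<rho> \<le> 1 / 2" by (rule le) (use nn q M in \<open>simp add: K_def\<close>)
  have r3: "4 * (q * M) * \<rho> \<le> 1 / 2" by (rule le) (use nn q M in \<open>simp add: K_def\<close>)
  have r4: "(2 * q\<^sup>2 * (norm a + 1) + 2 * (q * M)) * \<rho> \<le> 1 / 2" by (rule le) (use nn q M in \<open>simp add: K_def\<close>)
  have r5: "2 * M / \<epsilon> * \<rho> \<le> 1 / 2" by (rule le) (use nn q M in \<open>simp add: K_def\<close>)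
  then have r6: "2 * (M * \<rho>) < \<epsilon>" using e by (simp add: field_simps)
  show ?thesis
  proof (intro exI[of _ "\<rho> / 4"] conjI allI impI)
    show "\<rho> / 4 > 0" using \<rho> by simp
    fix x0 x1 :: L2 assume x0: "norm (x0 - a) < \<rho> / 4" and x1: "norm (x1 - a) < \<rho> / 4"
    have "\<exists>x. \<forall>z. solution (U z) x0 (x z)" using solution_exists[OF U] by (intro choice allI) blast
    then obtain x where x: "\<And>z. solution (U z) x0 (x z)" by blast
    have cx: "continuous_on {0..T} (x z)" for z using x[of z] by (simp add: solution_def)
    have xe: "x z t = x0 + duh \<mu> (U z) (x z) 0 t" if "t \<in> {0..T}" for z t using x[of z] that by (simp add: solution_def)
    have ca: "continuous_on {0..T} (\<lambda>s. a)" by simp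
    have cd: "continuous_on {0..T} (\<lambda>s. x z s - a)" for z by (intro continuous_intros cx)
    have cdd: "continuous_on {0..T} (\<lambda>s. x z s - x z' s)" for z z' by (intro continuous_intros cx)
    have TT: "T \<in> {0..T}" using T_pos by simp
    have c\<rho>: "cost (U z) \<le> q * \<rho>" if "norm z \<le> \<rho>" for z
      using bd[of z] mult_left_mono[OF that q] by linarith
    have ch: "cost (U z) \<le> 1 / 2" if "norm z \<le> \<rho>" for z using c\<rho>[OF that] r1 by linarith
    have near: "norm (x z t - a) \<le> 2 * (M * \<rho>)" if z: "norm z \<le> \<rho>" and t: "t \<in> {0..T}" for z t
    proof (rule solution_bound[OF U x _ _ ca _ t])
      show "sqrt \<kappa> * sqrt (integral\<^sup>L (lebesgue_on {0..T}) (\<lambda>s. (U z s)\<^sup>2)) \<le> 1 / 2"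
        using ch[OF z] by (simp add: cost_def)
      fix t assume t: "t \<in> {0..T}"
      show "x z t - a = (x0 - a + duh \<mu> (U z) (\<lambda>s. a) 0 t) + duh \<mu> (U z) (\<lambda>s. x z s - a) 0 t"
        using duh_diff[OF U cx ca, of 0 t z] t xe[OF t, of z] by (simp add: algebra_simps)
      have "norm (duh \<mu> (U z) (\<lambda>s. a) 0 t) \<le> cost (U z) * norm a" by (rule norm_duh_le_cost[OF U ca t]) simp
      also have "\<dots> \<le> q * \<rho> * norm a" by (intro mult_right_mono c\<rho> z) simp
      finally show "norm (x0 - a + duh \<mu> (U z) (\<lambda>s. a) 0 t) \<le> M * \<rho>"
        using norm_triangle_ineq[of "x0 - a" "duh \<mu> (U z) (\<lambda>s. a) 0 t"] x0 \<rho>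
        unfolding M_def distrib_right mult_1 by (simp only: mult.commute mult.left_commute)
    qed
    have size: "norm (x z t) \<le> norm a + 1" if "norm z \<le> \<rho>" "t \<in> {0..T}" for z t
      using near[OF that] norm_triangle_ineq2[of "x z t" a] r2 by simp
    have diff: "norm (x z t - x z' t) \<le> 2 * (q * norm (z - z') * (norm a + 1))"
      if z: "norm z \<le> \<rho>" and z': "norm z' \<le> \<rho>" and t: "t \<in> {0..T}" for z z' t
    proof (rule solution_bound[OF U x _ _ cx _ t])
      show "sqrt \<kappa> * sqrt (integral\<^sup>L (lebesgue_on {0..T}) (\<lambda>s. (U z s)\<^sup>2)) \<le> 1 / 2"
        using ch[OF z] by (simp add: cost_def)
      fix t assume t: "t \<in> {0..T}"
      show "x z t - x z' t = duh \<mu> (\<lambda>s. U z s - U z' s) (x z') 0 t + duh \<mu> (U z) (\<lambda>s. x z s - x z' s) 0 t"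
        using duh_split[OF U[of z] U[of z'] cx[of z] cx[of z'] t] xe[OF t, of z] xe[OF t, of z'] by simp
      have "norm (duh \<mu> (\<lambda>s. U z s - U z' s) (x z') 0 t) \<le> cost (\<lambda>s. U z s - U z' s) * (norm a + 1)"
        by (rule norm_duh_le_cost[OF sq_integrable_on_diff_real[OF U U] cx t size[OF z']])
      also have "\<dots> \<le> q * norm (z - z') * (norm a + 1)" by (intro mult_right_mono lip) simp
      finally show "norm (duh \<mu> (\<lambda>s. U z s - U z' s) (x z') 0 t) \<le> q * norm (z - z') * (norm a + 1)" .
    qed
    \<comment> \<open>Inserting the integral equation for \<open>x z T\<close> shows that
      \<open>G z = z\<close> is exactly the claimed relation between the end point and the linear
      response. The trajectory enters only through its deviation from \<open>a\<close>, which makes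
      the term quadratic.\<close>
    define G where "G z = x1 - x0 - duh \<mu> (U z) (\<lambda>s. x z s - a) 0 T" for z
    have "\<exists>!z\<in>cball 0 \<rho>. G z = z"
    proof (rule Banach_fix[where c = "1 / 2"])
      show "complete (cball (0::L2) \<rho>)" by (simp add: complete_eq_closed)
      show "cball (0::L2) \<rho> \<noteq> {}" using \<rho> by simp
      show "G ` cball 0 \<rho> \<subseteq> cball 0 \<rho>"
      proof (intro subsetI, elim imageE)
        fix y z assume z: "z \<in> cball 0 \<rho>" and y: "y = G z"
        have z\<rho>: "norm z \<le> \<rho>" using z by simp
        have "norm (duh \<mu> (U z) (\<lambda>s. x z s - a) 0 T) \<le> cost (U z) * (2 * (M * \<rho>))"
          by (rule norm_duh_le_cost[OF U cd TT near[OF z\<rho>]])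
        also have "\<dots> \<le> q * \<rho> * (2 * (M * \<rho>))" by (intro mult_right_mono c\<rho> z\<rho>) (use M \<rho> in simp)
        also have "\<dots> = (4 * (q * M) * \<rho>) * (\<rho> / 2)" by simp
        also have "\<dots> \<le> 1 / 2 * (\<rho> / 2)" using r3 \<rho> by (intro mult_right_mono) auto
        finally have d: "norm (duh \<mu> (U z) (\<lambda>s. x z s - a) 0 T) \<le> 1 / 2 * (\<rho> / 2)" .
        have "norm (x1 - x0) \<le> norm (x1 - a) + norm (x0 - a)"
          using norm_triangle_ineq4[of "x1 - a" "x0 - a"] by simp
        then have "norm (G z) \<le> \<rho>"
          using d x0 x1 \<rho> norm_triangle_ineq4[of "x1 - x0" "duh \<mu> (U z) (\<lambda>s. x z s - a) 0 T"] by (simp add: G_def)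
        then show "y \<in> cball 0 \<rho>" by (simp add: y)
      qed
      fix z z' :: L2 assume "z \<in> cball 0 \<rho>" "z' \<in> cball 0 \<rho>"
      then have z: "norm z \<le> \<rho>" and z': "norm z' \<le> \<rho>" by auto
      have "norm (duh \<mu> (U z) (\<lambda>s. x z s - x z' s) 0 T) \<le> cost (U z) * (2 * (q * norm (z - z') * (norm a + 1)))"
        by (rule norm_duh_le_cost[OF U cdd TT diff[OF z z']])
      also have "\<dots> \<le> q * \<rho> * (2 * (q * norm (z - z') * (norm a + 1)))"
        by (intro mult_right_mono c\<rho> z) (use q in simp)
      finally have 1: "norm (duh \<mu> (U z) (\<lambda>s. x z s - x z' s) 0 T) \<le> q * \<rho> * (2 * (q * norm (z - z') * (norm a + 1)))" .
      have "norm (duh \<mu> (\<lambda>s. U z s - U z' s) (\<lambda>s. x z' s - a) 0 T) \<le> cost (\<lambda>s. U z s - U z' s) * (2 * (M * \<rho>))"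
        by (rule norm_duh_le_cost[OF sq_integrable_on_diff_real[OF U U] cd TT near[OF z']])
      also have "\<dots> \<le> q * norm (z - z') * (2 * (M * \<rho>))" by (intro mult_right_mono lip) (use M \<rho> in simp)
      finally have 2: "norm (duh \<mu> (\<lambda>s. U z s - U z' s) (\<lambda>s. x z' s - a) 0 T) \<le> q * norm (z - z') * (2 * (M * \<rho>))" .
      have "G z' - G z = duh \<mu> (U z) (\<lambda>s. x z s - x z' s) 0 T + duh \<mu> (\<lambda>s. U z s - U z' s) (\<lambda>s. x z' s - a) 0 T"
        using duh_split[OF U[of z] U[of z'] cd[of z] cd[of z'] TT] by (simp add: G_def)
      then have "norm (G z' - G z) \<le> q * \<rho> * (2 * (q * norm (z - z') * (norm a + 1))) + q * norm (z - z') * (2 * (M * \<rho>))"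
        using norm_triangle_ineq[of "duh \<mu> (U z) (\<lambda>s. x z s - x z' s) 0 T" "duh \<mu> (\<lambda>s. U z s - U z' s) (\<lambda>s. x z' s - a) 0 T"] 1 2 by simp
      also have "\<dots> = ((2 * q\<^sup>2 * (norm a + 1) + 2 * (q * M)) * \<rho>) * norm (z - z')"
        by (simp add: power2_eq_square algebra_simps)
      also have "\<dots> \<le> 1 / 2 * norm (z - z')" by (intro mult_right_mono r4) simp
      finally show "dist (G z) (G z') \<le> 1 / 2 * dist z z'" by (simp add: dist_norm norm_minus_commute)
    qed auto
    then obtain z where z: "norm z \<le> \<rho>" "G z = z" by auto
    have "x z T - x1 = duh \<mu> (U z) (\<lambda>s. a) 0 T - z"
      using xe[OF TT, of z] z(2) duh_diff[OF U cx ca, of 0 T z] TT by (simp add: G_def algebra_simps)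
    moreover have "norm (x z T - a) < \<epsilon>" using near[OF z(1) TT] r6 by linarith
    ultimately show "\<exists>z x. solution (U z) x0 x \<and> x T - x1 = duh \<mu> (U z) (\<lambda>s. a) 0 T - z \<and> norm (x T - a) < \<epsilon>"
      using x by blast
  qed
qed

text \<open>Composing the moment solver with the inverse of the diagonal factors of the linearised
  response gives controls whose response reproduces \<open>z\<close> except for its real part along
  \<open>phi l\<close>. \<open>small_controls\<close> then reaches the target up to a real multiple
  \<alpha> of \<open>phi l\<close>, and norm conservation forces this multiple to vanish.\<close>

theorem local_exact_controllability:
  assumes l: "l \<ge> 1"
    and nonres: "\<And>j k :: nat. j \<ge> 1 \<and> j \<noteq> l \<and> k \<ge> 1 \<and> k \<noteq> l \<Longrightarrow>
      (int j)\<^sup>2 - (int l)\<^sup>2 \<noteq> (int l)\<^sup>2 - (int k)\<^sup>2"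
    and C: "C > 0" "\<And>k. k \<ge> 1 \<Longrightarrow> cmod (cinner_L2 (mult_L2 \<mu> (phi l)) (phi k)) \<ge> C / real k"
  shows "\<exists>\<delta>>0. \<forall>\<psi>\<^sub>0\<in>H10. \<forall>\<psi>\<^sub>1\<in>H10.
    norm \<psi>\<^sub>0 = 1 \<and> norm \<psi>\<^sub>1 = 1 \<and> H10_norm (\<psi>\<^sub>0 - phi l) < \<delta> \<and> H10_norm (\<psi>\<^sub>1 - eigensol l T) < \<delta> \<longrightarrow>
    (\<exists>u. u sq_integrable_on {0<..<T} \<and> (\<exists>\<psi>. mild_solution T \<mu> \<psi>\<^sub>0 u \<psi> \<and> \<psi> T = \<psi>\<^sub>1))"
proof -
  define a where "a = of_nat l *\<^sub>C phi l"
  define \<beta> where "\<beta> k = cinner_L2 (mult_L2 \<mu> (phi l)) (phi k)" for k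
  have o: "cinner_L2 (phi l) (phi k) = (if k = l then 1 else 0)" if "k \<ge> 1" for k
    using orthonormal_phi l that by (simp add: orthonormal_def)
  have ac: "cinner_L2 a (phi k) = (if k = l then of_nat l else 0)" if "k \<ge> 1" for k
    by (simp add: a_def cinner_L2_scaleC_left o[OF that])
  have Linv_a: "Linv a = phi l"
    by (rule L2_eqI) (use l in \<open>auto simp: cinner_Linv ac o\<close>)
  have sl: "schroedinger t (phi l) = cis (- (eigenval l * t)) *\<^sub>C phi l" for t
    by (rule L2_eqI) (simp add: cinner_schroedinger cinner_L2_scaleC_left o)
  have \<beta>0: "\<beta> k \<noteq> 0" if "k \<ge> 1" for k using C(2)[OF that] C(1) that by (auto simp: \<beta>_def divide_le_0_iff)
  have \<beta>l: "Im (\<beta> l) = 0"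
  proof -
    have "\<beta> l = cnj (\<beta> l)" unfolding \<beta>_def by (metis cinner_mult_L2[OF ess] cinner_L2_commute)
    then show ?thesis by (simp add: complex_eq_iff)
  qed
  obtain u Cu where u: "0 \<le> Cu" "\<And>z :: L2. u z sq_integrable_on UNIV" "\<And>z. zero_ext T (u z) = u z"
    "\<And>z k. k \<ge> 1 \<Longrightarrow> integral\<^sup>L (lebesgue_on {0..T}) (\<lambda>s. complex_of_real (u z s) * cis ((eigenval k - eigenval l) * s)) =
      (if k = l then complex_of_real (Re (cinner_L2 z (phi k))) else cinner_L2 z (phi k))"
    "\<And>z z'. integral\<^sup>L (lebesgue_on {0..T}) (\<lambda>s. (u z s - u z' s)\<^sup>2) \<le> (Cu * norm (z - z'))\<^sup>2"
    "\<And>z. integral\<^sup>L (lebesgue_on {0..T}) (\<lambda>s. (u z s)\<^sup>2) \<le> (Cu * norm z)\<^sup>2"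
    by (rule moment_control[OF l T_pos nonres]) (assumption, rule that)
  \<comment> \<open>The inverse of the factor between moment and Duhamel coefficient; the assumed
    lower bound says exactly that it is bounded by \<open>1 / C\<close>.\<close>
  define m where "m k = 1 / (- \<i> * of_nat k * \<beta> k)" for k
  define w where "w = multiplier phi {1..} m"
  have mB: "cmod (m k) \<le> 1 / C" if "k \<in> {1..}" for k
  proof -
    have k: "k \<ge> 1" using that by simp
    have "C \<le> real k * cmod (\<beta> k)" using C(2)[OF k] k by (simp add: \<beta>_def field_simps)
    then show ?thesis using C(1) by (simp add: m_def norm_divide norm_mult frac_le)
  qed
  have wb: "bounded_linear w" unfolding w_def by (rule bounded_linear_multiplier[OF orthonormal_phi mB]) (use C in auto)
  have wn: "norm (w z) \<le> 1 / C * norm z" for z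
    unfolding w_def by (rule norm_multiplier[OF orthonormal_phi mB]) (use C in auto)
  have wc: "cinner_L2 (w z) (phi k) = m k * cinner_L2 z (phi k)" if "k \<ge> 1" for z k
    unfolding w_def by (rule cinner_multiplier[OF orthonormal_phi mB]) (use that in auto)
  define U where "U z = u (w z)" for z
  have U: "U z sq_integrable_on UNIV" for z unfolding U_def by (rule u(2))
  have ca: "continuous_on {0..T} (\<lambda>s. a)" by simp
  have resp: "cinner_L2 (duh \<mu> (U z) (\<lambda>s. a) 0 T) (phi k) =
      (if k = l then \<i> * complex_of_real (Im (cinner_L2 z (phi k))) else cinner_L2 z (phi k))" if k: "k \<ge> 1" for z k
  proof -
    have di: "duh_integrand \<mu> (\<lambda>s. a) k = (\<lambda>s. cis ((eigenval k - eigenval l) * s) * \<beta> k)"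
    proof
      fix s
      have "cis (eigenval k * s) * cis (- (eigenval l * s)) = cis ((eigenval k - eigenval l) * s)"
        by (simp add: cis_mult algebra_simps)
      then show "duh_integrand \<mu> (\<lambda>s. a) k s = cis ((eigenval k - eigenval l) * s) * \<beta> k"
        by (simp add: duh_integrand_def pot_def Linv_schroedinger Linv_a sl mult_L2_scaleC[OF ess]
            cinner_L2_scaleC_left \<beta>_def flip: mult.assoc)
    qed
    let ?I = "integral\<^sup>L (lebesgue_on {0..T}) (\<lambda>s. complex_of_real (U z s) * cis ((eigenval k - eigenval l) * s))"
    have I: "?I = (if k = l then complex_of_real (Re (m k * cinner_L2 z (phi k))) else m k * cinner_L2 z (phi k))"
      unfolding U_def u(4)[OF k] wc[OF k] ..
    have "cinner_L2 (duh \<mu> (U z) (\<lambda>s. a) 0 T) (phi k) = duh_coeff \<mu> (U z) (\<lambda>s. a) 0 T k"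
      by (rule cinner_duh[OF U ca _ _ _ k]) (use T_pos in auto)
    also have "\<dots> = - \<i> * of_nat k * (?I * \<beta> k)"
      by (simp only: duh_coeff_def di mult.assoc[symmetric] integral_mult_left_zero)
    also have "\<dots> = (if k = l then \<i> * complex_of_real (Im (cinner_L2 z (phi k))) else cinner_L2 z (phi k))"
    proof (cases "k = l")
      case True
      \<comment> \<open>As \<open>\<beta> l\<close> is real, \<open>m l\<close> is purely imaginary,
        so the real moment available at \<open>k = l\<close> sees the imaginary part of the
        coefficient of \<open>z\<close> and nothing of its real part.\<close>
      have b: "\<beta> l = complex_of_real (Re (\<beta> l))" using \<beta>l by (simp add: complex_eq_iff)
      have r: "Re (\<beta> l) \<noteq> 0" using \<beta>0[OF l] b by auto
      have "m l = \<i> * complex_of_real (1 / (real l * Re (\<beta> l)))"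
        unfolding m_def by (subst b) (use r l in \<open>simp add: field_simps\<close>)
      then have "Re (m l * cinner_L2 z (phi l)) = - Im (cinner_L2 z (phi l)) / (real l * Re (\<beta> l))"
        by simp
      then have "?I = complex_of_real (- Im (cinner_L2 z (phi l)) / (real l * Re (\<beta> l)))" using trans[OF I if_P[OF True]] by (simp only: True)
      moreover have "- \<i> * of_nat l * (complex_of_real (- y / (real l * Re (\<beta> l))) * complex_of_real (Re (\<beta> l))) = \<i> * complex_of_real y" for y
        using r l by (simp add: field_simps)
      ultimately show ?thesis unfolding True using b by (simp only: if_True) metis
    next
      case False
      have "- \<i> * n * (1 / (- \<i> * n * b) * y * b) = y" if "n \<noteq> 0" "b \<noteq> 0" for n b y :: complex
        using that by (simp add: field_simps)
      from this[OF _ \<beta>0[OF k], of "of_nat k" "cinner_L2 z (phi k)"] show ?thesis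
        unfolding I m_def using False k by (simp only: if_False) simp
    qed
    finally show ?thesis .
  qed
  define q where "q = sqrt \<kappa> * (Cu * (1 / C))"
  have q: "0 \<le> q" using \<kappa>_nonneg u(1) C by (simp add: q_def)
  have cst: "cost v \<le> q * n" if "integral\<^sup>L (lebesgue_on {0..T}) (\<lambda>s. (v s)\<^sup>2) \<le> (Cu * n')\<^sup>2" "0 \<le> n'" "n' \<le> 1 / C * n" for v n n'
  proof -
    have "sqrt (integral\<^sup>L (lebesgue_on {0..T}) (\<lambda>s. (v s)\<^sup>2)) \<le> Cu * n'"
      using real_sqrt_le_mono[OF that(1)] u(1) that(2) by simp
    also have "\<dots> \<le> Cu * (1 / C * n)" by (rule mult_left_mono[OF that(3) u(1)])
    finally have "cost v \<le> sqrt \<kappa> * (Cu * (1 / C * n))"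
      unfolding cost_def by (rule mult_left_mono) (use \<kappa>_nonneg in simp)
    then show ?thesis by (simp add: q_def)
  qed
  have lip: "cost (\<lambda>s. U z s - U z' s) \<le> q * norm (z - z')" for z z'
    unfolding U_def
    by (rule cst[OF u(5)]) (use wn[of "z - z'"] in \<open>simp_all add: linear_diff[OF bounded_linear.linear[OF wb]]\<close>)
  have bd: "cost (U z) \<le> q * norm z" for z
    unfolding U_def by (rule cst[OF u(6) norm_ge_zero wn])
  obtain \<delta> where \<delta>: "\<delta> > 0" "\<And>x0 x1. norm (x0 - a) < \<delta> \<Longrightarrow> norm (x1 - a) < \<delta> \<Longrightarrow>
    \<exists>z x. solution (U z) x0 x \<and> x T - x1 = duh \<mu> (U z) (\<lambda>s. a) 0 T - z \<and> norm (x T - a) < 1"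
    using small_controls[OF U q lip bd, of 1 a] by auto
  have phi1: "norm (phi l) = 1"
  proof -
    have "complex_of_real ((norm (phi l))\<^sup>2) = complex_of_real 1"
      using cinner_L2_norm[of "phi l"] trans[OF o[OF l] if_P[OF refl]] by (simp only: of_real_1)
    then have "(norm (phi l))\<^sup>2 = 1" by (simp only: of_real_eq_iff)
    then show ?thesis using norm_ge_zero[of "phi l"] unfolding power2_eq_1_iff by linarith
  qed
  \<comment> \<open>The coefficient of \<open>a\<close> along \<open>phi l\<close> is
    \<open>l \<ge> 1\<close>, so a perturbation of norm below 1 cannot make the real part
    nonpositive. This is needed both for the target and for the end point reached.\<close>
  have pos: "Re (cinner_L2 (Linv x) (phi l)) > 0" if "norm (x - a) < 1" for x
  proof -
    have "cmod (cinner_L2 (x - a) (phi l)) \<le> norm (x - a) * norm (phi l)" by (rule cinner_L2_Cauchy_Schwarz)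
    also have "norm (phi l) = 1" by (rule phi1)
    finally have "\<bar>Re (cinner_L2 (x - a) (phi l))\<bar> < 1" using that abs_Re_le_cmod[of "cinner_L2 (x - a) (phi l)"] by linarith
    moreover have "cinner_L2 (x - a) (phi l) = cinner_L2 x (phi l) - of_nat l" by (simp add: cinner_L2_diff_left ac[OF l])
    ultimately have "Re (cinner_L2 x (phi l)) > 0" using l by simp
    then show ?thesis using l by (simp add: cinner_Linv)
  qed
  show ?thesis
  \<comment> \<open>The 1 guarantees that \<open>pos\<close> applies to the target.\<close>
  proof (intro exI[of _ "min \<delta> 1"] conjI ballI impI)
    show "min \<delta> 1 > 0" using \<delta>(1) by simp
    fix \<psi>\<^sub>0 \<psi>\<^sub>1
    assume "\<psi>\<^sub>0 \<in> H10" "\<psi>\<^sub>1 \<in> H10" and n: "norm \<psi>\<^sub>0 = 1 \<and> norm \<psi>\<^sub>1 = 1 \<and>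
      H10_norm (\<psi>\<^sub>0 - phi l) < min \<delta> 1 \<and> H10_norm (\<psi>\<^sub>1 - eigensol l T) < min \<delta> 1"
    then obtain x0 X where x0: "\<psi>\<^sub>0 = Linv x0" and X: "\<psi>\<^sub>1 = Linv X" using H10_iff by blast
    define x1 where "x1 = schroedinger (- T) X"
    note Ld = linear_diff[OF bounded_linear.linear[OF bounded_linear_Linv]]
    note Sd = linear_diff[OF bounded_linear.linear[OF bounded_linear_schroedinger]]
    have \<psi>1: "\<psi>\<^sub>1 = schroedinger T (Linv x1)"
      by (simp add: X x1_def Linv_schroedinger schroedinger_schroedinger)
    have "H10_norm (\<psi>\<^sub>0 - phi l) = norm (x0 - a)" by (simp add: x0 H10_norm_Linv flip: Linv_a Ld)
    then have d0: "norm (x0 - a) < \<delta>" using n by simp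
    have "\<psi>\<^sub>1 - eigensol l T = Linv (schroedinger T (x1 - a))"
      by (simp add: \<psi>1 Ld Sd Linv_schroedinger Linv_a sl eigensol_def cis_conv_exp)
    then have d1: "norm (x1 - a) < \<delta>" "norm (x1 - a) < 1" using n by (simp_all add: H10_norm_Linv)
    obtain z x where x: "solution (U z) x0 x" and xT: "x T - x1 = duh \<mu> (U z) (\<lambda>s. a) 0 T - z" and xa: "norm (x T - a) < 1"
      using \<delta>(2)[OF d0 d1(1)] by blast
    \<comment> \<open>The unreached real component, divided by \<open>l\<close> because
      \<open>Linv\<close> divides the coefficient along \<open>phi l\<close> by
      \<open>l\<close>.\<close>
    define \<alpha> where "\<alpha> = - Re (cinner_L2 z (phi l)) / real l"
    have ii: "\<i> * complex_of_real (Im c) - c = complex_of_real (- Re c)" for c by (simp add: complex_eq_iff)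
    have p: "Linv (x T) = Linv x1 + complex_of_real \<alpha> *\<^sub>C phi l"
    proof (rule L2_eqI)
      fix k :: nat assume k: "k \<ge> 1"
      have "cinner_L2 (x T) (phi k) - cinner_L2 x1 (phi k) = (if k = l then complex_of_real (- Re (cinner_L2 z (phi k))) else 0)"
        unfolding cinner_L2_diff_left[symmetric] xT by (simp add: cinner_L2_diff_left resp[OF k] ii)
      then have "cinner_L2 (x T) (phi k) = cinner_L2 x1 (phi k) + (if k = l then complex_of_real (- Re (cinner_L2 z (phi k))) else 0)"
        by (simp add: algebra_simps)
      then show "cinner_L2 (Linv (x T)) (phi k) = cinner_L2 (Linv x1 + complex_of_real \<alpha> *\<^sub>C phi l) (phi k)"
        using k by (simp add: cinner_Linv cinner_L2_add_left cinner_L2_scaleC_left o \<alpha>_def add_divide_distrib)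
    qed
    have n1: "norm (Linv x1) = 1" using n by (simp add: \<psi>1)
    have nT: "norm (Linv (x T)) = 1" using solution_norm[OF U x, of T] T_pos n by (simp add: x0)
    let ?c = "Re (cinner_L2 (Linv x1) (phi l))"
    have c: "?c > 0" by (rule pos[OF d1(2)])
    have "?c + \<alpha> > 0" using pos[OF xa] by (simp add: p cinner_L2_add_left cinner_L2_scaleC_left o[OF l])
    moreover have "(norm (Linv (x T)))\<^sup>2 = (norm (Linv x1))\<^sup>2 + 2 * \<alpha> * ?c + \<alpha>\<^sup>2"
    proof -
      have "complex_of_real ((norm (Linv (x T)))\<^sup>2) = cinner_L2 (Linv (x T)) (Linv (x T))" by (simp only: cinner_L2_norm)
      also have "\<dots> = complex_of_real ((norm (Linv x1))\<^sup>2) + complex_of_real \<alpha> * cinner_L2 (Linv x1) (phi l)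
          + complex_of_real \<alpha> * cnj (cinner_L2 (Linv x1) (phi l)) + complex_of_real (\<alpha>\<^sup>2)"
        unfolding p cinner_L2_norm[symmetric]
        by (simp add: cinner_L2_add_left cinner_L2_add_right cinner_L2_scaleC_left cinner_L2_scaleC_right o[OF l]
            power2_eq_square distrib_left cinner_L2_commute[of "phi l" "Linv x1"])
      also have "\<dots> = complex_of_real ((norm (Linv x1))\<^sup>2 + 2 * \<alpha> * ?c + \<alpha>\<^sup>2)"
        by (simp add: complex_eq_iff)
      finally show ?thesis by (simp only: of_real_eq_iff)
    qed
    \<comment> \<open>Both end points have norm 1. The second root \<open>- 2 * ?c\<close> would
      reverse the sign of the component along \<open>phi l\<close>, but both \<open>?c\<close> and
      \<open>?c + \<alpha>\<close> are positive.\<close>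
    ultimately have "\<alpha> * (2 * ?c + \<alpha>) = 0" "2 * ?c + \<alpha> > 0" using c by (simp_all add: n1 nT power2_eq_square algebra_simps)
    then have "\<alpha> = 0" by simp
    then have end_eq: "Linv (x T) = Linv x1" using p by simp
    have U01: "U z sq_integrable_on {0<..<T}" by (rule sq_integrable_subset[OF U]) auto
    have zU: "solution (zero_ext T (U z)) x0 x" using x u(3)[of "w z"] by (simp add: U_def)
    have "mild_solution T \<mu> \<psi>\<^sub>0 (U z) (\<lambda>t. schroedinger t (Linv (x t)))"
      unfolding x0 by (rule solution_imp_mild[OF U01 zU]) simp
    then show "\<exists>u. u sq_integrable_on {0<..<T} \<and> (\<exists>\<psi>. mild_solution T \<mu> \<psi>\<^sub>0 u \<psi> \<and> \<psi> T = \<psi>\<^sub>1)"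
      by (intro exI[of _ "U z"] exI[of _ "\<lambda>t. schroedinger t (Linv (x t))"] conjI)
        (use U01 end_eq \<psi>1 in simp_all)
  qed
qed

end

theorem theorem1p1:
  fixes N :: nat and A :: "real set" and \<mu> :: "real \<Rightarrow> real"
  assumes "N \<ge> 1" and "finite A" and "card A = N" and "A \<subseteq> {0<..<1}"
    and "\<mu> \<in> H1_piecewise A"
  shows "(\<forall>T>0. \<forall>\<psi>\<^sub>0\<in>H10. \<forall>u :: real \<Rightarrow> real. u sq_integrable_on {0<..<T} \<longrightarrow>
            (\<exists>\<psi>. mild_solution T \<mu> \<psi>\<^sub>0 u \<psi> \<and>
              (\<forall>\<psi>'. mild_solution T \<mu> \<psi>\<^sub>0 u \<psi>' \<longrightarrow> (\<forall>t\<in>{0..T}. \<psi>' t = \<psi> t))))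
       \<and> (\<forall>l::nat. l \<ge> 1 \<longrightarrow>
            (\<forall>j k :: nat. j \<ge> 1 \<and> j \<noteq> l \<and> k \<ge> 1 \<and> k \<noteq> l \<longrightarrow>
               (int j)\<^sup>2 - (int l)\<^sup>2 \<noteq> (int l)\<^sup>2 - (int k)\<^sup>2) \<longrightarrow>
            (\<exists>C>0. \<forall>k::nat. k \<ge> 1 \<longrightarrow> cmod (cinner_L2 (mult_L2 \<mu> (phi l)) (phi k)) \<ge> C / real k) \<longrightarrow>
            (\<forall>T>0. \<exists>\<delta>>0. \<forall>\<psi>\<^sub>0\<in>H10. \<forall>\<psi>\<^sub>1\<in>H10.
               norm \<psi>\<^sub>0 = 1 \<and> norm \<psi>\<^sub>1 = 1 \<and>
               H10_norm (\<psi>\<^sub>0 - phi l) < \<delta> \<and> H10_norm (\<psi>\<^sub>1 - eigensol l T) < \<delta> \<longrightarrow>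
               (\<exists>u :: real \<Rightarrow> real. u sq_integrable_on {0<..<T} \<and>
                 (\<exists>\<psi>. mild_solution T \<mu> \<psi>\<^sub>0 u \<psi> \<and> \<psi> T = \<psi>\<^sub>1))))"
proof (intro conjI allI impI)
  fix T :: real assume "T > 0"
  then obtain B \<kappa> where cs: "control_system \<mu> T B \<kappa>"
    using control_system_exists[OF assms(2,4,5)] by blast
  show "\<forall>\<psi>\<^sub>0\<in>H10. \<forall>u :: real \<Rightarrow> real. u sq_integrable_on {0<..<T} \<longrightarrow>
      (\<exists>\<psi>. mild_solution T \<mu> \<psi>\<^sub>0 u \<psi> \<and>
        (\<forall>\<psi>'. mild_solution T \<mu> \<psi>\<^sub>0 u \<psi>' \<longrightarrow> (\<forall>t\<in>{0..T}. \<psi>' t = \<psi> t)))"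
    using control_system.mild_well_posed[OF cs] by blast
next
  fix l :: nat and T :: real
  assume l: "l \<ge> 1" and nonres: "\<forall>j k :: nat. j \<ge> 1 \<and> j \<noteq> l \<and> k \<ge> 1 \<and> k \<noteq> l \<longrightarrow>
      (int j)\<^sup>2 - (int l)\<^sup>2 \<noteq> (int l)\<^sup>2 - (int k)\<^sup>2"
    and "\<exists>C>0. \<forall>k::nat. k \<ge> 1 \<longrightarrow> cmod (cinner_L2 (mult_L2 \<mu> (phi l)) (phi k)) \<ge> C / real k" and "T > 0"
  then obtain C where C: "C > 0" "\<And>k. k \<ge> 1 \<Longrightarrow> cmod (cinner_L2 (mult_L2 \<mu> (phi l)) (phi k)) \<ge> C / real k"
    by blast
  obtain B \<kappa> where cs: "control_system \<mu> T B \<kappa>"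
    using control_system_exists[OF assms(2,4,5) \<open>T > 0\<close>] by blast
  show "\<exists>\<delta>>0. \<forall>\<psi>\<^sub>0\<in>H10. \<forall>\<psi>\<^sub>1\<in>H10.
      norm \<psi>\<^sub>0 = 1 \<and> norm \<psi>\<^sub>1 = 1 \<and>
      H10_norm (\<psi>\<^sub>0 - phi l) < \<delta> \<and> H10_norm (\<psi>\<^sub>1 - eigensol l T) < \<delta> \<longrightarrow>
      (\<exists>u :: real \<Rightarrow> real. u sq_integrable_on {0<..<T} \<and>
        (\<exists>\<psi>. mild_solution T \<mu> \<psi>\<^sub>0 u \<psi> \<and> \<psi> T = \<psi>\<^sub>1))"
    by (rule control_system.local_exact_controllability[OF cs l _ C]) (use nonres in blast)+
qed

end
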